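(* Let $K/k$ be a finite abelian extension, and let $n,m\in\mathbb{N}$ and $N\in R_T$ be such that $K\subseteq {}_nk(\Lambda_N)_m$. Put $M:=L_nk_m$ and $$E:=KM\cap k(\Lambda_N).$$ Let $H$ be the decomposition group of any prime in $S_\infty(K)$ in the extension $E_{\mathfrak{ge}}K/K$, let $H_1:=H|_{E_{\mathfrak{ge}}}$ and $H_2:=H_1|_E$ be the groups obtained by restriction, and let $d:=f_\infty(EK/K)$. Then $$K_{\mathfrak{ge}}=(E_{\mathfrak{ge}})^{H_1}K=(E_{\mathfrak{ge}}K)^{H}.$$ Moreover $H\cong H_1\cong H_2\cong C_d$ and $d\mid q-1$. Also, $E_{\mathfrak{ge}}K/K_{\mathfrak{ge}}$ and $EK/E^{H_2}K$ are extensions of constants of degree $d$. Finally, the field of constants of $K_{\mathfrak{ge}}$ is $\mathbb{F}_{q^t}$, where $t$ is the degree of the primes of $S_\infty(K)$ in $K$.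
   Context: $k=\mathbb{F}_q(T)$ is a global rational function field of characteristic $p$, $R_T=\mathbb{F}_q[T]$, and $P_\infty$ (the infinite prime) is the pole of $T$ in $k$. For nonzero $N\in R_T$, $k(\Lambda_N)$ is the $N$-th Carlitz cyclotomic function field. $L_n$ denotes the subfield of degree $q^n$ over $k$ of $k(\Lambda_{1/T^{n+1}})$, the cyclotomic function field of modulus $(1/T)^{n+1}$ constructed with $\mathbb{F}_q[1/T]$ in place of $\mathbb{F}_q[T]$ (so $L_n$ is the fixed field of $\mathbb{F}_q^*$); $P_\infty$ is totally wildly ramified in $L_n/k$. $k_m:=\mathbb{F}_{q^m}(T)$, and ${}_nk(\Lambda_N)_m:=L_n\,k(\Lambda_N)\,\mathbb{F}_{q^m}$. By the Kronecker--Weber theorem every finite abelian extension of $k$ is contained in some ${}_nk(\Lambda_N)_m$. For a finite abelian extension $F/k$, $S_\infty(F)$ is the set of primes of $F$ above $P_\infty$; for $E/F$ abelian, $f_\infty(E/F)$ is the inertia degree of $S_\infty(F)$ in $E$. The degree of a prime of $S_\infty(K)$ in $K$ here means its relative degree $t=f_\infty(K/k)$ over $P_\infty$. The genus field $F_{\mathfrak{ge}}$ of a finite abelian extension $F/k$ is the maximal extension of $F$ that is abelian over $k$ and contained in the Hilbert class field of $F$, the latter being (Rosen) the maximal abelian extension of $F$ that is unramified at every prime and in which every prime of $S_\infty(F)$ decomposes fully. For a group $G$ of automorphisms of a field $A$, $A^G$ is the fixed field. $C_d$ is the cyclic group of order $d$. An extension of constants $B/A$ is an extension of the form $B=A\,\mathbb{F}_{q^r}$.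 *)

theory Defs
  imports "HOL-Library.Cardinality" "HOL-Algebra.Algebra" "HOL-Algebra.Algebraic_Closure_Type"
begin

text \<open>
  The base field is \<open>\<kk> = \<F>\<^sub>q(\<TT>)\<close>, where \<open>\<F>\<^sub>q\<close> is an arbitrary finite field, given as a type \<open>'a\<close>,
  and \<open>q = CARD('a)\<close>. All fields are subfields (as sets) of the algebraic closure of \<open>\<kk>\<close>.
\<close>

type_synonym 'a ac = "'a poly fract alg_closure"


section \<open>Subfields, Galois groups, abelian extensions\<close>

text \<open>The ambient field as a ring in the sense of HOL-Algebra, and its subset \<open>A\<close> with the
  inherited operations.\<close>

abbreviation \<Omega> :: "'b::field ring" where
  "\<Omega> \<equiv> ring_of_type_algebra"

abbreviation sub :: "'b::field set \<Rightarrow> 'b ring" where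
  "sub A \<equiv> \<Omega>\<lparr>carrier := A\<rparr>"

definition compositum :: "'b::field set set \<Rightarrow> 'b set" where
  "compositum \<F> = generate_field \<Omega> (\<Union>\<F>)"

abbreviation composite :: "'b::field set \<Rightarrow> 'b set \<Rightarrow> 'b set" (infixl \<open>\<squnion>\<^sub>F\<close> 65) where
  "A \<squnion>\<^sub>F B \<equiv> compositum {A, B}"

abbreviation has_degree :: "'b::field set \<Rightarrow> 'b set \<Rightarrow> nat \<Rightarrow> bool" where
  "has_degree F E n \<equiv> ring.dimension \<Omega> n F E"

text \<open>Automorphisms of \<open>E\<close> are extensional functions (undefined outside \<open>E\<close>), as in
  \<^theory>\<open>HOL-Algebra.Bij\<close>.\<close>

definition Gal :: "'b::field set \<Rightarrow> 'b set \<Rightarrow> ('b \<Rightarrow> 'b) set" where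
  "Gal E F = {\<sigma> \<in> Bij E. \<sigma> \<in> ring_hom (sub E) (sub E) \<and> (\<forall>x\<in>F. \<sigma> x = x)}"

definition aut_group :: "'b set \<Rightarrow> ('b \<Rightarrow> 'b) set \<Rightarrow> ('b \<Rightarrow> 'b) monoid" where
  "aut_group E G = BijGroup E\<lparr>carrier := G\<rparr>"

definition fixed_field :: "'b set \<Rightarrow> ('b \<Rightarrow> 'b) set \<Rightarrow> 'b set" where
  "fixed_field A G = {x \<in> A. \<forall>\<sigma>\<in>G. \<sigma> x = x}"

definition restrict_group :: "('b \<Rightarrow> 'b) set \<Rightarrow> 'b set \<Rightarrow> ('b \<Rightarrow> 'b) set" where
  "restrict_group G A = (\<lambda>\<sigma>. restrict \<sigma> A) ` G"

definition finite_abelian_ext :: "'b::field set \<Rightarrow> 'b set \<Rightarrow> bool" where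
  "finite_abelian_ext F E \<longleftrightarrow>
     subfield F \<Omega> \<and> subfield E \<Omega> \<and> F \<subseteq> E \<and> ring.finite_dimension \<Omega> F E \<and>
     fixed_field E (Gal E F) = F \<and> comm_group (aut_group E (Gal E F))"


section \<open>The rational function field, constants and cyclotomic function fields\<close>

definition cst :: "'a::{field,finite} \<Rightarrow> 'a ac" where
  "cst a = to_ac (Fract [:a:] 1)"

definition \<TT> :: "'a::{field,finite} ac" where
  "\<TT> = to_ac (Fract [:0, 1:] 1)"

definition \<kk> :: "'a::{field,finite} ac set" where
  "\<kk> = range to_ac"

text \<open>\<open>\<F>\<^bsub>q^r\<^esub>\<close> (for \<open>r \<ge> 1\<close>) is the set of roots of \<open>X\<^bsup>q^r\<^esup> - X\<close>.\<close>

definition Fq :: "nat \<Rightarrow> 'a::{field,finite} ac set" where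
  "Fq r = {x. x ^ (CARD('a) ^ r) = x}"

definition field_of_constants :: "'a::{field,finite} ac set \<Rightarrow> 'a ac set" where
  "field_of_constants F = {x \<in> F. ring.algebraic \<Omega> (range cst) x}"

definition ext_of_constants :: "'a::{field,finite} ac set \<Rightarrow> 'a ac set \<Rightarrow> bool" where
  "ext_of_constants A B \<longleftrightarrow> (\<exists>r\<ge>1. B = A \<squnion>\<^sub>F Fq r)"

text \<open>The Carlitz action of \<open>N \<in> \<F>\<^sub>q[t]\<close>, where \<open>t\<close> acts by \<open>y \<mapsto> t y + y\<^sup>q\<close>. The generator \<open>t\<close> is a
  parameter because both \<open>t = \<TT>\<close> and \<open>t = 1/\<TT>\<close> are needed; \<open>N\<close> is a polynomial in \<open>t\<close>.\<close>

definition carlitz :: "'a::{field,finite} ac \<Rightarrow> 'a poly \<Rightarrow> 'a ac \<Rightarrow> 'a ac" where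
  "carlitz t N x =
     (\<Sum>i\<le>Polynomial.degree N. cst (poly.coeff N i) * ((\<lambda>y. t * y + y ^ CARD('a)) ^^ i) x)"

definition cyclotomic_wrt :: "'a::{field,finite} ac \<Rightarrow> 'a poly \<Rightarrow> 'a ac set" where
  "cyclotomic_wrt t N = \<kk> \<squnion>\<^sub>F {x. carlitz t N x = 0}"

abbreviation cyclotomic :: "'a::{field,finite} poly \<Rightarrow> 'a ac set" where
  "cyclotomic N \<equiv> cyclotomic_wrt \<TT> N"

definition \<LL> :: "nat \<Rightarrow> 'a::{field,finite} ac set" where
  "\<LL> n = (THE F. subfield F \<Omega> \<and> \<kk> \<subseteq> F \<and>
            F \<subseteq> cyclotomic_wrt (inverse \<TT>) (Polynomial.monom 1 (n + 1)) \<and>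
            has_degree \<kk> F (CARD('a) ^ n))"

definition k_ext :: "nat \<Rightarrow> 'a::{field,finite} ac set" where
  "k_ext m = \<kk> \<squnion>\<^sub>F Fq m"

definition nkNm :: "nat \<Rightarrow> 'a::{field,finite} poly \<Rightarrow> nat \<Rightarrow> 'a ac set" where
  "nkNm n N m = \<LL> n \<squnion>\<^sub>F cyclotomic N \<squnion>\<^sub>F Fq m"


section \<open>Primes\<close>

text \<open>A prime of \<open>F\<close> is represented by its valuation ring \<open>P\<close>; the maximal ideal is the set of
  non-units. For \<open>F \<subseteq> E\<close>, the prime of \<open>F\<close> below the prime \<open>Q\<close> of \<open>E\<close> is \<open>Q \<inter> F\<close>.\<close>

definition primes_of :: "'a::{field,finite} ac set \<Rightarrow> 'a ac set set" where
  "primes_of F = {P. subring P \<Omega> \<and> range cst \<subseteq> P \<and> P \<subset> F \<and>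
                  (\<forall>x\<in>F. x \<in> P \<or> inverse x \<in> P)}"

definition max_ideal :: "'b::field set \<Rightarrow> 'b set" where
  "max_ideal P = P - Units (sub P)"

definition P_infty :: "'a::{field,finite} ac set" where
  "P_infty = {to_ac (Fract f g) | f g. g \<noteq> 0 \<and> Polynomial.degree f \<le> Polynomial.degree g}"

definition S_infty :: "'a::{field,finite} ac set \<Rightarrow> 'a ac set set" where
  "S_infty F = {P \<in> primes_of F. P \<inter> \<kk> = P_infty}"

text \<open>The exponent \<open>e\<close> with \<open>\<pp> \<O> = \<PP>\<^sup>e\<close>, where \<open>\<O> = Q\<close> is the valuation ring of \<open>\<PP> = (\<pi>)\<close> and \<open>\<pp>\<close> is
  the maximal ideal of \<open>Q \<inter> F\<close>.\<close>

definition ramification_index :: "'b::field set \<Rightarrow> 'b set \<Rightarrow> nat" where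
  "ramification_index F Q = (THE e. \<exists>\<pi>\<in>Q. PIdl\<^bsub>sub Q\<^esub> \<pi> = max_ideal Q \<and>
     Idl\<^bsub>sub Q\<^esub> (max_ideal (Q \<inter> F)) = PIdl\<^bsub>sub Q\<^esub> (\<pi> ^ e))"

text \<open>The residue field of \<open>Q \<inter> F\<close> is identified with its image in the residue field of \<open>Q\<close>.\<close>

definition inertia_degree :: "'b::field set \<Rightarrow> 'b set \<Rightarrow> nat" where
  "inertia_degree F Q = (let R = sub Q Quot max_ideal Q in
     ring.dim R ((\<lambda>x. max_ideal Q +>\<^bsub>sub Q\<^esub> x) ` (Q \<inter> F)) (carrier R))"

text \<open>\<open>f\<^sub>\<infinity>(E/F)\<close>; for \<open>E/\<kk>\<close> abelian all primes in \<open>S\<^sub>\<infinity>(E)\<close> have the same inertia degree over \<open>F\<close>.\<close>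

definition f_infty :: "'a::{field,finite} ac set \<Rightarrow> 'a ac set \<Rightarrow> nat" where
  "f_infty E F = (THE f. \<forall>Q\<in>S_infty E. inertia_degree F Q = f)"

definition unramified :: "'a::{field,finite} ac set \<Rightarrow> 'a ac set \<Rightarrow> bool" where
  "unramified F E \<longleftrightarrow> (\<forall>Q\<in>primes_of E. ramification_index F Q = 1)"

definition decomposes_fully ::
    "'a::{field,finite} ac set \<Rightarrow> 'a ac set \<Rightarrow> 'a ac set \<Rightarrow> bool" where
  "decomposes_fully F E P \<longleftrightarrow> finite {Q \<in> primes_of E. Q \<inter> F = P} \<and>
     has_degree F E (card {Q \<in> primes_of E. Q \<inter> F = P})"

definition decomposition_group :: "'b::field set \<Rightarrow> 'b set \<Rightarrow> 'b set \<Rightarrow> ('b \<Rightarrow> 'b) set" where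
  "decomposition_group E F Q = {\<sigma> \<in> Gal E F. \<sigma> ` Q = Q}"


section \<open>Hilbert class field and genus field\<close>

text \<open>The defining properties are stable under composita, and an algebraic extension has them iff
  its finite subextensions do; so the maximal extension is the compositum of the finite ones.\<close>

definition hilbert_class_field :: "'a::{field,finite} ac set \<Rightarrow> 'a ac set" where
  "hilbert_class_field F = compositum {E. finite_abelian_ext F E \<and> unramified F E \<and>
     (\<forall>P\<in>S_infty F. decomposes_fully F E P)}"

definition genus_field :: "'a::{field,finite} ac set \<Rightarrow> 'a ac set" where
  "genus_field F = compositum {E. F \<subseteq> E \<and> finite_abelian_ext \<kk> E \<and> E \<subseteq> hilbert_class_field F}"

end

theory Submission
  imports Defs
begin

text \<open>All fields are subfields of the algebraic closure of \<open>\<kk>\<close>, and their places are the traces of its valuation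
  rings \<open>V\<close>. Ramification theory turns the genus field into Galois theory: for finite abelian extensions of \<open>\<kk>\<close>,
  \<open>F/K\<close> is unramified at \<open>V\<close>, or fully decomposed there, iff the elements of the inertia group, or of the
  decomposition group, of \<open>V\<close> that fix \<open>K\<close> also fix \<open>F\<close>.

  At an infinite place the decomposition group of \<open>k(\<Lambda>\<^sub>N)/k\<close> is its inertia group and has order dividing \<open>q - 1\<close>,
  while \<open>L\<^sub>n\<close> is totally ramified of degree \<open>q\<^bsup>n\<^esup>\<close> and the constant extension \<open>k\<^sub>m\<close> is unramified. So if \<open>i\<close> is in the
  inertia group, then \<open>i\<^bsup>q^n\<^esup>\<close> agrees with \<open>i\<close> on \<open>k(\<Lambda>\<^sub>N)\<close> and is trivial on \<open>L\<^sub>n k\<^sub>m\<close>. Dividing automorphisms by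
  such powers separates their actions on \<open>k(\<Lambda>\<^sub>N)\<close> and \<open>L\<^sub>n k\<^sub>m\<close>; this puts the genus field of \<open>K\<close> inside the composite of
  \<open>K\<close> and the genus field of \<open>E\<close>, and shows that an element of the decomposition group over \<open>K\<close> that fixes the
  constants of \<open>EK\<close> is trivial on that composite. That group is therefore generated by a Frobenius automorphism,
  of order \<open>d\<close> on every field between \<open>E\<close> and the composite.\<close>

text \<open>One valuation ring \<open>V\<close> of the algebraic closure induces primes in all
  intermediate fields at once. Hence the groups \<open>dgrp V L\<close> and \<open>igrp V L\<close>,
  for all \<open>L\<close>, lie in one group of automorphisms of the closure: enlarging the base
  field is inclusion, shrinking the top field is restriction. Residues of \<open>V\<close> are
  represented by constants in \<open>Fqbar\<close>, so a Frobenius automorphism acts on elements of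
  the fields themselves, and its order can be read off from constant fields. The genus field is only
  known as a union of finite layers; every Galois argument is made in a layer
  \<open>genus_ext\<close> and then passed to the union. The inclusion into the composite with
  \<open>K\<close> is delicate because an automorphism that fixes the right subfield need not
  preserve \<open>V\<close>. It has to be exchanged for one that does, acts in the same way on
  \<open>\<LL> n\<close> and on constants, and is trivial on the genus field of \<open>E\<close>.
  Total ramification makes this possible: some decomposition element realizes the action on
  constants, and an inertia element corrects it on \<open>\<LL> n\<close> without touching the
  constants.\<close>

abbreviation (input) iff_infix (infixr "<->" 25) where "A <-> B == A = (B::bool)"
abbreviation (input) composite_infix (infixl "**" 65) where "A**B == A \<squnion>\<^sub>F B"
abbreviation "rgrp == restrict_group"
abbreviation "pdeg == Polynomial.degree"
abbreviation "pmon == Polynomial.monom"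
abbreviation "plc == Polynomial.lead_coeff"
abbreviation "psmul == Polynomial.smult"

section \<open>Subfields and generated subfields\<close>

text \<open>Subfields in terms of the type class operations. As \<open>inverse 0 = 0\<close>,
  closure under \<open>inverse\<close> covers all elements; sums and negatives come from
  differences.\<close>

definition sfield :: "'b::field set => bool" where
 "sfield F <-> 1:F & (ALL x:F. ALL y:F. x-y:F & x*y:F) & (ALL x:F. inverse x:F)"

lemma field_\<Omega>: "Ring.field (\<Omega> :: 'b::field ring)"
 by(rule field_from_type_algebra)

lemma \<Omega>_simps [simp]:
 "carrier (\<Omega> :: 'b::field ring) = UNIV" "x \<otimes>\<^bsub>\<Omega>\<^esub> y = x*(y :: 'b::field)"
 "x \<oplus>\<^bsub>\<Omega>\<^esub> y = x+(y :: 'b::field)" "\<one>\<^bsub>\<Omega>\<^esub> = (1 :: 'b::field)" "\<zero>\<^bsub>\<Omega>\<^esub> = (0 :: 'b::field)"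
 by(simp_all add: ring_of_type_algebra_def)

lemma \<Omega>_a_inv [simp]:"\<ominus>\<^bsub>\<Omega>\<^esub> x =-(x :: 'b::field)"
proof -
 interpret Ring.field "\<Omega> :: 'b ring" by(rule field_\<Omega>)
 show ?thesis using minus_equality[of "-x" x] by simp
qed

lemma \<Omega>_m_inv [simp]:"x~=0 ==> inv\<^bsub>\<Omega>\<^esub> x = inverse (x :: 'b::field)"
proof -
 interpret Ring.field "\<Omega> :: 'b ring" by(rule field_\<Omega>)
 assume "x~=0"
 thus ?thesis using comm_inv_char[of x "inverse x"] by simp
qed

lemma \<Omega>_nat_pow [simp]:"x [^]\<^bsub>\<Omega>\<^esub> (n::nat) = (x :: 'b::field)^n"
proof -
 interpret Ring.field "\<Omega> :: 'b ring" by(rule field_\<Omega>)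
 show ?thesis by(induction n) (simp_all add: mult.commute)
qed

context
 fixes F :: "'b::field set"
 assumes F:"sfield F"
begin

lemma sfield_1:"1:F" and sfield_diff:"x:F ==> y:F ==> x-y:F"
 and sfield_mult:"x:F ==> y:F ==> x*y:F" and sfield_inverse:"x:F ==> inverse x:F"
 using F by(auto simp: sfield_def)

lemma sfield_0:"0:F"
 using sfield_diff[OF sfield_1 sfield_1] by simp

lemma sfield_uminus:"x:F ==>-x:F"
 using sfield_diff[OF sfield_0] by force

lemma sfield_add:"x:F ==> y:F ==> x+y:F"
 using sfield_diff[OF _ sfield_uminus, of x y] by simp

lemma sfield_divide:"x:F ==> y:F ==> x/y:F"
 using sfield_mult sfield_inverse by(simp add: divide_inverse)

lemma sfield_power:"x:F ==> x^n:F"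
 by(induction n) (auto intro: sfield_1 sfield_mult)

lemma sfield_sum:"(!!i. i:I ==> f i:F) ==> sum f I:F"
 by(induction I rule: infinite_finite_induct) (auto intro: sfield_0 sfield_add)

lemma sfield_prod:"(!!i. i:I ==> f i:F) ==> prod f I:F"
 by(induction I rule: infinite_finite_induct) (auto intro: sfield_1 sfield_mult)

lemmas sfield_intros = sfield_0 sfield_1 sfield_diff sfield_mult sfield_inverse sfield_uminus sfield_add
 sfield_divide sfield_power sfield_sum sfield_prod

end

lemma subfield_\<Omega>_iff:"subfield F \<Omega> <-> sfield (F :: 'b::field set)"
proof
 interpret Ring.field "\<Omega> :: 'b ring" by(rule field_\<Omega>)
 assume *: "subfield F \<Omega>"
 then interpret S: subfield F \<Omega> .
 have inv:"inverse x:F" if "x:F" for x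
 proof (cases "x = 0")
  case True thus ?thesis using that by simp
 next
  case False
  thus ?thesis using subfield_m_inv[OF *, of x] that by simp
 qed
 have "1:F" using S.one_closed by simp
 moreover have "x*y:F" if "x:F" "y:F" for x y using S.m_closed[of x y] that by simp
 moreover have "x-y:F" if "x:F" "y:F" for x y
 proof -
  have "- y:F" using subringE(5)[OF subfieldE(1)[OF *], of y] that by simp
  thus ?thesis using subringE(7)[OF subfieldE(1)[OF *], of x "-y"] that by simp
 qed
 ultimately show "sfield F" using inv by(auto simp: sfield_def)
next
 interpret Ring.field "\<Omega> :: 'b ring" by(rule field_\<Omega>)
 assume *: "sfield F"
 have "subring F \<Omega>"
  by(rule subringI) (auto intro: sfield_intros[OF *])
 thus "subfield F \<Omega>"
  by(rule subfieldI') (use sfield_inverse[OF *] in auto)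
qed

lemma sfield_Int:"sfield A ==> sfield B ==> sfield (A Int B)"
 by(auto simp: sfield_def)

abbreviation adj :: "'b::field set => 'b set" where
 "adj S == generate_field \<Omega> S"

lemma sfield_adj:"sfield (adj (S :: 'b::field set))"
proof -
 interpret Ring.field "\<Omega> :: 'b ring" by(rule field_\<Omega>)
 show ?thesis using generate_field_is_subfield[of S] by(simp add: subfield_\<Omega>_iff)
qed

lemma adj_incl:"S<=adj (S :: 'b::field set)"
 by(auto intro: generate_field.incl)

lemma adj_min:"sfield F ==> S<=F ==> adj S<=(F :: 'b::field set)"
proof -
 interpret Ring.field "\<Omega> :: 'b ring" by(rule field_\<Omega>)
 assume "sfield F" "S<=F"
 thus ?thesis using generate_field_min_subfield1[of S F] by(simp add: subfield_\<Omega>_iff)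
qed

lemma adj_mono:"S<=T ==> adj S<=adj (T :: 'b::field set)"
 by(rule adj_min[OF sfield_adj]) (use adj_incl in auto)

lemma adj_eq:"sfield F ==> adj F = (F :: 'b::field set)"
 using adj_min[of F F] adj_incl by auto

lemma adj_Un_adj:"adj (A Un adj B) = adj (A Un (B :: 'b::field set))"
proof
 have "B<=adj B" by(rule adj_incl)
 thus "adj (A Un B)<=adj (A Un adj B)" by(intro adj_mono) auto
 have "adj B<=adj (A Un B)" by(rule adj_mono) auto
 thus "adj (A Un adj B)<=adj (A Un B)" using adj_incl[of "A Un B"] by(intro adj_min sfield_adj) auto
qed

text \<open>Two elements generated by finite sets are both generated by the union of these sets; so
  the elements of this kind form a field containing \<open>S\<close>.\<close>

lemma adj_finitary:
 assumes "x:adj (S :: 'b::field set)"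
 shows "EX T. finite T & T<=S & x:adj T"
proof -
 let ?F = "{x. EX T. finite T & T<=S & x:adj T}"
 have two:"EX T. finite T & T<=S & x:adj T & y:adj T" if "x:?F" "y:?F" for x y
 proof -
  from that obtain T U where "finite T" "T<=S" "x:adj T" "finite U" "U<=S" "y:adj U" by auto
  moreover have "adj T<=adj (T Un U)" "adj U<=adj (T Un U)" by(auto intro!: adj_mono)
  ultimately show ?thesis by(intro exI[of _ "T Un U"]) auto
 qed
 have "sfield ?F"
  unfolding sfield_def
 proof (intro conjI ballI)
  show "1:?F" using sfield_1[OF sfield_adj, of "{}"] by auto
  fix x y assume "x:?F" "y:?F"
  from two[OF this] obtain T where T:"finite T" "T<=S" "x:adj T" "y:adj T" by blast
  show "x-y:?F" using T sfield_diff[OF sfield_adj T(3,4)] by auto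
  show "x*y:?F" using T sfield_mult[OF sfield_adj T(3,4)] by auto
 next
  fix x assume "x:?F"
  then obtain T where T:"finite T" "T<=S" "x:adj T" by blast
  thus "inverse x:?F" using sfield_inverse[OF sfield_adj T(3)] by auto
 qed
 moreover have "S<=?F"
 proof
  fix x assume "x:S"
  thus "x:?F" using adj_incl[of "{x}"] by(intro CollectI exI[of _ "{x}"]) auto
 qed
 ultimately show ?thesis using adj_min[of ?F S] assms by blast
qed

lemma composite_eq:"A**B = adj (A Un B)"
 by(simp add: compositum_def)

lemma sfield_composite:"sfield (A**B)"
 by(simp add: composite_eq sfield_adj)

lemma composite_incl:"A<=A**B" "B<=A**B"
 using adj_incl[of "A Un B"] by(auto simp: composite_eq)

lemma composite_min:"sfield F ==> A<=F ==> B<=F ==> A**B<=F"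
 by(simp add: composite_eq adj_min)

lemma composite_mono:"A<=A' ==> B<=B' ==> A**B<=A'**B'"
 by(auto simp: composite_eq intro!: adj_mono)


section \<open>Polynomials over a subfield\<close>

text \<open>Polynomials over \<open>F\<close> are kept as polynomials over the ambient field, so
  that evaluation, derivatives and splitting take place there without coercions.\<close>

definition coeffs_in :: "'b::field set => 'b poly => bool" where
 "coeffs_in F p <-> (ALL i. coeff p i:F)"

lemma coeffs_inD:"coeffs_in F p ==> coeff p i:F"
 by(simp add: coeffs_in_def)

lemma coeffs_in_mono:"coeffs_in F p ==> F<=F' ==> coeffs_in F' p"
 by(auto simp: coeffs_in_def)

context
 fixes F :: "'b::field set"
 assumes F:"sfield F"
begin

lemma coeffs_in_0:"coeffs_in F 0" and coeffs_in_1:"coeffs_in F 1"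
 using sfield_0[OF F] sfield_1[OF F] by(auto simp: coeffs_in_def coeff_1)

lemma coeffs_in_pCons:"coeffs_in F (pCons a p) <-> a:F & coeffs_in F p"
proof -
 have "(ALL i. coeff (pCons a p) i:F) <-> coeff (pCons a p) 0:F & (ALL i. coeff (pCons a p) (Suc i):F)"
  by(metis nat.exhaust)
 thus ?thesis by(simp add: coeffs_in_def)
qed

lemma coeffs_in_add:"coeffs_in F p ==> coeffs_in F q ==> coeffs_in F (p+q)"
 and coeffs_in_diff:"coeffs_in F p ==> coeffs_in F q ==> coeffs_in F (p-q)"
 and coeffs_in_smult:"a:F ==> coeffs_in F p ==> coeffs_in F (psmul a p)"
 and coeffs_in_mult:"coeffs_in F p ==> coeffs_in F q ==> coeffs_in F (p*q)"
 and coeffs_in_monom:"a:F ==> coeffs_in F (pmon a n)"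
 and coeffs_in_pderiv:"coeffs_in F p ==> coeffs_in F (pderiv p)"
 and poly_in:"coeffs_in F p ==> x:F ==> poly p x:F"
proof -
 have of_nat:"of_nat n:F" for n by(induction n) (auto intro: sfield_intros[OF F])
 show "coeffs_in F p ==> coeffs_in F (pderiv p)"
  unfolding coeffs_in_def coeff_pderiv by(intro allI sfield_mult[OF F] of_nat) auto
qed (auto simp: coeffs_in_def coeff_mult poly_altdef intro!: sfield_intros[OF F])

lemma coeffs_in_power:"coeffs_in F p ==> coeffs_in F (p^n)"
 by(induction n) (auto intro: coeffs_in_1 coeffs_in_mult)

lemma coeffs_in_prod:"(!!i. i:I ==> coeffs_in F (f i)) ==> coeffs_in F (prod f I)"
 by(induction I rule: infinite_finite_induct) (auto intro: coeffs_in_1 coeffs_in_mult)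

lemma coeffs_in_sum:"(!!i. i:I ==> coeffs_in F (f i)) ==> coeffs_in F (sum f I)"
 by(induction I rule: infinite_finite_induct) (auto intro: coeffs_in_0 coeffs_in_add)

text \<open>Long division only uses field operations on coefficients, so quotient and remainder stay
  over \<open>F\<close>: subtracting \<open>f*?m\<close> cancels the leading term of
  \<open>p\<close>.\<close>

lemma coeffs_in_division:
 assumes f:"coeffs_in F f" "f~=0" and p:"coeffs_in F p"
 shows "EX s r. p = f*s+r & coeffs_in F s & coeffs_in F r & (r = 0 | pdeg r < pdeg f)"
 using p
proof (induction "pdeg p" arbitrary: p rule: less_induct)
 case less
 show ?case
 proof (cases "p = 0 | pdeg p < pdeg f")
  case True
  thus ?thesis using less.prems coeffs_in_0 by(intro exI[of _ 0] exI[of _ p]) auto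
 next
  case False
  let ?c = "plc p/plc f"
  let ?m = "pmon ?c (pdeg p-pdeg f)"
  have c:"?c:F" using less.prems f by(intro sfield_divide[OF F]) (auto simp: coeffs_in_def)
  have m:"coeffs_in F ?m" by(rule coeffs_in_monom[OF c])
  have nz:"plc p~=0" "plc f~=0" using False f by auto
  hence "?c~=0" by simp
  let ?p = "p-f*?m"
  have "pdeg (f*?m) = pdeg p"
   using False f `?c ~= 0` by(subst degree_mult_eq) (auto simp: degree_monom_eq monom_eq_0_iff)
  moreover have "coeff (f*?m) (pdeg p) = plc p"
   using False nz by(subst mult.commute) (simp add: coeff_monom_mult)
  ultimately have "?p = 0 | pdeg ?p < pdeg p"
   by(metis (no_types, lifting) coeff_diff degree_diff_le diff_self leading_coeff_0_iff order.refl order_le_imp_less_or_eq)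
  moreover have p':"coeffs_in F ?p" using less.prems m f by(intro coeffs_in_diff coeffs_in_mult)
  ultimately have "EX s r. ?p = f*s+r & coeffs_in F s & coeffs_in F r & (r = 0 | pdeg r < pdeg f)"
   using less.hyps[of ?p] coeffs_in_0 by(metis add_0_right mult_zero_right)
  then obtain s r where "?p = f*s+r" "coeffs_in F s" "coeffs_in F r" "r = 0 | pdeg r < pdeg f"
   by blast
  moreover from this have "p = f*(?m+s)+r" by(simp add: algebra_simps)
  ultimately show ?thesis using coeffs_in_add[OF m] by blast
 qed
qed

end

text \<open>A generator of the ideal of polynomials over \<open>F\<close> that vanish at
  \<open>x\<close>; it is not normalized to be monic.\<close>

definition min_poly :: "'b::field set => 'b => 'b poly => bool" where
 "min_poly F x f <-> coeffs_in F f & f~=0 & pdeg f > 0 & poly f x = 0 &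
  (ALL g. coeffs_in F g --> poly g x = 0 --> (EX s. coeffs_in F s & g = f*s))"

lemma min_polyD:
 assumes "min_poly F x f"
 shows "coeffs_in F f" "f~=0" "pdeg f > 0" "poly f x = 0"
  "!!g. coeffs_in F g ==> poly g x = 0 ==> EX s. coeffs_in F s & g = f*s"
 using assms unfolding min_poly_def by simp_all

lemma ex_min_poly:
 assumes F:"sfield F" and "EX p. coeffs_in F p & p~=0 & poly p x = 0"
 shows "EX f. min_poly F x f"
proof -
 define f where "f = (ARG_MIN pdeg p. coeffs_in F p & p~=0 & poly p x = 0)"
 have f:"coeffs_in F f & f~=0 & poly f x = 0"
  and min:"!!g. coeffs_in F g & g~=0 & poly g x = 0 ==> pdeg f<=pdeg g"
  using assms(2) arg_min_natI[of "%p. coeffs_in F p & p~=0 & poly p x = 0" _ pdeg]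
   arg_min_nat_le[of "%p. coeffs_in F p & p~=0 & poly p x = 0" _ pdeg]
  unfolding f_def by blast+
 have "pdeg f > 0"
 proof (rule ccontr)
  assume "~?thesis"
  then obtain a where "f = [:a:]" using degree_eq_zeroE by blast
  thus False using f by simp
 qed
 moreover have "EX s. coeffs_in F s & g = f*s" if g:"coeffs_in F g" "poly g x = 0" for g
 proof -
  obtain s r where *: "g = f*s+r" "coeffs_in F s" "coeffs_in F r" "r = 0 | pdeg r < pdeg f"
   using coeffs_in_division[OF F _ _ g(1), of f] f by blast
  have "poly r x = 0" using * f g by simp
  hence "r = 0" using min[of r] * by fastforce
  thus ?thesis using * by auto
 qed
 ultimately have "min_poly F x f" using f unfolding min_poly_def by simp
 thus ?thesis ..
qed

lemma poly_splits:
 fixes p :: "'b::alg_closed_field poly"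
 assumes "p~=0"
 obtains A where "p = psmul (plc p) (PROD a:#A. [:- a, 1:])"
  "size A = pdeg p" "set_mset A = {a. poly p a = 0}"
proof -
 obtain A where A:"size A = pdeg p" "p = psmul (plc p) (PROD x:#A. [:- x, 1:])"
  using alg_closed_imp_factorization[OF assms] by blast
 have "poly p a = 0 <-> a \<in># A" for a
 proof -
  have "poly (PROD x:#A. [:- x, 1:]) a = 0 <-> a \<in># A" for A :: "'b multiset"
   by(induction A) auto
  thus ?thesis using assms by(subst A(2)) simp
 qed
 thus thesis using that[OF A(2,1)] by auto
qed

text \<open>A root of multiplicity two would be a root of the derivative. So the multiset of roots
  has no repetitions, and its size is the degree.\<close>

lemma card_roots_simple:
 fixes p :: "'b::alg_closed_field poly"
 assumes "p~=0" "!!a. poly p a = 0 ==> poly (pderiv p) a~=0"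
 shows "card {a. poly p a = 0} = pdeg p"
proof -
 obtain A where A:"p = psmul (plc p) (PROD a:#A. [:- a, 1:])"
  "size A = pdeg p" "set_mset A = {a. poly p a = 0}" using poly_splits[OF assms(1)] .
 have "count A a<=1" for a
 proof (rule ccontr)
  assume "~count A a<=1"
  hence "{#a, a#} <=# A" by(simp add: subseteq_mset_def)
  then obtain B where "A = {#a, a#}+B" using mset_subset_eq_exists_conv by metis
  hence "p = [:- a, 1:]\<^sup>2*psmul (plc p) (PROD a:#B. [:- a, 1:])"
   by(subst A(1)) (simp add: power2_eq_square mult_smult_right mult.assoc del: mult_pCons_left mult_pCons_right)
  then obtain g where g:"p = [:- a, 1:]\<^sup>2*g" by blast
  have "poly p a = 0" "poly (pderiv p) a = 0"
   unfolding g by(simp_all add: pderiv_mult power2_eq_square del: mult_pCons_left mult_pCons_right)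
  thus False using assms(2) by blast
 qed
 thus ?thesis by(metis (no_types, lifting) A(2,3) count_eq_zero_iff count_greater_eq_one_iff count_mset_set(1,3) finite_set_mset multiset_eqI order_antisym_conv size_mset_set)
qed

section \<open>Automorphisms of the algebraic closure\<close>

text \<open>Intermediate fields between \<open>\<kk>\<close> and its algebraic closure; every
  element of the closure is algebraic over them.\<close>

definition ifield :: "'a::{field,finite} ac set => bool" where
 "ifield L <-> sfield L & \<kk><=L"

definition endo :: "('b::field => 'b) => bool" where
 "endo sg <-> sg 1 = 1 & (ALL x y. sg (x+y) = sg x+sg y) & (ALL x y. sg (x*y) = sg x*sg y)"

text \<open>Only endomorphisms are asked for: above \<open>\<kk>\<close> algebraicity makes them
  bijective (\<open>auts_bij\<close>), so for an intermediate field this is the automorphism group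
  of the closure over \<open>L\<close>.\<close>

definition auts :: "'b::field set => ('b => 'b) set" where
 "auts L = {sg. endo sg & (ALL x:L. sg x = x)}"

lemma sfield_kk:"sfield \<kk>"
 unfolding sfield_def \<kk>_def
proof (intro conjI ballI)
 show "1:range to_ac" by(metis rangeI to_ac_1)
 fix x y :: "'a ac" assume "x:range to_ac" "y:range to_ac"
 then obtain a b where "x = to_ac a" "y = to_ac b" by blast
 hence "x-y = to_ac (a-b)" "x*y = to_ac (a*b)" by simp_all
 thus "x-y:range to_ac" "x*y:range to_ac" by blast+
next
 fix x :: "'a ac" assume "x:range to_ac"
 then obtain a where "x = to_ac a" by blast
 hence "inverse x = to_ac (inverse a)" by simp
 thus "inverse x:range to_ac" by blast
qed

lemma ifield_sfield:"ifield L ==> sfield L" and ifield_kk:"ifield L ==> \<kk><=L"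
 by(auto simp: ifield_def)

lemma ifield_kk_self:"ifield \<kk>"
 by(simp add: ifield_def sfield_kk)

lemma ifield_adj:"\<kk><=S ==> ifield (adj S)"
 using adj_incl[of S] by(auto simp: ifield_def sfield_adj)

lemma ifield_composite:"\<kk><=A ==> ifield (A**B)" "\<kk><=B ==> ifield (A**B)"
 using composite_incl[of A B] composite_incl[of B A] by(auto simp: ifield_def sfield_composite)

lemma ifield_Int:"ifield A ==> ifield B ==> ifield (A Int B)"
 by(auto simp: ifield_def sfield_Int)

lemma algebraic_over_kk:"EX p. coeffs_in \<kk> p & p~=0 & poly p (x :: 'a::{field,finite} ac) = 0"
proof -
 obtain p :: "'a poly fract poly" where p:"p~=0" "poly (map_poly to_ac p) x = 0"
  using alg_closure_algebraic[of x] .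
 have "map_poly to_ac p~=0" using p(1) by(simp add: map_poly_eq_0_iff)
 moreover have "coeffs_in \<kk> (map_poly to_ac p)" by(simp add: coeffs_in_def \<kk>_def coeff_map_poly)
 ultimately show ?thesis using p(2) by blast
qed

lemma algebraic_over_ifield:"ifield L ==> EX p. coeffs_in L p & p~=0 & poly p (x :: 'a::{field,finite} ac) = 0"
 by(meson algebraic_over_kk coeffs_in_mono ifield_kk)

text \<open>Inverses come from algebraicity: for \<open>x~=0\<close> the minimal polynomial over
  \<open>\<kk>\<close> has constant term \<open>c~=0\<close>, and solving
  \<open>c+x*poly q x = 0\<close> writes \<open>inverse x\<close> as a polynomial in
  \<open>x\<close>.\<close>

lemma ifieldI:
 assumes kk:"\<kk><=A" and diff:"!!x y. x:A ==> y:A ==> x-y:A"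
  and mult:"!!x y. x:A ==> y:A ==> x*y:A"
 shows "ifield A"
proof -
 have 0:"0:A" using kk sfield_0[OF sfield_kk] by blast
 have add:"x+y:A" if "x:A" "y:A" for x y
  using diff[OF that(1) diff[OF 0 that(2)]] by simp
 have "inverse x:A" if x:"x:A" for x
 proof (cases "x = 0")
  case True
  thus ?thesis using 0 by simp
 next
  case False
  obtain f where fm:"min_poly \<kk> x f" using ex_min_poly[OF sfield_kk algebraic_over_kk[of x]] by blast
  note f = min_polyD[OF fm]
  obtain c q where cq:"f = pCons c q" by(rule pCons_cases)
  have q:"coeffs_in \<kk> q" and c:"c:\<kk>" using f(1) by(auto simp: cq coeffs_in_pCons[OF sfield_kk])
  have eq:"c+x*poly q x = 0" using f(4) by(simp add: cq)
  have "c~=0"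
  proof
   assume "c = 0"
   hence "poly q x = 0" using eq False by simp
   then obtain s where s:"q = f*s" using f(5) q by blast
   have "q~=0" using f(2) `c = 0` by(simp add: cq)
   hence "pdeg q = pdeg f+pdeg s"
    using s by(metis degree_mult_eq mult_eq_0_iff)
   thus False using `q ~= 0` by(simp add: cq)
  qed
  hence "inverse x = (- inverse c)*poly q x"
  proof -
   have "x*poly q x = - c" using eq by(simp add: add_eq_0_iff)
   hence "x*(- inverse c*poly q x) = 1" using `c ~= 0` by(simp add: mult.left_commute[of x])
   thus ?thesis by(rule inverse_unique)
  qed
  moreover have "poly q x:A"
   using q
  proof (induction q)
   case 0
   show ?case using `0:A` by simp
  next
   case (pCons a p)
   thus ?case using kk by(auto simp: coeffs_in_pCons[OF sfield_kk] intro!: add mult x)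
  qed
  moreover have "- inverse c:A" by(rule subsetD[OF kk sfield_uminus[OF sfield_kk sfield_inverse[OF sfield_kk c]]])
  ultimately show ?thesis using mult by metis
 qed
 thus ?thesis using kk diff mult sfield_1[OF sfield_kk] by(auto simp: ifield_def sfield_def)
qed

lemma endo_1:"endo sg ==> sg 1 = 1" and endo_add:"endo sg ==> sg (x+y) = sg x+sg y"
 and endo_mult:"endo sg ==> sg (x*y) = sg x*sg y"
 by(auto simp: endo_def)

lemma endo_0:"endo sg ==> sg 0 = 0"
 by(metis add_cancel_left_left endo_add)

lemma endo_uminus:"endo sg ==> sg (- x) =-sg x"
 using endo_add[of sg x "- x"] endo_0[of sg] by(simp add: eq_neg_iff_add_eq_0 add.commute)

lemma endo_diff:"endo sg ==> sg (x-y) = sg x-sg y"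
 using endo_add[of sg x "- y"] endo_uminus[of sg y] by simp

lemma endo_inverse:"endo sg ==> sg (inverse x) = inverse (sg x)"
 by(metis endo_0 endo_1 endo_mult inverse_unique inverse_zero right_inverse)

lemma endo_power:"endo sg ==> sg (x^n) = sg x^n"
 by(induction n) (simp_all add: endo_1 endo_mult)

lemma endo_sum:"endo sg ==> sg (sum f I) = (SUM i:I. sg (f i))"
 by(induction I rule: infinite_finite_induct) (auto simp: endo_0 endo_add)

lemma endo_prod:"endo sg ==> sg (prod f I) = (PROD i:I. sg (f i))"
 by(induction I rule: infinite_finite_induct) (auto simp: endo_1 endo_mult)

lemma endo_eq_0_iff:"endo sg ==> sg x = 0 <-> x = 0"
 by(metis endo_0 endo_1 endo_mult mult_zero_left right_inverse zero_neq_one)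

lemma endo_inj:"endo sg ==> sg x = sg y <-> x = y"
 using endo_eq_0_iff[of sg "x-y"] by(simp add: endo_diff)

lemma endo_poly:"endo sg ==> coeffs_in L p ==> (!!a. a:L ==> sg a = a) ==> sg (poly p x) = poly p (sg x)"
 by(simp add: poly_altdef endo_sum endo_mult endo_power coeffs_inD)

lemma endo_comp:"endo sg ==> endo ta ==> endo (%x. sg (ta x))"
 by(simp add: endo_def)

lemma auts_endo:"sg:auts L ==> endo sg" and auts_fix:"sg:auts L ==> x:L ==> sg x = x"
 by(auto simp: auts_def)

lemma auts_mono:"L<=L' ==> auts L'<=auts L"
 by(auto simp: auts_def)

lemma auts_id:"(%x. x):auts L"
 by(simp add: auts_def endo_def)

lemma auts_comp:"sg:auts L ==> ta:auts L ==> (%x. sg (ta x)):auts L"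
 by(simp add: auts_def endo_comp)

lemma endo_eq_adj:
 assumes "endo sg" "endo ta" "!!x. x:S ==> sg x = ta x" "x:adj S"
 shows "sg x = ta (x :: 'b::field)"
proof -
 have "sfield {x. sg x = ta x}"
  using assms(1,2) by(simp add: sfield_def endo_1 endo_diff endo_mult endo_inverse)
 hence "adj S<={x. sg x = ta x}" by(rule adj_min) (use assms(3) in auto)
 thus ?thesis using assms(4) by blast
qed

text \<open>An injective map that sends the finite root set of a polynomial over
  \<open>\<kk>\<close> into itself permutes it, and every element is such a root.\<close>

lemma auts_bij:
 assumes "sg:auts \<kk>"
 shows "bij (sg :: 'a::{field,finite} ac => 'a ac)"
proof -
 note e = auts_endo[OF assms]
 have "inj sg" by(rule injI) (simp add: endo_inj[OF e])
 moreover have "y:range sg" for y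
 proof -
  obtain p where p:"coeffs_in \<kk> p" "p~=0" "poly p y = 0" using algebraic_over_kk[of y] by blast
  let ?Z = "{x. poly p x = 0}"
  have "sg`?Z<=?Z"
   using endo_poly[OF e p(1) auts_fix[OF assms], symmetric] endo_0[OF e] by auto
  moreover have "finite ?Z" by(rule poly_roots_finite[OF p(2)])
  ultimately have "sg`?Z = ?Z"
   by(meson `inj sg` endo_inj_surj inj_on_subset subset_UNIV)
  thus ?thesis using p(3) by blast
 qed
 ultimately show ?thesis by(auto intro: bijI)
qed

lemma auts_kk:"ifield L ==> sg:auts L ==> sg:auts \<kk>"
 using auts_mono[OF ifield_kk] by blast

abbreviation ainv :: "('b => 'b) => 'b => 'b" where
 "ainv == inv_into UNIV"

lemma auts_inv:
 assumes "sg:auts L" "ifield L"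
 shows "ainv sg:auts L"
proof -
 have b:"bij sg" by(rule auts_bij[OF auts_kk[OF assms(2,1)]])
 note e = auts_endo[OF assms(1)]
 have i:"ainv sg y = x" if "sg x = y" for x y using that b by(metis bij_inv_eq_iff)
 have s:"sg (ainv sg x) = x" for x using b by(metis bij_inv_eq_iff)
 show ?thesis
  unfolding auts_def endo_def
  by(intro CollectI conjI allI ballI; rule i) (simp_all add: e endo_1 endo_add endo_mult s auts_fix[OF assms(1)])
qed

lemma auts_inv_simps:
 assumes "sg:auts \<kk>"
 shows "sg (ainv sg x) = x" "ainv sg (sg x) = x"
 using auts_bij[OF assms] by(metis bij_inv_eq_iff)+

lemma auts_funpow:"sg:auts L ==> (sg ^^ n):auts L"
proof (induction n)
 case 0
 thus ?case using auts_id by(simp add: id_def)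
next
 case (Suc n)
 thus ?case using auts_comp[of sg L "sg ^^ n"] by(simp add: comp_def)
qed

lemma finite_auts_orbit:"finite {sg x | sg. sg:auts \<kk>}"
proof -
 obtain p where p:"coeffs_in \<kk> p" "p~=0" "poly p x = 0" using algebraic_over_kk[of x] by blast
 have "{sg x | sg. sg:auts \<kk>}<={y. poly p y = 0}"
  by(smt (verit) Set.basic_monos(6) auts_endo auts_fix endo_0 endo_poly p(1,3))
 thus ?thesis using poly_roots_finite[OF p(2)] finite_subset by blast
qed

text \<open>The graph of an isomorphism between two subrings of the algebraic closure that fixes \<open>\<kk>\<close>.\<close>

definition partial_iso :: "('a::{field,finite} ac \<times> 'a ac) set => bool" where
 "partial_iso R <-> (ALL a:\<kk>. (a, a):R) & (ALL b. (0, b):R --> b = 0) &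
   (ALL a b c d. (a, b):R --> (c, d):R --> (a - c, b-d):R & (a * c, b*d):R)"

context
 fixes R :: "('a::{field,finite} ac \<times> 'a ac) set"
 assumes R:"partial_iso R"
begin

lemma partial_iso_kk:"a:\<kk> ==> (a, a):R" and partial_iso_0D:"(0, b):R ==> b = 0"
 and partial_iso_diff:"(a, b):R ==> (c, d):R ==> (a - c, b-d):R"
 and partial_iso_mult:"(a, b):R ==> (c, d):R ==> (a * c, b*d):R"
 using R unfolding partial_iso_def by blast+

lemma partial_iso_0:"(0, 0):R" and partial_iso_1:"(1, 1):R"
 using partial_iso_kk sfield_0[OF sfield_kk] sfield_1[OF sfield_kk] by auto

lemma partial_iso_add:"(a, b):R ==> (c, d):R ==> (a + c, b+d):R"
 using partial_iso_diff[of a b "0 - c" "0-d"] partial_iso_diff[OF partial_iso_0, of c d] by simp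

lemma partial_iso_functional:"(a, b):R ==> (a, b'):R ==> b = b'"
 using partial_iso_diff[of a b a b'] partial_iso_0D[of "b-b'"] by simp

lemma partial_iso_sum:"(!!i. i:I ==> (f i, g i):R) ==> (sum f I, sum g I):R"
 by(induction I rule: infinite_finite_induct) (auto intro: partial_iso_0 partial_iso_add)

lemma ifield_Domain_partial_iso:"ifield (Domain R)"
proof (rule ifieldI)
 show "\<kk><=Domain R" using partial_iso_kk by(auto intro: DomainI)
 fix x y assume "x:Domain R" "y:Domain R"
 then obtain x' y' where "(x, x'):R" "(y, y'):R" by(elim DomainE)
 thus "x-y:Domain R" "x*y:Domain R"
  by(rule DomainI[OF partial_iso_diff] DomainI[OF partial_iso_mult]; assumption)+
qed

text \<open>The minimal polynomial of \<open>x\<close> over the domain is transported along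
  \<open>R\<close>, and \<open>x\<close> is sent to a root \<open>y\<close> of the result.
  \<open>pair\<close> relates polynomials coefficientwise; the new relation consists of the values
  of paired polynomials at \<open>x\<close> and \<open>y\<close>.\<close>

lemma partial_iso_extend1:"EX y R'. partial_iso R' & R<=R' & (x, y):R'"
proof -
 define pair where "pair p q <-> (ALL i. (coeff p i, coeff q i):R)" for p q
 have pair_diff:"pair (p-p') (q-q')" if "pair p q" "pair p' q'" for p q p' q'
  unfolding pair_def coeff_diff using partial_iso_diff that pair_def by simp
 have pair_mult:"pair (p*p') (q*q')" if "pair p q" "pair p' q'" for p q p' q'
  unfolding pair_def coeff_mult using partial_iso_mult that pair_def by(intro allI partial_iso_sum) simp
 have pair_monom:"pair (pmon a n) (pmon b n)" if "(a, b):R" for a b n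
  unfolding pair_def coeff_monom using that partial_iso_0 by simp
 have pair_const:"pair [:a:] [:b:]" if "(a, b):R" for a b
  using pair_monom[OF that, of 0] by(simp add: monom_0)
 have pair_0:"q = 0" if "pair 0 q" for q
  using that by(auto simp: pair_def poly_eq_iff dest: partial_iso_0D)
 have A:"sfield (Domain R)" using ifield_Domain_partial_iso by(rule ifield_sfield)
 obtain f where fm:"min_poly (Domain R) x f" using ex_min_poly[OF A algebraic_over_ifield[OF ifield_Domain_partial_iso, of x]] by blast
  note f = min_polyD[OF fm]
 define ph where "ph a = (THE b. (a, b):R)" for a
 have ph:"ph a = b" if "(a, b):R" for a b
  unfolding ph_def by(rule the_equality) (use that partial_iso_functional in auto)
 have ph_mem:"(a, ph a):R" if "a:Domain R" for a
  using that ph by auto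
 have ph0:"ph 0 = 0" by(rule ph[OF partial_iso_0])
 have pair_map:"pair p (map_poly ph p)" if "coeffs_in (Domain R) p" for p
  using that ph_mem by(auto simp: pair_def coeff_map_poly ph0 coeffs_in_def)
 define f' where "f' = map_poly ph f"
 have ff':"pair f f'" unfolding f'_def by(rule pair_map[OF f(1)])
 \<comment> \<open>The leading coefficient has an inverse in the domain, so its image cannot be
   \<open>0\<close>; hence \<open>f'\<close> has positive degree and a root.\<close>
 have "coeff f' (pdeg f)~=0"
 proof
  let ?c = "plc f"
  assume "coeff f' (pdeg f) = 0"
  hence c0:"(?c, 0):R" using ff' by(metis pair_def)
  have "inverse ?c:Domain R" using f(1) A by(intro sfield_inverse) (auto simp: coeffs_in_def)
  then obtain e where "(inverse ?c, e):R" by auto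
  from partial_iso_mult[OF this c0] have "(1, 0):R" using f(2) by simp
  from partial_iso_functional[OF partial_iso_1 this] show False by simp
 qed
 hence "pdeg f' > 0" using f(3) le_degree by fastforce
 then obtain y where y:"poly f' y = 0" using alg_closed_imp_poly_has_root by blast
 \<comment> \<open>A relation of \<open>x\<close> over the domain is a multiple of \<open>f\<close>,
   so its transport is a multiple of \<open>f'\<close> and holds for \<open>y\<close>. This gives
   the condition at \<open>0\<close> for \<open>R'\<close>.\<close>
 have vanish:"poly q y = 0" if pq:"pair p q" "poly p x = 0" for p q
 proof -
  have "coeffs_in (Domain R) p" using pq(1) by(auto simp: pair_def coeffs_in_def)
  then obtain s where s:"coeffs_in (Domain R) s" "p = f*s" using f(5) pq(2) by blast
  have "pair 0 (q-f'*map_poly ph s)"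
   using pair_diff[OF pq(1) pair_mult[OF ff' pair_map[OF s(1)]]] s(2) by simp
  hence "q = f'*map_poly ph s" using pair_0 by fastforce
  thus ?thesis using y by simp
 qed
 define R' where "R' = {(poly p x, poly q y) | p q. pair p q}"
 have R'I:"(poly p x, poly q y):R'" if "pair p q" for p q
  unfolding R'_def using that by blast
 have sub:"R<=R'"
 proof
  fix z assume z:"z:R"
  obtain a b where ab:"z = (a, b)" by(cases z)
  show "z:R'" using R'I[OF pair_const, of a b] z ab by simp
 qed
 have xy:"(x, y):R'"
  using R'I[OF pair_monom[OF partial_iso_1, of 1]] by(simp add: poly_monom)
 have "partial_iso R'"
  unfolding partial_iso_def
 proof (intro conjI ballI allI impI)
  show "(a, a):R'" if "a:\<kk>" for a using partial_iso_kk[OF that] sub by blast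
  show "b = 0" if "(0, b):R'" for b using that vanish unfolding R'_def by fastforce
  fix a b c d assume "(a, b):R'" "(c, d):R'"
  then obtain p q p' q' where *: "pair p q" "pair p' q'" "a = poly p x" "b = poly q y" "c = poly p' x" "d = poly q' y"
   unfolding R'_def by blast
  show "(a - c, b-d):R'" using R'I[OF pair_diff[OF *(1,2)]] * by simp
  show "(a * c, b*d):R'" using R'I[OF pair_mult[OF *(1,2)]] * by simp
 qed
 thus ?thesis using sub xy by blast
qed

end

text \<open>A Zorn-maximal extension is defined everywhere, since otherwise
  \<open>partial_iso_extend1\<close> would enlarge it; being functional, it is then an element of
  \<open>auts \<kk>\<close>.\<close>

lemma partial_iso_extend:
 assumes R:"partial_iso R"
 shows "EX sg:auts \<kk>. ALL x y. (x, y):R --> sg x = y"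
proof -
 let ?Z = "{S. partial_iso S & R<=S}"
 have "EX M:?Z. ALL S:?Z. M<=S --> S = M"
 proof (rule subset_Zorn_nonempty)
  show "?Z~={}" using R by blast
  fix C assume C:"C~={}" "subset.chain ?Z C"
  have iso:"partial_iso S" "R<=S" if "S:C" for S using C(2) that by(auto simp: subset.chain_def)
  have both:"EX S:C. z:S & w:S" if "z:\<Union>C" "w:\<Union>C" for z w
  proof -
   from that obtain S T where "S:C" "z:S" "T:C" "w:T" by blast
   moreover from this have "S<=T | T<=S" using C(2) unfolding subset_chain_def by blast
   ultimately show ?thesis by blast
  qed
  have "partial_iso (\<Union>C)"
   unfolding partial_iso_def
  proof (intro conjI ballI allI impI)
   show "(a, a):\<Union>C" if "a:\<kk>" for a
    using C(1) iso(2) partial_iso_kk[OF R that] by blast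
   show "b = 0" if "(0, b):\<Union>C" for b
    using that iso(1) unfolding partial_iso_def by blast
   fix a b c d assume "(a, b):\<Union>C" "(c, d):\<Union>C"
   then obtain S where S:"S:C" "(a, b):S" "(c, d):S" using both by blast
   hence "(a - c, b-d):S" "(a * c, b*d):S" using iso(1)[OF S(1)] unfolding partial_iso_def by blast+
   thus "(a - c, b-d):\<Union>C" "(a * c, b*d):\<Union>C" using S(1) by blast+
  qed
  thus "\<Union>C:?Z" using C(1) iso(2) by blast
 qed
 then obtain M where MZ:"M:?Z" and maxZ:"ALL S:?Z. M<=S --> S = M" by(rule bexE)
 hence M:"partial_iso M" "R<=M" by simp_all
 have max:"S = M" if "partial_iso S" "M<=S" for S
  using maxZ that M(2) by(metis (mono_tags, lifting) mem_Collect_eq order_trans)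
 have "EX y. (x, y):M" for x
  by(metis M(1) max partial_iso_extend1)
 then obtain sg where s:"!!x. (x, sg x):M" by metis
 have fn:"sg x = y" if "(x, y):M" for x y
  by(rule partial_iso_functional[OF M(1) s that])
 have "sg:auts \<kk>"
  unfolding auts_def endo_def
 proof (intro CollectI conjI allI ballI)
  show "sg 1 = 1" by(rule fn[OF partial_iso_1[OF M(1)]])
  fix x y
  show "sg (x+y) = sg x+sg y" by(rule fn[OF partial_iso_add[OF M(1) s s]])
  show "sg (x*y) = sg x*sg y" by(rule fn[OF partial_iso_mult[OF M(1) s s]])
 next
  fix x :: "'a ac" assume "x:\<kk>"
  thus "sg x = x" by(rule fn[OF partial_iso_kk[OF M(1)]])
 qed
 thus ?thesis using fn M(2) by(intro bexI[of _ sg]) auto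
qed

lemma extend_embedding:
 assumes L:"ifield L" and "!!x. x:\<kk> ==> ph x = x"
  and "!!x y. x:L ==> y:L ==> ph (x+y) = ph x+ph y" "!!x y. x:L ==> y:L ==> ph (x*y) = ph x*ph y"
 shows "EX sg:auts \<kk>. ALL x:L. sg x = ph x"
proof -
 let ?R = "{(x, ph x) | x. x:L}"
 have d:"ph (x-y) = ph x-ph y" if "x:L" "y:L" for x y
  using assms(3)[OF sfield_diff[OF ifield_sfield[OF L] that] that(2)] by(simp add: eq_diff_eq)
 have "partial_iso ?R"
  unfolding partial_iso_def
 proof (intro conjI ballI allI impI)
  show "(a, a):?R" if "a:\<kk>" for a using that assms(2)[OF that] subsetD[OF ifield_kk[OF L] that] by simp
  show "b = 0" if "(0, b):?R" for b using that assms(2)[OF sfield_0[OF sfield_kk]] by simp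
  fix a b c e assume "(a, b):?R" "(c, e):?R"
  hence *: "a:L" "c:L" "b = ph a" "e = ph c" by simp_all
  show "(a - c, b-e):?R" using d[OF *(1,2)] sfield_diff[OF ifield_sfield[OF L] *(1,2)] *(3,4) by simp
  show "(a * c, b*e):?R" using assms(4)[OF *(1,2)] sfield_mult[OF ifield_sfield[OF L] *(1,2)] *(3,4) by simp
 qed
 from partial_iso_extend[OF this] obtain sg where "sg:auts \<kk>" "ALL x y. (x, y):?R --> sg x = y"
  by(rule bexE)
 thus ?thesis by(intro bexI[of _ sg]) simp_all
qed

text \<open>Sending \<open>poly p x\<close> to \<open>poly p y\<close> is a partial isomorphism over
  \<open>L\<close>: the hypothesis on relations is what makes it well defined.\<close>

lemma conjugate_root:
 assumes L:"ifield L" and *: "!!p. coeffs_in L p ==> poly p x = 0 ==> poly p y = 0"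
 shows "EX sg:auts L. sg x = y"
proof -
 note s = ifield_sfield[OF L]
 let ?R = "{(poly p x, poly p y) | p. coeffs_in L p}"
 have RI:"(poly p x, poly p y):?R" if "coeffs_in L p" for p using that by blast
 have const:"(a, a):?R" if "a:L" for a
  using RI[of "[:a:]"] that coeffs_in_0[OF s] by(simp add: coeffs_in_pCons[OF s])
 have xy:"(x, y):?R"
  using RI[of "[:0, 1:]"] coeffs_in_0[OF s] sfield_0[OF s] sfield_1[OF s] by(simp add: coeffs_in_pCons[OF s])
 have "partial_iso ?R"
  unfolding partial_iso_def
 proof (intro conjI ballI allI impI)
  show "(a, a):?R" if "a:\<kk>" for a using const that ifield_kk[OF L] by blast
  show "b = 0" if "(0, b):?R" for b
  proof -
   from that obtain p where "coeffs_in L p" "0 = poly p x" "b = poly p y" by blast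
   thus ?thesis using *[of p] by simp
  qed
  fix a b c d assume "(a, b):?R" "(c, d):?R"
  then obtain p q where *: "coeffs_in L p" "coeffs_in L q" "a = poly p x" "b = poly p y" "c = poly q x" "d = poly q y"
   by blast
  show "(a - c, b-d):?R" using RI[OF coeffs_in_diff[OF s *(1,2)]] * by simp
  show "(a * c, b*d):?R" using RI[OF coeffs_in_mult[OF s *(1,2)]] * by simp
 qed
 from partial_iso_extend[OF this] obtain sg where sg:"sg:auts \<kk>" "ALL a b. (a, b):?R --> sg a = b"
  by(rule bexE)
 show ?thesis by(smt (verit) sg(1,2) auts_def const mem_Collect_eq xy)
qed


section \<open>Separable elements\<close>

text \<open>Some polynomial over \<open>L\<close> with a simple root at \<open>x\<close> suffices:
  the minimal polynomial divides it and so has a simple root there too. In this form separability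
  passes to larger base fields at once.\<close>

definition sep :: "'b::field set => 'b => bool" where
 "sep L x <-> (EX p. coeffs_in L p & poly p x = 0 & poly (pderiv p) x~=0)"

lemma sep_mono:"sep L x ==> L<=L' ==> sep L' x"
 unfolding sep_def using coeffs_in_mono by blast

text \<open>The values of polynomials form a ring containing \<open>\<kk>\<close>, and by
  \<open>ifieldI\<close> such a ring is a field.\<close>

lemma adj_insert_eq:
 assumes "ifield L"
 shows "adj (insert y L) = {poly g y | g. coeffs_in L g}"
proof
 note s = ifield_sfield[OF assms]
 have I:"poly g y:{poly g y | g. coeffs_in L g}" if "coeffs_in L g" for g using that by blast
 have "ifield {poly g y | g. coeffs_in L g}"
 proof (rule ifieldI)
  show "\<kk><={poly g y | g. coeffs_in L g}"
   by(smt (verit) add.right_neutral assms coeffs_in_0 coeffs_in_mono coeffs_in_pCons ifield_kk mem_Collect_eq mult_zero_right poly_0 poly_pCons sfield_kk subsetI)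
  fix u v assume "u:{poly g y | g. coeffs_in L g}" "v:{poly g y | g. coeffs_in L g}"
  then obtain g h where *: "coeffs_in L g" "coeffs_in L h" "u = poly g y" "v = poly h y" by blast
  show "u-v:{poly g y | g. coeffs_in L g}" using I[OF coeffs_in_diff[OF s *(1,2)]] * by simp
  show "u*v:{poly g y | g. coeffs_in L g}" using I[OF coeffs_in_mult[OF s *(1,2)]] * by simp
 qed
 moreover have "insert y L<={poly g y | g. coeffs_in L g}"
 proof
  fix a assume "a:insert y L"
  thus "a:{poly g y | g. coeffs_in L g}"
   using I[of "[:a:]"] I[of "[:0,1:]"] coeffs_in_0[OF s] sfield_0[OF s] sfield_1[OF s]
   by(auto simp add: coeffs_in_pCons[OF s])
 qed
 ultimately show "adj (insert y L)<={poly g y | g. coeffs_in L g}"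
  by(intro adj_min ifield_sfield)
 show "{poly g y | g. coeffs_in L g}<=adj (insert y L)"
  by(smt (verit, del_insts) adj_incl coeffs_in_mono insert_subset mem_Collect_eq poly_in sfield_adj subsetI)
qed

text \<open>Write \<open>x\<close> as \<open>poly r y\<close> with \<open>r\<close> reduced modulo
  the minimal polynomial \<open>f\<close> of \<open>y\<close>. The roots of \<open>f\<close> are
  conjugates of \<open>y\<close> and, by separability, \<open>pdeg f\<close> in number; all are
  roots of \<open>r-[:x:]\<close> because \<open>x\<close> is fixed. By degrees \<open>r\<close> is
  the constant \<open>x\<close>, and its coefficients lie in \<open>L\<close>.\<close>

lemma sep_fixed1:
 assumes L:"ifield L" and y:"sep L y" and x:"x:adj (insert y L)"
  and fixd:"!!sg. sg:auts L ==> sg x = x"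
 shows "x:L"
proof -
 note s = ifield_sfield[OF L]
 obtain f where fm:"min_poly L y f" using ex_min_poly[OF s algebraic_over_ifield[OF L, of y]] by blast
  note f = min_polyD[OF fm]
 have conj:"EX sg:auts L. sg y = a" if "poly f a = 0" for a
 proof (rule conjugate_root[OF L])
  fix p assume "coeffs_in L p" "poly p y = 0"
  then obtain s where "p = f*s" using f(5)[of p] by blast
  thus "poly p a = 0" using that by simp
 qed
 obtain p where p:"coeffs_in L p" "poly p y = 0" "poly (pderiv p) y~=0" using y by(auto simp: sep_def)
 then obtain h where "p = f*h" using f(5) by blast
 hence f':"poly (pderiv f) y~=0" using p(3) f(4) by(auto simp: pderiv_mult)
 have "poly (pderiv f) a~=0" if a:"poly f a = 0" for a
 proof -
  obtain sg where sg:"sg:auts L" "sg y = a" using conj[OF a] by blast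
  have "sg (poly (pderiv f) y) = poly (pderiv f) a"
   using endo_poly[OF auts_endo[OF sg(1)] coeffs_in_pderiv[OF s f(1)] auts_fix[OF sg(1)]] sg(2) by simp
  thus ?thesis using f' endo_eq_0_iff[OF auts_endo[OF sg(1)]] by metis
 qed
 hence card:"card {a. poly f a = 0} = pdeg f" by(rule card_roots_simple[OF f(2)])
 obtain g where g:"coeffs_in L g" "x = poly g y" using x by(auto simp: adj_insert_eq[OF L])
 obtain t r where r:"g = f*t+r" "coeffs_in L r" "r = 0 | pdeg r < pdeg f"
  using coeffs_in_division[OF s f(1,2) g(1)] by blast
 have "r-[:x:] = 0"
 proof (rule ccontr)
  assume nz:"r-[:x:]~=0"
  have "{a. poly f a = 0}<={a. poly (r-[:x:]) a = 0}"
  proof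
   fix a assume "a:{a. poly f a = 0}"
   then obtain sg where sg:"sg:auts L" "sg y = a" using conj by blast
   have "sg x = poly r a"
    using endo_poly[OF auts_endo[OF sg(1)] r(2) auts_fix[OF sg(1)], of y] g(2) r(1) f(4) sg(2) by simp
   thus "a:{a. poly (r-[:x:]) a = 0}" using fixd[OF sg(1)] by simp
  qed
  hence "pdeg f <= card {a. poly (r-[:x:]) a = 0}"
   unfolding card[symmetric] by(rule card_mono[OF poly_roots_finite[OF nz]])
  also have "\<dots><=pdeg (r-[:x:])" by(rule card_poly_roots_bound[OF nz])
  also have "\<dots> < pdeg f" using r(3) f(3) by(intro degree_diff_less) auto
  finally show False by simp
 qed
 hence "x = coeff r 0" by simp
 thus ?thesis using r(2) by(simp add: coeffs_in_def)
qed

text \<open>\<open>x\<close> involves finitely many elements of \<open>S\<close>; they are removed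
  one at a time by \<open>sep_fixed1\<close>, each time over the field generated by the remaining
  ones.\<close>

lemma sep_fixed:
 assumes L:"ifield L" and sep:"!!y. y:S ==> sep L y" and x:"x:adj (L Un S)"
  and fixd:"!!sg. sg:auts L ==> sg x = x"
 shows "x:L"
proof -
 have fin:"x:L" if "finite T" "T<=S" "x:adj (L Un T)" for T
  using that
 proof (induction T)
  case empty
  thus ?case by(simp add: adj_eq ifield_sfield[OF L])
 next
  case (insert y T)
  let ?L = "adj (L Un T)"
  have L':"ifield ?L" using ifield_kk[OF L] by(intro ifield_adj) auto
  have sub:"L<=?L" using adj_incl[of "L Un T"] by blast
  have eq:"adj (insert y ?L) = adj (L Un insert y T)"
   using adj_Un_adj[of "{y}" "L Un T"] by simp
  have "x:?L"
   by(rule sep_fixed1[OF L', of y])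
    (use insert.prems sep_mono[OF sep sub] fixd auts_mono[OF sub] eq in auto)
  thus ?case using insert by simp
 qed
 obtain T where T:"finite T" "T<=L Un S" "x:adj T" using adj_finitary[OF x] by blast
 have "adj T<=adj (L Un (T Int S))" using T(2) by(intro adj_mono) auto
 thus ?thesis using fin[of "T Int S"] T by auto
qed

text \<open>It is used for finite orbits of automorphism groups: invariance of the orbit puts the
  coefficients into the fixed field, and all roots are simple.\<close>

definition orbit_poly :: "'b::field set => 'b poly" where
 "orbit_poly S = (PROD y:S. [:- y, 1:])"

lemma orbit_poly_coeff_image:
 assumes "endo sg"
 shows "sg (coeff (PROD y:S. [:- f y, 1:]) i) = coeff (PROD y:S. [:- sg (f y), 1:]) i"
proof (induction S arbitrary: i rule: infinite_finite_induct)
 case (insert y S)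
 thus ?case
  by(cases i) (simp_all add: endo_0[OF assms] endo_diff[OF assms] endo_mult[OF assms] endo_uminus[OF assms] endo_add[OF assms])
qed (auto simp: coeff_1 endo_1[OF assms] endo_0[OF assms])

lemma orbit_poly_coeff_fixed:
 assumes "endo sg" "sg`S = S"
 shows "sg (coeff (orbit_poly S) i) = coeff (orbit_poly S) i"
proof -
 have "orbit_poly (sg`S) = (PROD y:S. [:- sg y, 1:])"
  unfolding orbit_poly_def by(subst prod.reindex) (auto simp: inj_on_def endo_inj[OF assms(1)])
 thus ?thesis using orbit_poly_coeff_image[OF assms(1), of "%y. y" S i] assms(2)
  by(simp add: orbit_poly_def)
qed

lemma orbit_poly_simple_roots:
 assumes "finite S"
 shows "poly (orbit_poly S) a = 0 <-> a:S" "a:S ==> poly (pderiv (orbit_poly S)) a~=0"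
  "orbit_poly S~=0" "pdeg (orbit_poly S) = card S" "plc (orbit_poly S) = 1"
proof -
 show 1:"poly (orbit_poly S) a = 0 <-> a:S" for a
  using assms by(auto simp: orbit_poly_def poly_prod)
 show nz:"orbit_poly S~=0" using assms by(auto simp: orbit_poly_def)
 show "poly (pderiv (orbit_poly S)) a~=0" if a:"a:S"
 proof -
  have "orbit_poly S = [:- a, 1:] * orbit_poly (S-{a})"
   unfolding orbit_poly_def using assms a by(simp add: prod.remove)
  hence "poly (pderiv (orbit_poly S)) a = poly (orbit_poly (S-{a})) a"
   by(simp only: pderiv_mult) (simp add: pderiv_pCons)
  thus ?thesis using assms by(simp add: orbit_poly_def poly_prod)
 qed
 show "pdeg (orbit_poly S) = card S"
  unfolding orbit_poly_def by(subst degree_prod_eq_sum_degree) auto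
 show "plc (orbit_poly S) = 1"
  unfolding orbit_poly_def by(simp add: lead_coeff_prod)
qed

lemma coeffs_in_orbit_poly:"sfield F ==> S<=F ==> coeffs_in F (orbit_poly S)"
 unfolding orbit_poly_def
 by(rule coeffs_in_prod) (auto simp: coeffs_in_pCons coeffs_in_0 sfield_1 sfield_uminus)

declare [[blast_depth_limit = 8]]

section \<open>Finite abelian extensions inside the algebraic closure\<close>

lemma rgrp_eq_iff:"restrict sg F = restrict ta F <-> (ALL x:F. sg x = ta x)"
proof
 assume "restrict sg F = restrict ta F"
 thus "ALL x:F. sg x = ta x" by(metis restrict_apply')
qed (auto simp: restrict_def fun_eq_iff)

lemma rgrpI:"sg:Ga ==> restrict sg F:rgrp Ga F"
 by(simp add: restrict_group_def)

lemma rgrpE:"rh:rgrp Ga F ==> EX sg:Ga. rh = restrict sg F"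
 by(auto simp: restrict_group_def)

lemma rgrp_mono:"Ga<=De ==> rgrp Ga F<=rgrp De F"
 unfolding restrict_group_def by(rule image_mono)

lemma image_restrict_group:"F'<=F ==> (%rh. restrict rh F')`rgrp Ga F = rgrp Ga F'"
 unfolding restrict_group_def image_image by(rule image_cong) (auto simp: rgrp_eq_iff restrict_apply' subsetD)

lemma rgrp_restrict:"F'<=F ==> rgrp (rgrp Ga F) F' = rgrp Ga F'"
 unfolding restrict_group_def image_image by(rule image_cong) (auto simp: rgrp_eq_iff restrict_apply' subsetD)

text \<open>Finite abelian extensions through automorphisms of the whole closure: normality,
  commutativity, separability and finitely many restrictions, without carrying a group along.
  \<open>finite_abelian_ext_iff\<close> compares this with
  \<open>finite_abelian_ext\<close>.\<close>

definition finab :: "'a::{field,finite} ac set => 'a ac set => bool" where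
 "finab L F <-> ifield L & ifield F & L<=F & (ALL sg:auts L. ALL x:F. sg x:F) &
   (ALL sg:auts L. ALL ta:auts L. ALL x:F. sg (ta x) = ta (sg x)) & (ALL x:F. sep L x) &
   finite (rgrp (auts L) F)"

lemma finabD:
 assumes "finab L F"
 shows "ifield L" "ifield F" "L<=F" "!!sg x. sg:auts L ==> x:F ==> sg x:F"
  "!!sg ta x. sg:auts L ==> ta:auts L ==> x:F ==> sg (ta x) = ta (sg x)"
  "!!x. x:F ==> sep L x" "finite (rgrp (auts L) F)"
 using assms unfolding finab_def by simp_all

lemma finab_fixed:
 assumes "finab L F" "x:F" "!!sg. sg:auts L ==> sg x = x"
 shows "x:L"
proof (rule sep_fixed[OF finabD(1)[OF assms(1)], of F])
 show "x:adj (L Un F)" using assms(2) adj_incl[of "L Un F"] by blast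
qed (use finabD(6)[OF assms(1)] assms(3) in simp_all)

lemma infinite_kk:"infinite (\<kk> :: 'a::{field,finite} ac set)"
proof -
 have "inj (%i. to_ac (Fract (pmon (1 :: 'a) i) 1))"
 proof (rule injI)
  fix i j assume "to_ac (Fract (pmon (1 :: 'a) i) 1) = to_ac (Fract (pmon 1 j) 1)"
  hence "pmon (1 :: 'a) i = pmon 1 j" by(simp add: eq_fract)
  thus "i = j" by(metis degree_monom_eq one_neq_zero)
 qed
 hence "infinite (range (%i. to_ac (Fract (pmon (1 :: 'a) i) 1)))"
  using range_inj_infinite by blast
 thus ?thesis unfolding \<kk>_def by(rule infinite_super[rotated]) auto
qed

text \<open>Take \<open>y\<close> with the fewest restrictions fixing it. If some \<open>sg\<close>
  fixes \<open>y\<close> but moves \<open>x\<close>, then \<open>y+a*x\<close> has a smaller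
  stabilizer for all but finitely many \<open>a:L\<close>, and \<open>L\<close> is infinite.\<close>

lemma finab_primitive_element:
 assumes F:"finab L F"
 shows "EX y:F. ALL sg:auts L. sg y = y --> (ALL x:F. sg x = x)"
proof -
 let ?G = "rgrp (auts L) F"
 define st where "st y = {rh:?G. rh y = y}" for y
 have fin:"finite (st y)" for y unfolding st_def using finabD(7)[OF F] by simp
 have "EX y. y:F" using sfield_0[OF ifield_sfield[OF finabD(2)[OF F]]] by blast
 then obtain y where y:"y:F" and min:"!!z. z:F ==> card (st y) <= card (st z)"
  using exists_least_iff[of "%n. EX y:F. card (st y) = n"] by(metis linorder_not_less)
 have "ALL x:F. sg x = x" if s:"sg:auts L" "sg y = y" for sg
 proof (rule ccontr)
  assume "~?thesis"
  then obtain x where x:"x:F" "sg x~=x" by blast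
  \<comment> \<open>The values of \<open>a\<close> for which \<open>rh\<close> moves
    \<open>y\<close> but fixes \<open>y+a*x\<close>; there is at most one for each
    \<open>rh\<close>.\<close>
  define bad where "bad rh = {a. rh y~=y & rh y+a*rh x = y+a*x}" for rh
  have "bad rh<={(rh y-y)/(x-rh x)}" for rh
  proof
   fix a assume "a:bad rh"
   hence "a*(x-rh x) = rh y-y" "rh y-y~=0" by(simp_all add: bad_def algebra_simps eq_diff_eq)
   hence "a = (rh y-y)/(x-rh x)" by(metis mult_eq_0_iff nonzero_eq_divide_eq)
   thus "a:{(rh y-y)/(x-rh x)}" by simp
  qed
  hence "finite (bad rh)" for rh using finite_subset by blast
  hence "finite (insert 0 (UN rh:?G. bad rh))" using finabD(7)[OF F] by simp
  hence "~L<=insert 0 (UN rh:?G. bad rh)"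
   using infinite_super[OF ifield_kk[OF finabD(1)[OF F]] infinite_kk] finite_subset by metis
  then obtain a where a:"a:L" "a~=0" "!!rh. rh:?G ==> a~:bad rh" by blast
  define z where "z = y+a*x"
  have aF:"a:F" using a(1) finabD(3)[OF F] by blast
  have zF:"z:F" unfolding z_def
   by(intro sfield_add sfield_mult ifield_sfield[OF finabD(2)[OF F]] y x(1) aF)
  have image:"restrict ta F z = restrict ta F y+a*restrict ta F x" if "ta:auts L" for ta
   using zF y x(1) auts_fix[OF that a(1)] by(simp add: z_def endo_add[OF auts_endo[OF that]] endo_mult[OF auts_endo[OF that]])
  have "st z<=st y"
  proof
   fix rh assume r:"rh:st z"
   then obtain ta where t:"ta:auts L" "rh = restrict ta F" using rgrpE unfolding st_def by fast
   have "rh y+a*rh x = y+a*x" using r image[OF t(1)] unfolding st_def t(2)[symmetric] by(simp add: z_def)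
   moreover have "a~:bad rh" using r a(3) unfolding st_def by blast
   ultimately have "rh y = y" unfolding bad_def by blast
   thus "rh:st y" using r unfolding st_def by blast
  qed
  moreover have "restrict sg F:st y" using s y by(simp add: st_def rgrpI)
  moreover have "restrict sg F~:st z"
   using image[OF s(1)] s(2) x a(2) y by(simp add: st_def z_def)
  ultimately have "st z \<subset> st y" by blast
  thus False using psubset_card_mono[OF fin] min[OF zF] by(metis linorder_not_less)
 qed
 thus ?thesis using y by blast
qed

lemma finite_restrict_orbit:"finite {sg y | sg. sg:Ga}" if "Ga<=auts \<kk>"
 using finite_auts_orbit[of y] by(rule finite_subset[rotated]) (use that in auto)

lemma orbit_self:"(%x. x):Ga ==> y:{sg y | sg. sg:Ga}"
 by(intro CollectI exI[of _ "%x. x"]) simp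

lemma orbit_image:
 assumes "D<=auts \<kk>" "!!sg ta. sg:D ==> ta:D ==> (%x. sg (ta x)):D" "ta:D"
 shows "ta`{rh y | rh. rh:D} = {rh y | rh. rh:D}"
proof (rule endo_inj_surj[OF finite_restrict_orbit[OF assms(1)]])
 show "ta`{rh y | rh. rh:D}<={rh y | rh. rh:D}"
 proof
  fix z assume "z:ta`{rh y | rh. rh:D}"
  then obtain rh where "rh:D" "z = ta (rh y)" by blast
  thus "z:{rh y | rh. rh:D}"
   using assms(2)[OF assms(3)] by(intro CollectI exI[of _ "%x. ta (rh x)"]) simp
 qed
 show "inj_on ta {rh y | rh. rh:D}" by(metis (mono_tags, lifting) assms(1,3) auts_endo endo_inj inj_on_def subsetD)
qed

lemma auts_orbit_image:
 assumes "ifield L" "ta:auts L"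
 shows "ta`{rh y | rh. rh:auts L} = {rh y | rh. rh:auts L}"
 by(simp add: assms(1,2) auts_comp auts_mono ifield_kk orbit_image)

text \<open>The polynomial of the \<open>D\<close>-orbit of a primitive element \<open>y\<close> has
  coefficients fixed by \<open>D\<close>, hence by \<open>sg\<close>. So \<open>sg y\<close> lies in
  this orbit, and agreement at \<open>y\<close> means agreement on \<open>F\<close>.\<close>

lemma galois_correspondence:
 assumes F:"finab L F" and D:"D<=auts L" "(%x. x):D"
  and comp:"!!sg ta. sg:D ==> ta:D ==> (%x. sg (ta x)):D"
  and s:"sg:auts L" "!!x. x:F ==> (!!ta. ta:D ==> ta x = x) ==> sg x = x"
 shows "EX ta:D. ALL x:F. ta x = sg x"
proof -
 obtain y where y:"y:F" and prim:"ALL sg:auts L. sg y = y --> (ALL x:F. sg x = x)"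
  using finab_primitive_element[OF F] by(rule bexE)
 define S where "S = {ta y | ta. ta:D}"
 have kk:"ta:auts \<kk>" if "ta:D" for ta
  using auts_kk[OF finabD(1)[OF F]] that D(1) by blast
 have fin:"finite S" unfolding S_def by(rule finite_restrict_orbit) (use kk in blast)
 have SF:"S<=F" unfolding S_def using finabD(4)[OF F] D(1) y by blast
 have perm:"ta`S = S" if t:"ta:D" for ta
  unfolding S_def by(rule orbit_image) (use kk comp t in blast)+
 have "sg (coeff (orbit_poly S) i) = coeff (orbit_poly S) i" for i
  by(meson F SF auts_endo coeffs_inD coeffs_in_orbit_poly finabD(2) ifield_sfield kk orbit_poly_coeff_fixed perm s(2))
 hence "sg (poly (orbit_poly S) y) = poly (orbit_poly S) (sg y)"
  by(intro endo_poly[OF auts_endo[OF s(1)], of "{a. sg a = a}"]) (simp_all add: coeffs_in_def)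
 moreover have "y:S" unfolding S_def by(rule orbit_self[OF D(2)])
 ultimately have "poly (orbit_poly S) (sg y) = 0"
  using orbit_poly_simple_roots(1)[OF fin] endo_0[OF auts_endo[OF s(1)]] by metis
 then obtain ta where t:"ta:D" "sg y = ta y" using S_def fin orbit_poly_simple_roots(1) by auto
 have tL:"ta:auts L" using t(1) D(1) by blast
 have "ainv ta (sg y) = y" by(simp add: t(2) auts_inv_simps[OF kk[OF t(1)]])
 hence "ALL x:F. ainv ta (sg x) = x"
  using bspec[OF prim auts_comp[OF auts_inv[OF tL finabD(1)[OF F]] s(1)]] by simp
 hence "ALL x:F. ta x = sg x" using auts_inv_simps(1)[OF kk[OF t(1)]] by metis
 thus ?thesis using t(1) by blast
qed

text \<open>Commutativity makes every intermediate field normal: for \<open>ta\<close> over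
  \<open>F'\<close> and \<open>x:F'\<close>, \<open>ta (sg x) = sg (ta x) = sg x\<close>, so
  \<open>sg x\<close> is fixed by all of \<open>auts F'\<close>.\<close>

lemma finab_mid:
 assumes F:"finab L F" and F':"ifield F'" "L<=F'" "F'<=F"
 shows "finab L F'" "finab F' F"
proof -
 note m = auts_mono[OF F'(2)]
 show 2:"finab F' F"
  unfolding finab_def
 proof (intro conjI ballI)
  show "finite (rgrp (auts F') F)"
   by(rule finite_subset[OF rgrp_mono[OF m] finabD(7)[OF F]])
  show "sg x:F" if "sg:auts F'" "x:F" for sg x
   by(rule finabD(4)[OF F subsetD[OF m that(1)] that(2)])
  show "sg (ta x) = ta (sg x)" if "sg:auts F'" "ta:auts F'" "x:F" for sg ta x
   by(rule finabD(5)[OF F subsetD[OF m that(1)] subsetD[OF m that(2)] that(3)])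
  show "sep F' x" if "x:F" for x by(rule sep_mono[OF finabD(6)[OF F that] F'(2)])
 qed (use F' finabD(2)[OF F] in simp_all)
 have stable:"sg x:F'" if s:"sg:auts L" "x:F'" for sg x
  by(smt (verit) "2" F assms(4) auts_fix finabD(4,5) finab_fixed in_mono m that(1,2))
 have "finite (rgrp (auts L) F')"
  using finite_imageI[OF finabD(7)[OF F], of "%rh. restrict rh F'"] image_restrict_group[OF F'(3), of "auts L"] by simp
 thus "finab L F'"
  unfolding finab_def using stable F' finabD(1)[OF F] finabD(5)[OF F _ _ subsetD[OF F'(3)]] finabD(6)[OF F subsetD[OF F'(3)]]
  by simp
qed

lemma endo_adj_stable:
 assumes "endo sg" "!!x. x:S ==> sg x:adj T" "x:adj S"
 shows "sg x:adj (T :: 'b::field set)"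
proof -
 note t = sfield_adj[of T]
 have "sfield {x. sg x:adj T}"
  using assms(1) sfield_1[OF t] sfield_diff[OF t] sfield_mult[OF t] sfield_inverse[OF t]
  by(simp add: sfield_def endo_1 endo_diff endo_mult endo_inverse)
 hence "adj S<={x. sg x:adj T}" by(rule adj_min) (use assms(2) in auto)
 thus ?thesis using assms(3) by blast
qed

lemma finite_restrict_adj:
 assumes fin:"finite (rgrp (auts L) S)"
 shows "finite (rgrp (auts L) (adj (L Un S)))"
proof -
 let ?F = "adj (L Un S)"
 have inj:"inj_on (%rh. restrict rh S) (rgrp (auts L) ?F)"
 proof (rule inj_onI)
  fix rh rh' assume "rh:rgrp (auts L) ?F" "rh':rgrp (auts L) ?F" and eq:"restrict rh S = restrict rh' S"
  then obtain sg ta where s:"sg:auts L" "rh = restrict sg ?F" "ta:auts L" "rh' = restrict ta ?F"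
   using rgrpE by metis
  have SF:"S<=?F" using adj_incl[of "L Un S"] by blast
  have "sg x = ta x" if "x:S" for x
   using eq that SF unfolding rgrp_eq_iff s by(metis restrict_apply' subsetD)
  hence "sg x = ta x" if "x:L Un S" for x
   using that auts_fix[OF s(1)] auts_fix[OF s(3)] by auto
  hence "ALL x:?F. sg x = ta x"
   using endo_eq_adj[OF auts_endo[OF s(1)] auts_endo[OF s(3)]] by blast
  thus "rh = rh'" unfolding s rgrp_eq_iff .
 qed
 have "(%rh. restrict rh S)`rgrp (auts L) ?F = rgrp (auts L) S"
  by(rule image_restrict_group) (use adj_incl[of "L Un S"] in blast)
 thus "finite (rgrp (auts L) ?F)" using fin inj by(metis finite_imageD)
qed

text \<open>The conditions only have to be checked on generators. For separability of an arbitrary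
  \<open>x\<close>, its orbit polynomial has simple roots, and its coefficients lie in
  \<open>L\<close> by \<open>sep_fixed\<close>.\<close>

lemma finab_adj:
 assumes L:"ifield L" and stable:"!!sg x. sg:auts L ==> x:S ==> sg x:adj (L Un S)"
  and comm:"!!sg ta x. sg:auts L ==> ta:auts L ==> x:S ==> sg (ta x) = ta (sg x)"
  and sep:"!!x. x:S ==> sep L x" and fin:"finite (rgrp (auts L) S)"
 shows "finab L (adj (L Un S))"
proof -
 let ?F = "adj (L Un S)"
 have LF:"L<=?F" using adj_incl[of "L Un S"] by blast
 have F:"ifield ?F" using ifield_kk[OF L] by(intro ifield_adj) blast
 have st:"sg x:?F" if s:"sg:auts L" "x:?F" for sg x
  by(smt (verit, best) LF Un_iff auts_endo auts_fix endo_adj_stable stable subset_eq that(1,2))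
 have cm:"sg (ta x) = ta (sg x)" if s:"sg:auts L" "ta:auts L" "x:?F" for sg ta x
 proof (rule endo_eq_adj[OF endo_comp[OF auts_endo[OF s(1)] auts_endo[OF s(2)]]
    endo_comp[OF auts_endo[OF s(2)] auts_endo[OF s(1)]] _ s(3)])
  fix z assume "z:L Un S"
  thus "sg (ta z) = ta (sg z)" using comm[OF s(1,2)] auts_fix[OF s(1)] auts_fix[OF s(2)] by auto
 qed
 have sp:"sep L x" if x:"x:?F" for x
 proof -
  let ?O = "{sg x | sg. sg:auts L}"
  have fO:"finite ?O" by(rule finite_restrict_orbit) (use auts_kk[OF L] in blast)
  have OF:"?O<=?F" using st x by blast
  have xO:"x:?O" by(rule orbit_self[OF auts_id])
  have "coeff (orbit_poly ?O) i:L" for i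
  proof (rule sep_fixed[OF L sep])
   show "coeff (orbit_poly ?O) i:?F"
    using coeffs_in_orbit_poly[OF ifield_sfield[OF F] OF] by(rule coeffs_inD)
   fix ta assume t:"ta:auts L"
   have "ta`?O = ?O"
    by(rule auts_orbit_image[OF L t])
   thus "ta (coeff (orbit_poly ?O) i) = coeff (orbit_poly ?O) i"
    by(rule orbit_poly_coeff_fixed[OF auts_endo[OF t]])
  qed
  thus ?thesis
   by(metis (lifting) coeffs_in_def fO orbit_poly_simple_roots(1,2) sep_def xO)
 qed
 show ?thesis by(simp add: F L LF cm fin finab_def finite_restrict_adj sp st)
qed

lemma finab_refl:"ifield L ==> finab L L"
proof -
 assume L:"ifield L"
 have "rgrp (auts L) L<={restrict (%x. x) L}"
 proof
  fix rh assume "rh:rgrp (auts L) L"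
  then obtain sg where "sg:auts L" "rh = restrict sg L" using rgrpE by blast
  thus "rh:{restrict (%x. x) L}" using auts_fix by(auto simp: rgrp_eq_iff)
 qed
 hence "finite (rgrp (auts L) L)" using finite_subset by blast
 moreover have "sep L x" if "x:L" for x
  unfolding sep_def using that ifield_sfield[OF L]
  by(intro exI[of _ "[:- x, 1:]"]) (simp add: coeffs_in_pCons coeffs_in_0 sfield_1 sfield_uminus pderiv_pCons)
 ultimately show ?thesis using L by(simp add: finab_def auts_fix)
qed

lemma finab_composite:
 assumes A:"finab L A" and B:"finab L B"
 shows "finab L (A**B)"
proof -
 have "finab L (adj (L Un (A Un B)))"
 proof (rule finab_adj[OF finabD(1)[OF A]])
  have incl:"A Un B<=adj (L Un (A Un B))" using adj_incl[of "L Un (A Un B)"] by blast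
  show "sg x:adj (L Un (A Un B))" if "sg:auts L" "x:A Un B" for sg x
   using incl finabD(4)[OF A that(1)] finabD(4)[OF B that(1)] that(2) by blast
  show "sg (ta x) = ta (sg x)" if "sg:auts L" "ta:auts L" "x:A Un B" for sg ta x
   using finabD(5)[OF A that(1,2)] finabD(5)[OF B that(1,2)] that(3) by blast
  show "sep L x" if "x:A Un B" for x using that finabD(6)[OF A] finabD(6)[OF B] by blast
  let ?f = "%rh. (restrict rh A, restrict rh B)"
  have "inj_on ?f (rgrp (auts L) (A Un B))"
  proof (rule inj_onI)
   fix rh rh' assume r:"rh:rgrp (auts L) (A Un B)" "rh':rgrp (auts L) (A Un B)" and eq:"?f rh = ?f rh'"
   obtain sg where s:"rh = restrict sg (A Un B)" using rgrpE[OF r(1)] by(rule bexE)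
   obtain ta where t:"rh' = restrict ta (A Un B)" using rgrpE[OF r(2)] by(rule bexE)
   have "rh x = rh' x" if "x:A Un B" for x
    using eq that unfolding prod.inject rgrp_eq_iff by blast
   hence "sg x = ta x" if "x:A Un B" for x
    using that unfolding s t by(metis restrict_apply')
   thus "rh = rh'" unfolding s t rgrp_eq_iff by blast
  qed
  moreover have "?f`rgrp (auts L) (A Un B)<=rgrp (auts L) A \<times> rgrp (auts L) B"
  proof (rule image_subsetI)
   fix rh assume r:"rh:rgrp (auts L) (A Un B)"
   have "restrict rh A:rgrp (auts L) A" "restrict rh B:rgrp (auts L) B"
    using imageI[OF r, of "%rh. restrict rh A"] imageI[OF r, of "%rh. restrict rh B"]
     image_restrict_group[of A "A Un B" "auts L"] image_restrict_group[of B "A Un B" "auts L"] by simp_all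
   thus "?f rh:rgrp (auts L) A \<times> rgrp (auts L) B" by simp
  qed
  ultimately show "finite (rgrp (auts L) (A Un B))"
   by(rule inj_on_finite) (rule finite_cartesian_product[OF finabD(7)[OF A] finabD(7)[OF B]])
 qed
 moreover have "adj (L Un (A Un B)) = A**B"
  unfolding composite_eq using finabD(3)[OF A] by(simp add: Un_absorb1 le_supI1)
 ultimately show ?thesis by simp
qed

lemma finab_lift:
 assumes F:"finab L F" and L':"ifield L'" "L<=L'"
 shows "finab L' (F**L')"
proof -
 note m = auts_mono[OF L'(2)]
 have "finab L' (adj (L' Un F))"
 proof (rule finab_adj[OF L'(1)])
  show "finite (rgrp (auts L') F)"
   by(rule finite_subset[OF rgrp_mono[OF m] finabD(7)[OF F]])
  show "sg x:adj (L' Un F)" if "sg:auts L'" "x:F" for sg x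
   using finabD(4)[OF F subsetD[OF m that(1)] that(2)] adj_incl[of "L' Un F"] by blast
  show "sg (ta x) = ta (sg x)" if "sg:auts L'" "ta:auts L'" "x:F" for sg ta x
   by(rule finabD(5)[OF F subsetD[OF m that(1)] subsetD[OF m that(2)] that(3)])
  show "sep L' x" if "x:F" for x by(rule sep_mono[OF finabD(6)[OF F that] L'(2)])
 qed
 thus ?thesis by(simp add: composite_eq Un_commute)
qed

lemma finite_restrict_finite:
 assumes "finite S" "Ga<=auts \<kk>"
 shows "finite (rgrp Ga S)"
proof (rule finite_subset)
 show "finite (PiE S (%x. {sg x | sg. sg:auts \<kk>}))"
  using assms(1) finite_auts_orbit by(intro finite_PiE) simp_all
 show "rgrp Ga S<=PiE S (%x. {sg x | sg. sg:auts \<kk>})"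
 proof
  fix rh assume "rh:rgrp Ga S"
  then obtain sg where s:"sg:Ga" "rh = restrict sg S" using rgrpE by metis
  hence "sg:auts \<kk>" using assms(2) by blast
  thus "rh:PiE S (%x. {sg x | sg. sg:auts \<kk>})"
   unfolding s(2) by(intro restrict_PiE_iff[THEN iffD2] ballI) blast
 qed
qed

lemma coeffs_in_orbit_poly_base:
 assumes F:"finab L F" and y:"y:F"
 shows "coeffs_in L (orbit_poly {sg y | sg. sg:auts L})"
 unfolding coeffs_in_def
proof
 fix i
 show "coeff (orbit_poly {sg y | sg. sg:auts L}) i:L"
 proof (rule finab_fixed[OF F])
  have "{sg y | sg. sg:auts L}<=F" using finabD(4)[OF F] y by blast
  thus "coeff (orbit_poly {sg y | sg. sg:auts L}) i:F"
   by(rule coeffs_inD[OF coeffs_in_orbit_poly[OF ifield_sfield[OF finabD(2)[OF F]]]])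
  fix ta assume t:"ta:auts L"
  show "ta (coeff (orbit_poly {sg y | sg. sg:auts L}) i) = coeff (orbit_poly {sg y | sg. sg:auts L}) i"
   by(rule orbit_poly_coeff_fixed[OF auts_endo[OF t] auts_orbit_image[OF finabD(1)[OF F] t]])
 qed
qed

text \<open>Artin: the powers of a primitive element form a basis.\<close>

lemma finab_dimension:
 assumes F:"finab L F"
 shows "has_degree L F (card (rgrp (auts L) F))"
proof -
 interpret Ring.field "\<Omega> :: 'a ac ring" by(rule field_\<Omega>)
 note L = finabD(1)[OF F] and l = ifield_sfield[OF finabD(1)[OF F]]
 obtain y where y:"y:F" and prim:"ALL sg:auts L. sg y = y --> (ALL x:F. sg x = x)"
  using finab_primitive_element[OF F] by(rule bexE)
 let ?G = "rgrp (auts L) F"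
 define S where "S = {sg y | sg. sg:auts L}"
 define n where "n = card ?G"
 have "(%rh. rh y)`?G = S"
  unfolding S_def restrict_group_def image_image using y by auto
 moreover have "inj_on (%rh. rh y) ?G"
 proof (rule inj_onI)
  fix rh rh' assume "rh:?G" "rh':?G" and eq:"rh y = rh' y"
  then obtain sg ta where s:"sg:auts L" "rh = restrict sg F" "ta:auts L" "rh' = restrict ta F"
   using rgrpE by metis
  have "sg y = ta y" using eq y s by simp
  hence "ainv ta (sg y) = y" using auts_inv_simps[OF auts_kk[OF L s(3)]] by simp
  hence "ALL x:F. ainv ta (sg x) = x"
   using bspec[OF prim auts_comp[OF auts_inv[OF s(3) L] s(1)]] by simp
  hence "ALL x:F. sg x = ta x" using auts_inv_simps(1)[OF auts_kk[OF L s(3)]] by metis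
  thus "rh = rh'" unfolding s rgrp_eq_iff .
 qed
 ultimately have cardS:"card S = n" unfolding n_def using card_image by metis
 have finS:"finite S" unfolding S_def by(rule finite_restrict_orbit) (use auts_kk[OF L] in blast)
 have yS:"y:S" unfolding S_def by(rule orbit_self[OF auts_id])
 have SF:"S<=F" unfolding S_def using finabD(4)[OF F] y by blast
 have cL:"coeffs_in L (orbit_poly S)" unfolding S_def by(rule coeffs_in_orbit_poly_base[OF F y])
 define E where "E k = {SUM i<k. a i*y^i | a. ALL i. a i:L}" for k :: nat
 have E0:"E 0 = {0}" unfolding E_def using sfield_0[OF l] by auto
 have ESuc:"line_extension L (y^k) (E k) = E (Suc k)" for k
 proof (intro equalityI subsetI)
  fix u assume "u:line_extension L (y^k) (E k)"
  then obtain c v where cv:"c:L" "v:E k" "u = c*y^k+v" unfolding line_extension_mem_iff by auto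
  then obtain a where a:"ALL i. a i:L" "v = (SUM i<k. a i*y^i)" unfolding E_def by blast
  have "u = (SUM i<Suc k. (a(k := c)) i*y^i)" using cv a by simp
  thus "u:E (Suc k)" unfolding E_def using a(1) cv(1) by(intro CollectI exI[of _ "a(k := c)"]) simp
 next
  fix u assume "u:E (Suc k)"
  then obtain a where a:"ALL i. a i:L" "u = (SUM i<Suc k. a i*y^i)" unfolding E_def by blast
  have "(SUM i<k. a i*y^i):E k" unfolding E_def using a(1) by blast
  thus "u:line_extension L (y^k) (E k)"
   unfolding line_extension_mem_iff using a by(intro bexI[of _ "a k"] bexI[of _ "SUM i<k. a i*y^i"]) simp_all
 qed
 \<comment> \<open>A relation would give a nonzero polynomial of degree at most \<open>k < n\<close>
   over \<open>L\<close> vanishing at all \<open>n\<close> conjugates of \<open>y\<close>.\<close>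
 have notin:"y^k~:E k" if "k < n" for k
 proof
  assume "y^k:E k"
  then obtain a where a:"ALL i. a i:L" "y^k = (SUM i<k. a i*y^i)" unfolding E_def by blast
  define p where "p = pmon 1 k-(SUM i<k. pmon (a i) i)"
  have "poly.coeff p k = 1" by(simp add: p_def coeff_sum)
  hence nz:"p~=0" by auto
  have pL:"coeffs_in L p" unfolding p_def using a(1) sfield_1[OF l]
   by(intro coeffs_in_diff[OF l] coeffs_in_sum[OF l] coeffs_in_monom[OF l]) simp_all
  have "poly p y = 0" using a(2) by(simp add: p_def poly_sum poly_monom)
  hence "poly p (sg y) = 0" if "sg:auts L" for sg
   using endo_poly[OF auts_endo[OF that] pL auts_fix[OF that], of y] endo_0[OF auts_endo[OF that]] by simp
  hence "S<={z. poly p z = 0}" unfolding S_def by blast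
  hence "n <= card {z. poly p z = 0}" unfolding cardS[symmetric] by(rule card_mono[OF poly_roots_finite[OF nz]])
  also have "\<dots><=pdeg p" by(rule card_poly_roots_bound[OF nz])
  also have "\<dots><=k" unfolding p_def
  proof (intro degree_diff_le degree_sum_le)
   show "pdeg (pmon (a i) i)<=k" if "i:{..<k}" for i
    using degree_monom_le[of "a i" i] that by simp
  qed (simp_all add: degree_monom_le)
  finally show False using that by simp
 qed
 have dim:"dimension k L (E k)" if "k<=n" for k
  using that
 proof (induction k)
  case 0
  show ?case unfolding E0 using zero_dim[of L] by simp
 next
  case (Suc k)
  have "dimension (Suc k) L (line_extension L (y^k) (E k))"
   using Suc notin[of k] by(intro Suc_dim) simp_all
  thus ?case unfolding ESuc .
 qed
 have "E n = F"
 proof (intro equalityI subsetI)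
  fix u assume "u:E n"
  then obtain a where a:"ALL i. a i:L" "u = (SUM i<n. a i*y^i)" unfolding E_def by blast
  note f = ifield_sfield[OF finabD(2)[OF F]]
  show "u:F" unfolding a(2) using a(1) finabD(3)[OF F] y
   by(intro sfield_sum[OF f] sfield_mult[OF f] sfield_power[OF f]) auto
 next
  fix u assume u:"u:F"
  let ?L = "adj (insert y L)"
  have L':"ifield ?L" using ifield_kk[OF L] by(intro ifield_adj) blast
  have sub:"L<=?L" "?L<=F"
   using adj_incl[of "insert y L"] adj_min[OF ifield_sfield[OF finabD(2)[OF F]], of "insert y L"] finabD(3)[OF F] y
   by simp_all
  have "u:?L"
  proof (rule finab_fixed[OF finab_mid(2)[OF F L' sub] u])
   fix sg assume s:"sg:auts ?L"
   have "sg y = y" using auts_fix[OF s] adj_incl[of "insert y L"] by blast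
   moreover have "sg:auts L" using s auts_mono[OF sub(1)] by blast
   ultimately show "sg u = u" using bspec[OF prim] u by simp
  qed
  then obtain g where g:"coeffs_in L g" "u = poly g y" unfolding adj_insert_eq[OF L] by blast
  obtain t r where r:"g = orbit_poly S*t+r" "coeffs_in L r" "r = 0 | pdeg r < pdeg (orbit_poly S)"
   using coeffs_in_division[OF l cL orbit_poly_simple_roots(3)[OF finS] g(1)] by blast
  have "u = poly r y" using g(2) r(1) orbit_poly_simple_roots(1)[OF finS, of y] yS by simp
  also have "\<dots> = (SUM i<n. poly.coeff r i*y^i)"
  proof (cases "r = 0")
   case False
   hence "pdeg r < n" using r(3) orbit_poly_simple_roots(4)[OF finS] cardS by simp
   thus ?thesis unfolding poly_altdef
    by(intro sum.mono_neutral_left) (auto simp: coeff_eq_0)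
  qed simp
  finally show "u:E n" unfolding E_def using r(2) unfolding coeffs_in_def by blast
 qed
 thus ?thesis using dim[of n] unfolding n_def by simp
qed

section \<open>Groups of automorphisms\<close>

definition autgrp :: "('a::{field,finite} ac => 'a ac) set => bool" where
 "autgrp Ga <-> Ga<=auts \<kk> & (%x. x):Ga & (ALL sg:Ga. ALL ta:Ga. (%x. sg (ta x)):Ga) & (ALL sg:Ga. ainv sg:Ga)"

lemma autgrpD:
 assumes "autgrp Ga"
 shows "Ga<=auts \<kk>" "(%x. x):Ga" "!!sg ta. sg:Ga ==> ta:Ga ==> (%x. sg (ta x)):Ga"
  "!!sg. sg:Ga ==> ainv sg:Ga"
 using assms unfolding autgrp_def by simp_all

lemma autgrp_auts:"ifield L ==> autgrp (auts L)"
 unfolding autgrp_def using auts_mono[OF ifield_kk] auts_id[of L] auts_comp[of _ L] auts_inv[of _ L] by simp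

lemma autgrp_funpow:
 assumes "autgrp Ga" "sg:Ga"
 shows "(sg ^^ n):Ga"
proof (induction n)
 case 0
 show ?case using autgrpD(2)[OF assms(1)] by(simp add: id_def)
next
 case (Suc n)
 thus ?case using autgrpD(3)[OF assms(1,2), of "sg ^^ n"] by(simp add: comp_def)
qed

definition stable :: "('b => 'b) set => 'b set => bool" where
 "stable Ga E <-> (ALL sg:Ga. ALL x:E. sg x:E)"

lemma stableD:"stable Ga E ==> sg:Ga ==> x:E ==> sg x:E"
 by(simp add: stable_def)

lemma stable_mono:"stable Ga E ==> De<=Ga ==> stable De E"
 by(auto simp: stable_def)

lemma stable_finab:"finab L F ==> stable (auts L) F"
 by(simp add: stable_def finabD(4))

lemma autgrp_image_eq:
 assumes "autgrp Ga" "stable Ga E" "sg:Ga"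
 shows "sg`E = E"
proof
 show "sg`E<=E" using stableD[OF assms(2,3)] by blast
 show "E<=sg`E"
 proof
  fix x assume "x:E"
  hence "ainv sg x:E" by(rule stableD[OF assms(2) autgrpD(4)[OF assms(1,3)]])
  moreover have "sg (ainv sg x) = x" using auts_inv_simps autgrpD(1)[OF assms(1)] assms(3) by blast
  ultimately show "x:sg`E" by(metis imageI)
 qed
qed

lemma restrict_in_Bij:
 assumes "sg:auts \<kk>" "sg`E = E"
 shows "restrict sg E:Bij E"
proof -
 have "inj_on sg E" using endo_inj[OF auts_endo[OF assms(1)]] by(simp add: inj_on_def)
 hence "bij_betw sg E E" using assms(2) by(simp add: bij_betw_def)
 hence "bij_betw (restrict sg E) E E" by(subst bij_betw_cong[of E _ sg]) simp_all
 thus ?thesis by(simp add: Bij_def)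
qed

section \<open>Comparison with \<open>Gal\<close> and \<open>finite_abelian_ext\<close>\<close>

lemma restrict_in_Gal:
 assumes "sg:auts \<kk>" "sg`E = E" "F<=E" "!!x. x:F ==> sg x = x" "sfield E"
 shows "restrict sg E:Gal E F"
proof -
 note e = auts_endo[OF assms(1)]
 have "restrict sg E:ring_hom (sub E) (sub E)"
  using assms(2) sfield_intros[OF assms(5)]
  by(intro ring_hom_memI) (auto simp: endo_mult[OF e] endo_add[OF e] endo_1[OF e])
 thus ?thesis unfolding Gal_def using restrict_in_Bij[OF assms(1,2)] assms(3,4) by auto
qed

lemma Gal_extends:
 assumes F:"\<kk><=F" and E:"ifield E" and g:"g:Gal E F" "F<=E"
 shows "EX sg:auts F. g = restrict sg E"
proof -
 have gB:"g:Bij E" and hom:"g:ring_hom (sub E) (sub E)" and fx:"ALL x:F. g x = x"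
  using g(1) by(simp_all add: Gal_def)
 have "EX sg:auts \<kk>. ALL x:E. sg x = g x"
 proof (rule extend_embedding[OF E])
  show "g x = x" if "x:\<kk>" for x using fx that F by blast
  show "g (x+y) = g x+g y" if "x:E" "y:E" for x y
   using ring_hom_add[OF hom, of x y] that by simp
  show "g (x*y) = g x*g y" if "x:E" "y:E" for x y
   using ring_hom_mult[OF hom, of x y] that by simp
 qed
 then obtain sg where s:"sg:auts \<kk>" "ALL x:E. sg x = g x" by(rule bexE)
 have "sg:auts F" using auts_endo[OF s(1)] s(2) fx g(2) by(auto simp: auts_def)
 moreover have "g = restrict sg E"
  using Bij_imp_extensional[OF gB] s(2) by(intro extensionalityI[of _ E]) simp_all
 ultimately show ?thesis by blast
qed

lemma Gal_finab:
 assumes "finab F E"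
 shows "Gal E F = rgrp (auts F) E"
proof
 note d = finabD[OF assms]
 show "Gal E F<=rgrp (auts F) E"
  using Gal_extends[OF ifield_kk[OF d(1)] d(2) _ d(3)] unfolding restrict_group_def by blast
 show "rgrp (auts F) E<=Gal E F"
 proof
  fix g assume "g:rgrp (auts F) E"
  then obtain sg where s:"sg:auts F" "g = restrict sg E" using rgrpE by blast
  show "g:Gal E F" unfolding s(2)
   by(rule restrict_in_Gal[OF auts_kk[OF d(1) s(1)] autgrp_image_eq[OF autgrp_auts[OF d(1)] stable_finab[OF assms] s(1)] d(3)
      auts_fix[OF s(1)] ifield_sfield[OF d(2)]])
 qed
qed

lemma BijGroup_mult_restrict:
 assumes "sg:auts \<kk>" "sg`E = E" "ta:auts \<kk>" "ta`E = E"
 shows "restrict sg E \<otimes>\<^bsub>aut_group E G\<^esub> restrict ta E = restrict (%x. sg (ta x)) E"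
proof -
 have "ta x:E" if "x:E" for x using that assms(4) by blast
 hence "compose E (restrict sg E) (restrict ta E) = restrict (%x. sg (ta x)) E"
  unfolding compose_def rgrp_eq_iff by simp
 thus ?thesis
  using restrict_in_Bij[OF assms(1,2)] restrict_in_Bij[OF assms(3,4)]
  by(simp add: aut_group_def BijGroup_def)
qed

lemma group_aut_group:
 assumes G:"autgrp Ga" and st:"stable Ga E"
 shows "group (aut_group E (rgrp Ga E))"
proof -
 let ?A = "aut_group E (rgrp Ga E)"
 note im = autgrp_image_eq[OF G st] and kk = subsetD[OF autgrpD(1)[OF G]]
 have car:"carrier ?A = rgrp Ga E" by(simp add: aut_group_def)
 have one:"\<one>\<^bsub>?A\<^esub> = restrict (%x. x) E" by(simp add: aut_group_def BijGroup_def)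
 have mult:"restrict sg E \<otimes>\<^bsub>?A\<^esub> restrict ta E = restrict (%x. sg (ta x)) E" if "sg:Ga" "ta:Ga" for sg ta
  by(rule BijGroup_mult_restrict[OF kk[OF that(1)] im[OF that(1)] kk[OF that(2)] im[OF that(2)]])
 show ?thesis
 proof (rule groupI)
  fix a b assume "a:carrier ?A" "b:carrier ?A"
  then obtain sg ta where s:"sg:Ga" "a = restrict sg E" "ta:Ga" "b = restrict ta E"
   unfolding car using rgrpE by metis
  show "a \<otimes>\<^bsub>?A\<^esub> b:carrier ?A"
   unfolding s(2,4) mult[OF s(1,3)] car by(rule rgrpI[OF autgrpD(3)[OF G s(1,3)]])
  fix c assume "c:carrier ?A"
  then obtain rh where r:"rh:Ga" "c = restrict rh E" unfolding car using rgrpE by metis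
  show "a \<otimes>\<^bsub>?A\<^esub> b \<otimes>\<^bsub>?A\<^esub> c = a \<otimes>\<^bsub>?A\<^esub> (b \<otimes>\<^bsub>?A\<^esub> c)"
   unfolding s(2,4) r(2) mult[OF s(1,3)] mult[OF s(3) r(1)]
   by(simp add: mult[OF autgrpD(3)[OF G s(1,3)] r(1)] mult[OF s(1) autgrpD(3)[OF G s(3) r(1)]])
 next
  show "\<one>\<^bsub>?A\<^esub>:carrier ?A" unfolding one car by(rule rgrpI[OF autgrpD(2)[OF G]])
  fix a assume "a:carrier ?A"
  then obtain sg where s:"sg:Ga" "a = restrict sg E" unfolding car using rgrpE by metis
  show "\<one>\<^bsub>?A\<^esub> \<otimes>\<^bsub>?A\<^esub> a = a" unfolding one s(2) mult[OF autgrpD(2)[OF G] s(1)] ..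
  have "restrict (ainv sg) E \<otimes>\<^bsub>?A\<^esub> a = \<one>\<^bsub>?A\<^esub>"
   unfolding one s(2) mult[OF autgrpD(4)[OF G s(1)] s(1)] by(simp add: auts_inv_simps[OF kk[OF s(1)]])
  thus "EX b:carrier ?A. b \<otimes>\<^bsub>?A\<^esub> a = \<one>\<^bsub>?A\<^esub>"
   unfolding car using rgrpI[OF autgrpD(4)[OF G s(1)]] by blast
 qed
qed

lemma dimension_generated:
 assumes "has_degree L F n"
 shows "EX S. finite S & F<=adj (L Un (S :: 'b::field set))"
proof -
 interpret Ring.field "\<Omega> :: 'b ring" by(rule field_\<Omega>)
 from assms show ?thesis
 proof (induction n L F rule: dimension.induct)
  case (zero_dim K)
  have "{0}<=adj (K Un {})" using sfield_0[OF sfield_adj] by simp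
  thus ?case by(intro exI[of _ "{}"]) simp
 next
  case (Suc_dim v E n K)
  then obtain S where S:"finite S" "E<=adj (K Un S)" by blast
  let ?A = "adj (K Un insert v S)"
  have sub:"adj (K Un S)<=?A" by(rule adj_mono) blast
  have incl:"K Un insert v S<=?A" by(rule adj_incl)
  have "line_extension K v E<=?A"
  proof
   fix u assume "u:line_extension K v E"
   then obtain k w where kw:"k:K" "w:E" "u = k*v+w" unfolding line_extension_mem_iff by auto
   hence "k:?A" "v:?A" "w:?A" using incl S(2) sub by blast+
   thus "u:?A" unfolding kw(3) by(intro sfield_add[OF sfield_adj] sfield_mult[OF sfield_adj])
  qed
  thus ?case using S(1) by(intro exI[of _ "insert v S"]) simp
 qed
qed

text \<open>The polynomial of the orbit of \<open>x\<close> under the finite group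
  \<open>Gal E F\<close> has coefficients in its fixed field \<open>F\<close>. Its simple roots give
  separability, and since all of them lie in \<open>E\<close>, every automorphism of the closure
  over \<open>F\<close> preserves \<open>E\<close>.\<close>

lemma finite_abelian_ext_finab:
 assumes "\<kk><=F" "finite_abelian_ext F E"
 shows "finab F E"
proof -
 interpret Ring.field "\<Omega> :: 'a ac ring" by(rule field_\<Omega>)
 let ?G = "Gal E F" and ?A = "aut_group E (Gal E F)"
 have F:"ifield F" and FE:"F<=E" and E:"ifield E" and fd:"finite_dimension F E"
  and fx:"fixed_field E ?G = F" and comm:"comm_group ?A"
  using assms by(auto simp: finite_abelian_ext_def ifield_def subfield_\<Omega>_iff)
 have Gal_auts:"g:rgrp (auts F) E" if "g:?G" for g
  using Gal_extends[OF assms(1) E that FE] unfolding restrict_group_def by blast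
 obtain n where "dimension n F E" using fd by(auto simp: finite_dimension_def)
 then obtain S where S:"finite S" "E<=adj (F Un S)" using dimension_generated by blast
 have fin:"finite (rgrp (auts F) E)"
 proof -
  have "finite (rgrp (auts F) (adj (F Un S)))"
   by(rule finite_restrict_adj[OF finite_restrict_finite[OF S(1) auts_mono[OF ifield_kk[OF F]]]])
  thus ?thesis using finite_imageI image_restrict_group[OF S(2), of "auts F"] by metis
 qed
 have finG:"finite ?G" by(rule finite_subset[OF _ fin]) (use Gal_auts in blast)
 have gE:"g x:E" if "g:?G" "x:E" for g x
  using that Bij_imp_funcset unfolding Gal_def by blast
 have car:"carrier ?A = ?G" by(simp add: aut_group_def)
 have one:"\<one>\<^bsub>?A\<^esub> = restrict (%x. x) E" by(simp add: aut_group_def BijGroup_def)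
 have mult:"g \<otimes>\<^bsub>?A\<^esub> h = compose E g h" if "g:?G" "h:?G" for g h
  using that by(simp add: aut_group_def BijGroup_def Gal_def)
 have orb:"sep F x & (ALL sg:auts F. sg x:E)" if x:"x:E" for x
 proof -
  define T where "T = (%g. g x)`?G"
  have fT:"finite T" unfolding T_def using finG by simp
  have TE:"T<=E" unfolding T_def using gE x by blast
  have "restrict (%x. x) E:?G" using comm_groupE(2)[OF comm] unfolding car one .
  hence "restrict (%x. x) E x:T" unfolding T_def by blast
  hence xT:"x:T" using x by simp
  have "poly.coeff (orbit_poly T) i:fixed_field E ?G" for i
   unfolding fixed_field_def
  proof (intro CollectI conjI ballI)
   show cE:"poly.coeff (orbit_poly T) i:E"
    by(rule coeffs_inD[OF coeffs_in_orbit_poly[OF ifield_sfield[OF E] TE]])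
   fix g assume g:"g:?G"
   obtain sg where s:"sg:auts F" "g = restrict sg E" using Gal_auts[OF g] rgrpE by blast
   have "sg`T = T"
   proof (rule endo_inj_surj[OF fT])
    show "sg`T<=T"
    proof
     fix z assume "z:sg`T"
     then obtain h where h:"h:?G" "z = sg (h x)" unfolding T_def by blast
     hence "z = compose E g h x" using x gE[OF h(1) x] unfolding s(2) by(simp add: compose_def)
     moreover have "compose E g h:?G" using comm_groupE(1)[OF comm, of g h] mult[OF g h(1)] g h(1) unfolding car by simp
     ultimately show "z:T" unfolding T_def by blast
    qed
    show "inj_on sg T" using endo_inj[OF auts_endo[OF s(1)]] by(simp add: inj_on_def)
   qed
   thus "g (poly.coeff (orbit_poly T) i) = poly.coeff (orbit_poly T) i"
    using orbit_poly_coeff_fixed[OF auts_endo[OF s(1)], of T i] cE unfolding s(2) by simp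
  qed
  hence c:"coeffs_in F (orbit_poly T)" unfolding fx by(simp add: coeffs_in_def)
  have "sep F x"
   using c orbit_poly_simple_roots(1)[OF fT, of x] orbit_poly_simple_roots(2)[OF fT xT] xT unfolding sep_def by blast
  moreover have "sg x:E" if s:"sg:auts F" for sg
  proof -
   have "poly (orbit_poly T) (sg x) = 0"
    using endo_poly[OF auts_endo[OF s] c auts_fix[OF s], of x] orbit_poly_simple_roots(1)[OF fT, of x] xT
     endo_0[OF auts_endo[OF s]] by simp
   thus ?thesis using orbit_poly_simple_roots(1)[OF fT] TE by blast
  qed
  ultimately show ?thesis by blast
 qed
 have st:"sg x:E" if "sg:auts F" "x:E" for sg x using orb that by blast
 hence stab:"stable (auts F) E" by(simp add: stable_def)
 have inG:"restrict sg E:?G" if s:"sg:auts F" for sg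
  by(rule restrict_in_Gal[OF auts_kk[OF F s] autgrp_image_eq[OF autgrp_auts[OF F] stab s] FE auts_fix[OF s] ifield_sfield[OF E]])
 have "sg (ta x) = ta (sg x)" if s:"sg:auts F" "ta:auts F" "x:E" for sg ta x
 proof -
  have "compose E (restrict sg E) (restrict ta E) = compose E (restrict ta E) (restrict sg E)"
   using comm_groupE(4)[OF comm, of "restrict sg E" "restrict ta E"] inG[OF s(1)] inG[OF s(2)]
   unfolding car by(simp add: mult)
  hence "compose E (restrict sg E) (restrict ta E) x = compose E (restrict ta E) (restrict sg E) x" by simp
  thus ?thesis using s(3) st[OF s(1,3)] st[OF s(2,3)] by(simp add: compose_def)
 qed
 thus ?thesis unfolding finab_def using F E FE st orb fin by simp
qed

lemma finab_finite_abelian_ext: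
 assumes "finab F E"
 shows "finite_abelian_ext F E"
proof -
 note d = finabD[OF assms]
 interpret Ring.field "\<Omega> :: 'a ac ring" by(rule field_\<Omega>)
 have G:"Gal E F = rgrp (auts F) E" by(rule Gal_finab[OF assms])
 have "finite_dimension F E" using finab_dimension[OF assms] by(rule finite_dimensionI)
 moreover have "fixed_field E (Gal E F) = F"
 proof
  show "fixed_field E (Gal E F)<=F"
  proof
   fix x assume x:"x:fixed_field E (Gal E F)"
   hence xE:"x:E" by(simp add: fixed_field_def)
   show "x:F"
   proof (rule finab_fixed[OF assms xE])
    fix sg assume "sg:auts F"
    hence "restrict sg E:Gal E F" unfolding G by(rule rgrpI)
    hence "restrict sg E x = x" using x unfolding fixed_field_def by blast
    thus "sg x = x" using xE by simp
   qed
  qed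
  show "F<=fixed_field E (Gal E F)" using d(3) by(auto simp: fixed_field_def Gal_def)
 qed
 moreover have "comm_group (aut_group E (Gal E F))"
 proof (rule group.group_comm_groupI)
  show "group (aut_group E (Gal E F))"
   unfolding G by(rule group_aut_group[OF autgrp_auts[OF d(1)] stable_finab[OF assms]])
  fix a b assume "a:carrier (aut_group E (Gal E F))" "b:carrier (aut_group E (Gal E F))"
  hence ab:"a:rgrp (auts F) E" "b:rgrp (auts F) E"
   unfolding G by(simp_all add: aut_group_def)
  obtain sg ta where s:"sg:auts F" "a = restrict sg E" "ta:auts F" "b = restrict ta E"
   using rgrpE[OF ab(1)] rgrpE[OF ab(2)] by blast
  note im = autgrp_image_eq[OF autgrp_auts[OF d(1)] stable_finab[OF assms]] and kk = auts_kk[OF d(1)]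
  have "restrict (%x. sg (ta x)) E = restrict (%x. ta (sg x)) E"
   using d(5)[OF s(1,3)] by(simp add: rgrp_eq_iff)
  thus "a \<otimes>\<^bsub>aut_group E (Gal E F)\<^esub> b = b \<otimes>\<^bsub>aut_group E (Gal E F)\<^esub> a"
   unfolding s(2,4)
   using BijGroup_mult_restrict[OF kk[OF s(1)] im[OF s(1)] kk[OF s(3)] im[OF s(3)]]
    BijGroup_mult_restrict[OF kk[OF s(3)] im[OF s(3)] kk[OF s(1)] im[OF s(1)]] by simp
 qed
 ultimately show ?thesis
  unfolding finite_abelian_ext_def using d(1-3) by(simp add: subfield_\<Omega>_iff ifield_sfield)
qed

lemma finite_abelian_ext_iff:"\<kk><=F ==> finite_abelian_ext F E <-> finab F E"
 using finite_abelian_ext_finab finab_finite_abelian_ext by blast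


section \<open>Compactness of the Galois group\<close>

text \<open>All orbits are finite, so a maximal family with the finite intersection property determines
  the value at every element.\<close>

lemma auts_compact:
 fixes C :: "'i => ('a::{field,finite} ac => 'a ac) set"
 assumes L:"ifield L"
  and local:"!!i. i:I ==> EX S. finite S & (ALL sg:auts L. ALL ta:auts L. (ALL x:S. sg x = ta x) --> sg:C i --> ta:C i)"
  and fin:"!!J. finite J ==> J<=I ==> EX sg:auts L. ALL i:J. sg:C i"
 shows "EX sg:auts L. ALL i:I. sg:C i"
proof -
 define fip where "fip M <-> (ALL N<=M. finite N --> (EX sg:auts L. ALL A:N. sg:A))" for M
 let ?Z = "{M. fip M & C`I<=M}"
 have fipC:"fip (C`I)"
  unfolding fip_def
 proof (intro allI impI)
  fix N assume "N<=C`I" "finite N"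
  then obtain J where J:"J<=I" "finite J" "N = C`J" using finite_subset_image by metis
  thus "EX sg:auts L. ALL A:N. sg:A" using fin[OF J(2,1)] by simp
 qed
 have "EX M:?Z. ALL M':?Z. M<=M' --> M' = M"
 proof (rule subset_Zorn_nonempty)
  show "?Z~={}" using fipC by blast
  fix K assume K:"K~={}" "subset.chain ?Z K"
  have KZ:"K<=?Z" using K(2) unfolding subset_chain_def by blast
  have "fip (\<Union>K)"
   unfolding fip_def
  proof (intro allI impI)
   fix N assume N:"N<=\<Union>K" "finite N"
   obtain M where "M:K" "N<=M" using finite_subset_Union_chain[OF N(2,1) K] by blast
   thus "EX sg:auts L. ALL A:N. sg:A" using KZ N(2) unfolding fip_def by blast
  qed
  moreover have "C`I<=\<Union>K" using K(1) KZ by blast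
  ultimately show "\<Union>K:?Z" by simp
 qed
 then obtain M where MZ:"M:?Z" and max:"ALL M':?Z. M<=M' --> M' = M" by(rule bexE)
 hence M:"fip M" "C`I<=M" by simp_all
 have Mfin:"EX sg:auts L. ALL A:N. sg:A" if "N<=M" "finite N" for N
  using M(1) that unfolding fip_def by blast
 have absurd:"EX N. N<=M & finite N & ~(EX sg:auts L. sg:A & (ALL B:N. sg:B))" if A:"A~:M" for A
 proof (rule ccontr)
  assume *: "~?thesis"
  have "fip (insert A M)"
   unfolding fip_def
  proof (intro allI impI)
   fix N assume N:"N<=insert A M" "finite N"
   hence "N-{A}<=M" "finite (N-{A})" by auto
   then obtain sg where "sg:auts L" "sg:A" "ALL B:N-{A}. sg:B" using * by blast
   thus "EX sg:auts L. ALL B:N. sg:B" by blast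
  qed
  hence "insert A M:?Z" using M(2) by blast
  thus False using bspec[OF max, of "insert A M"] A by blast
 qed
 have ultra:"A:M |-A:M" for A
 proof (rule ccontr)
  assume "~?thesis"
  then obtain N N' where N:"N<=M" "finite N" "~(EX sg:auts L. sg:A & (ALL B:N. sg:B))"
   "N'<=M" "finite N'" "~(EX sg:auts L. sg:- A & (ALL B:N'. sg:B))"
   using absurd[of A] absurd[of "- A"] by blast
  obtain sg where "sg:auts L" "ALL B:N Un N'. sg:B" using Mfin[of "N Un N'"] N by blast
  thus False using N(3,6) by blast
 qed
 have "EX y. {sg. sg x = y}:M" for x
 proof (rule ccontr)
  assume "~?thesis"
  \<comment> \<open>The complements for the finitely many conjugates of \<open>x\<close> would have
    a common member, although it must send \<open>x\<close> to one of these conjugates.\<close>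
  hence no:"- {sg. sg x = y}:M" for y using ultra[of "{sg. sg x = y}"] by blast
  let ?N = "(%y.-{sg. sg x = y})`{sg x | sg. sg:auts \<kk>}"
  have "?N<=M" using no by blast
  moreover have "finite ?N" using finite_auts_orbit by(rule finite_imageI)
  ultimately obtain sg where s:"sg:auts L" "ALL A:?N. sg:A" using Mfin[of ?N] by blast
  have "sg x:{sg x | sg. sg:auts \<kk>}" using auts_kk[OF L s(1)] by blast
  hence "- {sg'. sg' x = sg x}:?N" by(rule imageI)
  hence "sg:- {sg'. sg' x = sg x}" using s(2) by blast
  thus False by simp
 qed
 then obtain ta where t:"!!x. {sg. sg x = ta x}:M" by metis
 have agree:"EX sg:auts L. (ALL x:S. sg x = ta x) & (ALL A:N. sg:A)" if "finite S" "finite N" "N<=M" for S N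
 proof -
  have "EX sg:auts L. ALL A:(%x. {sg. sg x = ta x})`S Un N. sg:A"
   by(rule Mfin) (use that t in auto)
  then obtain sg where s:"sg:auts L" "ALL A:(%x. {sg. sg x = ta x})`S Un N. sg:A" by(rule bexE)
  thus ?thesis by(intro bexI[of _ sg]) auto
 qed
 have tau:"ta:auts L"
  unfolding auts_def endo_def
 proof (intro CollectI conjI allI ballI)
  obtain sg where s:"sg:auts L" "ALL x:{1}. sg x = ta x" using agree[of "{1}" "{}"] by auto
  thus "ta 1 = 1" using endo_1[OF auts_endo[OF s(1)]] by simp
  fix x y
  obtain sg where s:"sg:auts L" "ALL z:{x, y, x+y, x*y}. sg z = ta z" using agree[of "{x, y, x+y, x*y}" "{}"] by auto
  show "ta (x+y) = ta x+ta y" using endo_add[OF auts_endo[OF s(1)], of x y] s(2) by simp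
  show "ta (x*y) = ta x*ta y" using endo_mult[OF auts_endo[OF s(1)], of x y] s(2) by simp
 next
  fix x assume x:"x:L"
  obtain sg where s:"sg:auts L" "ALL z:{x}. sg z = ta z" using agree[of "{x}" "{}"] by auto
  thus "ta x = x" using auts_fix[OF s(1) x] by simp
 qed
 \<comment> \<open>Membership in \<open>C i\<close> depends on finitely many values only, and there
   \<open>ta\<close> agrees with a member of \<open>C i\<close>.\<close>
 have "ta:C i" if i:"i:I" for i
 proof -
  obtain S where S:"finite S" "ALL sg:auts L. ALL ta:auts L. (ALL x:S. sg x = ta x) --> sg:C i --> ta:C i"
   using local[OF i] by blast
  have "{C i}<=M" using M(2) i by blast
  from agree[OF S(1) _ this] obtain sg where s:"sg:auts L" "(ALL x:S. sg x = ta x) & (ALL A:{C i}. sg:A)" by blast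
  have "(ALL x:S. sg x = ta x) --> sg:C i --> ta:C i" by(rule bspec[OF bspec[OF S(2) s(1)] tau])
  thus ?thesis using s(2) by simp
 qed
 thus ?thesis using tau by blast
qed

section \<open>Finite fields of constants\<close>

lemma card_field_ge_2:"CARD('a::{field,finite}) >= 2"
proof -
 have "card {0, 1 :: 'a}<=CARD('a)" by(rule card_mono) simp_all
 thus ?thesis by simp
qed

lemma power_card_eq:"(a :: 'a::{field,finite})^CARD('a) = a"
proof (cases "a = 0")
 case True
 thus ?thesis using card_field_ge_2[where ?'a = 'a] by simp
next
 case False
 let ?U = "UNIV-{0 :: 'a}"
 have "(%x. a*x)`?U = ?U"
 proof
  show "?U<=(%x. a*x)`?U"
  proof
   fix x assume "x:?U"
   hence "x/a:?U" "x = a*(x/a)" using False by simp_all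
   thus "x:(%x. a*x)`?U" by blast
  qed
 qed (use False in auto)
 hence "\<Prod>?U = \<Prod>((%x. a*x)`?U)" by simp
 also have "\<dots> = (PROD x:?U. a*x)" by(subst prod.reindex) (simp_all add: inj_on_def False)
 also have "\<dots> = a ^ card ?U*\<Prod>?U" by(simp add: prod.distrib)
 finally have "a ^ card ?U = 1" by simp
 hence "a^Suc (card ?U) = a" by(simp only: power_Suc mult_1_right)
 moreover have "Suc (card ?U) = CARD('a)" by(simp add: card_Diff_singleton Suc_pred[OF zero_less_card_finite])
 ultimately show ?thesis by metis
qed

text \<open>Comparing \<open>(x+1)^q = x+1 = x^q+1\<close> with the binomial expansion, the middle
  terms define a polynomial of degree below \<open>q\<close> with \<open>q\<close> roots. Additivity
  of the \<open>q\<close>-th power thus comes directly from \<open>q = CARD('a)\<close>.\<close>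

lemma binomial_card_eq_0:
 assumes "0 < i" "i < CARD('a::{field,finite})"
 shows "of_nat (CARD('a) choose i) = (0 :: 'a)"
proof -
 let ?q = "CARD('a)"
 define f where "f = (SUM i:{1..<?q}. pmon (of_nat (?q choose i) :: 'a) i)"
 have "poly f x = 0" for x :: 'a
 proof -
  have split:"{..?q} = insert 0 (insert ?q {1..<?q})" by auto
  have "x+1 = (x+1)^?q" by(simp add: power_card_eq)
  also have "\<dots> = (SUM k<=?q. of_nat (?q choose k)*x^k)" by(simp add: binomial_ring)
  also have "\<dots> = 1+(x^?q+(SUM k:{1..<?q}. of_nat (?q choose k)*x^k))"
   unfolding split by(subst sum.insert; simp)+
  finally show ?thesis by(simp add: f_def poly_sum poly_monom power_card_eq)
 qed
 hence "{x. poly f x = 0} = UNIV" by blast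
 moreover have "pdeg f < ?q"
 proof -
  have "pdeg f<=?q-1" unfolding f_def
  proof (rule degree_sum_le)
   fix i assume "i:{1..<?q}"
   hence "i < ?q" by simp
   hence "i<=?q-1" by linarith
   thus "pdeg (pmon (of_nat (?q choose i) :: 'a) i)<=?q-1"
    by(rule order_trans[OF degree_monom_le])
  qed simp
  thus ?thesis using card_field_ge_2[where ?'a = 'a] by linarith
 qed
 ultimately have "f = 0" using card_poly_roots_bound[of f] by(metis linorder_not_less)
 moreover have "coeff f i = of_nat (?q choose i)"
  unfolding f_def using assms by(simp add: coeff_sum)
 ultimately show ?thesis by simp
qed

lemma cst_simps:
 "cst 0 = 0" "cst 1 = 1" "cst (a+b) = cst a + cst b" "cst (a*b) = cst a * cst b" "cst (- a) = - cst a"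
 "cst (a-b) = cst a - cst b" "cst (a^n) = cst a^n" "cst (of_nat n) = of_nat n"
proof -
 show 0:"cst 0 = 0" by(simp add: cst_def fract_collapse)
 show 1:"cst 1 = 1" by(simp add: cst_def one_pCons[symmetric] fract_collapse)
 show add:"cst (a+b) = cst a + cst b" for a b by(simp add: cst_def to_ac_add[symmetric])
 show mult:"cst (a*b) = cst a * cst b" for a b by(simp add: cst_def to_ac_mult[symmetric] mult.commute)
 show neg:"cst (- a) = - cst a" for a
  by(metis "0" add add_eq_0_iff)
 show "cst (a-b) = cst a - cst b" using add[of a "- b"] neg[of b] by simp
 show "cst (a^n) = cst a^n" by(induction n) (simp_all add: 1 mult)
 show "cst (of_nat n) = of_nat n" by(induction n) (simp_all add: 0 1 add)
qed

lemma cst_eq_iff:"cst a = cst b <-> a = b"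
 by(simp add: cst_def eq_fract)

lemma cst_inverse:"cst (inverse a) = inverse (cst a)"
 by(metis cst_simps(1,2,4) inverse_unique inverse_zero right_inverse)

lemma cst_kk:"range cst<=\<kk>"
 unfolding cst_def \<kk>_def by blast

lemma power_q_add:"(x+y)^CARD('a) = x^CARD('a)+(y :: 'a::{field,finite} ac)^CARD('a)"
proof -
 let ?q = "CARD('a)"
 have split:"{..?q} = insert 0 (insert ?q {1..<?q})" by auto
 have z:"of_nat (?q choose k) = (0 :: 'a ac)" if "k:{1..<?q}" for k
 proof -
  have "cst (of_nat (?q choose k) :: 'a) = cst 0" using that by(subst binomial_card_eq_0) simp_all
  thus ?thesis by(simp add: cst_simps)
 qed
 have "(x+y)^?q = (SUM k<=?q. of_nat (?q choose k)*x^k*y^(?q-k))" by(simp add: binomial_ring)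
 also have "\<dots> = y^?q+(x^?q+(SUM k:{1..<?q}. of_nat (?q choose k)*x^k*y^(?q-k)))"
  unfolding split by(subst sum.insert; simp)+
 finally show ?thesis using z by(simp add: add.commute)
qed

lemma endo_frob:"endo (%x :: 'a::{field,finite} ac. x^(CARD('a)^n))"
proof -
 have "(x+y)^(CARD('a)^n) = x^(CARD('a)^n)+y^(CARD('a)^n)" for x y :: "'a ac"
  by(induction n) (simp_all add: power_q_add power_mult mult.commute[of "CARD('a)"])
 thus ?thesis by(simp add: endo_def power_mult_distrib)
qed

lemma Fq_iff:"x:Fq r <-> x^(CARD('a)^r) = (x :: 'a::{field,finite} ac)"
 by(simp add: Fq_def)

lemma sfield_Fq:"sfield (Fq r)"
 unfolding sfield_def
 by(simp add: Fq_iff endo_1[OF endo_frob] endo_diff[OF endo_frob] endo_mult[OF endo_frob] endo_inverse[OF endo_frob])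

lemma power_card_power:"(x :: 'a::{field,finite} ac)^(CARD('a)^r) = x ==> x^(CARD('a)^(r*n)) = x"
 by(induction n) (simp_all add: power_add power_mult)

lemma Fq_mono:"s dvd r ==> Fq s<=Fq r"
 by(auto simp: Fq_iff power_card_power elim!: dvdE)

lemma cst_Fq:"cst a:Fq r"
proof -
 have "cst a^CARD('a) = cst a" by(simp add: cst_simps(7)[symmetric] power_card_eq)
 hence "cst a:Fq 1" by(simp add: Fq_iff)
 thus ?thesis using Fq_mono[of 1 r] by auto
qed

lemma of_nat_q_eq_0:"of_nat CARD('a) = (0 :: 'a::{field,finite} ac)"
proof -
 have "of_nat (CARD('a) choose 1) = (0 :: 'a)"
  using card_field_ge_2[where ?'a = 'a] by(intro binomial_card_eq_0) simp_all
 hence "cst (of_nat CARD('a) :: 'a) = cst 0" by simp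
 thus ?thesis by(simp add: cst_simps)
qed

definition Fq_poly :: "nat => 'a::{field,finite} ac poly" where
 "Fq_poly r = pmon 1 (CARD('a)^r)-pmon 1 1"

lemma Fq_roots:
 fixes r :: nat and x :: "'a::{field,finite} ac"
 assumes "r >= 1"
 defines "p == Fq_poly r :: 'a ac poly"
 shows "Fq r = {x. poly p x = 0}" "pdeg p = CARD('a)^r" "p~=0" "poly (pderiv p) x = -1" "coeffs_in \<kk> p"
proof -
 note p_def = p_def[unfolded Fq_poly_def]
 let ?n = "CARD('a)^r"
 have "CARD('a)^1<=?n" using assms(1) card_field_ge_2[where ?'a = 'a] by(intro power_increasing) simp_all
 hence n:"?n > 1" using card_field_ge_2[where ?'a = 'a] by simp
 show "Fq r = {x. poly p x = 0}" by(auto simp: Fq_iff p_def poly_monom)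
 have "pdeg (pmon (1 :: 'a ac) 1) < pdeg (pmon (1 :: 'a ac) ?n)"
  using n by(simp add: degree_monom_eq)
 hence "pdeg p = pdeg (pmon (1 :: 'a ac) ?n)"
  unfolding p_def diff_conv_add_uminus by(intro degree_add_eq_left) simp
 thus d:"pdeg p = ?n" by(simp add: degree_monom_eq)
 thus "p~=0" using n by auto
 have "of_nat ?n = (0 :: 'a ac)" using of_nat_q_eq_0[where ?'a = 'a] assms(1) by simp
 thus "poly (pderiv p) x = -1" using assms(1) by(simp add: p_def pderiv_diff pderiv_monom zero_power)
 show "coeffs_in \<kk> p" unfolding p_def
  by(intro coeffs_in_diff[OF sfield_kk] coeffs_in_monom[OF sfield_kk] sfield_1[OF sfield_kk])
qed

lemma card_Fq:"r >= 1 ==> card (Fq r :: 'a::{field,finite} ac set) = CARD('a)^r"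
 by(simp add: Fq_roots(1,2,3,4) card_roots_simple)

lemma finite_Fq:"r >= 1 ==> finite (Fq r :: 'a::{field,finite} ac set)"
 using poly_roots_finite[OF Fq_roots(3)] Fq_roots(1) by metis

lemma sep_Fq:"r >= 1 ==> c:Fq r ==> sep \<kk> c"
 by(smt (verit, best) Fq_roots(1,4,5) mem_Collect_eq neg_equal_0_iff_equal one_neq_zero sep_def)

lemma Fq_1:"Fq 1 = range (cst :: 'a::{field,finite} => 'a ac)"
proof -
 have "range (cst :: 'a => 'a ac)<=Fq 1" using cst_Fq by blast
 moreover have "card (range (cst :: 'a => 'a ac)) = CARD('a)"
  by(rule card_image) (simp add: inj_on_def cst_eq_iff)
 ultimately show ?thesis using card_subset_eq[OF finite_Fq] card_Fq[where ?'a = 'a, of 1] by(metis le_refl power_one_right)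
qed

lemma endo_Fq:"endo sg ==> c:Fq r ==> sg c:Fq r"
 by(simp add: Fq_iff endo_power[symmetric])

lemma Fq_generator:
 assumes "r >= 1"
 obtains th where "th:Fq r" "th~=0" "!!c. c:Fq r ==> c~=0 ==> EX i. c = th^i"
proof -
 interpret R: Ring.field "\<Omega> :: 'a ac ring" by(rule field_\<Omega>)
 interpret F: Ring.field "sub (Fq r :: 'a ac set)"
  using R.subfield_iff(2) subfield_\<Omega>_iff sfield_Fq by blast
 obtain a where a:"a:carrier (mult_of (sub (Fq r :: 'a ac set)))"
  "carrier (mult_of (sub (Fq r))) = {a [^]\<^bsub>sub (Fq r)\<^esub> i | i::nat. i:UNIV}"
  using F.finite_field_mult_group_has_gen finite_Fq[OF assms] by(auto simp: nat_pow_mult_of)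
 have "a [^]\<^bsub>sub (Fq r)\<^esub> (i::nat) = a^i" for i
  by(induction i) (simp_all add: mult.commute)
 thus thesis using that[of a] a by auto
qed

text \<open>A multiplicative generator \<open>th\<close> tests all of \<open>Fq r\<close>, as
  endomorphisms commute with powers.\<close>

lemma endo_eq_Fq:
 assumes "r >= 1"
 shows "EX th:Fq r. ALL sg ta. endo sg --> endo ta --> sg th = ta th --> (ALL c:Fq r. sg c = (ta c :: 'a::{field,finite} ac))"
proof -
 obtain th :: "'a ac" where t:"th:Fq r" "!!c. c:Fq r ==> c~=0 ==> EX i. c = th^i"
  using Fq_generator[OF assms] by metis
 have "sg c = ta c" if h:"endo sg" "endo ta" "sg th = ta th" "c:Fq r" for sg ta :: "'a ac => 'a ac" and c
  by(metis endo_0 endo_power t(2) that(1,2,3,4))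
 thus ?thesis using t(1) by blast
qed

definition Fqbar :: "'a::{field,finite} ac set" where
 "Fqbar = (UN r:{1..}. Fq r)"

lemma Fq_Fqbar:"r >= 1 ==> Fq r<=Fqbar"
 by(auto simp: Fqbar_def)

lemma Fqbar_finite_subset:
 assumes "finite S" "S<=Fqbar"
 shows "EX r>=1. S<=Fq r"
 using assms
proof (induction S)
 case empty
 thus ?case by auto
next
 case (insert x S)
 then obtain r where r:"r >= 1" "S<=Fq r" by auto
 obtain s where s:"s >= 1" "x:Fq s" using insert.prems by(auto simp: Fqbar_def)
 have "insert x S<=Fq (r*s)" using r s Fq_mono[of r "r*s"] Fq_mono[of s "r*s"] by auto
 moreover have "r*s >= 1" using r s by simp
 ultimately show ?case by blast
qed

lemma sfield_Fqbar:"sfield Fqbar"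
 unfolding sfield_def
proof (intro conjI ballI)
 show "1:Fqbar" using Fq_Fqbar[of 1] sfield_1[OF sfield_Fq, of 1] by blast
 fix x y :: "'a ac" assume "x:Fqbar" "y:Fqbar"
 then obtain r where "r >= 1" "x:Fq r" "y:Fq r" using Fqbar_finite_subset[of "{x, y}"] by auto
 thus "x-y:Fqbar" "x*y:Fqbar"
  using Fq_Fqbar[of r] sfield_diff[OF sfield_Fq, of x r y] sfield_mult[OF sfield_Fq, of x r y] by auto
next
 fix x :: "'a ac" assume "x:Fqbar"
 then obtain r where "r >= 1" "x:Fq r" by(auto simp: Fqbar_def)
 thus "inverse x:Fqbar" using Fq_Fqbar[of r] sfield_inverse[OF sfield_Fq, of x r] by auto
qed

lemma endo_Fqbar:"endo sg ==> c:Fqbar ==> sg c:Fqbar"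
 unfolding Fqbar_def using endo_Fq by blast

lemma cst_Fqbar:"range cst<=Fqbar"
 using cst_Fq[of _ 1] Fq_Fqbar[of 1] by blast

lemma endo_funpow:"endo sg ==> endo (sg ^^ n)"
proof (induction n)
 case 0
 thus ?case by(simp add: endo_def)
next
 case (Suc n)
 thus ?case using endo_comp[of sg "sg ^^ n"] by(simp add: comp_def)
qed

text \<open>The coefficients lie in some \<open>Fq r\<close>, and the ring generated by
  \<open>x\<close> over it is finite. So two iterates of the power map \<open>ph\<close> agree at
  \<open>x\<close>, and by injectivity some positive iterate fixes \<open>x\<close>.\<close>

lemma Fqbar_root:
 assumes p:"coeffs_in Fqbar p" "p~=0" "poly p x = 0"
 shows "x:Fqbar"
proof -
 have "finite (insert 0 (set (coeffs p)))" by simp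
 moreover have "insert 0 (set (coeffs p))<=Fqbar"
  using p(1) sfield_0[OF sfield_Fqbar] by(auto simp: coeffs_def coeffs_in_def)
 ultimately obtain r where r:"r >= 1" "insert 0 (set (coeffs p))<=Fq r" using Fqbar_finite_subset by blast
 have pr:"coeffs_in (Fq r) p"
  unfolding coeffs_in_def using r(2) by(metis insert_subset range_coeff insert_iff rangeI subsetD)
 let ?K = "Fq r :: 'a ac set"
 let ?n = "pdeg p"
 define A where "A = {poly g x | g. coeffs_in ?K g}"
 have "A<=(%a. SUM i<?n. a i*x^i)`(PiE {..<?n} (%_. ?K))"
 proof
  fix z assume "z:A"
  then obtain g where g:"coeffs_in ?K g" "z = poly g x" unfolding A_def by blast
  obtain s h where h:"g = p*s+h" "coeffs_in ?K h" "h = 0 | pdeg h < ?n"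
   using coeffs_in_division[OF sfield_Fq pr p(2) g(1)] by blast
  have "z = poly h x" using g(2) h(1) p(3) by simp
  also have "\<dots> = (SUM i<?n. coeff h i*x^i)"
  proof (cases "h = 0")
   case False
   thus ?thesis using h(3) unfolding poly_altdef by(intro sum.mono_neutral_left) (auto simp: coeff_eq_0)
  qed simp
  also have "\<dots> = (SUM i<?n. restrict (coeff h) {..<?n} i*x^i)" by simp
  finally have "z = (SUM i<?n. restrict (coeff h) {..<?n} i*x^i)" .
  moreover have "restrict (coeff h) {..<?n}:PiE {..<?n} (%_. ?K)"
   using coeffs_inD[OF h(2)] by simp
  ultimately show "z:(%a. SUM i<?n. a i*x^i)`(PiE {..<?n} (%_. ?K))"
   by(rule image_eqI)
 qed
 moreover have "finite (PiE {..<?n} (%_. ?K))" using finite_Fq[OF r(1)] by(intro finite_PiE) simp_all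
 ultimately have fA:"finite A" using finite_surj by blast
 define ph where "ph = (%y :: 'a ac. y^(CARD('a)^r))"
 have e:"endo ph" unfolding ph_def by(rule endo_frob)
 have iter:"(ph ^^ i) x = x^(CARD('a)^(r*i))" for i
 proof (induction i)
  case (Suc i)
  have "(x^CARD('a)^(r*i))^CARD('a)^r = x^CARD('a)^(r*Suc i)"
   by(simp add: power_mult[symmetric] power_add[symmetric] add.commute)
  thus ?case using Suc by(simp add: ph_def)
 qed simp
 have "x^i:A" for i
  unfolding A_def using coeffs_in_monom[OF sfield_Fq sfield_1[OF sfield_Fq], of r i]
  by(intro CollectI exI[of _ "pmon 1 i"]) (simp add: poly_monom)
 hence "range (%i. (ph ^^ i) x)<=A" unfolding iter by blast
 hence "finite (range (%i. (ph ^^ i) x))" using fA finite_subset by blast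
 then obtain i j where "(ph ^^ i) x = (ph ^^ j) x" "i < j"
  by(metis (no_types, lifting) inj_def linorder_neqE_nat range_inj_infinite)
 moreover from this have "(ph ^^ j) x = (ph ^^ i) ((ph ^^ (j-i)) x)"
  by(metis add_diff_inverse_nat comp_apply funpow_add less_imp_not_less)
 ultimately have "(ph ^^ (j-i)) x = x" using endo_inj[OF endo_funpow[OF e]] by metis
 hence "x:Fq (r*(j-i))" unfolding iter Fq_iff by simp
 moreover have "r*(j-i) >= 1" using r(1) `i < j` by simp
 ultimately show ?thesis using Fq_Fqbar by blast
qed

text \<open>The iterates of \<open>x^(q^t)\<close> applied to a generator \<open>th\<close> form a
  finite set \<open>S\<close> permuted by that map. The coefficients of its polynomial lie in
  \<open>Fq t\<close>, so \<open>sg\<close> sends \<open>th\<close> to an element of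
  \<open>S\<close>.\<close>

lemma endo_Fq_power:
 assumes t:"t >= 1" and d:"d >= 1" and e:"endo sg" and fx:"!!c. c:Fq t ==> sg c = c"
 shows "EX i. ALL c:Fq (t*d). sg c = (c :: 'a::{field,finite} ac)^(CARD('a)^(t*i))"
proof -
 let ?q = "CARD('a)"
 have "t*d >= 1" using t d by simp
 from endo_eq_Fq[OF this] obtain th :: "'a ac" where th:"th:Fq (t*d)"
  "ALL sg ta. endo sg --> endo ta --> sg th = ta th --> (ALL c:Fq (t*d). sg c = ta c)" by(rule bexE)
 define S where "S = range (%i. th^(?q^(t*i)))"
 have "S<=Fq (t*d)" unfolding S_def using sfield_power[OF sfield_Fq th(1)] by blast
 hence fS:"finite S" using finite_Fq[OF `t * d >= 1`] finite_subset by blast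
 have e':"endo (%x :: 'a ac. x^(?q^t))" by(rule endo_frob)
 have "(%x. x^(?q^t))`S = S"
 proof (rule endo_inj_surj[OF fS])
  have *: "(th^?q^(t*i))^?q^t = th^?q^(t*Suc i)" for i
   by(simp add: power_mult[symmetric] power_add[symmetric] add.commute)
  show "(%x. x^?q^t)`S<=S"
  proof (rule image_subsetI)
   fix y assume "y:S"
   then obtain i where "y = th^?q^(t*i)" unfolding S_def by blast
   thus "y^?q^t:S" unfolding S_def using * by(intro range_eqI[of _ _ "Suc i"]) simp
  qed
  show "inj_on (%x. x^?q^t) S" using endo_inj[OF e'] by(simp add: inj_on_def)
 qed
 hence c:"coeff (orbit_poly S) i^(?q^t) = coeff (orbit_poly S) i" for i
  by(rule orbit_poly_coeff_fixed[OF e'])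
 hence "coeffs_in (Fq t) (orbit_poly S)" by(simp add: coeffs_in_def Fq_iff)
 hence "sg (poly (orbit_poly S) th) = poly (orbit_poly S) (sg th)" by(rule endo_poly[OF e _ fx])
 moreover have "th:S" unfolding S_def by(rule range_eqI[of _ _ 0]) simp
 ultimately have "sg th:S" using orbit_poly_simple_roots(1)[OF fS] endo_0[OF e] by metis
 then obtain i where "sg th = th^(?q^(t*i))" unfolding S_def by blast
 hence "ALL c:Fq (t*d). sg c = c^(?q^(t*i))" using th(2) e endo_frob[of "t*i"] by blast
 thus ?thesis by blast
qed

text \<open>With \<open>s\<close> minimal such that \<open>R<=Fq s\<close>, equality follows by
  exhibiting \<open>q^s\<close> elements of \<open>R\<close>.\<close>

lemma subfield_of_Fq:
 assumes R:"sfield R" "range cst<=R" "R<=Fq r" "r >= 1"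
 shows "EX s>=1. R = Fq s"
proof -
 have fin:"finite R" using finite_subset[OF R(3) finite_Fq[OF R(4)]] .
 let ?q = "CARD('a)"
 define s where "s = (LEAST s. s >= 1 & R<=Fq s)"
 have s:"s >= 1 & R<=Fq s" unfolding s_def by(rule LeastI[of _ r]) (use R in simp)
 have min:"s<=s'" if "s' >= 1" "R<=Fq s'" for s'
  unfolding s_def by(rule Least_le) (use that in simp)
 obtain th where th:"th:R" "!!c. c:R ==> c~=0 ==> EX i. c = th^i"
 proof -
  interpret R: Ring.field "\<Omega> :: 'a ac ring" by(rule field_\<Omega>)
  interpret F: Ring.field "sub R" using R.subfield_iff(2) subfield_\<Omega>_iff R(1) by blast
  obtain a where a:"a:carrier (mult_of (sub R))"
   "carrier (mult_of (sub R)) = {a [^]\<^bsub>sub R\<^esub> i | i::nat. i:UNIV}"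
   using F.finite_field_mult_group_has_gen fin by(auto simp: nat_pow_mult_of)
  have "a [^]\<^bsub>sub R\<^esub> (i::nat) = a^i" for i
   by(induction i) (simp_all add: mult.commute)
  thus thesis using that[of a] a by auto
 qed
 have thq:"th^(?q^i) = th ==> R<=Fq i" if "i >= 1" for i
 proof
  fix c assume "th^(?q^i) = th" "c:R"
  thus "c:Fq i"
   by(metis Fq_iff sfield_0 sfield_Fq sfield_power th(2))
 qed
 text \<open>The conjugates of a generator are the roots of a polynomial over \<open>\<F>\<^sub>q\<close>, and the
    \<open>\<F>\<^sub>q\<close>-combinations of its first \<open>s\<close> powers are pairwise distinct.\<close>
 have inj:"inj_on (%i. th^(?q^i)) {..<s}"
 proof (rule inj_onI, rule ccontr)
  fix i j assume ij:"i:{..<s}" "j:{..<s}" "th^?q^i = th^?q^j" "i~=j"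
  have *: False if "i < j" "j < s" "th^?q^i = th^?q^j" for i j
  proof -
   have "?q^j = ?q^(j-i)*?q^i" using that(1) by(simp add: power_add[symmetric])
   hence "(th^?q^(j-i))^?q^i = th^?q^i" using that(3) by(simp add: power_mult)
   hence "th^?q^(j-i) = th" using endo_inj[OF endo_frob] by blast
   hence "s<=j-i" using that(1) by(intro min thq) simp_all
   thus False using that by simp
  qed
  show False using *[of i j] *[of j i] ij by(metis lessThan_iff linorder_neqE_nat)
 qed
 define comb where "comb a = (SUM i<s. a i*th^i)" for a :: "nat => 'a ac"
 let ?P = "PiE {..<s} (%_. range (cst :: 'a => 'a ac))"
 have "inj_on comb ?P"
 proof (rule inj_onI)
  fix a b assume a:"a:?P" "b:?P" "comb a = comb b"
  define g where "g = (SUM i<s. pmon (a i-b i) i)"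
  have cg:"coeffs_in (Fq 1) g"
   unfolding g_def Fq_1 using a(1,2) sfield_Fq[of 1, unfolded Fq_1]
   by(intro coeffs_in_sum coeffs_in_monom sfield_diff) (auto simp: PiE_iff)
  have "poly g th = 0" using a(3) by(simp add: g_def comb_def poly_sum poly_monom left_diff_distrib sum_subtractf)
  hence "poly g (th^?q^i) = 0" for i
   using endo_poly[OF endo_frob[where ?'a = 'a, of i] cg, of th] Fq_mono[where ?'a = 'a, of 1 i] endo_0[OF endo_frob[where ?'a = 'a, of i]]
   by(auto simp: Fq_iff subset_iff)
  hence sub:"(%i. th^?q^i)`{..<s}<={z. poly g z = 0}" by blast
  have dg:"pdeg g<=s-1" unfolding g_def
  proof (rule degree_sum_le)
   show "pdeg (pmon (a i-b i) i)<=s-1" if "i:{..<s}" for i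
    using degree_monom_le[of "a i-b i" i] that by simp
  qed simp
  have "g = 0"
  proof (rule ccontr)
   assume nz:"g~=0"
   have "s = card ((%i. th^?q^i)`{..<s})" by(simp add: card_image[OF inj])
   also have "\<dots> <= card {z. poly g z = 0}" by(rule card_mono[OF poly_roots_finite[OF nz] sub])
   also have "\<dots><=pdeg g" by(rule card_poly_roots_bound[OF nz])
   finally show False using dg s by linarith
  qed
  have "a i = b i" if "i < s" for i
  proof -
   have "poly.coeff g i = a i-b i" unfolding g_def using that by(simp add: coeff_sum)
   thus ?thesis using `g = 0` by simp
  qed
  thus "a = b" using a(1,2) by(intro PiE_ext) auto
 qed
 moreover have "comb`?P<=R"
 proof
  fix z assume "z:comb`?P"
  then obtain a where "a:?P" "z = comb a" by blast
  thus "z:R" unfolding comb_def using R(2) th(1)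
   by(auto simp: PiE_iff intro!: sfield_sum[OF R(1)] sfield_mult[OF R(1)] sfield_power[OF R(1)])
 qed
 ultimately have "card ?P <= card R" using card_inj_on_le fin by blast
 moreover have "card ?P = ?q^s"
  by(subst card_PiE) (simp_all add: card_image inj_on_def cst_eq_iff)
 ultimately have "R = Fq s"
  using s card_subset_eq[OF finite_Fq, of s R] card_Fq[where ?'a = 'a, of s] card_mono[OF finite_Fq, of s R]
  by(metis le_antisym)
 thus ?thesis using s by blast
qed

text \<open>\<open>ring.eval\<close> reads coefficient lists from the highest degree down,
  \<open>Poly\<close> from the lowest up.\<close>

lemma eval_Poly:"ring.eval \<Omega> xs x = poly (Poly (rev xs)) (x :: 'b::field)"
proof -
 interpret R: Ring.field "\<Omega> :: 'b ring" by(rule field_\<Omega>)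
 show ?thesis by(induction xs) (simp_all add: Poly_append poly_monom)
qed

lemma algebraic_over_range_cst:"ring.algebraic \<Omega> (range cst) x <-> x:Fqbar"
proof
 interpret R: Ring.field "\<Omega> :: 'a ac ring" by(rule field_\<Omega>)
 let ?K = "range (cst :: 'a => 'a ac)"
 have K:"sfield ?K" using sfield_Fq[of 1] unfolding Fq_1 .
 hence sr:"subring ?K \<Omega>" using subfieldE(1) subfield_\<Omega>_iff by blast
 show "x:Fqbar" if "R.algebraic ?K x"
 proof -
  have a:"(R.algebraic over ?K) x" using that by(simp add: over_def)
  have c:"x:carrier \<Omega>" by simp
  obtain p where p:"p:carrier (univ_poly \<Omega> ?K)" "p~=[]" "R.eval p x = \<zero>\<^bsub>\<Omega>\<^esub>"
   by(rule R.algebraicE[OF sr c a])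
  have pK:"set p<=?K" "hd p~=0" using p(1,2) by(auto simp: univ_poly_def polynomial_def)
  have "Poly (rev p)~=0"
  proof
   assume "Poly (rev p) = 0"
   then obtain n where n:"rev p = replicate n 0" by(auto simp: Poly_eq_0)
   hence "last (rev p) = 0" using p(2) by(cases n) (auto simp: last_replicate)
   thus False using pK(2) p(2) by(simp add: last_rev)
  qed
  moreover have "poly (Poly (rev p)) x = 0" using p(3) by(simp add: eval_Poly)
  moreover have "coeffs_in Fqbar (Poly (rev p))"
   unfolding coeffs_in_def
  proof
   fix i
   show "poly.coeff (Poly (rev p)) i:Fqbar"
   proof (cases "i < length p")
    case True
    hence "rev p ! i:set p" by(metis length_rev nth_mem set_rev)
    thus ?thesis using pK(1) cst_Fqbar True by(auto simp: coeff_Poly_eq nth_default_def)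
   next
    case False
    thus ?thesis using sfield_0[OF sfield_Fqbar] by(simp add: coeff_Poly_eq nth_default_def)
   qed
  qed
  ultimately show ?thesis by(intro Fqbar_root)
 qed
 show "R.algebraic ?K x" if "x:Fqbar"
 proof -
  obtain r where r:"r >= 1" "x:Fq r" using `x:Fqbar` by(auto simp: Fqbar_def)
  define g where "g = (Fq_poly r :: 'a ac poly)"
  note g = Fq_roots[where ?'a = 'a, OF r(1), folded g_def]
  let ?p = "rev (coeffs g)"
  have "set (coeffs g)<=?K"
  proof -
   have "coeffs_in ?K g" unfolding g_def Fq_poly_def
    by(intro coeffs_in_diff[OF K] coeffs_in_monom[OF K] sfield_1[OF K])
   thus ?thesis by(auto simp: coeffs_def coeffs_in_def)
  qed
  moreover have "hd ?p~=0" using g(3) by(simp add: hd_rev last_coeffs_eq_coeff_degree)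
  moreover have "?p~=[]" using g(3) by simp
  moreover have "R.eval ?p x = 0" using g(1) r(2) by(simp add: eval_Poly)
  ultimately show ?thesis
   using R.algebraicI[of ?p ?K x] by(auto simp: univ_poly_def polynomial_def over_def)
 qed
qed

lemma field_of_constants_eq:"field_of_constants F = F Int Fqbar"
 unfolding field_of_constants_def algebraic_over_range_cst by blast

section \<open>Places of the algebraic closure\<close>

definition place :: "'a::{field,finite} ac set => bool" where
 "place V <-> V:primes_of UNIV"

text \<open>In a valuation ring \<open>inverse x~:V\<close> forces \<open>x:V\<close>, so this is
  the maximal ideal; \<open>0\<close> is listed separately because \<open>inverse 0 = 0\<close> lies
  in \<open>V\<close>.\<close>

definition mx :: "'b::field set => 'b set" where
 "mx V = {x. x = 0 | inverse x~:V}"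

definition unit_at :: "'b::field set => 'b => bool" where
 "unit_at V x <-> x:V & x~:mx V"

lemma subring_\<Omega>_iff:"subring P \<Omega> <-> 1:P & (ALL x:P. ALL y:P. x-y:P & x*y:(P :: 'b::field set))"
proof
 interpret Ring.field "\<Omega> :: 'b ring" by(rule field_\<Omega>)
 assume P:"subring P \<Omega>"
 have "x-y:P" if "x:P" "y:P" for x y
  using subringE(7)[OF P that(1), of "- y"] subringE(5)[OF P that(2)] by simp
 thus "1:P & (ALL x:P. ALL y:P. x-y:P & x*y:P)"
  using subringE(3)[OF P] subringE(6)[OF P] by simp
next
 interpret Ring.field "\<Omega> :: 'b ring" by(rule field_\<Omega>)
 assume *: "1:P & (ALL x:P. ALL y:P. x-y:P & x*y:P)"
 hence 0:"0:P" by(metis diff_self)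
 hence neg:"- x:P" if "x:P" for x using * that by(metis diff_0)
 hence "x+y:P" if "x:P" "y:P" for x y using * that by(metis diff_minus_eq_add)
 thus "subring P \<Omega>" using * neg by(intro subringI) simp_all
qed

lemma primes_of_iff:
 "P:primes_of F <-> 1:P & (ALL x:P. ALL y:P. x-y:P & x*y:P) & range cst<=P & P \<subset> F &
   (ALL x:F. x:P | inverse x:P)"
 by(simp add: primes_of_def subring_\<Omega>_iff)

lemma primes_ofD:
 assumes "P:primes_of F"
 shows "1:P" "!!x y. x:P ==> y:P ==> x-y:P" "!!x y. x:P ==> y:P ==> x*y:P"
  "cst a:P" "P<=F" "P~=F" "!!x. x:F ==> x:P | inverse x:P"
 using assms unfolding primes_of_iff by blast+

text \<open>A subring that is maximal among those meeting \<open>F\<close> in \<open>P\<close> is a valuation ring.\<close>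

lemma extend_prime:
 assumes F:"sfield F" and P:"P:primes_of F"
 shows "EX V. place V & V Int F = P"
proof -
 note p = primes_ofD[OF P]
 let ?sub = "%R. 1:R & (ALL x:R. ALL y:R. x-y:R & x*y:R)"
 let ?Z = "{R. ?sub R & R Int F = P}"
 have PZ:"P:?Z" using p(1-3,5) by blast
 have "EX M:?Z. ALL M':?Z. M<=M' --> M' = M"
 proof (rule subset_Zorn_nonempty)
  show "?Z~={}" using PZ by blast
  fix K assume K:"K~={}" "subset.chain ?Z K"
  have KZ:"K<=?Z" using K(2) unfolding subset_chain_def by blast
  have "x-y:\<Union>K & x*y:\<Union>K" if xy:"x:\<Union>K" "y:\<Union>K" for x y
  proof -
   obtain R R' where R:"R:K" "x:R" "R':K" "y:R'" using xy by blast
   hence "R<=R' | R'<=R" using K(2) unfolding subset_chain_def by blast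
   then obtain R'' where "R'':K" "x:R''" "y:R''" using R by blast
   thus ?thesis using KZ by blast
  qed
  moreover have "1:\<Union>K" "\<Union>K Int F = P" using K(1) KZ by blast+
  ultimately show "\<Union>K:?Z" by simp
 qed
 then obtain V where VZ:"V:?Z" and max:"ALL M':?Z. V<=M' --> M' = V" by(rule bexE)
 hence V1:"1:V" and Vd:"!!x y. x:V ==> y:V ==> x-y:V"
  and Vm:"!!x y. x:V ==> y:V ==> x*y:V" and VF:"V Int F = P" by simp_all
 have V0:"0:V" using Vd[OF V1 V1] by simp
 have Vneg:"- x:V" if "x:V" for x using Vd[OF V0 that] by simp
 have Va:"x+y:V" if "x:V" "y:V" for x y using Vd[OF that(1) Vneg[OF that(2)]] by simp
 have Vp:"x^n:V" if "x:V" for x n using that by(induction n) (simp_all add: V1 Vm)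
 have Vs:"sum f I:V" if "!!i. i:I ==> f i:V" for f :: "nat => 'a ac" and I
  using that by(induction I rule: infinite_finite_induct) (simp_all add: V0 Va)
 have PV:"P<=V" using VF by blast
 \<comment> \<open>The nonzero elements of the maximal ideal of \<open>P\<close>.\<close>
 define m where "m = {b:F. b~=0 & b:P & inverse b~:P}"
 have m_inv:"inverse b~:V" if "b:m" for b
  using that VF sfield_inverse[OF F, of b] unfolding m_def by blast
 have m_out:"EX b:m. b*a = 1" if "a:F" "a~:P" for a
 proof -
  have "inverse a:P" using p(7)[OF that(1)] that(2) by blast
  moreover have "a~=0" using that(2) p(2)[OF p(1) p(1)] by auto
  ultimately show ?thesis using that sfield_inverse[OF F that(1)] by(intro bexI[of _ "inverse a"]) (simp_all add: m_def)
 qed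
 \<comment> \<open>Divisibility in \<open>P\<close> is total, so of two elements of \<open>m\<close>
   one divides the other. This lets two relations share one factor.\<close>
 have common:"EX b:m. (EX x:P. b1 = b*x) & (EX y:P. b2 = b*y)" if b:"b1:m" "b2:m" for b1 b2
 proof -
  have F12:"b2/b1:F" using b sfield_divide[OF F] by(simp add: m_def)
  have nz:"b1~=0" "b2~=0" using b by(simp_all add: m_def)
  show ?thesis
  proof (cases "b2/b1:P")
   case True
   thus ?thesis using b(1) nz p(1) by(intro bexI[of _ b1] conjI bexI[of _ 1] bexI[of _ "b2/b1"]) simp_all
  next
   case False
   hence "b1/b2:P" using p(7)[OF F12] by(simp add: inverse_eq_divide)
   thus ?thesis using b(2) nz p(1) by(intro bexI[of _ b2] conjI bexI[of _ 1] bexI[of _ "b1/b2"]) simp_all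
  qed
 qed
 \<comment> \<open>By maximality of \<open>V\<close>, a larger ring meets \<open>F\<close> outside
   \<open>P\<close>.\<close>
 have extend:"EX a:R. a:F & a~:P" if R:"?sub R" "V<=R" "x:R" "x~:V" for R x
 proof (rule ccontr)
  assume "~?thesis"
  hence "R Int F<=P" by blast
  moreover have "P<=R Int F" using PV R(2) p(5) by blast
  ultimately have "R:?Z" using R(1) by simp
  thus False using max R by blast
 qed
 \<comment> \<open>If \<open>1-b*v\<close> is not a unit, adjoining \<open>inverse u\<close>
   produces some \<open>a\<close> in \<open>F\<close> outside \<open>P\<close>. Multiplying by
   \<open>u^l\<close>, which is \<open>1\<close> modulo \<open>c\<close>, exhibits
   \<open>inverse c\<close> in \<open>V\<close>, contrary to \<open>c:m\<close>.\<close>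
 have unit:"inverse u:V" if u:"u = 1-b*v" "b:m" "v:V" for u b v
 proof (rule ccontr)
  assume nu:"inverse u~:V"
  have u0:"u~=0"
   using V0 nu by auto
  have bV:"b:V" using u(2) PV by(auto simp: m_def)
  have uV:"u:V" unfolding u(1) by(rule Vd[OF V1 Vm[OF bV u(3)]])
  define R where "R = {r*inverse u^l | r l. r:V}"
  have RI:"r*inverse u^l:R" if "r:V" for r and l :: nat using that unfolding R_def by blast
  have Rsub:"x-y:R & x*y:R" if h:"x:R" "y:R" for x y
  proof -
   obtain r l where x:"x = r*inverse u^l" "r:V" using h(1) unfolding R_def by blast
   obtain r' l' where y:"y = r'*inverse u^l'" "r':V" using h(2) unfolding R_def by blast
   have "x-y = (r*u^l'-r'*u^l)*inverse u^(l+l')"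
    using u0 unfolding x y by(simp add: field_simps power_add)
   moreover have "(r*u^l'-r'*u^l)*inverse u^(l+l'):R"
    by(intro RI Vd Vm Vp uV x(2) y(2))
   moreover have "x*y = (r*r')*inverse u^(l+l')" unfolding x y by(simp add: power_add)
   moreover have "(r*r')*inverse u^(l+l'):R" by(intro RI Vm x(2) y(2))
   ultimately show ?thesis by simp
  qed
  have R1:"1:R" using RI[OF V1, of 0] by simp
  have VR:"V<=R"
  proof
   fix x assume "x:V"
   thus "x:R" using RI[of x 0] by simp
  qed
  have iR:"inverse u:R" using RI[OF V1, of 1] by simp
  obtain a where a:"a:R" "a:F" "a~:P" by(metis R1 Rsub VR extend iR nu)
  then obtain r l where r:"a = r*inverse u^l" "r:V" unfolding R_def by blast
  obtain b' where b':"b':m" "b'*a = 1" using m_out[OF a(2,3)] by blast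
  obtain c x y where c:"c:m" "x:P" "b = c*x" "y:P" "b' = c*y" using common[OF u(2) b'(1)] by blast
  have cV:"c:V" using c(1) PV by(auto simp: m_def)
  have "EX w:V. u^l = 1 + c*w"
  proof (induction l)
   case (Suc l)
   then obtain w where w:"w:V" "u^l = 1 + c*w" by blast
   have "u^Suc l = u*(1 + c*w)" using w(2) by simp
   also have "\<dots> = 1 + c*(w-x*v - c*w*x*v)" unfolding u(1) c(3) by(simp add: algebra_simps)
   finally have "u^Suc l = 1 + c*(w-x*v - c*w*x*v)" .
   moreover have "w-x*v - c*w*x*v:V" by(intro Vd Vm w(1) u(3) cV subsetD[OF PV c(2)])
   ultimately show ?case by blast
  qed (simp add: bexI[OF _ V0])
  then obtain w where w:"w:V" "u^l = 1 + c*w" by blast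
  have "u^l = b'*a*u^l" using b'(2) by simp
  also have "\<dots> = c*(y*r)" using u0 by(simp add: r(1) c(5) field_simps)
  finally have "c*(y*r-w) = 1" using w(2) by(simp add: algebra_simps)
  hence "inverse c = y*r-w" by(rule inverse_unique)
  moreover have "y*r-w:V" by(intro Vd Vm r(2) w(1) subsetD[OF PV c(4)])
  ultimately show False using m_inv[OF c(1)] by simp
 qed
 \<comment> \<open>Adjoining \<open>x\<close> to \<open>V\<close> also reaches an element of
   \<open>F\<close> outside \<open>P\<close>; multiplying it by its inverse \<open>b\<close> gives
   the relation.\<close>
 have rel:"EX b:m. EX n>0. EX v. (ALL i. v i:V) & (SUM i<=n. v i*x^i)*b = 1" if x:"x~:V" for x
 proof -
  define R where "R = {poly g x | g. ALL i. coeff g i:V}"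
  have RI:"poly g x:R" if "ALL i. coeff g i:V" for g using that unfolding R_def by blast
  have Rsub:"z-y:R & z*y:R" if h:"z:R" "y:R" for z y
  proof -
   obtain g where g:"z = poly g x" "ALL i. coeff g i:V" using h(1) unfolding R_def by blast
   obtain h' where h':"y = poly h' x" "ALL i. coeff h' i:V" using h(2) unfolding R_def by blast
   have "ALL i. coeff (g-h') i:V" using g(2) h'(2) by(simp add: Vd)
   moreover have "ALL i. coeff (g*h') i:V" using g(2) h'(2) by(simp add: coeff_mult Vs Vm)
   ultimately show ?thesis using RI[of "g-h'"] RI[of "g*h'"] g(1) h'(1) by simp
  qed
  have VR:"V<=R"
  proof
   fix z assume "z:V"
   thus "z:R" using RI[of "[:z:]"] V0 by(simp add: coeff_pCons split: nat.split)
  qed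
  have xR:"x:R" using RI[of "[:0, 1:]"] V0 V1 by(simp add: coeff_pCons split: nat.split)
  have "EX a:R. a:F & a~:P" by(rule extend[OF _ VR xR x]) (simp add: Rsub subsetD[OF VR V1])
  then obtain g where g:"poly g x:F" "poly g x~:P" "ALL i. coeff g i:V" unfolding R_def by blast
  obtain b where b:"b:m" "b*poly g x = 1" using m_out[OF g(1,2)] by blast
  let ?n = "Suc (pdeg g)"
  have "poly g x = (SUM i<=?n. coeff g i*x^i)" by(simp add: poly_altdef coeff_eq_0)
  hence "(SUM i<=?n. coeff g i*x^i)*b = 1" using b(2) by(simp add: mult.commute)
  thus ?thesis using b(1) g(3) by blast
 qed
 define rl where "rl x n <-> (EX b:m. EX v. (ALL i. v i:V) & (SUM i<=n. v i*x^i)*b = 1)" for x and n :: nat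
 have rl0:"~rl x 0" for x
 proof
  assume "rl x 0"
  then obtain b where b:"b:m" "EX v. (ALL i. v i:V) & (SUM i<=(0::nat). v i*x^i)*b = 1"
   unfolding rl_def by(rule bexE)
  from b(2) obtain v where v:"(ALL i. v i:V) & (SUM i<=(0::nat). v i*x^i)*b = 1" by(rule exE)
  hence "b*v 0 = 1" by(simp add: mult.commute)
  hence "inverse b = v 0" by(rule inverse_unique)
  thus False using m_inv[OF b(1)] v by simp
 qed
 text \<open>The standard reduction: with relations of minimal degrees for \<open>x\<close> and \<open>1/x\<close>, the longer one can be shortened.\<close>
 have reduce:"rl x (n-1)" if xx:"x~=0" "rl x n" "rl (inverse x) k" "k<=n" "k > 0" for x n k
 proof -
  obtain b where b1:"b:m" "EX v. (ALL i. v i:V) & (SUM i<=n. v i*x^i)*b = 1"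
   using xx(2) unfolding rl_def by(rule bexE)
  from b1(2) obtain v where v:"(ALL i. v i:V) & (SUM i<=n. v i*x^i)*b = 1" by(rule exE)
  obtain b' where b2:"b':m" "EX v. (ALL i. v i:V) & (SUM i<=k. v i*inverse x^i)*b' = 1"
   using xx(3) unfolding rl_def by(rule bexE)
  from b2(2) obtain v' where v':"(ALL i. v' i:V) & (SUM i<=k. v' i*inverse x^i)*b' = 1" by(rule exE)
  note b = b1(1) conjunct1[OF v] conjunct2[OF v] and b' = b2(1) conjunct1[OF v'] conjunct2[OF v']
  obtain c y y' where c:"c:m" "y:P" "b = c*y" "y':P" "b' = c*y'" using common[OF b(1) b'(1)] by blast
  have yV:"y:V" "y':V" "c:V" using c PV by(auto simp: m_def)
  define u where "u = 1 - c*(y'*v' 0)"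
  have iu:"inverse u:V" by(rule unit[OF u_def c(1) Vm[OF yV(2)]]) (use b'(2) in blast)
  have u0:"u~=0"
  proof
   assume "u = 0"
   hence "c*(y'*v' 0) = 1" by(simp add: u_def)
   hence "inverse c = y'*v' 0" by(rule inverse_unique)
   thus False using m_inv[OF c(1)] Vm[OF yV(2)] b'(2) by metis
  qed
  have s1:"{..k} = insert 0 {1..k}" by auto
  have "(SUM i:{1..k}. v' i*inverse x^i)*b' = u"
   using b'(3) unfolding s1 by(simp add: u_def c(5) algebra_simps)
  hence "x^n*u = x^n*(SUM i:{1..k}. v' i*inverse x^i)*b'" by(simp only: mult.assoc)
  also have "\<dots> = (SUM i:{1..k}. v' i*(x^n*inverse x^i))*b'"
   by(simp only: sum_distrib_left mult.left_commute)
  also have "\<dots> = (SUM i:{1..k}. v' i*x^(n-i))*b'"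
  proof -
   have "x^n*inverse x^i = x^(n-i)" if "i:{1..k}" for i
   proof -
    have "i<=n" using that xx(4) by simp
    hence e:"x^n = x^(n-i)*x^i" by(simp add: power_add[symmetric])
    have "x^i*inverse x^i = 1" using xx(1) by(simp add: power_mult_distrib[symmetric])
    thus ?thesis unfolding e by(simp only: mult.assoc mult_1_right)
   qed
   thus ?thesis by simp
  qed
  also have "(SUM i:{1..k}. v' i*x^(n-i)) = (SUM j:{n-k..n-1}. v' (n-j)*x^j)"
   by(rule sum.reindex_bij_witness[of _ "%j. n-j" "%i. n-i"]) (use xx(4,5) in auto)
  also have "\<dots> = (SUM j<=n-1. (if n-k<=j then v' (n-j) else 0)*x^j)"
   by(rule sum.mono_neutral_cong_left) auto
  finally have xn:"x^n = (SUM j<=n-1. (if n-k<=j then v' (n-j) else 0)*x^j)*(b'*inverse u)"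
   using u0 by(simp add: field_simps)
  define w where "w j = v j*y+v n*y*(if n-k<=j then v' (n-j) else 0)*(b'*inverse u)" for j
  have n:"n > 0" using xx(4,5) by simp
  hence s2:"{..n} = insert n {..n-1}" by auto
  have "1 = c*((SUM j<=n-1. v j*x^j)*y+v n*y*x^n)"
  proof -
   have "1 = (v n*x^n+(SUM j<=n-1. v j*x^j))*(c*y)"
    using b(3) n unfolding s2 c(3) by simp
   thus ?thesis by(simp add: algebra_simps)
  qed
  also have "(SUM j<=n-1. v j*x^j)*y+v n*y*x^n = (SUM j<=n-1. w j*x^j)"
   unfolding xn w_def by(simp add: sum_distrib_left sum_distrib_right sum.distrib[symmetric] algebra_simps)
  finally have "(SUM j<=n-1. w j*x^j) * c = 1" by(simp add: mult.commute)
  moreover have "w j:V" for j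
   by(simp add: V0 Va Vm b'(2) b(2) c(5) iu w_def yV(1,2,3))
  ultimately show ?thesis unfolding rl_def using c(1) by blast
 qed
 have "x:V | inverse x:V" for x
 proof (rule ccontr)
  assume no:"~?thesis"
  hence x0:"x~=0" using V0 by auto
  have e1:"EX n. rl x n" "EX n. rl (inverse x) n" using rel[of x] rel[of "inverse x"] no unfolding rl_def by blast+
  define n where "n = (LEAST n. rl x n)"
  define k where "k = (LEAST n. rl (inverse x) n)"
  have n:"rl x n" "!!j. rl x j ==> n<=j" unfolding n_def using LeastI_ex[OF e1(1)] Least_le by auto
  have k:"rl (inverse x) k" "!!j. rl (inverse x) j ==> k<=j" unfolding k_def using LeastI_ex[OF e1(2)] Least_le by auto
  have pos:"n > 0" "k > 0" using n(1) k(1) rl0 by(metis not_gr_zero)+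
  show False
  proof (cases "k<=n")
   case True
   thus False using n(2)[OF reduce[OF x0 n(1) k(1) True pos(2)]] pos(1) by simp
  next
   case False
   have "rl (inverse (inverse x)) n" using n(1) by simp
   hence "rl (inverse x) (k-1)" using reduce[of "inverse x" k n] x0 k(1) False pos(1) by simp
   thus False using k(2)[of "k-1"] pos(2) by simp
  qed
 qed
 moreover have "V~=UNIV" using VF p(6) by blast
 moreover have "range cst<=V" using p(4) PV by blast
 ultimately have "place V" unfolding place_def primes_of_iff using V1 Vd Vm by blast
 thus ?thesis using VF by blast
qed

context
 fixes V :: "'a::{field,finite} ac set"
 assumes V:"place V"
begin

lemma place_1:"1:V" and place_diff:"x:V ==> y:V ==> x-y:V"
 and place_mult:"x:V ==> y:V ==> x*y:V" and place_cst:"cst a:V"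
 and place_total:"x:V | inverse x:V" and place_neq:"V~=UNIV"
 using primes_ofD[OF V[unfolded place_def]] by simp_all

lemma place_0:"0:V"
 using place_diff[OF place_1 place_1] by simp

lemma place_uminus:"x:V ==>-x:V"
 using place_diff[OF place_0, of x] by simp

lemma place_add:"x:V ==> y:V ==> x+y:V"
 using place_diff[OF _ place_uminus, of x y] by simp

lemma place_power:"x:V ==> x^n:V"
 by(induction n) (simp_all add: place_1 place_mult)

lemma place_sum:"(!!i. i:I ==> f i:V) ==> sum f I:V"
 by(induction I rule: infinite_finite_induct) (simp_all add: place_0 place_add)

lemma place_prod:"(!!i. i:I ==> f i:V) ==> prod f I:V"
 by(induction I rule: infinite_finite_induct) (simp_all add: place_1 place_mult)

lemma place_poly:"(!!i. coeff p i:V) ==> x:V ==> poly p x:V"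
 unfolding poly_altdef by(intro place_sum place_mult place_power) simp_all

lemma mx_0:"0:mx V" and mx_1:"1~:mx V"
 using place_1 by(simp_all add: mx_def)

lemma mx_place:"x:mx V ==> x:V"
 using place_total[of x] place_0 by(auto simp: mx_def)

lemma notin_place:"x~:V ==> inverse x:mx V"
 using place_0 by(auto simp: mx_def)

lemma notin_mx:"x~:mx V ==> x~=0 & inverse x:V"
 by(simp add: mx_def)

lemma mx_mult:"x:V ==> y:mx V ==> x*y:mx V"
proof (rule ccontr)
 assume *: "x:V" "y:mx V" "x*y~:mx V"
 hence xy:"x*y~=0" "inverse (x*y):V" by(simp_all add: mx_def)
 hence "x*inverse (x*y):V" by(intro place_mult *(1))
 moreover have "x*inverse (x*y) = inverse y" using xy(1) by(simp add: field_simps)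
 ultimately have "inverse y:V" by metis
 thus False using *(2) xy(1) by(auto simp: mx_def)
qed

lemma mx_mult2:"x:mx V ==> y:V ==> x*y:mx V"
 using mx_mult[of y x] by(simp add: mult.commute)

lemma mx_add:"x:mx V ==> y:mx V ==> x+y:mx V"
proof -
 assume *: "x:mx V" "y:mx V"
 have key:"a+b:mx V" if "b~=0" "b:mx V" "a/b:V" for a b
 proof -
  have "(a/b+1)*b:mx V" by(intro mx_mult place_add place_1 that)
  thus ?thesis using that(1) by(simp add: field_simps)
 qed
 show ?thesis
 proof (cases "x = 0 | y = 0")
  case True
  thus ?thesis using * by auto
 next
  case False
  hence "x/y:V | y/x:V" using place_total[of "x/y"] by simp
  thus ?thesis using key[of y x] key[of x y] False * by(auto simp: add.commute)
 qed
qed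

lemma mx_uminus:"x:mx V ==>-x:mx V"
 using mx_mult[OF place_uminus[OF place_1], of x] by simp

lemma mx_diff:"x:mx V ==> y:mx V ==> x-y:mx V"
 using mx_add[OF _ mx_uminus, of x y] by simp

lemma mx_sum:"(!!i. i:I ==> f i:mx V) ==> sum f I:mx V"
 by(induction I rule: infinite_finite_induct) (simp_all add: mx_0 mx_add)

lemma mx_prime:"x:V ==> y:V ==> x*y:mx V ==> x:mx V | y:mx V"
 by(metis (mono_tags, lifting) inverse_mult_distrib mem_Collect_eq mult_eq_0_iff mx_def place_mult)

lemma mx_power:"x:mx V ==> n > 0 ==> x^n:mx V"
 by(cases n) (simp_all add: mx_mult2 place_power mx_place)

lemma mx_prod_prime:"finite I ==> (!!i. i:I ==> f i:V) ==> prod f I:mx V ==> EX i:I. f i:mx V"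
proof (induction I rule: finite_induct)
 case (insert i I)
 thus ?case using mx_prime[of "f i" "prod f I"] place_prod[of I f] by auto
qed (simp add: mx_1)

lemma mx_power_iff:"x:V ==> n > 0 ==> x^n:mx V <-> x:mx V"
 using mx_power mx_prod_prime[of "{..<n}" "%_. x"] by auto

lemma mx_diff_cong:"x-y:mx V ==> x'-y':mx V ==> x:V ==> y':V ==> x*x'-y*y':mx V"
proof -
 assume *: "x-y:mx V" "x'-y':mx V" "x:V" "y':V"
 have "x*x'-y*y' = x*(x'-y')+(x-y)*y'" by(simp add: algebra_simps)
 thus ?thesis using mx_add[OF mx_mult[OF *(3,2)] mx_mult2[OF *(1,4)]] by simp
qed

lemma unit_at_iff:"unit_at V x <-> x~=0 & x:V & inverse x:V"
 by(auto simp: unit_at_def mx_def)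

lemma unit_at_1:"unit_at V 1" and unit_at_mult:"unit_at V x ==> unit_at V y ==> unit_at V (x*y)"
 and unit_at_inverse:"unit_at V x ==> unit_at V (inverse x)"
 by(simp_all add: unit_at_iff place_1 place_mult)

lemma unit_at_power:"unit_at V x ==> unit_at V (x^n)"
 by(induction n) (simp_all add: unit_at_1 unit_at_mult)

lemma unit_at_power_iff:"n > 0 ==> unit_at V (x^n) <-> unit_at V x"
proof
 assume n:"n > 0" and u:"unit_at V (x^n)"
 have "x:V"
  by(metis (no_types, lifting) mx_power n notin_place power_inverse u unit_at_def unit_at_inverse)
 thus "unit_at V x" using u n mx_power_iff[of x n] by(simp add: unit_at_def)
qed (rule unit_at_power)

text \<open>Nonzero constants are roots of unity, and an element with a power that is a unit is
  itself a unit.\<close>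

lemma Fqbar_place:"Fqbar<=V"
proof
 fix c :: "'a ac" assume "c:Fqbar"
 then obtain r where r:"r >= 1" "c:Fq r" by(auto simp: Fqbar_def)
 have q:"CARD('a)^r > 1" using card_field_ge_2[where ?'a = 'a] r(1) by(intro one_less_power) simp_all
 show "c:V"
 proof (cases "c = 0")
  case False
  have "c^(CARD('a)^r) = c" using r(2) by(simp add: Fq_iff)
  moreover have "c^(CARD('a)^r) = c * c^(CARD('a)^r-1)" using power_minus_mult[of "CARD('a)^r" c] q by(simp only: mult.commute)
  ultimately have "c^(CARD('a)^r-1) = 1" using False by simp
  hence "unit_at V (c^(CARD('a)^r-1))" by(simp add: unit_at_1)
  thus ?thesis using q unit_at_power_iff[of "CARD('a)^r-1" c] by(simp add: unit_at_def)
 qed (simp add: place_0)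
qed

lemma Fqbar_mx:"c:Fqbar ==> c:mx V ==> c = 0"
 using Fqbar_place sfield_inverse[OF sfield_Fqbar, of c] by(auto simp: mx_def)

lemma dominant_element:
 assumes "finite Z" "Z~={}" "0~:Z"
 shows "EX z:Z. ALL w:Z. w/z:V"
 using assms
proof (induction Z rule: finite_ne_induct)
 case (singleton x)
 thus ?case by(simp add: place_1)
next
 case (insert x Z)
 then obtain z where z:"z:Z" "ALL w:Z. w/z:V" by auto
 have nz:"x~=0" "z~=0" using insert.prems z(1) by auto
 show ?case
 proof (cases "x/z:V")
  case True
  thus ?thesis using z by auto
 next
  case False
  hence zx:"z/x:V" using place_total[of "x/z"] by(simp add: inverse_eq_divide)
  have "w/x:V" if "w:Z" for w
   using place_mult[OF bspec[OF z(2) that] zx] nz by simp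
  thus ?thesis using nz place_1 by(intro bexI[of _ x]) auto
 qed
qed

end

section \<open>Normalized valuations and residues\<close>

lemma kk_eq_adj:"\<kk> = adj (range cst Un {\<TT> :: 'a::{field,finite} ac})"
proof
 let ?A = "adj (range cst Un {\<TT> :: 'a ac})"
 note A = sfield_adj[of "range cst Un {\<TT> :: 'a ac}"] and incl = adj_incl[of "range cst Un {\<TT> :: 'a ac}"]
 have T:"\<TT>:?A" using incl by blast
 have c:"cst a:?A" for a using incl by blast
 have poly:"to_ac (Fract (a :: 'a poly) 1):?A" for a
 proof (induction a)
  case 0
  show ?case using sfield_0[OF A] by(simp add: fract_collapse)
 next
  case (pCons b a)
  have "Fract (pCons b a) 1 = Fract [:b:] 1+Fract [:0, 1:] 1*Fract a 1" by simp
  hence "to_ac (Fract (pCons b a) 1) = cst b+\<TT>*to_ac (Fract a 1)"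
   by(simp only: to_ac_add to_ac_mult cst_def \<TT>_def)
  thus ?case using sfield_add[OF A c sfield_mult[OF A T pCons.IH]] by simp
 qed
 show "\<kk><=?A"
 proof
  fix x :: "'a ac" assume "x:\<kk>"
  then obtain z where z:"x = to_ac z" unfolding \<kk>_def by blast
  obtain a b where ab:"z = Fract a b" "b~=0" by(cases z)
  have "z = Fract a 1/Fract b 1" using ab by(simp add: divide_fract)
  hence "x = to_ac (Fract a 1)/to_ac (Fract b 1)" using z by(simp only: to_ac_divide)
  thus "x:?A" using sfield_divide[OF A poly poly] by metis
 qed
 have "\<TT>:(\<kk> :: 'a ac set)" unfolding \<TT>_def \<kk>_def by blast
 thus "?A<=\<kk>" using cst_kk by(intro adj_min[OF sfield_kk]) blast
qed

lemma T_kk:"\<TT>:\<kk>"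
 unfolding \<TT>_def \<kk>_def by blast

lemma T_transcendental:"(\<TT> :: 'a::{field,finite} ac)~:Fqbar"
proof
 assume "(\<TT> :: 'a ac):Fqbar"
 then obtain r where r:"r >= 1" "(\<TT> :: 'a ac):Fq r" by(auto simp: Fqbar_def)
 let ?n = "CARD('a)^r"
 have n:"?n > 1" using card_field_ge_2[where ?'a = 'a] r(1) by(intro one_less_power) simp_all
 have pw:"Fract a 1^k = Fract (a^k) 1" for a :: "'a poly" and k
  by(induction k) (simp_all add: one_fract_def[symmetric] fract_collapse)
 have "(\<TT> :: 'a ac)^?n = \<TT>" using r(2) by(simp add: Fq_iff)
 hence "Fract ([:0, 1:]^?n) 1 = Fract [:0, 1 :: 'a:] 1"
  unfolding \<TT>_def by(simp only: to_ac_power[symmetric] to_ac_eq_iff pw)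
 hence "[:0, 1 :: 'a:]^?n = [:0, 1:]" by(simp add: eq_fract)
 hence "pdeg ([:0, 1 :: 'a:]^?n) = 1" by simp
 thus False using n by(auto simp: degree_power_eq)
qed

text \<open>One of the two is integral at any given place, and both occur as the generator acting on
  Carlitz modules.\<close>

definition parameter :: "'a::{field,finite} ac => bool" where
 "parameter t <-> t = \<TT> | t = inverse \<TT>"

lemma T_neq_0:"\<TT>~=0"
 using T_transcendental sfield_0[OF sfield_Fqbar] by metis

lemma parameter_kk:"parameter t ==> t:\<kk>"
 unfolding parameter_def using T_kk sfield_inverse[OF sfield_kk T_kk] by blast

lemma parameter_transcendental:"parameter t ==> t~:Fqbar"
 unfolding parameter_def using T_transcendental sfield_inverse[OF sfield_Fqbar, of "inverse \<TT>"] by auto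

lemma parameter_neq_0:"parameter t ==> t~=0"
 using parameter_transcendental sfield_0[OF sfield_Fqbar] by metis

lemma sfield_range_cst:"sfield (range cst)"
 using sfield_Fq[of 1] unfolding Fq_1 .

lemma parameter_poly_nonzero:"parameter t ==> coeffs_in (range cst) g ==> g~=0 ==> poly g t~=0"
 using Fqbar_root[OF coeffs_in_mono[OF _ cst_Fqbar]] parameter_transcendental by blast

lemma kk_fractions:
 assumes t:"parameter t" and x:"x:\<kk>"
 shows "EX f g. coeffs_in (range cst) f & coeffs_in (range cst) g & poly g t~=0 & x = poly f t/poly g t"
proof -
 let ?K = "range (cst :: 'a => 'a ac)"
 note K = sfield_range_cst[where ?'a = 'a]
 define A where "A = {poly f t/poly g t | f g. coeffs_in ?K f & coeffs_in ?K g & poly g t~=0}"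
 have AI:"poly f t/poly g t:A" if "coeffs_in ?K f" "coeffs_in ?K g" "poly g t~=0" for f g
  using that unfolding A_def by blast
 have AE:"EX f g. coeffs_in ?K f & coeffs_in ?K g & poly g t~=0 & y = poly f t/poly g t" if "y:A" for y
  using that unfolding A_def by blast
 have c1:"coeffs_in ?K 1" by(rule coeffs_in_1[OF K])
 have pol:"poly f t:A" if "coeffs_in ?K f" for f using AI[OF that c1] by simp
 have "sfield A"
  unfolding sfield_def
 proof (intro conjI ballI)
  show "1:A" using pol[OF c1] by simp
  fix y z assume "y:A" "z:A"
  then obtain f g f' g' where *: "coeffs_in ?K f" "coeffs_in ?K g" "poly g t~=0" "y = poly f t/poly g t"
   "coeffs_in ?K f'" "coeffs_in ?K g'" "poly g' t~=0" "z = poly f' t/poly g' t"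
   using AE by metis
  have "y-z = poly (f*g'-f'*g) t/poly (g*g') t"
   unfolding *(4,8) using *(3,7) by(simp add: diff_frac_eq)
  moreover have "poly (f*g'-f'*g) t/poly (g*g') t:A"
   using * by(intro AI coeffs_in_diff[OF K] coeffs_in_mult[OF K]) simp_all
  ultimately show "y-z:A" by simp
  have "y*z = poly (f*f') t/poly (g*g') t" using * by simp
  moreover have "poly (f*f') t/poly (g*g') t:A"
   using * by(intro AI coeffs_in_mult[OF K]) simp_all
  ultimately show "y*z:A" by simp
 next
  fix y assume "y:A"
  then obtain f g where *: "coeffs_in ?K f" "coeffs_in ?K g" "poly g t~=0" "y = poly f t/poly g t" using AE by metis
  show "inverse y:A"
  proof (cases "poly f t = 0")
   case True
   thus ?thesis using *(4) pol[OF coeffs_in_0[OF K]] by simp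
  next
   case False
   thus ?thesis using AI[OF *(2,1) False] *(4) by(simp add: field_simps)
  qed
 qed
 moreover have tA:"t:A"
  using pol[of "[:0, 1:]"] sfield_0[OF K] sfield_1[OF K] by(simp add: coeffs_in_pCons[OF K] coeffs_in_0[OF K])
 moreover have "cst a:A" for a
  using pol[of "[:cst a:]"] by(simp add: coeffs_in_pCons[OF K] coeffs_in_0[OF K])
 moreover have "\<TT>:A"
  using t tA sfield_inverse[OF `sfield A` tA] unfolding parameter_def by auto
 ultimately have "\<kk><=A" unfolding kk_eq_adj by(intro adj_min) auto
 thus ?thesis using AE x by blast
qed

context
 fixes V :: "'a::{field,finite} ac set"
 assumes V:"place V"
begin

lemma ex_parameter_in_place:"EX t. parameter t & t:V"
 using place_total[OF V, of \<TT>] unfolding parameter_def by blast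

text \<open>The Newton polygon argument: divide the vanishing sum by a term that dominates all
  others. If no second term had the same size, \<open>1\<close> would lie in
  \<open>mx V\<close>.\<close>

lemma dominant_terms:
 assumes "p~=0" "poly p x = 0" "x~=0"
 shows "EX i j. i < j & j<=pdeg p & coeff p i~=0 & coeff p j~=0 &
  unit_at V (coeff p j / coeff p i*x^(j-i))"
proof -
 define J where "J = {j. j<=pdeg p & coeff p j~=0}"
 define z where "z j = coeff p j*x^j" for j
 have fJ:"finite J" unfolding J_def by simp
 have "pdeg p:J" unfolding J_def using assms(1) by simp
 hence "z`J~={}" "finite (z`J)" "0~:z`J" using fJ assms(3) by(auto simp: J_def z_def)
 from dominant_element[OF V this(2,1,3)] obtain i where i:"i:J" "!!j. j:J ==> z j/z i:V" by auto
 have zi:"z i~=0" using i(1) assms(3) by(simp add: J_def z_def)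
 have "(SUM j:J. z j) = 0"
 proof -
  have "(SUM j:J. z j) = (SUM j<=pdeg p. z j)"
   by(rule sum.mono_neutral_left) (auto simp: J_def z_def)
  thus ?thesis using assms(2) by(simp add: poly_altdef z_def)
 qed
 hence "(SUM j:J. z j/z i) = 0" by(simp add: sum_divide_distrib[symmetric])
 hence sum:"z i/z i+(SUM j:J-{i}. z j/z i) = 0"
  using sum.remove[OF fJ i(1), of "%j. z j/z i"] by simp
 obtain j where j:"j:J" "j~=i" "z j/z i~:mx V"
 proof (rule ccontr)
  assume "~thesis"
  hence "z j/z i:mx V" if "j:J-{i}" for j using that `~thesis` \<open>!!j. [|j:J; j ~= i; z j / z i~:mx V|] ==> thesis\<close> by blast
  hence "(SUM j:J-{i}. z j/z i):mx V" by(rule mx_sum[OF V])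
  moreover have "1 =-(SUM j:J-{i}. z j/z i)" using sum zi by(simp add: eq_neg_iff_add_eq_0)
  ultimately show False using mx_1[OF V] mx_uminus[OF V] by metis
 qed
 have u:"unit_at V (z j/z i)" using j(3) i(2)[OF j(1)] by(simp add: unit_at_def)
 have nz:"coeff p i~=0" "coeff p j~=0" "i<=pdeg p" "j<=pdeg p"
  using i(1) j(1) by(simp_all add: J_def)
 show ?thesis
 proof (cases "i < j")
  case True
  hence "x^j = x^(j-i)*x^i" by(simp add: power_add[symmetric])
  hence "z j/z i = coeff p j / coeff p i*x^(j-i)" using assms(3) by(simp add: z_def)
  thus ?thesis using True nz u by(intro exI[of _ i] exI[of _ j]) simp
 next
  case False
  hence "j < i" using j(2) by simp
  hence "x^i = x^(i-j)*x^j" by(simp add: power_add[symmetric])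
  hence "inverse (z j/z i) = coeff p i / coeff p j*x^(i-j)" using assms(3) by(simp add: z_def)
  hence "unit_at V (coeff p i / coeff p j*x^(i-j))" using unit_at_inverse[OF V u] by simp
  thus ?thesis using `j < i` nz by(intro exI[of _ j] exI[of _ i]) simp
 qed
qed

text \<open>Otherwise all nonzero elements of \<open>\<kk>\<close> are units at \<open>V\<close>;
  then \<open>dominant_terms\<close> makes a power of every \<open>x~=0\<close> a unit, and
  \<open>V\<close> is everything.\<close>

lemma kk_not_subset_place:"~\<kk><=V"
proof
 assume kk:"\<kk><=V"
 have unit:"unit_at V a" if "a:\<kk>" "a~=0" for a
  using that kk sfield_inverse[OF sfield_kk that(1)] by(auto simp: unit_at_iff[OF V])
 have "x:V" for x
 proof (cases "x = 0")
  case False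
  obtain p where p:"coeffs_in \<kk> p" "p~=0" "poly p x = 0" using algebraic_over_kk[of x] by blast
  obtain i j where ij:"i < j" "coeff p i~=0" "coeff p j~=0" "unit_at V (coeff p j / coeff p i*x^(j-i))"
   using dominant_terms[OF p(2,3) False] by blast
  have "unit_at V (coeff p j / coeff p i)"
   by(rule unit) (use ij p(1) in \<open>auto intro: sfield_divide[OF sfield_kk] coeffs_inD\<close>)
  from unit_at_mult[OF V unit_at_inverse[OF V this] ij(4)] have "unit_at V (x^(j-i))" using ij(2,3) by simp
  thus ?thesis using unit_at_power_iff[OF V, of "j-i" x] ij(1) by(simp add: unit_at_def)
 qed (simp add: place_0[OF V])
 thus False using place_neq[OF V] by blast
qed

lemma mx_poly_cong:
 assumes "x-y:mx V" "x:V" "y:V" "!!i. coeff g i:V"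
 shows "poly g x-poly g y:mx V"
proof -
 have "x^n-y^n:mx V" for n
 proof (induction n)
  case (Suc n)
  thus ?case using mx_diff_cong[OF V assms(1) Suc assms(2) place_power[OF V assms(3)]] by simp
 qed (simp add: mx_0[OF V])
 thus ?thesis by(smt (verit, ccfv_threshold) V assms(4) mx_mult mx_sum poly_altdef right_diff_distrib sum_subtractf)
qed

text \<open>\<open>h\<close> splits into linear factors with roots in \<open>Fqbar\<close>; as
  \<open>mx V\<close> is prime, one of the factors \<open>x-a\<close> lies in it.\<close>

lemma root_modulo_mx:
 assumes h:"coeffs_in Fqbar h" "h~=0" and x:"x:V" "poly h x:mx V"
 shows "EX c:Fqbar. x - c:mx V"
proof -
 obtain A where A:"h = psmul (plc h) (PROD a:#A. [:- a, 1:])" "set_mset A = {a. poly h a = 0}"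
  using poly_splits[OF h(2)] by metis
 have AF:"a:Fqbar" if "a \<in># A" for a
  using that A(2) Fqbar_root[OF h] by blast
 have lc:"plc h:Fqbar" "plc h~=0"
  using h(2) coeffs_inD[OF h(1)] by simp_all
 have dV:"x-a:V" if "a:Fqbar" for a
  by(rule place_diff[OF V x(1)]) (use that Fqbar_place[OF V] in blast)
 have pV:"poly (PROD a:#B. [:- a, 1:]) x:V" if "!!a. a \<in># B ==> a:Fqbar" for B
  using that
 proof (induction B)
  case (add b B)
  have "poly (PROD a:#add_mset b B. [:- a, 1:]) x = (x-b)*poly (PROD a:#B. [:- a, 1:]) x"
   by(simp add: algebra_simps)
  moreover have "(x-b)*poly (PROD a:#B. [:- a, 1:]) x:V"
   using add by(intro place_mult[OF V] dV) simp_all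
  ultimately show ?case by simp
 qed (simp add: place_1[OF V])
 have "\<exists>a\<in>#B. x-a:mx V" if "!!a. a \<in># B ==> a:Fqbar" "poly (PROD a:#B. [:- a, 1:]) x:mx V" for B
  using that
 proof (induction B)
  case empty
  thus ?case using mx_1[OF V] by simp
 next
  case (add a B)
  have aV:"x-a:V" by(rule dV) (use add.prems(1) in simp)
  have BV:"poly (PROD a:#B. [:- a, 1:]) x:V" by(rule pV) (use add.prems(1) in simp)
  have "(x-a)*poly (PROD a:#B. [:- a, 1:]) x:mx V" using add.prems(2) by(simp add: algebra_simps)
  from mx_prime[OF V aV BV this] show ?case
   using add.IH add.prems(1) by auto
 qed
 moreover have "poly (PROD a:#A. [:- a, 1:]) x:mx V"
 proof -
  have "poly h x = plc h*poly (PROD a:#A. [:- a, 1:]) x" by(subst A(1)) simp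
  hence "poly (PROD a:#A. [:- a, 1:]) x = inverse (plc h)*poly h x" using lc(2) by simp
  thus ?thesis
   using mx_mult[OF V subsetD[OF Fqbar_place[OF V] sfield_inverse[OF sfield_Fqbar lc(1)]] x(2)] by simp
 qed
 ultimately show ?thesis using AF by blast
qed

text \<open>For a parameter \<open>t\<close> integral at \<open>V\<close>, let \<open>f\<close> be a
  nonzero polynomial over \<open>range cst\<close> of least degree with \<open>p = poly f t\<close>
  in \<open>mx V\<close>. Division by \<open>f\<close> shows that every nonzero polynomial in
  \<open>t\<close> is a power of \<open>p\<close> times a unit. As \<open>t\<close> is congruent to
  some constant \<open>c\<close>, residues of fractions are found by evaluating at
  \<open>c\<close>.\<close>

lemma kk_valuation:
 "EX p:\<kk>. p~=0 & p:mx V & (ALL x:\<kk>. x~=0 --> (EX i::int. unit_at V (x*p powi i))) &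
   (ALL x:\<kk>. x:V --> (EX c:Fqbar. x - c:mx V))"
proof -
 let ?K = "range (cst :: 'a => 'a ac)"
 note K = sfield_range_cst[where ?'a = 'a]
 obtain t where t:"parameter t" "t:V" using ex_parameter_in_place by blast
 have KV:"?K<=V" using place_cst[OF V] by blast
 have polV:"poly g t:V" if "coeffs_in ?K g" for g
  by(rule place_poly[OF V _ t(2)]) (use coeffs_inD[OF that] KV in blast)
 have "EX g. coeffs_in ?K g & g~=0 & poly g t:mx V"
 proof -
  obtain x where x:"x:\<kk>" "x~:V" using kk_not_subset_place by blast
  obtain f g where fg:"coeffs_in ?K f" "coeffs_in ?K g" "poly g t~=0" "x = poly f t/poly g t"
   using kk_fractions[OF t(1) x(1)] by blast
  have x0:"x~=0" using x(2) place_0[OF V] by metis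
  have "poly g t = poly f t*inverse x" using fg(3,4) x0 by(simp add: field_simps)
  moreover have "poly f t*inverse x:mx V" by(rule mx_mult[OF V polV[OF fg(1)] notin_place[OF V x(2)]])
  ultimately show ?thesis using fg(2,3) by(intro exI[of _ g]) auto
 qed
 then obtain f0 where "coeffs_in ?K f0 & f0~=0 & poly f0 t:mx V" by blast
 from ex_has_least_nat[of "%g. coeffs_in ?K g & g~=0 & poly g t:mx V", OF this, of pdeg]
 obtain f where f:"coeffs_in ?K f & f~=0 & poly f t:mx V"
  "!!g. coeffs_in ?K g & g~=0 & poly g t:mx V ==> pdeg f<=pdeg g" by blast
 define p where "p = poly f t"
 have degf:"pdeg f > 0"
 proof (rule ccontr)
  assume "~?thesis"
  then obtain a where a:"f = [:a:]" using degree_eq_zeroE by blast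
  hence "a:?K" "a~=0" "a:mx V" using f(1) by(auto simp: coeffs_in_pCons[OF K])
  thus False using Fqbar_mx[OF V] cst_Fqbar by blast
 qed
 have p0:"p~=0" unfolding p_def using parameter_poly_nonzero[OF t(1)] f(1) by blast
 have pm:"p:mx V" unfolding p_def using f(1) by blast
 have pkk:"p:\<kk>" unfolding p_def
  using poly_in[OF sfield_kk coeffs_in_mono[OF _ cst_kk] parameter_kk[OF t(1)]] f(1) by blast
 have fac:"EX i s. coeffs_in ?K s & poly s t~:mx V & poly g t = p^i*poly s t" if "coeffs_in ?K g" "g~=0" for g
  using that
 proof (induction "pdeg g" arbitrary: g rule: less_induct)
  case less
  obtain s r where sr:"g = f*s+r" "coeffs_in ?K s" "coeffs_in ?K r" "r = 0 | pdeg r < pdeg f"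
   using coeffs_in_division[OF K _ _ less.prems(1), of f] f(1) by blast
  show ?case
  proof (cases "r = 0")
   case False
   \<comment> \<open>By minimality of \<open>f\<close> a nonzero remainder is a unit at
     \<open>V\<close>, and then so is \<open>poly g t\<close>.\<close>
   hence "poly r t~:mx V" using f(2)[of r] sr(3,4) by fastforce
   moreover have "poly g t-poly r t:mx V"
    using mx_mult2[OF V pm polV[OF sr(2)]] sr(1) by(simp add: p_def)
   ultimately have "poly g t~:mx V" using mx_diff[OF V, of "poly g t" "poly g t-poly r t"] by auto
   thus ?thesis using less.prems(1) by(intro exI[of _ 0] exI[of _ g]) simp
  next
   case True
   hence s0:"s~=0" "g = f*s" using sr(1) less.prems(2) by auto
   hence "pdeg s < pdeg g" using f(1) degf by(simp add: degree_mult_eq)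
   from less.hyps[OF this sr(2) s0(1)] obtain i s' where "coeffs_in ?K s'" "poly s' t~:mx V" "poly s t = p^i*poly s' t" by blast
   thus ?thesis using s0(2) by(intro exI[of _ "Suc i"] exI[of _ s']) (simp add: p_def)
  qed
 qed
 have frac:"EX (i::int) s s'. coeffs_in ?K s & coeffs_in ?K s' & poly s t~:mx V & poly s' t~:mx V & x = p powi i*(poly s t/poly s' t)"
  if x:"x:\<kk>" "x~=0" for x
 proof -
  obtain g h where gh:"coeffs_in ?K g" "coeffs_in ?K h" "poly h t~=0" "x = poly g t/poly h t"
   using kk_fractions[OF t(1) x(1)] by blast
  have "g~=0" "h~=0" using gh(3,4) x(2) by auto
  obtain i s where s:"coeffs_in ?K s" "poly s t~:mx V" "poly g t = p^i*poly s t" using fac[OF gh(1) `g ~= 0`] by blast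
  obtain j s' where s':"coeffs_in ?K s'" "poly s' t~:mx V" "poly h t = p^j*poly s' t" using fac[OF gh(2) `h ~= 0`] by blast
  have "x = p powi (int i-int j)*(poly s t/poly s' t)"
   using p0 unfolding gh(4) s(3) s'(3) by(simp add: power_int_diff)
  thus ?thesis using s(1,2) s'(1,2) by blast
 qed
 have pol_unit:"unit_at V (poly s t)" if "coeffs_in ?K s" "poly s t~:mx V" for s
  using polV[OF that(1)] that(2) by(simp add: unit_at_def)
 have val:"EX i::int. unit_at V (x*p powi i)" if x:"x:\<kk>" "x~=0" for x
 proof -
  obtain i :: int and s s' where s:"coeffs_in ?K s" "coeffs_in ?K s'" "poly s t~:mx V" "poly s' t~:mx V" "x = p powi i*(poly s t/poly s' t)"
   using frac[OF x] by blast
  have "x*p powi (- i) = poly s t*inverse (poly s' t)"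
   using p0 unfolding s(5) by(simp add: power_int_minus field_simps)
  moreover have "unit_at V (poly s t*inverse (poly s' t))"
   by(intro unit_at_mult[OF V] unit_at_inverse[OF V] pol_unit s)
  ultimately show ?thesis by metis
 qed
 obtain c where c:"c:Fqbar" "t - c:mx V"
  using root_modulo_mx[OF coeffs_in_mono[OF _ cst_Fqbar] _ t(2)] f(1) by blast
 have cV:"c:V" using c(1) Fqbar_place[OF V] by blast
 have residue:"EX c:Fqbar. x - c:mx V" if x:"x:\<kk>" "x:V" for x
 proof (cases "x:mx V")
  case True
  thus ?thesis using sfield_0[OF sfield_Fqbar] by(intro bexI[of _ 0]) simp_all
 next
  case False
  hence x0:"x~=0" using mx_0[OF V] by metis
  obtain i :: int and s s' where s:"coeffs_in ?K s" "coeffs_in ?K s'" "poly s t~:mx V" "poly s' t~:mx V" "x = p powi i*(poly s t/poly s' t)"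
   using frac[OF x(1) x0] by blast
  have u:"unit_at V (poly s t/poly s' t)"
   unfolding divide_inverse by(intro unit_at_mult[OF V] unit_at_inverse[OF V] pol_unit s)
  have "p powi i = x*inverse (poly s t/poly s' t)" using s(5) u by(simp add: unit_at_iff[OF V])
  moreover have "unit_at V (x*inverse (poly s t/poly s' t))"
   using x(2) False by(intro unit_at_mult[OF V] unit_at_inverse[OF V u]) (simp add: unit_at_def)
  ultimately have up:"unit_at V (p powi i)" by simp
  \<comment> \<open>\<open>x\<close> is a unit here and \<open>p\<close> is not, so \<open>x\<close>
    is a quotient of two unit values of polynomials.\<close>
  have "i = 0"
  proof (rule ccontr)
   assume "i~=0"
   hence n:"nat \<bar>i\<bar> > 0" by simp
   have "unit_at V (p^nat \<bar>i\<bar>)"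
    using up unit_at_inverse[OF V up] p0 by(cases "i >= 0") (auto simp: power_int_def power_inverse)
   thus False using pm unit_at_power_iff[OF V n] by(simp add: unit_at_def)
  qed
  hence xs:"x = poly s t/poly s' t" using s(5) by simp
  have sc:"poly s t-poly s c:mx V" "poly s' t-poly s' c:mx V"
   using mx_poly_cong[OF c(2) t(2) cV] coeffs_inD[OF s(1)] coeffs_inD[OF s(2)] KV by blast+
  have cF:"poly s c:Fqbar" "poly s' c:Fqbar"
   using poly_in[OF sfield_Fqbar coeffs_in_mono[OF _ cst_Fqbar] c(1)] s(1,2) by blast+
  have s'c:"poly s' c~:mx V" using sc(2) s(4) mx_add[OF V sc(2), of "poly s' c"] by auto
  hence "poly s' c~=0" using mx_0[OF V] by metis
  have inv:"inverse (poly s' c):V" "inverse (poly s' t):V" using notin_mx[OF V] s'c s(4) by blast+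
  have "poly s t*poly s' c-poly s c*poly s' t:mx V"
  proof -
   have "poly s t*poly s' c-poly s c*poly s' t = (poly s t-poly s c)*poly s' c-poly s c*(poly s' t-poly s' c)"
    by(simp add: algebra_simps)
   thus ?thesis
    using mx_diff[OF V mx_mult2[OF V sc(1)] mx_mult[OF V _ sc(2)], of "poly s' c" "poly s c"] cF Fqbar_place[OF V] by auto
  qed
  hence "(poly s t*poly s' c-poly s c*poly s' t)*(inverse (poly s' c)*inverse (poly s' t)):mx V"
   by(rule mx_mult2[OF V _ place_mult[OF V inv]])
  moreover have "(poly s t*poly s' c-poly s c*poly s' t)*(inverse (poly s' c)*inverse (poly s' t)) = x-poly s c/poly s' c"
   by(metis (no_types, lifting) V `poly s' c ~= 0` diff_frac_eq divide_divide_eq_right divide_inverse inverse_divide mx_0 s(4) xs)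
  ultimately show ?thesis using sfield_divide[OF sfield_Fqbar cF] by(intro bexI[of _ "poly s c/poly s' c"]) simp_all
 qed
 show ?thesis using pkk p0 pm val residue by blast
qed

end

definition unif :: "'a::{field,finite} ac set => 'a ac" where
 "unif V = (SOME p. p:\<kk> & p~=0 & p:mx V & (ALL x:\<kk>. x~=0 --> (EX i::int. unit_at V (x*p powi i))))"

text \<open>\<open>x^n\<close> is a unit times the \<open>i\<close>-th power of the uniformizer of
  \<open>\<kk>\<close>, so the value of \<open>x\<close> is \<open>i/n\<close>; algebraicity
  supplies such \<open>n\<close> and \<open>i\<close>.\<close>

definition vord_rel :: "'a::{field,finite} ac set => 'a ac => real => bool" where
 "vord_rel V x r <-> (EX (n::nat) (i::int). n > 0 & r = of_int i / of_nat n & unit_at V (x^n*unif V powi (- i)))"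

text \<open>The valuation with value group \<open>\<int>\<close> on \<open>\<kk>\<close>; its value at \<open>0\<close> is junk.\<close>

definition vord :: "'a::{field,finite} ac set => 'a ac => real" where
 "vord V x = (THE r. vord_rel V x r)"

text \<open>\<open>Fqbar\<close> lies in \<open>V\<close> and maps bijectively to its residue field,
  so residues are taken to be actual constants instead of cosets.\<close>

definition res :: "'a::{field,finite} ac set => 'a ac => 'a ac" where
 "res V x = (THE c. c:Fqbar & x - c:mx V)"

context
 fixes V :: "'a::{field,finite} ac set"
 assumes V:"place V"
begin

lemma unif_kk:"unif V:\<kk>" and unif_neq_0:"unif V~=0" and unif_mx:"unif V:mx V"
 and unif_unit:"!!x. x:\<kk> ==> x~=0 ==> EX i::int. unit_at V (x*unif V powi i)"
proof -
 have "EX p. p:\<kk> & p~=0 & p:mx V & (ALL x:\<kk>. x~=0 --> (EX i::int. unit_at V (x*p powi i)))"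
  using kk_valuation[OF V] by blast
 from someI_ex[OF this, folded unif_def]
 show "unif V:\<kk>" "unif V~=0" "unif V:mx V" "!!x. x:\<kk> ==> x~=0 ==> EX i::int. unit_at V (x*unif V powi i)"
  by blast+
qed

lemma unit_unif_powi:"unit_at V (unif V powi i) <-> i = 0"
proof
 assume up:"unit_at V (unif V powi i)"
 show "i = 0"
 proof (rule ccontr)
  assume "i~=0"
  hence n:"nat \<bar>i\<bar> > 0" by simp
  have "unit_at V (unif V^nat \<bar>i\<bar>)"
   using up unit_at_inverse[OF V up] by(cases "i >= 0") (auto simp: power_int_def power_inverse)
  thus False using unif_mx unit_at_power_iff[OF V n] by(simp add: unit_at_def)
 qed
qed (simp add: unit_at_1[OF V])

lemma vord_rel_ex:
 assumes x:"x~=0"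
 shows "EX r. vord_rel V x r"
proof -
 obtain p where p:"coeffs_in \<kk> p" "p~=0" "poly p x = 0" using algebraic_over_kk[of x] by blast
 obtain i j where ij:"i < j" "coeff p i~=0" "coeff p j~=0" "unit_at V (coeff p j / coeff p i*x^(j-i))"
  using dominant_terms[OF V p(2,3) x] by blast
 let ?a = "coeff p j / coeff p i"
 have a:"?a:\<kk>" "?a~=0"
  using ij(2,3) sfield_divide[OF sfield_kk coeffs_inD[OF p(1)] coeffs_inD[OF p(1)]] by simp_all
 obtain e :: int where e:"unit_at V (?a*unif V powi e)" using unif_unit[OF a] by blast
 have "unit_at V ((?a*x^(j-i))*inverse (?a*unif V powi e))"
  by(intro unit_at_mult[OF V] unit_at_inverse[OF V] ij(4) e)
 moreover have "(?a*x^(j-i))*inverse (?a*unif V powi e) = x^(j-i)*unif V powi (- e)"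
  using a(2) by(simp add: power_int_minus) (simp add: divide_inverse)
 ultimately have "vord_rel V x (of_int e / of_nat (j-i))" unfolding vord_rel_def using ij(1) by(intro exI[of _ "j-i"] exI[of _ e]) simp
 thus ?thesis by blast
qed

lemma powi_power:"(x powi i)^n = (x :: 'b::field) powi (i*int n)"
 by(simp add: power_int_mult)

lemma vord_rel_unique:
 assumes "vord_rel V x r" "vord_rel V x s"
 shows "r = s"
proof -
 obtain n i where n:"n > 0" "r = of_int i / of_nat n" "unit_at V (x^n*unif V powi (- i))"
  using assms(1) unfolding vord_rel_def by blast
 obtain m j where m:"m > 0" "s = of_int j / of_nat m" "unit_at V (x^m*unif V powi (- j))"
  using assms(2) unfolding vord_rel_def by blast
 have x:"x~=0" using n(1,3) by(auto simp: unit_at_def mx_def)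
 have "unit_at V ((x^n*unif V powi (- i))^m*inverse ((x^m*unif V powi (- j))^n))"
  by(intro unit_at_mult[OF V] unit_at_inverse[OF V] unit_at_power[OF V] n m)
 moreover have "(x^n*unif V powi (- i))^m*inverse ((x^m*unif V powi (- j))^n) = unif V powi (j*int n-i*int m)"
 proof -
  have "(x^n*unif V powi (- i))^m = x^(n*m)*unif V powi (- i*int m)"
   by(simp only: power_mult_distrib power_mult powi_power)
  moreover have "(x^m*unif V powi (- j))^n = x^(n*m)*unif V powi (- j*int n)"
   by(simp only: power_mult_distrib power_mult[symmetric] powi_power mult.commute[of m n])
  moreover have "unif V powi (- i*int m)*inverse (unif V powi (- j*int n)) = unif V powi (j*int n-i*int m)"
   using unif_neq_0 by(simp add: power_int_minus[symmetric] power_int_add[symmetric])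
  ultimately show ?thesis using x by(simp add: field_simps)
 qed
 ultimately have "j*int n = i*int m" using unit_unif_powi by simp
 hence "real_of_int j*real n = real_of_int i*real m" by(metis of_int_mult of_int_of_nat_eq)
 thus ?thesis unfolding n(2) m(2) using n(1) m(1) by(simp add: field_simps)
qed

lemma vord_eqI:"vord_rel V x r ==> vord V x = r"
 unfolding vord_def using vord_rel_unique by blast

lemma vord_rel_vord:"x~=0 ==> vord_rel V x (vord V x)"
 using vord_rel_ex vord_eqI by metis

lemma vord_mult:
 assumes "x~=0" "y~=0"
 shows "vord V (x*y) = vord V x+vord V y"
proof (rule vord_eqI)
 obtain n i where n:"n > 0" "vord V x = of_int i / of_nat n" "unit_at V (x^n*unif V powi (- i))"
  using vord_rel_vord[OF assms(1)] unfolding vord_rel_def by blast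
 obtain m j where m:"m > 0" "vord V y = of_int j / of_nat m" "unit_at V (y^m*unif V powi (- j))"
  using vord_rel_vord[OF assms(2)] unfolding vord_rel_def by blast
 have "unit_at V ((x^n*unif V powi (- i))^m*(y^m*unif V powi (- j))^n)"
  by(intro unit_at_mult[OF V] unit_at_power[OF V] n m)
 moreover have "(x^n*unif V powi (- i))^m*(y^m*unif V powi (- j))^n
   = (x*y)^(n*m)*unif V powi (- (i*int m+j*int n))"
 proof -
  have "(x^n*unif V powi (- i))^m = x^(n*m)*unif V powi (- i*int m)"
   by(simp only: power_mult_distrib power_mult powi_power)
  moreover have "(y^m*unif V powi (- j))^n = y^(n*m)*unif V powi (- j*int n)"
   by(simp only: power_mult_distrib power_mult[symmetric] powi_power mult.commute[of m n])
  moreover have "unif V powi (- i*int m)*unif V powi (- j*int n) = unif V powi (- (i*int m+j*int n))"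
   using unif_neq_0 by(simp add: power_int_add[symmetric])
  ultimately show ?thesis by(simp only: power_mult_distrib mult.assoc mult.left_commute)
 qed
 moreover have "vord V x+vord V y = of_int (i*int m+j*int n) / of_nat (n*m)"
  unfolding n(2) m(2) using n(1) m(1) by(simp add: add_frac_eq)
 ultimately show "vord_rel V (x*y) (vord V x+vord V y)"
  unfolding vord_rel_def using n(1) m(1) by(intro exI[of _ "n*m"] exI[of _ "i*int m+j*int n"]) simp
qed

lemma vord_unit:"unit_at V x ==> vord V x = 0"
 by(rule vord_eqI, unfold vord_rel_def, rule exI[of _ "1::nat"], rule exI[of _ "0::int"]) simp

lemma vord_1:"vord V 1 = 0"
 by(rule vord_unit[OF unit_at_1[OF V]])

lemma vord_inverse:"x~=0 ==> vord V (inverse x) =-vord V x"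
 using vord_mult[of x "inverse x"] vord_1 by simp

lemma vord_divide:"x~=0 ==> y~=0 ==> vord V (x/y) = vord V x-vord V y"
 by(simp add: divide_inverse vord_mult vord_inverse)

lemma vord_power:"x~=0 ==> vord V (x^n) = real n*vord V x"
 by(induction n) (simp_all add: vord_1 vord_mult algebra_simps)

lemma vord_prod:"finite I ==> (!!i. i:I ==> f i~=0) ==> vord V (prod f I) = (SUM i:I. vord V (f i))"
 by(induction I rule: finite_induct) (simp_all add: vord_1 vord_mult)

lemma vord_minus:"x~=0 ==> vord V (- x) = vord V x"
proof -
 assume "x~=0"
 have "unit_at V (-1)" using place_1[OF V] place_uminus[OF V, of 1] by(simp add: unit_at_iff[OF V])
 thus ?thesis using vord_mult[of "-1" x] vord_unit `x ~= 0` by simp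
qed

lemma vord_unif:"vord V (unif V) = 1"
 by(rule vord_eqI, unfold vord_rel_def, rule exI[of _ "1::nat"], rule exI[of _ "1::int"])
  (simp add: unif_neq_0 unit_at_1[OF V] power_int_minus)

lemma vord_kk:"x:\<kk> ==> x~=0 ==> EX i::int. vord V x = of_int i"
proof -
 assume "x:\<kk>" "x~=0"
 then obtain i :: int where i:"unit_at V (x*unif V powi i)" using unif_unit by blast
 have "vord V x = of_int (- i) / of_nat 1"
  by(rule vord_eqI, unfold vord_rel_def, rule exI[of _ "1::nat"], rule exI[of _ "- i"]) (use i in simp)
 thus ?thesis by(metis div_by_1 of_nat_1)
qed

lemma vord_zero_iff:"x~=0 ==> vord V x = 0 <-> unit_at V x"
proof
 assume x:"x~=0" and v:"vord V x = 0"
 obtain n i where n:"n > 0" "vord V x = of_int i / of_nat n" "unit_at V (x^n*unif V powi (- i))"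
  using vord_rel_vord[OF x] unfolding vord_rel_def by blast
 hence "i = 0" using v by simp
 thus "unit_at V x" using n unit_at_power_iff[OF V n(1)] by simp
qed (rule vord_unit)

lemma vord_pos:"x~=0 ==> x:mx V ==> vord V x > 0"
proof (rule ccontr)
 assume x:"x~=0" "x:mx V" "~vord V x > 0"
 obtain n i where n:"n > 0" "vord V x = of_int i / of_nat n" "unit_at V (x^n*unif V powi (- i))"
  using vord_rel_vord[OF x(1)] unfolding vord_rel_def by blast
 have "i<=0" using x(3) n(1,2) by(simp add: zero_less_divide_iff not_less)
 hence "unif V powi (- i) = unif V^nat (- i)" by(simp add: power_int_def)
 hence "x^n*unif V powi (- i):mx V"
  using mx_mult2[OF V mx_power[OF V x(2) n(1)] place_power[OF V mx_place[OF V unif_mx]]] by simp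
 thus False using n(3) by(simp add: unit_at_def)
qed

lemma vord_nonneg_iff:"x~=0 ==> vord V x >= 0 <-> x:V"
proof
 assume x:"x~=0" and v:"vord V x >= 0"
 show "x:V"
 proof (rule ccontr)
  assume "x~:V"
  hence "vord V (inverse x) > 0" using vord_pos[OF _ notin_place[OF V]] x by simp
  thus False using v vord_inverse[OF x] by simp
 qed
next
 assume x:"x~=0" "x:V"
 thus "vord V x >= 0"
  using vord_pos[OF x(1)] vord_unit[of x] by(cases "x:mx V") (auto simp: unit_at_def less_imp_le)
qed

lemma vord_pos_iff:"x~=0 ==> vord V x > 0 <-> x:mx V"
 using vord_pos vord_nonneg_iff[of x] vord_zero_iff[of x] unfolding unit_at_def by(metis less_eq_real_def less_irrefl)

lemma vord_add:
 assumes "x~=0" "y~=0" "x+y~=0" "a<=vord V x" "a<=vord V y"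
 shows "a<=vord V (x+y)"
proof -
 have key:"vord V x<=vord V (x+y)" if h:"x~=0" "y~=0" "x+y~=0" "vord V x<=vord V y" for x y
 proof -
  have "y/x:V" using vord_nonneg_iff[of "y/x"] vord_divide[OF h(2,1)] h by simp
  hence "1+y/x:V" using place_add[OF V place_1[OF V]] by blast
  moreover have "1+y/x = (x+y)/x" using h(1) by(simp add: field_simps)
  ultimately have "vord V ((x+y)/x) >= 0" using vord_nonneg_iff[of "(x+y)/x"] h(1,3) by simp
  thus ?thesis using vord_divide[OF h(3,1)] by simp
 qed
 show ?thesis using key[of x y] key[of y x] assms by(cases "vord V x<=vord V y") (auto simp: add.commute)
qed

lemma vord_add_eq:
 assumes "x~=0" "y~=0" "vord V x < vord V y"
 shows "x+y~=0" "vord V (x+y) = vord V x"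
proof -
 have "y/x:mx V" using vord_pos_iff[of "y/x"] vord_divide[OF assms(2,1)] assms by simp
 moreover have "(1+y/x)-y/x = 1" by simp
 ultimately have "1+y/x~:mx V" using mx_diff[OF V, of "1+y/x" "y/x"] mx_1[OF V] by metis
 moreover have "1+y/x:V" using `y / x:mx V` by(intro place_add[OF V] place_1[OF V] mx_place[OF V])
 ultimately have u:"unit_at V (1+y/x)" by(simp add: unit_at_def)
 have e:"x+y = x*(1+y/x)" using assms(1) by(simp add: field_simps)
 have nz:"1+y/x~=0" using u by(simp add: unit_at_iff[OF V])
 show "x+y~=0" unfolding e using assms(1) nz by simp
 show "vord V (x+y) = vord V x" unfolding e using vord_mult[OF assms(1) nz] vord_unit[OF u] by simp
qed

lemma vord_sum:
 assumes "finite I" "!!i. i:I ==> f i = 0 | a<=vord V (f i)" "sum f I~=0"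
 shows "a<=vord V (sum f I)"
 using assms
proof (induction I rule: finite_induct)
 case (insert i I)
 show ?case
 proof (cases "f i = 0 | sum f I = 0")
  case True
  thus ?thesis using insert.hyps insert.IH insert.prems(1)[of i] insert.prems(1) insert.prems(2)
   by(cases "f i = 0") auto
 next
  case False
  thus ?thesis using insert vord_add[of "f i" "sum f I" a] by auto
 qed
qed simp

text \<open>Dividing the equation of \<open>x\<close> by its dominant coefficient makes all
  coefficients integral and one of them \<open>1\<close>. Replacing them by their residues gives a
  nonzero polynomial over \<open>Fqbar\<close> with \<open>x\<close> as a root modulo
  \<open>mx V\<close>.\<close>

lemma ex_residue:
 assumes x:"x:V"
 shows "EX c:Fqbar. x - c:mx V"
proof (cases "x = 0")
 case True
 thus ?thesis using sfield_0[OF sfield_Fqbar] mx_0[OF V] by(intro bexI[of _ 0]) simp_all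
next
 case False
 obtain p where p:"coeffs_in \<kk> p" "p~=0" "poly p x = 0" using algebraic_over_kk[of x] by blast
 let ?Z = "(%j. coeff p j)`{j. j<=pdeg p & coeff p j~=0}"
 have "finite ?Z" "?Z~={}" "0~:?Z" using p(2) by auto
 from dominant_element[OF V this] obtain i where i:"coeff p i~=0" "!!j. coeff p j~=0 ==> coeff p j / coeff p i:V"
  using le_degree by auto
 define b where "b j = coeff p j / coeff p i" for j
 have bV:"b j:V" for j using i place_0[OF V] by(cases "coeff p j = 0") (simp_all add: b_def)
 have bk:"b j:\<kk>" for j unfolding b_def by(intro sfield_divide[OF sfield_kk] coeffs_inD[OF p(1)])
 have "EX c:Fqbar. b j - c:mx V" for j using kk_valuation[OF V] bV[of j] bk[of j] by blast
 then obtain c where c:"!!j. c j:Fqbar" "!!j. b j - c j:mx V" by metis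
 define h where "h = (SUM j<=pdeg p. pmon (c j) j)"
 have hF:"coeffs_in Fqbar h" unfolding h_def
  by(intro coeffs_in_sum[OF sfield_Fqbar] coeffs_in_monom[OF sfield_Fqbar] c(1))
 have "coeff h i = c i" using le_degree[OF i(1)] by(simp add: h_def coeff_sum)
 moreover have "c i~=0" using c(2)[of i] i(1) mx_1[OF V] by(auto simp: b_def)
 ultimately have h0:"h~=0" by auto
 have "(SUM j<=pdeg p. b j*x^j) = 0"
 proof -
  have "(SUM j<=pdeg p. b j*x^j) = poly p x / coeff p i"
   by(simp add: poly_altdef b_def sum_divide_distrib)
  thus ?thesis using p(3) by simp
 qed
 hence "poly h x =-(SUM j<=pdeg p. (b j - c j)*x^j)"
  by(simp add: h_def poly_sum poly_monom left_diff_distrib sum_subtractf)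
 moreover have "(SUM j<=pdeg p. (b j - c j)*x^j):mx V"
  by(intro mx_sum[OF V] mx_mult2[OF V] c(2) place_power[OF V x])
 ultimately have "poly h x:mx V" using mx_uminus[OF V] by simp
 thus ?thesis by(rule root_modulo_mx[OF V hF h0 x])
qed

lemma residue_unique:"c:Fqbar ==> c':Fqbar ==> x - c:mx V ==> x - c':mx V ==> c = c'"
 by(smt (verit, best) Fqbar_mx V cancel_ab_semigroup_add_class.diff_right_commute diff_eq_diff_eq mx_diff sfield_Fqbar sfield_diff)

lemma res_eqI:"c:Fqbar ==> x - c:mx V ==> res V x = c"
 unfolding res_def using residue_unique by blast

lemma res_Fqbar:"x:V ==> res V x:Fqbar" and res_cong:"x:V ==> x-res V x:mx V"
 using ex_residue[of x] res_eqI by auto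

lemma res_const:"c:Fqbar ==> res V c = c"
 by(rule res_eqI) (simp_all add: mx_0[OF V])

lemma res_place:"x:V ==> res V x:V"
 using res_Fqbar Fqbar_place[OF V] by blast

lemma res_add:"x:V ==> y:V ==> res V (x+y) = res V x+res V y"
 by(smt (verit, del_insts) ex_residue V add_diff_eq diff_add_eq diff_diff_eq mx_add res_eqI sfield_Fqbar sfield_add)

lemma res_mult:"x:V ==> y:V ==> res V (x*y) = res V x*res V y"
 by(metis (no_types, opaque_lifting) V ex_residue mx_diff_cong res_eqI res_place sfield_Fqbar sfield_mult)

lemma res_0:"res V 0 = 0" and res_1:"res V 1 = 1"
 by(simp_all add: res_const sfield_0[OF sfield_Fqbar] sfield_1[OF sfield_Fqbar])

lemma res_eq_0_iff:"x:V ==> res V x = 0 <-> x:mx V"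
 using res_cong[of x] res_eqI[of 0 x] sfield_0[OF sfield_Fqbar] by auto

lemma res_uminus:"x:V ==> res V (- x) =-res V x"
 using res_add[of x "- x"] place_uminus[OF V, of x] by(simp add: res_0 add_eq_0_iff)

lemma res_diff:"x:V ==> y:V ==> res V (x-y) = res V x-res V y"
 using res_add[of x "- y"] place_uminus[OF V, of y] by(simp add: res_uminus)

lemma res_eq_iff:"x:V ==> y:V ==> res V x = res V y <-> x-y:mx V"
 using res_eq_0_iff[of "x-y"] place_diff[OF V, of x y] by(simp add: res_diff)

lemma res_power:"x:V ==> res V (x^n) = res V x^n"
 by(induction n) (simp_all add: res_1 res_mult place_power[OF V])

lemma res_sum:"(!!i. i:I ==> f i:V) ==> res V (sum f I) = (SUM i:I. res V (f i))"
 by(induction I rule: infinite_finite_induct) (simp_all add: res_0 res_add place_sum[OF V])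

lemma res_inverse:"unit_at V x ==> res V (inverse x) = inverse (res V x)"
 by(metis V inverse_unique res_1 res_mult right_inverse unit_at_iff)

end

lemma place_vimage:
 assumes V:"place V" and s:"sg:auts \<kk>"
 shows "place (sg -` V)" "mx (sg -` V) = sg -` mx V"
proof -
 note e = auts_endo[OF s]
 have "sg -` V~=UNIV"
  by(metis UNIV_eq_I V auts_inv_simps(1) iso_tuple_UNIV_I place_neq s vimage_eq)
 moreover have "sg (cst a):V" for a
  using auts_fix[OF s subsetD[OF cst_kk]] place_cst[OF V] by simp
 ultimately show "place (sg -` V)"
  unfolding place_def primes_of_iff
  using place_1[OF V] place_diff[OF V] place_mult[OF V] place_total[OF V]
  by(auto simp: endo_1[OF e] endo_diff[OF e] endo_mult[OF e] endo_inverse[OF e])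
 show "mx (sg -` V) = sg -` mx V"
  by(auto simp: mx_def endo_inverse[OF e] endo_eq_0_iff[OF e])
qed

lemma res_vimage:
 assumes V:"place V" and s:"sg:auts \<kk>" and x:"sg x:V"
 shows "res V (sg x) = sg (res (sg -` V) x)"
 by(smt (verit, del_insts) V auts_endo endo_Fqbar endo_diff place_vimage(1,2) res_Fqbar res_cong res_eqI s vimage_eq x)

lemma vord_vimage:
 assumes V:"place V" and s:"sg:auts \<kk>" "sg -` V = V" and x:"x~=0"
 shows "vord V (sg x) = vord V x"
proof -
 note e = auts_endo[OF s(1)]
 have u:"unit_at V (sg y) <-> unit_at V y" for y
  using s(2) unfolding unit_at_iff[OF V] endo_inverse[OF e, symmetric] endo_eq_0_iff[OF e] by blast
 obtain n i where n:"n > 0" "vord V x = of_int i / of_nat n" "unit_at V (x^n*unif V powi (- i))"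
  using vord_rel_vord[OF V x] unfolding vord_rel_def by blast
 have "sg (unif V powi (- i)) = unif V powi (- i)"
  using auts_fix[OF s(1) unif_kk[OF V]] by(simp add: power_int_def endo_power[OF e] endo_inverse[OF e])
 hence "sg (x^n*unif V powi (- i)) = sg x^n*unif V powi (- i)"
  by(simp add: endo_mult[OF e] endo_power[OF e])
 hence "unit_at V (sg x^n*unif V powi (- i))" using u n(3) by metis
 hence "vord_rel V (sg x) (vord V x)" unfolding vord_rel_def using n(1,2) by blast
 thus ?thesis by(rule vord_eqI[OF V])
qed

section \<open>Decomposition and inertia groups\<close>

definition dgrp :: "'a::{field,finite} ac set => 'a ac set => ('a ac => 'a ac) set" where
 "dgrp V L = {sg:auts L. sg -` V = V}"

text \<open>The residue field of \<open>V\<close> is \<open>Fqbar\<close>, so acting trivially on it means fixing the constants.\<close>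

definition igrp :: "'a::{field,finite} ac set => 'a ac set => ('a ac => 'a ac) set" where
 "igrp V L = {sg:dgrp V L. ALL c:Fqbar. sg c = c}"

lemma dgrpD:"sg:dgrp V L ==> sg:auts L" "sg:dgrp V L ==> sg x:V <-> x:V"
 by(auto simp: dgrp_def)

lemma igrpD:"sg:igrp V L ==> sg:dgrp V L" "sg:igrp V L ==> c:Fqbar ==> sg c = c"
 by(auto simp: igrp_def)

lemma igrp_auts:"sg:igrp V L ==> sg:auts L"
 using igrpD(1) dgrpD(1) by blast

lemma dgrp_mono:"L<=L' ==> dgrp V L'<=dgrp V L"
 using auts_mono unfolding dgrp_def by blast

lemma igrp_mono:"L<=L' ==> igrp V L'<=igrp V L"
 using dgrp_mono unfolding igrp_def by blast

lemma dgrpI:"sg:dgrp V L ==> (!!x. x:L' ==> sg x = x) ==> sg:dgrp V L'"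
 by(auto simp: dgrp_def auts_def)

lemma igrpI:"sg:igrp V L ==> (!!x. x:L' ==> sg x = x) ==> sg:igrp V L'"
 using dgrpI[of sg V L L'] by(simp add: igrp_def)

lemma autgrp_dgrp:"ifield L ==> autgrp (dgrp V L)"
proof -
 assume L:"ifield L"
 note A = autgrpD[OF autgrp_auts[OF L]]
 have inv:"ainv sg -` V = V" if s:"sg:dgrp V L" for sg
 proof -
  have "sg:auts \<kk>" using s A(1) by(auto simp: dgrp_def)
  from auts_inv_simps(1)[OF this] have "ainv sg x:V <-> x:V" for x
   using dgrpD(2)[OF s, of "ainv sg x"] by simp
  thus ?thesis by blast
 qed
 show ?thesis
  unfolding autgrp_def
 proof (intro conjI ballI)
  show "dgrp V L<=auts \<kk>" using A(1) unfolding dgrp_def by blast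
  show "(%x. x):dgrp V L" using A(2) by(simp add: dgrp_def)
  show "(%x. sg (ta x)):dgrp V L" if "sg:dgrp V L" "ta:dgrp V L" for sg ta
   using A(3)[OF dgrpD(1)[OF that(1)] dgrpD(1)[OF that(2)]] dgrpD(2)[OF that(1)] dgrpD(2)[OF that(2)]
   by(simp add: dgrp_def vimage_def)
  show "ainv sg:dgrp V L" if "sg:dgrp V L" for sg
   using A(4)[OF dgrpD(1)[OF that]] inv[OF that] by(simp add: dgrp_def)
 qed
qed

lemma autgrp_igrp:"ifield L ==> autgrp (igrp V L)"
proof -
 assume L:"ifield L"
 note A = autgrpD[OF autgrp_dgrp[OF L, of V]]
 have fixc:"ainv sg c = c" if s:"sg:igrp V L" "c:Fqbar" for sg c
 proof -
  have "sg:auts \<kk>" using A(1) igrpD(1)[OF s(1)] by blast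
  from auts_inv_simps(2)[OF this, of c] show ?thesis using igrpD(2)[OF s] by simp
 qed
 show ?thesis
  unfolding autgrp_def
  by(smt (verit, ccfv_threshold) A(1,2,3,4) fixc igrp_def mem_Collect_eq subset_iff)
qed

lemma dgrp_mx:"ifield L ==> place V ==> sg:dgrp V L ==> sg x:mx V <-> x:mx V"
 using place_vimage(2)[of V sg] auts_kk[of L sg] unfolding dgrp_def by auto

lemma dgrp_res:"ifield L ==> place V ==> sg:dgrp V L ==> x:V ==> res V (sg x) = sg (res V x)"
 using res_vimage[of V sg x] auts_kk[of L sg] unfolding dgrp_def by auto

lemma dgrp_vord:"ifield L ==> place V ==> sg:dgrp V L ==> x~=0 ==> vord V (sg x) = vord V x"
 using vord_vimage[of V sg x] auts_kk[of L sg] unfolding dgrp_def by auto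

text \<open>\<open>W\<^sup>2 / (1 - W + W\<^sup>2)\<close> with \<open>W = w\<^bsup>q^r-1\<^esup>\<close> is integral at all places in question and has residue \<open>0\<close> or
  \<open>1\<close>, according to whether \<open>w\<close> is in the maximal ideal or not.\<close>

definition splitter :: "nat => 'a::{field,finite} ac => 'a ac" where
 "splitter r w = (w^(CARD('a)^r-1))\<^sup>2/(1-w^(CARD('a)^r-1)+(w^(CARD('a)^r-1))\<^sup>2)"

lemma splitter:
 fixes w :: "'a::{field,finite} ac"
 assumes V:"place V" and r:"r >= 1" "w:V ==> res V w:Fq r"
 shows "w:mx V ==> splitter r w:mx V" "w~:mx V ==> splitter r w-1:mx V"
proof -
 define j where "j = CARD('a)^r-1"
 have q:"CARD('a)^r > 1" using card_field_ge_2[where ?'a = 'a] r(1) by(intro one_less_power) simp_all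
 hence j:"j > 0" unfolding j_def by simp
 define W where "W = w^j"
 define d where "d = 1-W+W\<^sup>2"
 have g:"splitter r w = W\<^sup>2/d" unfolding splitter_def d_def W_def j_def ..
 show "splitter r w:mx V" if w:"w:mx V"
 proof -
  have W:"W:mx V" unfolding W_def by(rule mx_power[OF V w j])
  have W2:"W\<^sup>2:mx V" by(rule mx_power[OF V W]) simp
  have "W-W\<^sup>2:mx V" by(rule mx_diff[OF V W W2])
  hence "d~:mx V" using mx_add[OF V, of d "W-W\<^sup>2"] mx_1[OF V] by(auto simp: d_def)
  hence "inverse d:V" using notin_mx[OF V] by blast
  thus ?thesis unfolding g divide_inverse by(rule mx_mult2[OF V W2])
 qed
 show "splitter r w-1:mx V" if w:"w~:mx V"
 proof (cases "w:V")
  case True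
  have "res V w^(CARD('a)^r) = res V w" using r(2)[OF True] by(simp add: Fq_iff)
  moreover have "res V w^(CARD('a)^r) = res V w^j*res V w"
   unfolding j_def using power_minus_mult[of "CARD('a)^r" "res V w"] q by simp
  moreover have "res V w~=0" using w res_eq_0_iff[OF V True] by blast
  ultimately have "res V w^j = 1" by simp
  hence "res V W = res V 1" unfolding W_def by(simp add: res_power[OF V True] res_1[OF V])
  moreover have WV:"W:V" unfolding W_def by(rule place_power[OF V True])
  ultimately have W1:"W-1:mx V" using res_eq_iff[OF V WV place_1[OF V]] by simp
  have "d-1 = W*(W-1)" by(simp add: d_def power2_eq_square algebra_simps)
  hence "d-1:mx V" using mx_mult[OF V WV W1] by simp
  hence "d~:mx V" using mx_diff[OF V, of d "d-1"] mx_1[OF V] by auto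
  hence d:"d~=0" "inverse d:V" using notin_mx[OF V] by blast+
  have "W\<^sup>2/d-1 = (W-1)*inverse d"
  proof -
   have "W\<^sup>2-d = W-1" by(simp add: d_def)
   thus ?thesis using d(1) by(simp add: field_simps)
  qed
  thus ?thesis unfolding g using mx_mult2[OF V W1 d(2)] by simp
 next
  case False
  hence w0:"w~=0" using place_0[OF V] by metis
  \<comment> \<open>At a pole of \<open>w\<close> the expression is \<open>1/(1-u+u^2)\<close> with
    \<open>u\<close> in \<open>mx V\<close>.\<close>
  define u where "u = inverse W"
  have "u:mx V" unfolding u_def W_def power_inverse[symmetric] by(rule mx_power[OF V notin_place[OF V False] j])
  hence u:"u\<^sup>2-u:mx V" by(intro mx_diff[OF V] mx_power[OF V]) simp_all
  have W0:"W~=0" unfolding W_def using w0 by simp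
  have e:"d = W\<^sup>2*(1+(u\<^sup>2-u))" unfolding d_def u_def using W0 by(simp add: power2_eq_square field_simps)
  have "1+(u\<^sup>2-u)~:mx V" using mx_diff[OF V _ u, of "1+(u\<^sup>2-u)"] mx_1[OF V] by auto
  hence nz:"1+(u\<^sup>2-u)~=0" "inverse (1+(u\<^sup>2-u)):V" using notin_mx[OF V] by blast+
  have "W\<^sup>2/d-1 =-(u\<^sup>2-u)*inverse (1+(u\<^sup>2-u))"
  proof -
   have "W\<^sup>2/d = inverse (1+(u\<^sup>2-u))" unfolding e using W0 by(simp add: divide_inverse)
   moreover have "inverse (1+(u\<^sup>2-u))*(1+(u\<^sup>2-u)) = 1" using nz(1) by simp
   ultimately show ?thesis by(simp add: algebra_simps)
  qed
  thus ?thesis unfolding g using mx_mult2[OF V mx_uminus[OF V u] nz(2)] by simp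
 qed
qed

lemma splitter_in:"sfield F ==> w:F ==> splitter r w:F"
 unfolding splitter_def by(intro sfield_divide sfield_add sfield_diff sfield_power sfield_1)

text \<open>The conjugates of \<open>w\<close> are finite in number, so one finite field contains
  the residues of \<open>w\<close> at all conjugates of \<open>V\<close>; this supplies the exponent
  for \<open>splitter\<close>.\<close>

lemma conjugate_residues:
 assumes V:"place V"
 shows "EX r>=1. ALL ta:auts \<kk>. w:ta -` V --> res (ta -` V) w:Fq r"
proof -
 let ?S = "res V`({ta w | ta. ta:auts \<kk>} Int V)"
 have "finite ?S" using finite_auts_orbit by(intro finite_imageI finite_Int) blast
 moreover have "?S<=Fqbar" using res_Fqbar[OF V] by blast
 ultimately obtain r where r:"r >= 1" "?S<=Fq r" using Fqbar_finite_subset by blast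
 have "res (ta -` V) w:Fq r" if t:"ta:auts \<kk>" "ta w:V" for ta
  by(smt (verit, ccfv_threshold) Int_iff assms auts_endo auts_inv auts_inv_simps(2) endo_Fq ifield_kk_self image_eqI mem_Collect_eq r(2) res_vimage subsetD that(1,2))
 thus ?thesis using r(1) by auto
qed

lemma mx_prod_1:
 assumes V:"place V" and "finite I" "!!i. i:I ==> f i-1:mx V"
 shows "prod f I-1:mx V"
 using assms(2,3)
proof (induction I rule: finite_induct)
 case (insert i I)
 have fi:"f i-1:mx V" using insert.prems by simp
 have "f i:V" using place_add[OF V mx_place[OF V fi] place_1[OF V]] by simp
 moreover have "prod f I-1:mx V" using insert by simp
 ultimately have "f i*prod f I-1*1:mx V" using mx_diff_cong[OF V fi _ _ place_1[OF V]] by blast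
 thus ?case using insert.hyps by simp
qed (simp add: mx_0[OF V])

lemma mx_prod:
 assumes V:"place V" and "finite I" "!!i. i:I ==> f i:V" "i:I" "f i:mx V"
 shows "prod f I:mx V"
proof -
 have "prod f (I-{i}):V" by(rule place_prod[OF V]) (use assms(3) in blast)
 thus ?thesis unfolding prod.remove[OF assms(2,4)] by(rule mx_mult2[OF V assms(5)])
qed

lemma near_1:"place V ==> x-1:mx V ==> x:V & x~:mx V"
 using mx_place[of V "x-1"] place_add[of V "x-1" 1] place_1[of V] mx_diff[of V x "x-1"] mx_1[of V] by auto

text \<open>All roots of the minimal polynomial of \<open>a\<close> are conjugates of
  \<open>a\<close>, hence equal to it. So it is a constant times a power of \<open>X-a\<close>, and
  its value at \<open>0\<close> yields a power of \<open>a\<close>. The exponent accounts for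
  inseparability.\<close>

lemma fixed_power:
 assumes L:"ifield L" and a:"!!sg. sg:auts L ==> sg a = a"
 shows "EX n>0. a^n:L"
proof -
 note l = ifield_sfield[OF L]
 obtain f where fm:"min_poly L a f" using ex_min_poly[OF l algebraic_over_ifield[OF L, of a]] by blast
 note f = min_polyD[OF fm]
 obtain A where A:"f = psmul (plc f) (PROD a:#A. [:- a, 1:])"
  "size A = pdeg f" "set_mset A = {a. poly f a = 0}" using poly_splits[OF f(2)] .
 have "b = a" if b:"b \<in># A" for b
 proof -
  have "poly f b = 0" using b A(3) by blast
  have "EX sg:auts L. sg a = b"
  proof (rule conjugate_root[OF L])
   fix p assume "coeffs_in L p" "poly p a = 0"
   then obtain s where "p = f*s" using f(5) by blast
   thus "poly p b = 0" using `poly f b = 0` by simp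
  qed
  thus ?thesis using a by auto
 qed
 hence "A = replicate_mset (size A) a" by(metis set_mset_subset_singletonD singletonI subsetI)
 hence fA:"f = psmul (plc f) ([:- a, 1:]^size A)"
  using A(1) by(metis image_replicate_mset prod_mset_replicate_mset)
 have lc:"plc f:L" "plc f~=0" using coeffs_inD[OF f(1)] f(2) by simp_all
 have "poly f 0:L" by(rule poly_in[OF l f(1) sfield_0[OF l]])
 moreover have "poly f 0 = plc f*(- a)^size A" by(subst fA) (simp add: poly_power)
 ultimately have "inverse (plc f)*(plc f*(- a)^size A):L"
  using sfield_mult[OF l sfield_inverse[OF l lc(1)]] by simp
 hence "(- a)^size A:L" using lc(2) by(simp add: mult.assoc[symmetric])
 moreover have "a^size A = (- a)^size A | a^size A =-((- a)^size A)"
  by(cases "even (size A)") simp_all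
 ultimately have "a^size A:L" using sfield_uminus[OF l] by auto
 thus ?thesis using A(2) f(3) by auto
qed

text \<open>\<open>inverse x\<close> lies in the maximal ideal of exactly one of the two places, so
  its splitter is near \<open>0\<close> at one and near \<open>1\<close> at the other; the direction
  decides between the splitter and its complement.\<close>

lemma separating_element:
 assumes V:"place V" and V':"place V'" and t:"ta:auts \<kk>" and x:"(x:V)~=(ta x:V')"
  and r:"r >= 1" "inverse x:V ==> res V (inverse x):Fq r"
   "inverse x:ta -` V' ==> res (ta -` V') (inverse x):Fq r"
 shows "EX g:{splitter r (inverse x), 1-splitter r (inverse x)}. g:mx V & ta g-1:mx V'"
proof -
 note e = auts_endo[OF t]
 note pl = place_vimage[OF V' t]
 let ?w = "inverse x" and ?s = "splitter r (inverse x)"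
 have x0:"x~=0" using x place_0[OF V] place_0[OF V'] by(auto simp: endo_0[OF e])
 show ?thesis
 proof (cases "x:V")
  case True
  hence "?w~:mx V" using x0 by(simp add: mx_def)
  hence "?s-1:mx V" using splitter(2)[OF V r(1,2)] by blast
  hence 1:"1-?s:mx V" using mx_uminus[OF V, of "?s-1"] by simp
  have "?w:mx (ta -` V')" using True x by(simp add: mx_def)
  hence "?s:ta -` mx V'" unfolding pl(2)[symmetric] using splitter(1)[OF pl(1) r(1,3)] by blast
  hence "ta (1-?s)-1:mx V'" using mx_uminus[OF V', of "ta ?s"] by(simp add: endo_diff[OF e] endo_1[OF e])
  thus ?thesis using 1 by blast
 next
  case False
  hence "?w:mx V" by(rule notin_place[OF V])
  hence 1:"?s:mx V" using splitter(1)[OF V r(1,2)] by blast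
  have "?w~:mx (ta -` V')" using False x x0 by(simp add: mx_def)
  hence "?s-1:ta -` mx V'" unfolding pl(2)[symmetric] using splitter(2)[OF pl(1) r(1,3)] by blast
  hence "ta ?s-1:mx V'" by(simp add: endo_diff[OF e] endo_1[OF e])
  thus ?thesis using 1 by blast
 qed
qed

lemma splitter_place:
 assumes V:"place V" and s:"sg:auts \<kk>" and r:"r >= 1" "w:sg -` V ==> res (sg -` V) w:Fq r"
  and g:"g:{splitter r w, 1-splitter r w}"
 shows "sg g:V"
proof -
 note pl = place_vimage[OF V s]
 have "splitter r w:sg -` V"
  by(metis mx_place near_1 pl(1) r(1,2) splitter(1,2))
 thus ?thesis using g pl(1) place_1 place_diff by fastforce
qed

text \<open>By compactness it suffices to match membership on a finite set \<open>S\<close>. If no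
  automorphism over \<open>D\<close> does, each one is detected by a separating element; these
  combine into some \<open>z\<close> in \<open>mx V\<close> all of whose conjugates over
  \<open>D\<close> are near \<open>1\<close> at \<open>V'\<close>. A power of the product of the
  conjugates lies in \<open>D\<close> and tells the two traces apart.\<close>

lemma places_conjugate:
 assumes D:"ifield D" and V:"place V" and V':"place V'" and eq:"V Int D = V' Int D"
 shows "EX ta:auts D. ta -` V' = V"
proof -
 note d = ifield_sfield[OF D]
 have finite_level:"EX ta:auts D. ALL x:S. x:V <-> ta x:V'" if S:"finite S" for S
 proof (rule ccontr)
  assume neg:"~?thesis"
  have "EX r>=1. (ALL ta:auts \<kk>. inverse x:ta -` V --> res (ta -` V) (inverse x):Fq r) &
    (ALL ta:auts \<kk>. inverse x:ta -` V' --> res (ta -` V') (inverse x):Fq r)" for x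
  proof -
   obtain r where r:"r >= 1" "ALL ta:auts \<kk>. inverse x:ta -` V --> res (ta -` V) (inverse x):Fq r"
    using conjugate_residues[OF V] by blast
   obtain s where s:"s >= 1" "ALL ta:auts \<kk>. inverse x:ta -` V' --> res (ta -` V') (inverse x):Fq s"
    using conjugate_residues[OF V'] by blast
   have "Fq r<=Fq (r*s)" "Fq s<=Fq (r*s)" "r*s >= 1" using Fq_mono[of r "r*s"] Fq_mono[of s "r*s"] r(1) s(1) by simp_all
   thus ?thesis using r(2) s(2) by(intro exI[of _ "r*s"]) blast
  qed
  then obtain r where r:"!!x. r x >= (1::nat)"
   "!!x ta. ta:auts \<kk> ==> inverse x:ta -` V ==> res (ta -` V) (inverse x):Fq (r x)"
   "!!x ta. ta:auts \<kk> ==> inverse x:ta -` V' ==> res (ta -` V') (inverse x):Fq (r x)" by metis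
  have rV:"inverse x:V ==> res V (inverse x):Fq (r x)" for x
   using r(2)[OF auts_id] by simp
  define G where "G = {g:(UN x:S. {splitter (r x) (inverse x), 1-splitter (r x) (inverse x)}). g:mx V}"
  have fG:"finite G" unfolding G_def using S by simp
  have GV:"sg g:V" "sg g:V'" if "sg:auts \<kk>" "g:G" for sg g
  proof -
   obtain x where x:"g:{splitter (r x) (inverse x), 1-splitter (r x) (inverse x)}" using `g:G` unfolding G_def by blast
   show "sg g:V" by(rule splitter_place[OF V `sg:auts \<kk>` r(1) r(2)[OF `sg:auts \<kk>`] x])
   show "sg g:V'" by(rule splitter_place[OF V' `sg:auts \<kk>` r(1) r(3)[OF `sg:auts \<kk>`] x])
  qed
  have sep:"EX g:G. ta g-1:mx V'" if t:"ta:auts D" for ta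
  proof -
   have tk:"ta:auts \<kk>" by(rule auts_kk[OF D t])
   obtain x where x:"x:S" "(x:V)~=(ta x:V')" using neg t by blast
   obtain g where g:"g:{splitter (r x) (inverse x), 1-splitter (r x) (inverse x)}" "g:mx V & ta g-1:mx V'"
    using separating_element[OF V V' tk x(2) r(1) rV r(3)[OF tk]] by blast
   thus ?thesis unfolding G_def using x(1) by blast
  qed
  \<comment> \<open>\<open>z\<close> is near \<open>0\<close> at \<open>V\<close> because all
    \<open>g:G\<close> are, and \<open>ta z\<close> is near \<open>1\<close> at \<open>V'\<close> as
    soon as one \<open>ta g\<close> is.\<close>
  define z where "z = 1-(PROD g:G. 1-g)"
  have z_im:"sg z = 1-(PROD g:G. 1-sg g)" if "sg:auts \<kk>" for sg
   using auts_endo[OF that] by(simp add: z_def endo_diff endo_1 endo_prod)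
  have zV:"z:mx V"
  proof -
   have "(1-g)-1:mx V" if "g:G" for g using that mx_uminus[OF V] unfolding G_def by simp
   hence "(PROD g:G. 1-g)-1:mx V" by(rule mx_prod_1[OF V fG])
   thus ?thesis using mx_uminus[OF V] unfolding z_def by fastforce
  qed
  have zV':"ta z-1:mx V'" if t:"ta:auts D" for ta
  proof -
   have tk:"ta:auts \<kk>" by(rule auts_kk[OF D t])
   obtain g where g:"g:G" "ta g-1:mx V'" using sep[OF t] by blast
   have g1:"1-ta g:mx V'" using mx_uminus[OF V' g(2)] by simp
   have "1-ta h:V'" if "h:G" for h by(rule place_diff[OF V' place_1[OF V'] GV(2)[OF tk that]])
   hence "(PROD h:G. 1-ta h):mx V'"
    using mx_prod[where f = "%h. 1-ta h", OF V' fG _ g(1) g1] by blast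
   thus ?thesis using mx_uminus[OF V'] by(simp add: z_im[OF tk])
  qed
  have zint:"sg z:V" if "sg:auts \<kk>" for sg
   unfolding z_im[OF that] by(intro place_diff[OF V] place_1[OF V] place_prod[OF V] GV(1)[OF that])
  define T where "T = {sg z | sg. sg:auts D}"
  have fT:"finite T" unfolding T_def by(rule finite_restrict_orbit) (use auts_kk[OF D] in blast)
  define a where "a = \<Prod>T"
  have "sg a = a" if s:"sg:auts D" for sg
  proof -
   note e = auts_endo[OF s]
   have im:"sg`T = T" unfolding T_def by(rule auts_orbit_image[OF D s])
   have "sg a = (PROD y:T. sg y)" unfolding a_def by(rule endo_prod[OF e])
   also have "\<dots> = \<Prod>(sg`T)" by(subst prod.reindex) (simp_all add: inj_on_def endo_inj[OF e])
   finally show ?thesis unfolding im a_def .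
  qed
  then obtain n where n:"n > 0" "a^n:D" using fixed_power[OF D, of a] by blast
  have zT:"z:T" unfolding T_def by(rule orbit_self[OF auts_id])
  have TV:"y:V" if "y:T" for y using that zint auts_kk[OF D] unfolding T_def by blast
  have an:"a^n:mx V" by(metis TV V a_def fT mx_power mx_prod n(1) zT zV)
  have TV':"y:V' & y~:mx V'" if "y:T" for y
   using that near_1[OF V' zV'] unfolding T_def by blast
  have an':"a^n~:mx V'" by(metis TV' V' a_def fT mx_power_iff mx_prod_prime n(1) place_prod)
  have "a^n~=0" using an' mx_0[OF V'] by metis
  hence "inverse (a^n)~:V" "inverse (a^n):V'" using an an' by(auto simp: mx_def)
  moreover have "inverse (a^n):D" by(rule sfield_inverse[OF d n(2)])
  ultimately show False using eq by blast
 qed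
 have "EX ta:auts D. ALL x:UNIV. ta:{ta. x:V <-> ta x:V'}"
 proof (rule auts_compact[OF D])
  fix i :: "'a ac"
  show "EX S. finite S & (ALL sg:auts D. ALL ta:auts D. (ALL x:S. sg x = ta x) -->
    sg:{ta. (i:V) = (ta i:V')} --> ta:{ta. (i:V) = (ta i:V')})"
   by(intro exI[of _ "{i}"]) simp
 next
  fix J :: "'a ac set" assume "finite J"
  thus "EX sg:auts D. ALL i:J. sg:{ta. (i:V) = (ta i:V')}"
   using finite_level[of J] by simp
 qed
 then obtain ta where t:"ta:auts D" "ALL x:UNIV. ta:{ta. x:V <-> ta x:V'}" by(rule bexE)
 hence "ta -` V' = V" by blast
 thus ?thesis using t(1) by blast
qed

text \<open>\<open>V\<close> and its preimage under \<open>sg\<close> have the same trace on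
  \<open>F\<close>, so some automorphism over \<open>F\<close> carries one to the other. Composing
  \<open>sg\<close> with its inverse preserves \<open>V\<close> and changes nothing on
  \<open>F\<close>.\<close>

lemma dgrp_adjust:
 assumes L:"ifield L" and F:"ifield F" "L<=F" and V:"place V" and s:"sg:auts L" "sg -` V Int F = V Int F"
 shows "EX ps:dgrp V L. ALL x:F. ps x = sg x"
proof -
 have sk:"sg:auts \<kk>" by(rule auts_kk[OF L s(1)])
 obtain ta where t:"ta:auts F" "ta -` V = sg -` V"
  using places_conjugate[OF F(1) place_vimage(1)[OF V sk] V s(2)] by blast
 note tk = auts_kk[OF F(1) t(1)]
 let ?ps = "%x. sg (ainv ta x)"
 have ti:"ainv ta:auts F" by(rule auts_inv[OF t(1) F(1)])
 have "?ps:auts L" by(rule auts_comp[OF s(1) subsetD[OF auts_mono[OF F(2)] ti]])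
 moreover have "sg (ainv ta x):V <-> x:V" for x
  by(metis auts_inv_simps(1) t(2) tk vimage_eq)
 ultimately have "?ps:dgrp V L" by(auto simp: dgrp_def)
 thus ?thesis using auts_fix[OF ti] by(intro bexI[of _ ?ps]) simp_all
qed

text \<open>Weak approximation: \<open>h\<close> is near \<open>1\<close> at \<open>V\<close> and
  near \<open>0\<close> at the other primes of \<open>F\<close> above the same prime of
  \<open>L\<close>. It is a product of factors \<open>1-g\<close> with a separating \<open>g\<close>
  for each restriction that moves the prime.\<close>

lemma approximation_at_place:
 assumes F:"finab L F" and V:"place V"
 shows "EX h:F. h-1:mx V & (ALL sg:auts L. sg h:V & (sg -` V Int F~=V Int F --> sg h:mx V))"
proof -
 note L = finabD(1)[OF F] and f = ifield_sfield[OF finabD(2)[OF F]]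
 let ?G = "rgrp (auts L) F"
 let ?P = "%sg g. g:F & g:mx V & (ALL ta:auts L. ta g:V) & sg g-1:mx V"
 have ex:"EX g. ?P sg g" if s:"sg:auts L" "sg -` V Int F~=V Int F" for sg
 proof -
  have sk:"sg:auts \<kk>" by(rule auts_kk[OF L s(1)])
  obtain x where x:"x:F" "(x:V)~=(sg x:V)" using s(2) by blast
  obtain r where r:"r >= 1" "ALL ta:auts \<kk>. inverse x:ta -` V --> res (ta -` V) (inverse x):Fq r"
   using conjugate_residues[OF V] by blast
  have rV:"inverse x:V ==> res V (inverse x):Fq r" using bspec[OF r(2) auts_id] by simp
  have rs:"inverse x:ta -` V ==> res (ta -` V) (inverse x):Fq r" if "ta:auts \<kk>" for ta
   using r(2) that by blast
  obtain g where g:"g:{splitter r (inverse x), 1-splitter r (inverse x)}" "g:mx V & sg g-1:mx V"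
   using separating_element[OF V V sk x(2) r(1) rV rs[OF sk]] by blast
  have sF:"splitter r (inverse x):F" by(rule splitter_in[OF f sfield_inverse[OF f x(1)]])
  hence gF:"g:F" using g(1) sfield_diff[OF f sfield_1[OF f] sF] by auto
  have "ta g:V" if t:"ta:auts L" for ta
   by(rule splitter_place[OF V auts_kk[OF L t] r(1) rs[OF auts_kk[OF L t]] g(1)])
  thus ?thesis using gF g(2) by blast
 qed
 define B where "B = {rh:?G. EX g. ?P rh g}"
 define g where "g rh = (SOME g. ?P rh g)" for rh
 have g:"?P rh (g rh)" if "rh:B" for rh
 proof -
  have "EX g. ?P rh g" using that unfolding B_def by blast
  thus ?thesis unfolding g_def by(rule someI_ex)
 qed
 have fB:"finite B" unfolding B_def using finabD(7)[OF F] by simp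
 define h where "h = (PROD rh:B. 1-g rh)"
 have hF:"h:F" unfolding h_def by(intro sfield_prod[OF f] sfield_diff[OF f] sfield_1[OF f]) (use g in blast)
 have h1:"h-1:mx V" by(smt (verit) V cancel_ab_semigroup_add_class.diff_right_commute fB g h_def mx_diff mx_prod_1 place_1 res_eq_iff)
 have him:"sg h = (PROD rh:B. 1-sg (g rh))" if "sg:auts L" for sg
  using auts_endo[OF that] by(simp add: h_def endo_diff endo_1 endo_prod)
 have fac:"1-sg (g rh):V" if "sg:auts L" "rh:B" for sg rh
  by(rule place_diff[OF V place_1[OF V]]) (use g[OF that(2)] that(1) in blast)
 have "sg h:V & (sg -` V Int F~=V Int F --> sg h:mx V)" if s:"sg:auts L" for sg
 proof (intro conjI impI)
  show "sg h:V" unfolding him[OF s] by(rule place_prod[OF V fac[OF s]])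
  assume bad:"sg -` V Int F~=V Int F"
  let ?rh = "restrict sg F"
  obtain g0 where g0:"?P sg g0" using ex[OF s bad] by(rule exE)
  hence "?P ?rh g0" by simp
  hence rB:"?rh:B" unfolding B_def using rgrpI[OF s, of F] by blast
  have "?rh (g ?rh)-1:mx V" "g ?rh:F" using g[OF rB] by blast+
  hence "sg (g ?rh)-1:mx V" by simp
  hence "1-sg (g ?rh):mx V" using mx_uminus[OF V, of "sg (g ?rh)-1"] by simp
  thus "sg h:mx V" unfolding him[OF s]
   using mx_prod[where f = "%rh. 1-sg (g rh)", OF V fB _ rB] fac[OF s] by blast
 qed
 thus ?thesis using hF h1 by blast
qed

section \<open>Residue fields and Frobenius automorphisms\<close>

definition rfield :: "'a::{field,finite} ac set => 'a ac set => 'a ac set" where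
 "rfield V F = res V`(V Int F)"

lemma rfieldI:"x:V ==> x:F ==> res V x:rfield V F"
 by(auto simp: rfield_def)

lemma rfieldE:"c:rfield V F ==> EX x. x:V & x:F & c = res V x"
 by(auto simp: rfield_def)

lemma rfield_Fqbar:"place V ==> rfield V F<=Fqbar"
 using res_Fqbar by(auto simp: rfield_def)

lemma rfield_const:"place V ==> c:F ==> c:Fqbar ==> c:rfield V F"
 using rfieldI[of c V F] res_const[of V c] Fqbar_place[of V] by auto

lemma sfield_rfield:
 assumes V:"place V" and F:"sfield F"
 shows "sfield (rfield V F)"
 unfolding sfield_def
proof (intro conjI ballI)
 show "1:rfield V F" using rfieldI[OF place_1[OF V] sfield_1[OF F]] by(simp add: res_1[OF V])
 fix c d assume "c:rfield V F" "d:rfield V F"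
 then obtain x y where x:"x:V" "x:F" "c = res V x" and y:"y:V" "y:F" "d = res V y" using rfieldE by metis
 show "c-d:rfield V F"
  using rfieldI[OF place_diff[OF V x(1) y(1)] sfield_diff[OF F x(2) y(2)]] by(simp add: res_diff[OF V x(1) y(1)] x(3) y(3))
 show "c*d:rfield V F"
  using rfieldI[OF place_mult[OF V x(1) y(1)] sfield_mult[OF F x(2) y(2)]] by(simp add: res_mult[OF V x(1) y(1)] x(3) y(3))
next
 fix c assume "c:rfield V F"
 then obtain x where x:"x:V" "x:F" "c = res V x" using rfieldE by metis
 show "inverse c:rfield V F"
  by(metis F V \<open>!!thesis. (!!x. [|x:V; x:F; c = res V x|] ==> thesis) ==> thesis\<close> res_eq_0_iff res_inverse rfieldI rfield_const sfield_0 sfield_Fqbar sfield_inverse unit_at_def unit_at_iff)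
qed

lemma cst_rfield:"place V ==> \<kk><=F ==> range cst<=rfield V F"
 using rfield_const[of V _ F] cst_kk cst_Fqbar by blast

lemma dgrp_rfield:
 assumes L:"ifield L" and V:"place V" and s:"sg:dgrp V L" and c:"c:rfield V L"
 shows "sg c = c"
 by(metis L V auts_fix c dgrpD(1) dgrp_res rfieldE s)

lemma finab_Fq:
 fixes r :: nat
 assumes r:"r >= 1"
 shows "finab \<kk> (adj (\<kk> Un Fq r) :: 'a::{field,finite} ac set)"
proof (rule finab_adj[OF ifield_kk_self])
 show "sg x:adj (\<kk> Un Fq r)" if "sg:auts \<kk>" "x:Fq r" for sg x
  using endo_Fq[OF auts_endo[OF that(1)] that(2)] adj_incl[of "\<kk> Un Fq r"] by blast
 show "sg (ta x) = ta (sg x)" if h:"sg:auts \<kk>" "ta:auts \<kk>" "x:Fq r" for sg ta and x :: "'a ac"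
 proof -
  have fx:"rh c = c" if "rh:auts \<kk>" "c:Fq 1" for rh and c :: "'a ac"
   using auts_fix[OF that(1)] that(2) cst_kk unfolding Fq_1 by blast
  obtain i where i:"ALL c:Fq (1*r). sg c = c^(CARD('a)^(1*i))"
   using endo_Fq_power[OF _ r auts_endo[OF h(1)], of 1] fx[OF h(1)] by blast
  hence "sg c = c^(CARD('a)^i)" if "c:Fq r" for c using that by simp
  thus ?thesis using h(3) endo_Fq[OF auts_endo[OF h(2)] h(3)] by(simp add: endo_power[OF auts_endo[OF h(2)]])
 qed
 show "sep \<kk> x" if "x:Fq r" for x by(rule sep_Fq[OF r that])
 show "finite (rgrp (auts \<kk>) (Fq r))" by(rule finite_restrict_finite[OF finite_Fq[OF r]]) blast
qed

text \<open>Classical surjectivity of the decomposition group onto residue automorphisms.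
  \<open>th\<close> is replaced by \<open>y = th*h\<close>, congruent to \<open>th\<close> at
  \<open>V\<close>, whose images under automorphisms moving the prime lie in \<open>mx V\<close>.
  The orbit polynomial of \<open>y\<close> reduces to one over the residue field of
  \<open>L\<close>, so \<open>ph th\<close>, like \<open>th\<close>, is congruent to some conjugate
  \<open>sg y\<close>; being nonzero, it forces \<open>sg\<close> to preserve the prime.\<close>

lemma residue_automorphism_Fq:
 fixes L :: "'a::{field,finite} ac set"
 assumes L:"ifield L" and V:"place V" and e:"endo ph" and fx:"!!c. c:rfield V L ==> ph c = c" and r:"r >= 1"
 shows "EX ps:dgrp V L. ALL c:(Fq r :: 'a ac set). ps c = ph c"
proof -
 obtain th :: "'a ac" where th:"th:Fq r" "ALL sg ta. endo sg --> endo ta --> sg th = ta th --> (ALL c:Fq r. sg c = ta c)"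
  using endo_eq_Fq[OF r] by(rule bexE)
 have red: ?thesis if "ps:dgrp V L" "ps th = ph th" for ps
  using th(2) auts_endo[OF dgrpD(1)[OF that(1)]] e that by blast
 show ?thesis
 proof (cases "th = 0")
  case True
  thus ?thesis using red[OF autgrpD(2)[OF autgrp_dgrp[OF L]]] endo_0[OF e] by simp
 next
  case False
  define F where "F = adj (\<kk> Un Fq r)**L"
  have F:"finab L F" unfolding F_def by(rule finab_lift[OF finab_Fq[OF r] L ifield_kk[OF L]])
  note f = ifield_sfield[OF finabD(2)[OF F]]
  have "Fq r<=F" unfolding F_def using composite_incl(1)[of "adj (\<kk> Un Fq r)" L] adj_incl[of "\<kk> Un Fq r"] by blast
  hence thF:"th:F" using th(1) by blast
  have thb:"th:Fqbar" using Fq_Fqbar[OF r] th(1) by blast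
  have conV:"sg th:V" if "endo sg" for sg using endo_Fqbar[OF that thb] Fqbar_place[OF V] by blast
  obtain h where h:"h:F" "h-1:mx V & (ALL sg:auts L. sg h:V & (sg -` V Int F~=V Int F --> sg h:mx V))"
   using approximation_at_place[OF F V] by(rule bexE)
  define y where "y = th*h"
  have yF:"y:F" unfolding y_def by(rule sfield_mult[OF f thF h(1)])
  have y1:"y-th:mx V"
  proof -
   have "y-th = th*(h-1)" by(simp add: y_def algebra_simps)
   thus ?thesis using mx_mult[OF V conV[OF auts_endo[OF auts_id]]] h(2) by simp
  qed
  have yim:"sg y = sg th*sg h" if "sg:auts L" for sg by(simp add: y_def endo_mult[OF auts_endo[OF that]])
  have yV:"sg y:V" if s:"sg:auts L" for sg
   unfolding yim[OF s] by(rule place_mult[OF V conV[OF auts_endo[OF s]]]) (use h(2) s in blast)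
  define T where "T = {sg y | sg. sg:auts L}"
  have fT:"finite T" unfolding T_def by(rule finite_restrict_orbit) (use auts_kk[OF L] in blast)
  have yT:"y:T" unfolding T_def by(rule orbit_self[OF auts_id])
  have TV:"T<=V" unfolding T_def using yV by blast
  let ?P = "orbit_poly T"
  have PL:"coeffs_in L ?P" unfolding T_def by(rule coeffs_in_orbit_poly_base[OF F yF])
  have PV:"coeff ?P i:V" for i
  proof -
   have "ALL i. coeff (PROD z:S. [:- z, 1:]) i:V" if "finite S" "S<=V" for S
    using that
   proof (induction S rule: finite_induct)
    case empty
    thus ?case using place_0[OF V] place_1[OF V] by(simp add: coeff_1)
   next
    case (insert z S)
    have *: "ALL i. coeff (PROD z:S. [:- z, 1:]) i:V" using insert by simp
    have z:"z:V" using insert.prems by simp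
    have "coeff ([:- z, 1:]*p) i:V" if p:"ALL i. coeff p i:V" for p i
     using p z by(cases i) (auto intro!: place_diff[OF V] place_add[OF V] place_mult[OF V] place_uminus[OF V])
    from this[OF *] show ?case using insert.hyps by simp
   qed
   from this[OF fT TV] show ?thesis unfolding orbit_poly_def by blast
  qed
  \<comment> \<open>The reduction of \<open>?P\<close>; its coefficients lie in the residue field of
    \<open>L\<close>, which \<open>ph\<close> fixes.\<close>
  define Q where "Q = (SUM i<=pdeg ?P. pmon (res V (coeff ?P i)) i)"
  have Qc:"coeff Q i = res V (coeff ?P i)" for i
   by(cases "i<=pdeg ?P") (simp_all add: Q_def coeff_sum coeff_eq_0 res_0[OF V])
  have Qr:"coeffs_in (rfield V L) Q"
   unfolding coeffs_in_def Qc using rfieldI[OF PV] coeffs_inD[OF PL] by blast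
  have Qpol:"poly Q x = (SUM i<=pdeg ?P. res V (coeff ?P i)*x^i)" for x
   by(simp add: Q_def poly_sum poly_monom)
  have Qcong:"poly Q c = res V (poly ?P c)" if "c:Fqbar" for c
  proof -
   have cV:"c:V" using that Fqbar_place[OF V] by blast
   show ?thesis unfolding Qpol unfolding poly_altdef
    by(subst res_sum[OF V]) (auto simp: res_mult[OF V PV place_power[OF V cV]] res_power[OF V cV] res_const[OF V that]
      intro!: place_mult[OF V] PV place_power[OF V cV])
  qed
  have "poly ?P th:mx V"
  proof -
   have "poly ?P y = 0" using orbit_poly_simple_roots(1)[OF fT] yT by blast
   moreover have "poly ?P y-poly ?P th:mx V"
    by(rule mx_poly_cong[OF V y1 _ _ PV]) (use yV[OF auts_id] conV[OF auts_endo[OF auts_id]] in simp_all)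
   ultimately show ?thesis using mx_uminus[OF V] by fastforce
  qed
  moreover have "poly ?P th:V" by(rule place_poly[OF V PV conV[OF auts_endo[OF auts_id]]])
  ultimately have "poly Q th = 0" using Qcong[OF thb] res_eq_0_iff[OF V] by simp
  hence "poly Q (ph th) = 0" using endo_poly[OF e Qr fx, of th] endo_0[OF e] by simp
  moreover have fb:"ph th:Fqbar" by(rule endo_Fqbar[OF e thb])
  moreover have "poly ?P (ph th):V" by(rule place_poly[OF V PV conV[OF e]])
  ultimately have "poly ?P (ph th):mx V" using Qcong[OF fb] res_eq_0_iff[OF V] by simp
  hence "(PROD z:T. ph th-z):mx V" by(simp add: orbit_poly_def poly_prod)
  then obtain z where z:"z:T" "ph th-z:mx V"
   using mx_prod_prime[OF V fT, of "%z. ph th-z"] place_diff[OF V conV[OF e]] TV by blast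
  then obtain sg where s:"sg:auts L" "ph th-sg y:mx V" unfolding T_def by blast
  have "sg h~:mx V"
  proof
   assume "sg h:mx V"
   hence "sg y:mx V" unfolding yim[OF s(1)] by(rule mx_mult[OF V conV[OF auts_endo[OF s(1)]]])
   hence "ph th:mx V" using mx_add[OF V s(2), of "sg y"] by simp
   thus False using Fqbar_mx[OF V fb] False endo_eq_0_iff[OF e] by simp
  qed
  hence "sg -` V Int F = V Int F" using h(2) s(1) by blast
  from dgrp_adjust[OF L finabD(2,3)[OF F] V s(1) this]
  obtain ps where p:"ps:dgrp V L" "ALL x:F. ps x = sg x" by(rule bexE)
  have "ps (y-th):mx V" using dgrp_mx[OF L V p(1)] y1 by blast
  hence "sg y-ps th:mx V" using p(2) yF by(simp add: endo_diff[OF auts_endo[OF dgrpD(1)[OF p(1)]]])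
  hence "ph th-ps th:mx V" using mx_add[OF V s(2)] by fastforce
  moreover have "ph th-ps th:Fqbar"
   by(rule sfield_diff[OF sfield_Fqbar fb endo_Fqbar[OF auts_endo[OF dgrpD(1)[OF p(1)]] thb]])
  ultimately have "ps th = ph th" using Fqbar_mx[OF V] by fastforce
  thus ?thesis by(rule red[OF p(1)])
 qed
qed

text \<open>Each condition concerns one element, so compactness leaves finitely many of them, and
  these involve only a finite field of constants.\<close>

theorem residue_automorphism:
 assumes L:"ifield L" and V:"place V" and e:"endo ph" and fx:"!!c. c:rfield V L ==> ph c = c"
 shows "EX ps:dgrp V L. ALL c:Fqbar. ps c = ph c"
proof -
 let ?C = "%x. {sg. (x:V <-> sg x:V) & (x:Fqbar --> sg x = ph x)}"
 have "EX ps:auts L. ALL x:UNIV. ps:?C x"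
 proof (rule auts_compact[OF L])
  fix x :: "'a ac"
  show "EX S. finite S & (ALL sg:auts L. ALL ta:auts L. (ALL y:S. sg y = ta y) --> sg:?C x --> ta:?C x)"
   by(intro exI[of _ "{x}"]) simp
 next
  fix J :: "'a ac set" assume "finite J"
  then obtain r where r:"r >= 1" "J Int Fqbar<=Fq r" using Fqbar_finite_subset[of "J Int Fqbar"] by auto
  obtain ps where p:"ps:dgrp V L" "ALL c:Fq r. ps c = ph c" using residue_automorphism_Fq[OF L V e fx r(1)] by blast
  have "ps:?C x" if "x:J" for x using dgrpD(2)[OF p(1)] p(2) r(2) that by blast
  thus "EX sg:auts L. ALL x:J. sg:?C x" using dgrpD(1)[OF p(1)] by blast
 qed
 then obtain ps where p:"ps:auts L" "ALL x:UNIV. ps:?C x" by(rule bexE)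
 have "ps -` V = V" using p(2) by blast
 hence "ps:dgrp V L" using p(1) by(simp add: dgrp_def)
 thus ?thesis using p(2) by blast
qed

text \<open>Every element of the decomposition group that fixes the residue field of \<open>F\<close> agrees on \<open>F\<close> with an
  element of the inertia group.\<close>

lemma inertia_lift:
 assumes L:"ifield L" and F:"ifield F" "L<=F" and V:"place V"
  and s:"sg:dgrp V L" "!!c. c:rfield V F ==> sg c = c"
 shows "EX ta:igrp V L. ALL x:F. ta x = sg x"
proof -
 \<comment> \<open>\<open>ps\<close> is trivial on \<open>F\<close> and acts on constants like
   \<open>sg\<close>; dividing by it leaves \<open>sg\<close> unchanged on \<open>F\<close> and
   makes it trivial on constants.\<close>
 obtain ps where p:"ps:dgrp V F" "ALL c:Fqbar. ps c = sg c"
  using residue_automorphism[OF F(1) V auts_endo[OF dgrpD(1)[OF s(1)]] s(2)] by blast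
 have pk:"ps:auts \<kk>" by(rule auts_kk[OF F(1) dgrpD(1)[OF p(1)]])
 have pL:"ps:dgrp V L" using p(1) dgrp_mono[OF F(2)] by blast
 let ?ta = "%x. sg (ainv ps x)"
 note A = autgrpD[OF autgrp_dgrp[OF L, of V]] and AF = autgrpD[OF autgrp_dgrp[OF F(1), of V]]
 have "?ta:dgrp V L" by(rule A(3)[OF s(1) A(4)[OF pL]])
 moreover have "sg (ainv ps c) = c" if c:"c:Fqbar" for c
  by(metis AF(4) auts_endo auts_inv_simps(1) dgrpD(1) endo_Fqbar p(1,2) pk that)
 ultimately have "?ta:igrp V L" by(simp add: igrp_def)
 moreover have "?ta x = sg x" if "x:F" for x using auts_fix[OF dgrpD(1)[OF AF(4)[OF p(1)]] that] by simp
 ultimately show ?thesis by(intro bexI[of _ ?ta] ballI)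
qed

lemma finite_restrict_funpow:
 assumes G:"autgrp Ga" and fin:"finite (rgrp Ga F)" and s:"sg:Ga"
 shows "EX i>0. ALL x:F. (sg ^^ i) x = x"
proof -
 have "finite (range (%i. restrict (sg ^^ i) F))" by(smt (verit, ccfv_SIG) G autgrp_funpow fin finite_subset imageE rgrpI s subsetI)
 then obtain i j where ij:"restrict (sg ^^ i) F = restrict (sg ^^ j) F" "i < j"
  by(metis (mono_tags, lifting) inj_def linorder_neqE_nat range_inj_infinite)
 have "(sg ^^ (j-i)) x = x" if "x:F" for x
 proof -
  have "(sg ^^ i) x = (sg ^^ j) x" using ij(1) that unfolding rgrp_eq_iff by blast
  moreover have "(sg ^^ j) x = (sg ^^ i) ((sg ^^ (j-i)) x)"
   using ij(2) by(metis add_diff_inverse_nat comp_apply funpow_add less_imp_not_less)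
  moreover have "endo (sg ^^ i)" using endo_funpow auts_endo autgrpD(1)[OF G] s by blast
  ultimately show ?thesis using endo_inj by metis
 qed
 thus ?thesis using ij(2) by(intro exI[of _ "j-i"]) simp
qed

lemma frob_funpow:"((%x :: 'a::{field,finite} ac. x^(CARD('a)^a)) ^^ i) x = x^(CARD('a)^(a*i))"
proof (induction i)
 case (Suc i)
 have "(x^CARD('a)^(a*i))^CARD('a)^a = x^CARD('a)^(a*Suc i)"
  by(simp add: power_mult[symmetric] power_add[symmetric] add.commute)
 thus ?case using Suc by simp
qed simp

lemma funpow_agree:
 assumes "!!c. c:S ==> sg c = ta c" "!!c. c:S ==> ta c:S" "c:S"
 shows "(sg ^^ i) c = (ta ^^ i) c"
proof -
 have "(sg ^^ i) c = (ta ^^ i) c & (ta ^^ i) c:S"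
  by(induction i) (use assms in simp_all)
 thus ?thesis ..
qed

lemma ex_frobenius:
 fixes L :: "'a::{field,finite} ac set"
 assumes L:"ifield L" and V:"place V" and R:"rfield V L<=Fq a"
 shows "EX ph:dgrp V L. ALL i. ALL c:Fqbar. (ph ^^ i) c = c^(CARD('a)^(a*i))"
proof -
 obtain ph where p:"ph:dgrp V L" "ALL c:Fqbar. ph c = c^(CARD('a)^a)"
  using residue_automorphism[OF L V endo_frob[of a]] R Fq_iff by blast
 have "(ph ^^ i) c = c^(CARD('a)^(a*i))" if "c:Fqbar" for i c
  using funpow_agree[of Fqbar ph "%x. x^(CARD('a)^a)" c i] p(2) endo_Fqbar[OF endo_frob[of a, where ?'a = 'a]] that by(simp add: frob_funpow)
 thus ?thesis using p(1) by blast
qed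

definition rfinite :: "'a::{field,finite} ac set => 'a ac set => bool" where
 "rfinite V F <-> (EX s>=1. rfield V F = Fq s)"

text \<open>Some positive iterate of a Frobenius lift over \<open>L\<close> is trivial on
  \<open>F\<close>, hence on its residues; so these satisfy \<open>c^(q^(a*i)) = c\<close>.\<close>

lemma rfinite_finab:
 assumes F:"finab L F" and V:"place V" and L:"rfinite V L"
 shows "rfinite V F"
proof -
 note Li = finabD(1)[OF F]
 obtain a where a:"a >= 1" "rfield V L = Fq a" using L unfolding rfinite_def by blast
 obtain ph where p:"ph:dgrp V L" "ALL i. ALL c:Fqbar. (ph ^^ i) c = c^(CARD('a)^(a*i))"
  using ex_frobenius[OF Li V] a(2) by blast
 have pL:"ph:auts L" by(rule dgrpD(1)[OF p(1)])
 obtain i where i:"i > 0" "ALL x:F. (ph ^^ i) x = x"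
  using finite_restrict_funpow[OF autgrp_auts[OF Li] finabD(7)[OF F] pL] by blast
 have pi:"(ph ^^ i):dgrp V L" by(rule autgrp_funpow[OF autgrp_dgrp[OF Li] p(1)])
 have "c:Fq (a*i)" if c:"c:rfield V F" for c
 proof -
  obtain x where x:"x:V" "x:F" "c = res V x" using rfieldE[OF c] by blast
  have "res V ((ph ^^ i) x) = (ph ^^ i) c" unfolding x(3) by(rule dgrp_res[OF Li V pi x(1)])
  hence "c = (ph ^^ i) c" using i(2) x(2,3) by simp
  moreover have "(ph ^^ i) c = c^(CARD('a)^(a*i))" using p(2) rfield_Fqbar[OF V] c by blast
  ultimately show ?thesis by(simp add: Fq_iff)
 qed
 hence "rfield V F<=Fq (a*i)" by blast
 moreover have "a*i >= 1" using a(1) i(1) by simp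
 ultimately show ?thesis
  unfolding rfinite_def
  using subfield_of_Fq[OF sfield_rfield[OF V ifield_sfield[OF finabD(2)[OF F]]] cst_rfield[OF V ifield_kk[OF finabD(2)[OF F]]]] by blast
qed

text \<open>Residues of fractions are fractions in the residue \<open>?c\<close> of
  \<open>t\<close>. When the denominator vanishes at \<open>?c\<close>, so does the numerator, and
  the minimal polynomial of \<open>?c\<close> is cancelled from both.\<close>

lemma rfield_kk_subset:
 assumes V:"place V" and t:"parameter t" "t:V" and a:"res V t:Fq a" "a >= 1"
 shows "rfield V \<kk><=Fq a"
proof -
 let ?K = "range (cst :: 'a => 'a ac)"
 note K = sfield_range_cst[where ?'a = 'a]
 let ?c = "res V t"
 have KV:"?K<=V" using place_cst[OF V] by blast
 have Kb:"?K<=Fqbar" by(rule cst_Fqbar)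
 have KF:"?K<=Fq a" using cst_Fq by blast
 have cb:"?c:Fqbar" by(rule res_Fqbar[OF V t(2)])
 have polV:"poly g t:V" if "coeffs_in ?K g" for g
  by(rule place_poly[OF V _ t(2)]) (use coeffs_inD[OF that] KV in blast)
 have polr:"res V (poly g t) = poly g ?c" if g:"coeffs_in ?K g" for g
  by(meson KV Kb V coeffs_inD coeffs_in_mono mx_poly_cong poly_in res_Fqbar res_cong res_eqI res_place sfield_Fqbar t(2) that)
 have polF:"poly g ?c:Fq a" if "coeffs_in ?K g" for g
  by(rule poly_in[OF sfield_Fq coeffs_in_mono[OF that KF] a(1)])
 have "EX p. coeffs_in ?K p & p~=0 & poly p ?c = 0"
  by(metis (mono_tags, lifting) Fq_poly_def Fq_roots(1,3) K assms(4,5) coeffs_in_diff coeffs_in_monom mem_Collect_eq sfield_1)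
 from ex_min_poly[OF K this] obtain m where m:"min_poly ?K ?c m" by(rule exE)
 note m = min_polyD[OF m]
 have key:"res V x:Fq a" if "coeffs_in ?K f" "coeffs_in ?K g" "g~=0" "x*poly g t = poly f t" "x:V" for f g x
  using that
 proof (induction "pdeg g" arbitrary: f g rule: less_induct)
  case less
  note h = less.prems
  have eq:"res V x*poly g ?c = poly f ?c"
   using res_mult[OF V h(5) polV[OF h(2)]] polr[OF h(1)] polr[OF h(2)] h(4) by simp
  show ?case
  proof (cases "poly g ?c = 0")
   case False
   hence "res V x = poly f ?c/poly g ?c" using eq by(simp add: field_simps)
   thus ?thesis using sfield_divide[OF sfield_Fq polF[OF h(1)] polF[OF h(2)]] by simp
  next
   case True
   hence "poly f ?c = 0" using eq by simp
   then obtain f' g' where f':"coeffs_in ?K f'" "f = m*f'" and g':"coeffs_in ?K g'" "g = m*g'"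
    using m(5)[OF h(1)] m(5)[OF h(2) True] by blast
   have g0:"g'~=0" using g'(2) h(3) by auto
   hence "pdeg g' < pdeg g" unfolding g'(2) using m(2,3) by(simp add: degree_mult_eq)
   moreover have "x*poly g' t = poly f' t"
    using h(4) parameter_poly_nonzero[OF t(1) m(1,2)] by(simp add: f'(2) g'(2))
   ultimately show ?thesis using less.hyps f'(1) g'(1) g0 h(5) by blast
  qed
 qed
 show ?thesis
 proof
  fix c assume "c:rfield V \<kk>"
  then obtain x where x:"x:V" "x:\<kk>" "c = res V x" using rfieldE by blast
  obtain f g where fg:"coeffs_in ?K f" "coeffs_in ?K g" "poly g t~=0" "x = poly f t/poly g t"
   using kk_fractions[OF t(1) x(2)] by blast
  show "c:Fq a" unfolding x(3)
   by(rule key[OF fg(1,2) _ _ x(1)]) (use fg(3,4) in auto)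
 qed
qed

lemma rfinite_kk:"place V ==> rfinite V \<kk>"
proof -
 assume V:"place V"
 obtain t where t:"parameter t" "t:V" using ex_parameter_in_place[OF V] by blast
 obtain a where a:"a >= 1" "res V t:Fq a" using res_Fqbar[OF V t(2)] by(auto simp: Fqbar_def)
 show ?thesis
  unfolding rfinite_def
  using subfield_of_Fq[OF sfield_rfield[OF V sfield_kk] cst_rfield[OF V order_refl] rfield_kk_subset[OF V t a(2,1)] a(1)] .
qed

section \<open>Ramification and inertia\<close>

definition discrete :: "'a::{field,finite} ac set => 'a ac set => bool" where
 "discrete V F <-> (EX N>0. ALL x:F. x~=0 --> (EX i::int. real N*vord V x = of_int i))"

lemma discrete_kk:"place V ==> discrete V \<kk>"
 unfolding discrete_def using vord_kk[of V] by(intro exI[of _ 1]) simp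

lemma card_orbit_le:
 assumes "finite (rgrp Ga F)" "x:F"
 shows "card {sg x | sg. sg:Ga} <= card (rgrp Ga F)"
proof -
 have "{sg x | sg. sg:Ga}<=(%g. g x)`rgrp Ga F"
 proof
  fix z assume "z:{sg x | sg. sg:Ga}"
  then obtain sg where s:"sg:Ga" "z = sg x" by auto
  have "z = (restrict sg F) x" using s(2) assms(2) by simp
  thus "z:(%g. g x)`rgrp Ga F" using rgrpI[OF s(1), of F] by(rule image_eqI)
 qed
 from card_mono[OF finite_imageI[OF assms(1)] this] show ?thesis
  using card_image_le[OF assms(1), of "%g. g x"] by linarith
qed

text \<open>Two terms of equal size in the orbit polynomial express \<open>(j-i)*vord V x\<close> by
  values from \<open>L\<close>. As \<open>j-i\<close> is at most the group order, the factorial of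
  the latter clears all new denominators.\<close>

lemma discrete_finab:
 assumes F:"finab L F" and V:"place V" and d:"discrete V L"
 shows "discrete V F"
proof -
 note Li = finabD(1)[OF F]
 obtain N where N:"N > 0" "!!x. x:L ==> x~=0 ==> EX i::int. real N*vord V x = of_int i"
  using d unfolding discrete_def by blast
 let ?n = "card (rgrp (auts L) F)"
 have "EX i::int. real (N*fact ?n)*vord V x = of_int i" if x:"x:F" "x~=0" for x
 proof -
  define T where "T = {sg x | sg. sg:auts L}"
  have fT:"finite T" unfolding T_def by(rule finite_restrict_orbit) (use auts_kk[OF Li] in blast)
  have xT:"x:T" unfolding T_def by(rule orbit_self[OF auts_id])
  have cT:"card T<=?n" unfolding T_def by(rule card_orbit_le[OF finabD(7)[OF F] x(1)])
  let ?p = "orbit_poly T"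
  have pL:"coeffs_in L ?p" unfolding T_def by(rule coeffs_in_orbit_poly_base[OF F x(1)])
  note r = orbit_poly_simple_roots[OF fT]
  obtain i j where ij:"i < j" "j<=pdeg ?p" "coeff ?p i~=0" "coeff ?p j~=0"
   "unit_at V (coeff ?p j / coeff ?p i*x^(j-i))"
   using dominant_terms[OF V r(3) _ x(2)] r(1) xT by blast
  have "vord V (coeff ?p j / coeff ?p i*x^(j-i)) = 0" by(rule vord_unit[OF V ij(5)])
  hence v:"real (j-i)*vord V x = vord V (coeff ?p i)-vord V (coeff ?p j)"
   using ij(3,4) x(2) by(simp add: vord_mult[OF V] vord_divide[OF V] vord_power[OF V])
  obtain a b :: int where ab:"real N*vord V (coeff ?p i) = of_int a" "real N*vord V (coeff ?p j) = of_int b"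
   using N(2)[OF coeffs_inD[OF pL] ij(3)] N(2)[OF coeffs_inD[OF pL] ij(4)] by blast
  have "j-i dvd fact ?n" using ij(1,2) cT r(4) by(intro dvd_fact) linarith+
  then obtain k where k:"fact ?n = (j-i)*k" by(auto simp: dvd_def)
  have "real (N*fact ?n)*vord V x = real N*real k*(real (j-i)*vord V x)"
   unfolding k by(simp only: of_nat_mult mult_ac)
  also have "\<dots> = of_int (int k*(a-b))" 
   by(smt (verit) ab(1,2) mult.assoc mult.commute of_int_diff of_int_mult of_int_of_nat_eq right_diff_distrib v)
  finally show ?thesis by blast
 qed
 moreover have "N*fact ?n > 0" using N(1) by simp
 ultimately show ?thesis unfolding discrete_def by blast
qed

lemma rgrp_translate:
 assumes G:"autgrp Ga" and st:"stable Ga F" and fin:"finite (rgrp Ga F)" and s:"sg:Ga"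
 shows "bij_betw (%g. restrict (%x. sg (g x)) F) (rgrp Ga F) (rgrp Ga F)"
proof -
 let ?f = "%g. restrict (%x. sg (g x)) F"
 have e:"endo sg" using autgrpD(1)[OF G] s auts_endo by blast
 have into:"?f`rgrp Ga F<=rgrp Ga F"
 proof
  fix g' assume "g':?f`rgrp Ga F"
  then obtain g where g:"g:rgrp Ga F" "g' = ?f g" by(rule imageE)
  obtain ta where t:"ta:Ga" "g = restrict ta F" using rgrpE[OF g(1)] by(rule bexE)
  have "g' = restrict (%x. sg (ta x)) F" unfolding g(2) t(2) by(simp add: rgrp_eq_iff)
  thus "g':rgrp Ga F" using rgrpI[OF autgrpD(3)[OF G s t(1)]] by simp
 qed
 have inj:"inj_on ?f (rgrp Ga F)"
 proof (rule inj_onI)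
  fix g h assume gh:"g:rgrp Ga F" "h:rgrp Ga F" "?f g = ?f h"
  obtain ta rh where t:"g = restrict ta F" "h = restrict rh F" using rgrpE[OF gh(1)] rgrpE[OF gh(2)] by blast
  have "ALL x:F. sg (g x) = sg (h x)" using gh(3) unfolding rgrp_eq_iff .
  hence "ALL x:F. g x = h x" using endo_inj[OF e] by blast
  thus "g = h" unfolding t by(simp add: rgrp_eq_iff)
 qed
 show ?thesis unfolding bij_betw_def using inj endo_inj_surj[OF fin into inj] by blast
qed

lemma trace_norm_invariant:
 assumes G:"autgrp Ga" and st:"stable Ga F" and fin:"finite (rgrp Ga F)" and s:"sg:Ga" and x:"x:F"
 shows "sg (SUM g:rgrp Ga F. g x) = (SUM g:rgrp Ga F. g x)"
  "sg (PROD g:rgrp Ga F. g x) = (PROD g:rgrp Ga F. g x)"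
proof -
 have e:"endo sg" using autgrpD(1)[OF G] s auts_endo by blast
 note b = rgrp_translate[OF G st fin s]
 show "sg (SUM g:rgrp Ga F. g x) = (SUM g:rgrp Ga F. g x)"
  using sum.reindex_bij_betw[OF b, of "%g. g x"] x by(simp add: endo_sum[OF e])
 show "sg (PROD g:rgrp Ga F. g x) = (PROD g:rgrp Ga F. g x)"
  using prod.reindex_bij_betw[OF b, of "%g. g x"] x by(simp add: endo_prod[OF e])
qed

text \<open>Vandermonde in polynomial form: if all these power sums vanished, so would the sum of
  \<open>r g*poly p (b g)\<close> for every \<open>p\<close> of degree at most
  \<open>card D\<close>. Taking \<open>p\<close> with roots at all nodes except \<open>b g0\<close>
  leaves a single nonzero term.\<close>

lemma power_sum_nonzero:
 fixes b r :: "'i => 'b::field"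
 assumes fin:"finite D" "D~={}" and inj:"inj_on b D" and r:"!!g. g:D ==> r g~=0"
 shows "EX j<=card D. (SUM g:D. r g*b g^j)~=0"
proof (rule ccontr)
 assume neg:"~?thesis"
 obtain g0 where g0:"g0:D" using fin(2) by blast
 let ?S = "b`(D-{g0})"
 let ?p = "orbit_poly ?S"
 have fS:"finite ?S" using fin(1) by simp
 note rt = orbit_poly_simple_roots[OF fS]
 have deg:"pdeg ?p <= card D"
  unfolding rt(4) using card_image_le[of "D-{g0}" b] fin(1) card_mono[of D "D-{g0}"] by fastforce
 have "(SUM g:D. r g*poly ?p (b g)) = (SUM g:D. SUM i<=pdeg ?p. coeff ?p i*(r g*b g^i))"
  by(intro sum.cong refl) (simp add: poly_altdef sum_distrib_left mult_ac)
 also have "\<dots> = (SUM i<=pdeg ?p. SUM g:D. coeff ?p i*(r g*b g^i))" by(rule sum.swap)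
 also have "\<dots> = (SUM i<=pdeg ?p. coeff ?p i*(SUM g:D. r g*b g^i))" by(simp add: sum_distrib_left)
 also have "\<dots> = 0" by(intro sum.neutral ballI) (use neg deg in auto)
 finally have "(SUM g:D. r g*poly ?p (b g)) = 0" .
 moreover have "(SUM g:D. r g*poly ?p (b g)) = r g0*poly ?p (b g0)+(SUM g:D-{g0}. r g*poly ?p (b g))"
  by(rule sum.remove[OF fin(1) g0])
 moreover have "(SUM g:D-{g0}. r g*poly ?p (b g)) = 0"
  by(intro sum.neutral ballI) (simp add: rt(1))
 moreover have "poly ?p (b g0)~=0" using inj g0 unfolding rt(1) inj_on_def by blast
 ultimately show False using r[OF g0] by simp
qed

lemma mx_power_large:
 assumes V:"place V" and w:"w:mx V"
 shows "EX M0. ALL M>=M0. u*w^M:mx V"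
proof (cases "u = 0 | w = 0")
 case True
 hence "u*w^M:mx V" if "M >= 1" for M using that mx_0[OF V] by(auto simp: power_0_left)
 thus ?thesis by blast
next
 case False
 hence d:"vord V w > 0" using vord_pos[OF V _ w] by blast
 obtain M0 :: nat where M0:"real M0 >-vord V u/vord V w" using reals_Archimedean2 by blast
 have "u*w^M:mx V" if "M >= M0" for M
 proof -
  have "real M >-vord V u/vord V w" using M0 that by linarith
  hence "real M*vord V w >-vord V u" using d by(simp add: field_simps)
  hence "vord V (u*w^M) > 0" using False by(simp add: vord_mult[OF V] vord_power[OF V])
  thus ?thesis using vord_pos_iff[OF V, of "u*w^M"] False by simp
 qed
 thus ?thesis by blast
qed

lemma common_bound:
 assumes "finite I" "!!i. i:I ==> EX M0. ALL M>=M0::nat. P i M"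
 shows "EX M. ALL i:I. P i M"
proof -
 have "eventually (%M. ALL i:I. P i M) sequentially"
  using assms by(intro eventually_ball_finite) (auto simp: eventually_sequentially)
 thus ?thesis by(auto simp: eventually_sequentially)
qed

definition trivial_on :: "('b => 'b) set => 'b set => bool" where
 "trivial_on Ga F <-> (ALL sg:Ga. ALL x:F. sg x = x)"

lemma trivial_onD:"trivial_on Ga F ==> sg:Ga ==> x:F ==> sg x = x"
 by(simp add: trivial_on_def)

text \<open>A suitable element of \<open>F\<close> of the same valuation has a trace whose leading term does not cancel:
  by Vandermonde, as the decomposition group acts faithfully on the residue field.\<close>

theorem value_group_eq_if_inertia_trivial:
 fixes L F V :: "'a::{field,finite} ac set"
 assumes F:"finab L F" and V:"place V" and rf:"rfinite V F"
  and triv:"trivial_on (igrp V L) F" and x:"x:F" "x~=0"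
 shows "EX y:L. y~=0 & vord V y = vord V x"
proof -
 note Li = finabD(1)[OF F] and Fi = finabD(2)[OF F] and LF = finabD(3)[OF F] and f = ifield_sfield[OF finabD(2)[OF F]]
 obtain s where s:"s >= 1" "rfield V F = Fq s" using rf unfolding rfinite_def by blast
 \<comment> \<open>\<open>th\<close> generates the residue field of \<open>F\<close>,
   \<open>y\<close> lifts it, and \<open>h\<close> isolates \<open>V\<close> among the primes of
   \<open>F\<close> above the prime of \<open>L\<close>.\<close>
 obtain th :: "'a ac" where th:"th:Fq s" "ALL sg ta. endo sg --> endo ta --> sg th = ta th --> (ALL c:Fq s. sg c = ta c)"
  using endo_eq_Fq[OF s(1)] by(rule bexE)
 obtain y where y:"y:V" "y:F" "th = res V y" using rfieldE s(2) th(1) by blast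
 obtain h where h:"h:F" "h-1:mx V & (ALL sg:auts L. sg h:V & (sg -` V Int F~=V Int F --> sg h:mx V))"
  using approximation_at_place[OF F V] by(rule bexE)
 define Ga where "Ga = rgrp (auts L) F"
 define D where "D = rgrp (dgrp V L) F"
 have fG:"finite Ga" unfolding Ga_def by(rule finabD(7)[OF F])
 have DG:"D<=Ga" unfolding D_def Ga_def by(rule rgrp_mono) (use dgrpD(1) in blast)
 have fD:"finite D" using fG DG finite_subset by blast
 have D0:"D~={}" unfolding D_def restrict_group_def using autgrpD(2)[OF autgrp_dgrp[OF Li]] by blast
 have bad:"g h:mx V" if g:"g:Ga" "g~:D" for g
 proof -
  obtain sg where sg:"sg:auts L" "g = restrict sg F" using rgrpE g(1) unfolding Ga_def by blast
  have "sg -` V Int F~=V Int F"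
   by(smt (verit, best) D_def Fi LF Li V dgrp_adjust rgrpI rgrp_eq_iff sg(1,2) that(2))
  thus ?thesis using h sg by simp
 qed
 have good:"g y:V & g h-1:mx V & unit_at V (g x/x) & (EX sg:dgrp V L. g = restrict sg F & res V (g y) = sg th)"
  if g:"g:D" for g
 proof -
  obtain sg where sg:"sg:dgrp V L" "g = restrict sg F" using rgrpE g unfolding D_def by blast
  note e = auts_endo[OF dgrpD(1)[OF sg(1)]]
  have "g h-1:mx V" by(metis Li V dgrp_mx e endo_1 endo_diff h(1,2) restrict_apply sg(1,2))
  moreover have "g y:V" unfolding sg(2) using y dgrpD(2)[OF sg(1)] by simp
  moreover have "res V (g y) = sg th" unfolding sg(2) y(3) using dgrp_res[OF Li V sg(1) y(1)] y(2) by simp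
  moreover have "unit_at V (g x/x)"
   by(smt (verit) Li V dgrp_vord divide_eq_0_iff e endo_eq_0_iff restrict_apply sg(1,2) vord_divide vord_zero_iff x(1,2))
  ultimately show ?thesis using sg by blast
 qed
 \<comment> \<open>Two elements of the decomposition group with the same effect on \<open>th\<close>
   differ on \<open>F\<close> by an element of the inertia group, which is trivial there.\<close>
 have inj:"inj_on (%g. res V (g y)) D"
 proof (rule inj_onI)
  fix g g' assume gg:"g:D" "g':D" and eq:"res V (g y) = res V (g' y)"
  obtain sg where sg:"sg:dgrp V L" "g = restrict sg F" "res V (g y) = sg th" using good[OF gg(1)] by blast
  obtain ta where tg:"ta:dgrp V L" "g' = restrict ta F" "res V (g' y) = ta th" using good[OF gg(2)] by blast
  have es:"endo sg" "endo ta" using auts_endo dgrpD(1) sg(1) tg(1) by blast+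
  have eqc:"ALL c:Fq s. sg c = ta c" using th(2) es eq sg(3) tg(3) by simp
  note A = autgrpD[OF autgrp_dgrp[OF Li, of V]]
  have tk:"ta:auts \<kk>" using A(1) tg(1) by blast
  have "(%x. ainv ta (sg x)):dgrp V L" by(rule A(3)[OF A(4)[OF tg(1)] sg(1)])
  moreover have "ainv ta (sg c) = c" if "c:rfield V F" for c
   using eqc that s(2) by(simp add: auts_inv_simps[OF tk])
  ultimately obtain rh where r:"rh:igrp V L" "ALL x:F. rh x = ainv ta (sg x)"
   using inertia_lift[OF Li Fi LF V] by blast
  have "sg x = ta x" if xF:"x:F" for x
   by(metis auts_inv_simps(1) r(1,2) tk triv trivial_onD xF)
  thus "g = g'" unfolding sg(2) tg(2) rgrp_eq_iff by blast
 qed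
 have rn:"res V (g x/x)~=0" if "g:D" for g
  using good[OF that] res_eq_0_iff[OF V] unfolding unit_at_def by blast
 obtain j where j:"j <= card D" "(SUM g:D. res V (g x/x)*res V (g y)^j)~=0"
  using power_sum_nonzero[OF fD D0 inj, of "%g. res V (g x/x)"] rn by blast
 have "EX M. ALL g:Ga-D. (g y^j*(g x/x))*g h^M:mx V"
  by(rule common_bound) (use fG mx_power_large[OF V bad] in blast)+
 then obtain M where M:"!!g. g:Ga-D ==> (g y^j*(g x/x))*g h^M:mx V" by blast
 \<comment> \<open>In the trace of \<open>z\<close>, divided by \<open>x\<close>, the terms outside
   \<open>D\<close> lie in \<open>mx V\<close> by the choice of \<open>M\<close>. Those in
   \<open>D\<close> reduce to the nonzero sum found above, since \<open>g h\<close> has residue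
   \<open>1\<close> for \<open>g:D\<close>.\<close>
 define z where "z = y^j*x*h^M"
 have zF:"z:F" unfolding z_def by(intro sfield_mult[OF f] sfield_power[OF f] y(2) h(1) x(1))
 have gz:"g z/x = (g y^j*(g x/x))*g h^M" if "g:Ga" for g
 proof -
  obtain sg where sg:"sg:auts L" "g = restrict sg F" using rgrpE `g:Ga` unfolding Ga_def by blast
  note e = auts_endo[OF sg(1)]
  have "g z = sg z" using zF sg(2) by simp
  also have "\<dots> = sg y^j*sg x*sg h^M" unfolding z_def by(simp add: endo_mult[OF e] endo_power[OF e])
  finally show ?thesis using y(2) x(1) h(1) sg(2) by simp
 qed
 define Z where "Z = (SUM g:Ga. g z)"
 have gzL:"g z:F" if g:"g:Ga" for g
  using F Ga_def finabD(4) rgrpE that zF by fastforce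
 have ZF:"Z:F" unfolding Z_def by(rule sfield_sum[OF f]) (rule gzL)
 have ZL:"Z:L"
  by(rule finab_fixed[OF F ZF])
   (unfold Z_def Ga_def, rule trace_norm_invariant(1)[OF autgrp_auts[OF Li] stable_finab[OF F] finabD(7)[OF F] _ zF])
 have "Z/x = (SUM g:Ga. g z/x)" by(simp add: Z_def sum_divide_distrib)
 also have "\<dots> = (SUM g:Ga. (g y^j*(g x/x))*g h^M)" by(rule sum.cong[OF refl gz])
 also have "\<dots> = (SUM g:Ga-D. (g y^j*(g x/x))*g h^M)+(SUM g:D. (g y^j*(g x/x))*g h^M)"
  by(rule sum.subset_diff[OF DG fG])
 finally have Zx:"Z/x = (SUM g:Ga-D. (g y^j*(g x/x))*g h^M)+(SUM g:D. (g y^j*(g x/x))*g h^M)" .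
 let ?b = "SUM g:Ga-D. (g y^j*(g x/x))*g h^M" and ?g = "SUM g:D. (g y^j*(g x/x))*g h^M"
 have b:"?b:mx V" by(rule mx_sum[OF V]) (rule M)
 have mem:"g y:V" "g x/x:V" "g h:V" "res V (g h) = 1" if "g:D" for g
 proof -
  note G = good[OF that]
  show "g y:V" "g x/x:V" using G unfolding unit_at_def by blast+
  show gh:"g h:V" using near_1[OF V] G by blast
  have "res V (g h) = res V 1" using res_eq_iff[OF V gh place_1[OF V]] G by blast
  thus "res V (g h) = 1" by(simp add: res_1[OF V])
 qed
 have tV:"(g y^j*(g x/x))*g h^M:V" if "g:D" for g
  by(intro place_mult[OF V] place_power[OF V] mem that)
 have "res V ?g = (SUM g:D. res V ((g y^j*(g x/x))*g h^M))" by(rule res_sum[OF V]) (rule tV)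
 also have "\<dots> = (SUM g:D. res V (g x/x)*res V (g y)^j)"
 proof (rule sum.cong[OF refl])
  fix g assume g:"g:D"
  note m = mem[OF g]
  have "res V ((g y^j*(g x/x))*g h^M) = res V (g y^j*(g x/x))*res V (g h^M)"
   by(rule res_mult[OF V place_mult[OF V place_power[OF V m(1)] m(2)] place_power[OF V m(3)]])
  also have "\<dots> = res V (g y)^j*res V (g x/x)"
   by(simp only: res_mult[OF V place_power[OF V m(1)] m(2)] res_power[OF V m(1)] res_power[OF V m(3)] m(4) power_one mult_1_right)
  finally show "res V ((g y^j*(g x/x))*g h^M) = res V (g x/x)*res V (g y)^j" by(simp only: mult.commute)
 qed
 finally have rg:"res V ?g~=0" using j(2) by simp
 have gV:"?g:V" by(rule place_sum[OF V]) (rule tV)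
 have "Z/x:V" unfolding Zx by(rule place_add[OF V mx_place[OF V b] gV])
 moreover have "Z/x~:mx V"
 proof
  assume "Z/x:mx V"
  hence "Z/x-?b:mx V" by(rule mx_diff[OF V _ b])
  hence "?g:mx V" unfolding Zx by simp
  thus False using rg res_eq_0_iff[OF V gV] by blast
 qed
 ultimately have u:"unit_at V (Z/x)" by(simp add: unit_at_def)
 hence "Z~=0" using unit_at_iff[OF V] by auto
 moreover have "vord V Z = vord V x" using vord_unit[OF V u] vord_divide[OF V `Z ~= 0` x(2)] by simp
 ultimately show ?thesis using ZL by blast
qed

lemma ex_uniformizer:
 assumes V:"place V" and F:"\<kk><=F" and d:"discrete V F"
 shows "EX p:F. p~=0 & vord V p > 0 & (ALL x:F. x~=0 --> x:mx V --> vord V p<=vord V x)"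
proof -
 obtain N where N:"N > 0" "!!x. x:F ==> x~=0 ==> EX i::int. real N*vord V x = of_int i"
  using d unfolding discrete_def by blast
 define Q where "Q k = (EX x:F. x~=0 & x:mx V & real N*vord V x = real k)" for k :: nat
 have Nk:"EX k::nat. real N*vord V x = real k" if x:"x:F" "x~=0" "x:mx V" for x
 proof -
  obtain i :: int where i:"real N*vord V x = of_int i" using N(2)[OF x(1,2)] by blast
  have "real N*vord V x > 0" using N(1) vord_pos[OF V x(2,3)] by simp
  hence "i > 0" unfolding i by simp
  thus ?thesis using i by(intro exI[of _ "nat i"]) simp
 qed
 have "EX k. Q k" using Nk[OF _ unif_neq_0[OF V] unif_mx[OF V]] unif_kk[OF V] F unif_neq_0[OF V] unif_mx[OF V] unfolding Q_def by blast
 hence L:"Q (LEAST k. Q k)" by(rule LeastI_ex)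
 then obtain p where p:"p:F" "p~=0" "p:mx V" "real N*vord V p = real (LEAST k. Q k)" unfolding Q_def by blast
 have "vord V p<=vord V x" if x:"x:F" "x~=0" "x:mx V" for x
 proof -
  obtain k where k:"real N*vord V x = real k" using Nk[OF x] by blast
  hence "Q k" unfolding Q_def using x by blast
  hence "(LEAST k. Q k)<=k" by(rule Least_le)
  hence "real N*vord V p<=real N*vord V x" unfolding p(4) k by simp
  thus ?thesis using N(1) by simp
 qed
 thus ?thesis using p(1,2) vord_pos[OF V p(2,3)] by blast
qed

text \<open>\<open>x = x\<^bsup>Q\<^esup> - py\<close> with \<open>y\<close> integral, \<open>Q\<close> being the order of the residue field; so
  \<open>\<sigma>x - x = (\<sigma>x - x)\<^bsup>Q\<^esup> - p(\<sigma>y - y)\<close> is divisible by all powers of the uniformizer \<open>p\<close>.\<close>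

theorem inertia_trivial_if_value_group_eq:
 fixes L F V :: "'a::{field,finite} ac set"
 assumes F:"finab L F" and V:"place V" and rf:"rfinite V F"
  and p:"p:L" "p~=0" "vord V p > 0" "!!x. x:F ==> x~=0 ==> x:mx V ==> vord V p<=vord V x"
  and s:"sg:igrp V L" and x:"x:F"
 shows "sg x = x"
proof -
 note Li = finabD(1)[OF F] and f = ifield_sfield[OF finabD(2)[OF F]]
 have pF:"p:F" using p(1) finabD(3)[OF F] by blast
 have sD:"sg:dgrp V L" and sa:"sg:auts L" using igrpD(1)[OF s] dgrpD(1) by blast+
 note e = auts_endo[OF sa]
 obtain r where r:"r >= 1" "rfield V F = Fq r" using rf unfolding rfinite_def by blast
 define Q where "Q = CARD('a)^r"
 have Q2:"Q >= 2" unfolding Q_def using card_field_ge_2[where ?'a = 'a] r(1) self_le_power[of "CARD('a)" r] by linarith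
 have div:"z/p:V" if z:"z:F" "z:mx V" for z
  by(smt (verit) V divide_eq_0_iff p(4) place_0 vord_divide vord_nonneg_iff z(1,2))
 have pV:"p:V" using vord_nonneg_iff[OF V p(2)] p(3) by simp
 have ring_eq:"(a-p*b)-(c-p*d) = (a - c)-p*(b-d)" for a b c d by(simp add: algebra_simps)
 have main:"(sg x-x)/p^Suc j:V" if "x:F" "x:V" for j x
  using that
 proof (induction j arbitrary: x)
  case 0
  have "sg x-x:mx V" by(metis "0.prems"(2) Li V dgrpD(2) dgrp_res igrpD(2) res_Fqbar res_eq_iff s sD)
  thus ?case using div[OF sfield_diff[OF f finabD(4)[OF F sa 0(1)] 0(1)]] by simp
 next
  case (Suc j)
  note xF = Suc.prems(1) and xV = Suc.prems(2)
  define y where "y = (x^Q-x)/p"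
  have "x^Q-x:mx V" by(metis Fq_iff Q_def V place_power r(2) res_eq_iff res_power rfieldI xF xV)
  hence yV:"y:V" unfolding y_def by(rule div[OF sfield_diff[OF f sfield_power[OF f xF] xF]])
  have yF:"y:F" unfolding y_def by(intro sfield_intros[OF f] xF pF)
  have xy:"x = x^Q-p*y" using p(2) by(simp add: y_def)
  have "sg x = sg x^Q-p*sg y"
   using arg_cong[OF xy, of sg] auts_fix[OF sa p(1)] by(simp add: endo_diff[OF e] endo_mult[OF e] endo_power[OF e])
  moreover have "(sg x-x)^Q = sg x^Q-x^Q" unfolding Q_def by(rule endo_diff[OF endo_frob])
  ultimately have eq:"sg x-x = (sg x-x)^Q-p*(sg y-y)" using xy
  by(metis (no_types) ring_eq)
  let ?w = "(sg x-x)/p^Suc j"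
  have w:"?w:V" by(rule Suc.IH[OF xF xV])
  \<comment> \<open>As \<open>Q >= 2\<close>, the \<open>Q\<close>-th power turns \<open>j+1\<close>
    factors \<open>p\<close> into at least \<open>j+2\<close>.\<close>
  have "(sg x-x)^Q/p^Suc (Suc j) = ?w^Q*p^(Suc j*Q-Suc (Suc j))"
  proof -
   have "Suc j*2<=Suc j*Q" using Q2 by(rule mult_le_mono2)
   hence le:"Suc (Suc j)<=Suc j*Q" by(rule order_trans[rotated]) simp
   have "(sg x-x)^Q = (?w*p^Suc j)^Q" using p(2) by simp
   hence "(sg x-x)^Q = ?w^Q*p^(Suc j*Q)" by(simp only: power_mult_distrib power_mult)
   moreover have "p^(Suc j*Q) = p^(Suc j*Q-Suc (Suc j))*p^Suc (Suc j)"
    by(simp only: power_add[symmetric] le_add_diff_inverse2[OF le])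
   ultimately show ?thesis using p(2) by simp
  qed
  hence 1:"(sg x-x)^Q/p^Suc (Suc j):V" using place_mult[OF V place_power[OF V w] place_power[OF V pV]] by simp
  have 2:"(sg y-y)/p^Suc j:V" by(rule Suc.IH[OF yF yV])
  have "(sg x-x)/p^Suc (Suc j) = (sg x-x)^Q/p^Suc (Suc j)-(sg y-y)/p^Suc j"
   by(subst eq) (use p(2) in \<open>simp add: diff_divide_distrib\<close>)
  thus ?case using place_diff[OF V 1 2] by simp
 qed
 have fixV:"sg x = x" if xx:"x:F" "x:V" for x
 proof (rule ccontr)
  assume ne:"sg x~=x"
  obtain j :: nat where j:"real j > vord V (sg x-x)/vord V p" using reals_Archimedean2 by blast
  have "vord V ((sg x-x)/p^Suc j) >= 0" using vord_nonneg_iff[OF V, of "(sg x-x)/p^Suc j"] main[OF xx, of j] ne p(2) by simp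
  hence "vord V (sg x-x) >= real (Suc j)*vord V p"
   using vord_divide[OF V, of "sg x-x" "p^Suc j"] vord_power[OF V p(2), of "Suc j"] ne p(2) by simp
  moreover have "real j*vord V p > vord V (sg x-x)" using j p(3) by(simp add: field_simps)
  moreover have "real (Suc j)*vord V p = real j*vord V p+vord V p" by(simp add: algebra_simps)
  ultimately show False using p(3) by linarith
 qed
 show ?thesis
 proof (cases "x:V")
  case False
  hence "sg (inverse x) = inverse x" using place_total[OF V, of x] fixV[OF sfield_inverse[OF f x]] by blast
  thus ?thesis by(simp add: endo_inverse[OF e])
 qed (rule fixV[OF x])
qed

text \<open>\<open>W\<close> is the inertia field inside \<open>B\<close>. The product
  \<open>z\<close> of the images of \<open>x\<close> under inertia lies in \<open>W\<close> and has
  the value on the left; as inertia is trivial on \<open>W\<close>, its values are those of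
  \<open>\<kk>\<close>, which are integers.\<close>

theorem card_inertia_mult_vord:
 assumes B:"finab \<kk> B" and V:"place V" and x:"x:B" "x~=0"
 shows "EX i::int. real (card (rgrp (igrp V \<kk>) B))*vord V x = of_int i"
proof -
 note b = ifield_sfield[OF finabD(2)[OF B]]
 define G where "G = rgrp (igrp V \<kk>) B"
 have sub:"igrp V \<kk><=auts \<kk>" using igrp_auts by blast
 have fG:"finite G" unfolding G_def using finite_subset[OF rgrp_mono[OF sub] finabD(7)[OF B]] .
 define W where "W = {x:B. ALL sg:igrp V \<kk>. sg x = x}"
 have "ifield W"
 proof (rule ifieldI)
  show "\<kk><=W" unfolding W_def using finabD(3)[OF B] auts_fix igrp_auts by blast
  fix u v assume "u:W" "v:W"
  hence uv:"u:B" "v:B" "!!sg. sg:igrp V \<kk> ==> sg u = u" "!!sg. sg:igrp V \<kk> ==> sg v = v"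
   unfolding W_def by blast+
  have "sg (u-v) = u-v & sg (u*v) = u*v" if "sg:igrp V \<kk>" for sg
   using uv(3,4)[OF that] by(simp add: endo_diff[OF auts_endo[OF igrp_auts[OF that]]] endo_mult[OF auts_endo[OF igrp_auts[OF that]]])
  thus "u-v:W" "u*v:W" unfolding W_def using sfield_diff[OF b uv(1,2)] sfield_mult[OF b uv(1,2)] by blast+
 qed
 moreover have "W<=B" unfolding W_def by blast
 ultimately have W:"finab \<kk> W" using finab_mid(1)[OF B] ifield_kk by blast
 define z where "z = (PROD g:G. g x)"
 have gG:"EX sg:igrp V \<kk>. g x = sg x" if "g:G" for g
  using rgrpE[OF that[unfolded G_def]] x(1) by force
 have zB:"z:B" unfolding z_def
  by(rule sfield_prod[OF b]) (use gG finabD(4)[OF B igrp_auts x(1)] in metis)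
 have st:"stable (igrp V \<kk>) B" by(rule stable_mono[OF stable_finab[OF B] sub])
 have zW:"z:W"
  unfolding W_def using zB trace_norm_invariant(2)[OF autgrp_igrp[OF ifield_kk_self] st fG[unfolded G_def] _ x(1)]
  unfolding z_def G_def by blast
 have nz:"g x~=0" if "g:G" for g using gG[OF that] endo_eq_0_iff[OF auts_endo[OF igrp_auts]] x(2) by metis
 have vz:"vord V z = real (card G)*vord V x"
 proof -
  have "vord V z = (SUM g:G. vord V (g x))" unfolding z_def by(rule vord_prod[OF V fG nz])
  also have "\<dots> = (SUM g:G. vord V x)"
   by(rule sum.cong[OF refl]) (use gG dgrp_vord[OF ifield_kk_self V igrpD(1) x(2)] in metis)
  finally show ?thesis by simp
 qed
 have z0:"z~=0" unfolding z_def using nz fG by simp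
 have tr:"trivial_on (igrp V \<kk>) W" unfolding W_def trivial_on_def by blast
 have rf:"rfinite V W" by(rule rfinite_finab[OF W V rfinite_kk[OF V]])
 obtain y where y:"y:\<kk>" "y~=0" "vord V y = vord V z"
  using value_group_eq_if_inertia_trivial[OF W V rf tr zW z0] by blast
 show ?thesis using vord_kk[OF V y(1,2)] unfolding y(3) vz G_def .
qed

section \<open>Ramification index and inertia degree\<close>

lemma (in ring) card_dimension:
 assumes K:"subfield K R" and d:"dimension n K E" and fin:"finite K"
 shows "card E = card K^n"
proof -
 obtain Vs where Vs:"set Vs <= carrier R" "independent K Vs" "length Vs = n" "Span K Vs = E"
  using exists_base[OF K d] by blast
 have "bij_betw (%Ks. combine Ks Vs) {Ks. set Ks<=K & length Ks = n} E"
  unfolding bij_betw_def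
 proof
  show im:"(%Ks. combine Ks Vs)`{Ks. set Ks<=K & length Ks = n} = E"
   using Span_eq_combine_set_length_version[OF K Vs(1)] unfolding Vs(3,4) by auto
  show "inj_on (%Ks. combine Ks Vs) {Ks. set Ks<=K & length Ks = n}"
  proof (rule inj_onI)
   fix Ks Ls assume h:"Ks:{Ks. set Ks<=K & length Ks = n}" "Ls:{Ks. set Ks<=K & length Ks = n}"
    "combine Ks Vs = combine Ls Vs"
   have "combine Ks Vs:Span K Vs" using im h(1) Vs(4) by blast
   from unique_decomposition[OF K Vs(2) this] show "Ks = Ls" using h Vs(3) by auto
  qed
 qed
 from bij_betw_same_card[OF this] show ?thesis using card_lists_length_eq[OF fin, of n] by simp
qed

lemma (in ring) finite_imp_dimension:
 assumes K:"subfield K R" and fin:"finite (carrier R)"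
 shows "EX n. dimension n K (carrier R)"
proof -
 obtain Us where Us:"set Us = carrier R" using finite_list[OF fin] by blast
 have "carrier R<=Span K Us" using Span_base_incl[OF K, of Us] Us by simp
 moreover have "Span K Us <= carrier R" using Span_in_carrier[OF subfieldE(3)[OF K], of Us] Us by simp
 ultimately show ?thesis using Span_finite_dimension[OF K, of Us] Us unfolding finite_dimension_def by simp
qed

lemma image_same_kernel:
 assumes "!!x y. x:A ==> y:A ==> f x = f y <-> g x = g y"
 shows "EX h. bij_betw h (f`A) (g`A)"
proof -
 let ?h = "%z. g (inv_into A f z)"
 have h:"?h (f x) = g x" if "x:A" for x
  using assms[OF inv_into_into[of "f x" f A] that] that f_inv_into_f[of "f x" f A] by simp
 have "?h`f`A = g`A" using h by(force simp: image_iff)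
 moreover have "inj_on ?h (f`A)" by(rule inj_onI) (use h assms in force)
 ultimately show ?thesis unfolding bij_betw_def by blast
qed

section \<open>Ideals of \<open>V Int F\<close> in terms of the valuation\<close>

context
 fixes V F :: "'a::{field,finite} ac set"
 assumes V:"place V" and F:"sfield F"
begin

lemma subring_place_Int:"subring (V Int F) \<Omega>"
 unfolding subring_\<Omega>_iff using place_1[OF V] sfield_1[OF F] place_diff[OF V] sfield_diff[OF F] place_mult[OF V] sfield_mult[OF F] by simp

lemma cring_place_Int:"cring (sub (V Int F))"
proof -
 interpret domain "\<Omega> :: 'a ac ring" using field_\<Omega> field.axioms(1) by blast
 have "domain (sub (V Int F))" by(rule subring_is_domain[OF subring_place_Int])
 thus ?thesis by(rule domain.axioms(1))
qed

lemma Units_place_Int:"Units (sub (V Int F)) = {x:F. unit_at V x}"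
proof
 show "Units (sub (V Int F))<={x:F. unit_at V x}"
 proof
  fix x assume "x:Units (sub (V Int F))"
  then obtain y where x:"x:V" "x:F" and y:"y:V" "y*x = 1" by(auto simp: Units_def)
  have "x~=0" using y(2) by auto
  moreover have "inverse x = y" using y(2) by(rule inverse_unique[of x y, unfolded mult.commute[of x]])
  ultimately have "unit_at V x" using x y(1) by(simp add: unit_at_iff[OF V])
  thus "x:{x:F. unit_at V x}" using x by simp
 qed
 show "{x:F. unit_at V x}<=Units (sub (V Int F))"
 proof
  fix x assume "x:{x:F. unit_at V x}"
  hence x:"x:F" "x~=0" "x:V" "inverse x:V" by(auto simp: unit_at_iff[OF V])
  have i:"inverse x:V Int F" "inverse x*x = 1" "x*inverse x = 1" using x sfield_inverse[OF F] by simp_all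
  have "EX y:V Int F. y*x = 1 & x*y = 1" by(rule bexI[OF _ i(1)]) (use i in simp)
  thus "x:Units (sub (V Int F))" unfolding Units_def using x by simp
 qed
qed

lemma max_ideal_place_Int:"max_ideal (V Int F) = mx V Int F"
 unfolding max_ideal_def Units_place_Int using mx_place[OF V] by(auto simp: unit_at_def)

lemma max_ideal_vord:"max_ideal (V Int F) = {x:F. x = 0 | vord V x > 0}"
 by(smt (verit, ccfv_SIG) Collect_cong Int_def V max_ideal_place_Int mx_0 vord_pos_iff)

lemma principal_ideal_vord:
 assumes a:"a:F" "a:V" "a~=0"
 shows "PIdl\<^bsub>sub (V Int F)\<^esub> a = {x:F. x = 0 | vord V a<=vord V x}"
proof
 have va:"vord V a >= 0" using vord_nonneg_iff[OF V a(3)] a(2) by simp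
 show "PIdl\<^bsub>sub (V Int F)\<^esub> a<={x:F. x = 0 | vord V a<=vord V x}"
 proof
  fix x assume "x:PIdl\<^bsub>sub (V Int F)\<^esub> a"
  then obtain y where y:"y:V" "y:F" "x = y*a" by(auto simp: cgenideal_def)
  have "vord V a<=vord V x" if "x~=0"
   using V that vord_mult vord_nonneg_iff y(1,3) by fastforce
  thus "x:{x:F. x = 0 | vord V a<=vord V x}" using sfield_mult[OF F y(2) a(1)] y(3) by auto
 qed
 show "{x:F. x = 0 | vord V a<=vord V x}<=PIdl\<^bsub>sub (V Int F)\<^esub> a"
 proof
  fix x assume x:"x:{x:F. x = 0 | vord V a<=vord V x}"
  have "x/a:V"
   by(smt (verit) V divide_eq_0_iff mem_Collect_eq place_0 vord_divide vord_nonneg_iff x)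
  moreover have "x/a:F" using x sfield_divide[OF F _ a(1)] by blast
  moreover have "x = x/a*a" using a(3) by simp
  ultimately have "EX y. x = y*a & y:V Int F" by blast
  thus "x:PIdl\<^bsub>sub (V Int F)\<^esub> a" by(simp add: cgenideal_def)
 qed
qed

lemma principal_ideal_eq:
 assumes a:"a:F" "a:V" "a~=0" and b:"b:F" "b:V" "b~=0"
 shows "PIdl\<^bsub>sub (V Int F)\<^esub> a = PIdl\<^bsub>sub (V Int F)\<^esub> b <-> vord V a = vord V b"
 unfolding principal_ideal_vord[OF a] principal_ideal_vord[OF b]
 by(smt (verit) Collect_cong assms(1,3) b(1,3) mem_Collect_eq)

end

definition uniformizer :: "'a::{field,finite} ac set => 'a ac set => 'a ac => bool" where
 "uniformizer V F p <-> p:F & p~=0 & vord V p > 0 & (ALL x:F. x~=0 --> x:mx V --> vord V p<=vord V x)"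

lemma uniformizerD:
 assumes "uniformizer V F p"
 shows "p:F" "p~=0" "vord V p > 0" "!!x. x:F ==> x~=0 ==> x:mx V ==> vord V p<=vord V x"
 using assms unfolding uniformizer_def by blast+

context
 fixes V F L :: "'a::{field,finite} ac set" and p pL :: "'a ac"
 assumes V:"place V" and F:"sfield F" and L:"sfield L" "L<=F"
  and p:"uniformizer V F p" and pL:"uniformizer V L pL"
begin

lemma uniformizer_power:
 assumes x:"x:F" "x~=0" "x:V"
 shows "EX k::nat. vord V x = real k*vord V p"
proof -
 note p = uniformizerD[OF p]
 have v:"vord V x >= 0" using vord_nonneg_iff[OF V x(2)] x(3) by simp
 define k where "k = nat \<lfloor>vord V x/vord V p\<rfloor>"
 have "real k<=vord V x/vord V p" "vord V x/vord V p < real k+1"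
  unfolding k_def using v p(3) by(simp_all add: floor_less_cancel)
 hence k:"real k*vord V p<=vord V x" "vord V x < real k*vord V p+vord V p"
  using p(3) by(simp_all add: field_simps)
 define y where "y = x/p^k"
 have y0:"y~=0" unfolding y_def using x(2) p(2) by simp
 have vy:"vord V y = vord V x-real k*vord V p"
  unfolding y_def using vord_divide[OF V x(2), of "p^k"] vord_power[OF V p(2), of k] p(2) by simp
 have yF:"y:F" unfolding y_def by(intro sfield_divide[OF F] sfield_power[OF F] x(1) p(1))
 have "y~:mx V"
  using k(2) p(4) vy y0 yF by force
 thus ?thesis by(smt (verit) V k(1) vord_pos_iff vy y0)
qed

text \<open>The maximal ideal of \<open>V Int L\<close> generates the principal ideal of
  \<open>pL\<close>, and principal ideals are compared by the value of a generator. So the exponent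
  in the definition is the ratio of the two least positive values.\<close>

lemma ramification_index_eq:
 assumes e:"vord V pL = real e*vord V p"
 shows "ramification_index L (V Int F) = e"
proof -
 note p = uniformizerD[OF p] and q = uniformizerD[OF pL]
 interpret R: cring "sub (V Int F)" by(rule cring_place_Int[OF V F])
 let ?R = "sub (V Int F)"
 have pV:"p:V" "pL:V" using p(2,3) q(2,3) vord_nonneg_iff[OF V] by(metis less_imp_le)+
 have qF:"pL:F" using q(1) L(2) by blast
 have VL:"V Int F Int L = V Int L" using L(2) by blast
 have pm:"PIdl\<^bsub>?R\<^esub> p = max_ideal (V Int F)"
  unfolding principal_ideal_vord[OF V F p(1) pV(1) p(2)] max_ideal_vord[OF V F]
  by(smt (verit, ccfv_SIG) Collect_cong V p(3,4) vord_pos_iff)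
 have I:"Idl\<^bsub>?R\<^esub> (max_ideal (V Int F Int L)) = PIdl\<^bsub>?R\<^esub> pL"
 proof
  show "Idl\<^bsub>?R\<^esub> (max_ideal (V Int F Int L))<=PIdl\<^bsub>?R\<^esub> pL"
  proof (rule R.genideal_minimal)
   show "ideal (PIdl\<^bsub>?R\<^esub> pL) ?R" by(rule R.cgenideal_ideal) (use pV qF in simp)
   show "max_ideal (V Int F Int L)<=PIdl\<^bsub>?R\<^esub> pL"
    unfolding VL max_ideal_place_Int[OF V L(1)] principal_ideal_vord[OF V F qF pV(2) q(2)] using q(4) L(2) by blast
  qed
  have sub:"max_ideal (V Int F Int L) <= carrier ?R"
   unfolding VL max_ideal_place_Int[OF V L(1)] using mx_place[OF V] L(2) by auto
  have "pL:max_ideal (V Int F Int L)" unfolding VL max_ideal_vord[OF V L(1)] using q by simp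
  hence "pL:Idl\<^bsub>?R\<^esub> (max_ideal (V Int F Int L))" using R.genideal_self[OF sub] by blast
  thus "PIdl\<^bsub>?R\<^esub> pL<=Idl\<^bsub>?R\<^esub> (max_ideal (V Int F Int L))"
   by(rule R.cgenideal_minimal[OF R.genideal_ideal[OF sub]])
 qed
 have key:"PIdl\<^bsub>?R\<^esub> pL = PIdl\<^bsub>?R\<^esub> (pp^e') <-> vord V pL = real e'*vord V pp" if h:"pp:F" "pp:V" "pp~=0" for pp e'
  using principal_ideal_eq[OF V F qF pV(2) q(2) sfield_power[OF F h(1)] place_power[OF V h(2)], of e'] h(3)
   vord_power[OF V h(3), of e'] by simp
 show ?thesis
  unfolding ramification_index_def I
 proof (rule the_equality)
  show "EX pp:V Int F. PIdl\<^bsub>?R\<^esub> pp = max_ideal (V Int F) & PIdl\<^bsub>?R\<^esub> pL = PIdl\<^bsub>?R\<^esub> (pp^e)"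
   using pm key[OF p(1) pV(1) p(2)] e p(1) pV(1) by blast
  fix e' assume "EX pp:V Int F. PIdl\<^bsub>?R\<^esub> pp = max_ideal (V Int F) & PIdl\<^bsub>?R\<^esub> pL = PIdl\<^bsub>?R\<^esub> (pp^e')"
  then obtain pp where pi:"pp:V" "pp:F" "PIdl\<^bsub>?R\<^esub> pp = PIdl\<^bsub>?R\<^esub> p" "PIdl\<^bsub>?R\<^esub> pL = PIdl\<^bsub>?R\<^esub> (pp^e')"
   unfolding pm by blast
  have "pp~=0"
  proof
   assume "pp = 0"
   hence "PIdl\<^bsub>?R\<^esub> pp<={0}" by(auto simp: cgenideal_def)
   moreover have "p:PIdl\<^bsub>?R\<^esub> p" by(rule R.cgenideal_self) (use p(1) pV in simp)
   ultimately show False using pi(3) p(2) by blast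
  qed
  hence "vord V pp = vord V p" using principal_ideal_eq[OF V F pi(2,1) _ p(1) pV(1) p(2)] pi(3) by blast
  hence "real e'*vord V p = real e*vord V p" using key[OF pi(2,1) `pp ~= 0`, of e'] pi(4) e by(simp only: simp_thms)
  thus "e' = e" using p(3) by auto
 qed
qed

end

text \<open>Index \<open>1\<close> means that a uniformizer of \<open>L\<close> is one of
  \<open>F\<close>. The two implications are \<open>inertia_trivial_if_value_group_eq\<close> and
  \<open>value_group_eq_if_inertia_trivial\<close>.\<close>

theorem ramification_index_eq_1_iff:
 assumes F:"finab L F" and V:"place V" and d:"discrete V L" and rf:"rfinite V L"
 shows "ramification_index L (V Int F) = 1 <-> trivial_on (igrp V L) F"
proof -
 note Li = finabD(1)[OF F] and Fi = finabD(2)[OF F]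
 note f = ifield_sfield[OF Fi] and l = ifield_sfield[OF Li]
 have dF:"discrete V F" by(rule discrete_finab[OF F V d])
 have rF:"rfinite V F" by(rule rfinite_finab[OF F V rf])
 obtain p where p:"uniformizer V F p"
  using ex_uniformizer[OF V ifield_kk[OF Fi] dF] unfolding uniformizer_def by blast
 obtain pL where pL:"uniformizer V L pL"
  using ex_uniformizer[OF V ifield_kk[OF Li] d] unfolding uniformizer_def by blast
 note p' = uniformizerD[OF p] and q = uniformizerD[OF pL]
 have qF:"pL:F" using q(1) finabD(3)[OF F] by blast
 have qV:"pL:V" "pL:mx V" using q(2,3) vord_nonneg_iff[OF V q(2)] vord_pos_iff[OF V q(2)] by auto
 obtain e where e:"vord V pL = real e*vord V p"
  using uniformizer_power[OF V f l finabD(3)[OF F] p pL qF q(2) qV(1)] by blast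
 have ram:"ramification_index L (V Int F) = e" by(rule ramification_index_eq[OF V f l finabD(3)[OF F] p pL e])
 show ?thesis unfolding ram
 proof
  assume "e = 1"
  hence eq:"vord V pL = vord V p" using e by simp
  have min:"!!x. x:F ==> x~=0 ==> x:mx V ==> vord V pL<=vord V x" unfolding eq by(rule p'(4))
  show "trivial_on (igrp V L) F"
   unfolding trivial_on_def
   using inertia_trivial_if_value_group_eq[where p = pL and V = V and L = L and F = F, OF F V rF q(1,2,3) min] by blast
 next
  assume "trivial_on (igrp V L) F"
  from value_group_eq_if_inertia_trivial[OF F V rF this p'(1,2)]
  obtain y where y:"y:L" "y~=0" "vord V y = vord V p" by blast
  have "y:mx V" using vord_pos_iff[OF V y(2)] y(3) p'(3) by simp
  hence "vord V pL<=vord V p" using q(4)[OF y(1,2)] y(3) by simp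
  moreover have "vord V p<=vord V pL" by(rule p'(4)[OF qF q(2) qV(2)])
  ultimately have "real e*vord V p = 1*vord V p" using e by simp
  thus "e = 1" using p'(3) by simp
 qed
qed

text \<open>Cosets of the maximal ideal correspond to residues, so the quotient has
  \<open>q^s\<close> elements and the image of \<open>V Int L\<close> has \<open>q^r\<close>. A
  vector space of dimension \<open>n\<close> over the latter has \<open>(q^r)^n\<close>
  elements.\<close>

theorem inertia_degree_eq:
 fixes V F L :: "'a::{field,finite} ac set"
 assumes V:"place V" and F:"sfield F" and L:"sfield L" "L<=F"
  and s:"rfield V F = Fq s" "s >= 1" and r:"rfield V L = Fq r" "r >= 1"
 shows "inertia_degree L (V Int F)*r = s"
proof -
 let ?Q = "V Int F"
 let ?R = "sub ?Q"
 define I where "I = max_ideal ?Q"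
 have Ieq:"I = mx V Int F" unfolding I_def by(rule max_ideal_place_Int[OF V F])
 interpret R: cring ?R by(rule cring_place_Int[OF V F])
 have aminus:"\<ominus>\<^bsub>?R\<^esub> x =-x" if "x:?Q" for x
  by(rule R.minus_equality) (use that place_uminus[OF V] sfield_uminus[OF F] in simp_all)
 have I:"ideal I ?R"
 proof (rule idealI[OF R.ring_axioms])
  show "subgroup I (add_monoid ?R)"
  proof (rule R.add.subgroupI)
   show "I <= carrier ?R" "I~={}" using mx_place[OF V] mx_0[OF V] sfield_0[OF F] unfolding Ieq by auto
   fix a assume a:"a:I"
   hence "- a:I" unfolding Ieq using mx_uminus[OF V] sfield_uminus[OF F] by blast
   moreover have "a:?Q" using a mx_place[OF V] unfolding Ieq by blast
   ultimately show "\<ominus>\<^bsub>?R\<^esub> a:I" using aminus by simp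
   fix b assume "b:I"
   thus "a \<oplus>\<^bsub>?R\<^esub> b:I" using a mx_add[OF V] sfield_add[OF F] unfolding Ieq by simp
  qed
  fix a x assume "a:I" "x:carrier ?R"
  hence "x*a:I" "a*x:I" using mx_mult[OF V] mx_mult2[OF V] sfield_mult[OF F] unfolding Ieq by auto
  thus "x \<otimes>\<^bsub>?R\<^esub> a:I" "a \<otimes>\<^bsub>?R\<^esub> x:I" by simp_all
 qed
 interpret I: ideal I ?R by(rule I)
 have "maximalideal I ?R"
 proof (rule maximalidealI[OF I])
  have "1~:I" unfolding Ieq using mx_1[OF V] by simp
  thus "carrier ?R~=I" using place_1[OF V] sfield_1[OF F] by auto
  fix J assume J:"ideal J ?R" "I<=J" "J <= carrier ?R"
  interpret J: ideal J ?R by(rule J(1))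
  show "J = I | J = carrier ?R"
  proof (cases "J<=I")
   case False
   then obtain x where x:"x:J" "x~:I" by blast
   hence xQ:"x:V" "x:F" "x~:mx V" using J(3) unfolding Ieq by auto
   hence "unit_at V x" by(simp add: unit_at_def)
   hence "x~=0" "inverse x:V" by(simp_all add: unit_at_iff[OF V])
   moreover have "inverse x:F" by(rule sfield_inverse[OF F xQ(2)])
   ultimately have "inverse x \<otimes>\<^bsub>?R\<^esub> x:J" using J.I_l_closed[OF x(1), of "inverse x"] by simp
   hence "\<one>\<^bsub>?R\<^esub>:J" using `x ~= 0` by simp
   thus ?thesis using J.one_imp_carrier by blast
  qed (use J(2) in blast)
 qed
 hence field:"field (?R Quot I)" by(rule maximalideal.quotient_is_field[OF _ R.cring_axioms])
 interpret Q: Ring.field "?R Quot I" by(rule field)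
 let ?h = "%x. I +>\<^bsub>?R\<^esub> x"
 have carr:"carrier (?R Quot I) = ?h`?Q"
  by(auto simp: FactRing_def A_RCOSETS_def' a_r_coset_def)
 have ker:"?h x = ?h y <-> res V x = res V y" if h:"x:?Q" "y:?Q" for x y
 proof -
  have "x \<ominus>\<^bsub>?R\<^esub> y = x-y" using aminus[OF h(2)] by(simp add: a_minus_def)
  moreover have "x-y:I <-> x-y:mx V" unfolding Ieq using sfield_diff[OF F] h by blast
  ultimately show ?thesis using R.quotient_eq_iff_same_a_r_cos[OF I, of x y] res_eq_iff[OF V] h by simp
 qed
 obtain h1 where h1:"bij_betw h1 (?h`?Q) (res V`?Q)" using image_same_kernel[of ?Q ?h "res V"] ker by blast
 obtain h2 where h2:"bij_betw h2 (?h`(?Q Int L)) (res V`(?Q Int L))"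
  using image_same_kernel[of "?Q Int L" ?h "res V"] ker by blast
 have QL:"?Q Int L = V Int L" using L(2) by blast
 have cR:"card (carrier (?R Quot I)) = CARD('a)^s" "finite (carrier (?R Quot I))"
  unfolding carr using bij_betw_same_card[OF h1] bij_betw_finite[OF h1] s card_Fq[OF s(2)] finite_Fq[OF s(2)] by(simp_all add: rfield_def)
 let ?K = "?h`(?Q Int L)"
 have cK:"card ?K = CARD('a)^r" "finite ?K"
  using bij_betw_same_card[OF h2] bij_betw_finite[OF h2] r card_Fq[OF r(2)] finite_Fq[OF r(2)] by(simp_all add: rfield_def QL)
 interpret hom: ring_hom_ring ?R "?R Quot I" ?h by(rule I.rcos_ring_hom_ring)
 have K:"subfield ?K (?R Quot I)"
 proof (rule Q.subfieldI')
  have "subring (?Q Int L) ?R"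
   unfolding QL
   by(intro R.subringI) (auto simp: aminus subsetD[OF L(2)] intro: place_mult[OF V] place_add[OF V] place_uminus[OF V] place_1[OF V]
     sfield_mult[OF L(1)] sfield_add[OF L(1)] sfield_uminus[OF L(1)] sfield_1[OF L(1)] subsetD[OF L(2)])
  thus "subring ?K (?R Quot I)" by(rule hom.img_is_subring)
  fix k assume k:"k:?K-{\<zero>\<^bsub>?R Quot I\<^esub>}"
  then obtain x where x:"x:V" "x:L" "k = ?h x" by blast
  have xF:"x:F" using x(2) L(2) by blast
  have xQ:"x:carrier ?R" using x xF by simp
  have "x~:mx V"
  proof
   assume "x:mx V"
   hence "x:I" using xF unfolding Ieq by blast
   hence "k = \<zero>\<^bsub>?R Quot I\<^esub>" using x(3) I.a_rcos_const by(simp add: FactRing_def)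
   thus False using k by blast
  qed
  hence "unit_at V x" using x(1) by(simp add: unit_at_def)
  hence y:"inverse x:V" "x~=0" by(simp_all add: unit_at_iff[OF V])
  have yL:"inverse x:L" by(rule sfield_inverse[OF L(1) x(2)])
  hence yQ:"inverse x:carrier ?R" using y L(2) by auto
  have "k \<otimes>\<^bsub>?R Quot I\<^esub> ?h (inverse x) = ?h (x \<otimes>\<^bsub>?R\<^esub> inverse x)" unfolding x(3) by(rule hom.hom_mult[OF xQ yQ, symmetric])
  also have "\<dots> = \<one>\<^bsub>?R Quot I\<^esub>" using y(2) hom.hom_one by simp
  finally have "inv\<^bsub>?R Quot I\<^esub> k = ?h (inverse x)"
   using Q.comm_inv_char[of k "?h (inverse x)"] hom.hom_closed[OF xQ] hom.hom_closed[OF yQ] x(3) by simp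
  thus "inv\<^bsub>?R Quot I\<^esub> k:?K" using y yL L(2) by auto
 qed
 obtain n where n:"Q.dimension n ?K (carrier (?R Quot I))" using Q.finite_imp_dimension[OF K cR(2)] by blast
 have "CARD('a)^s = (CARD('a)^r)^n" using Q.card_dimension[OF K n cK(2)] cR(1) cK(1) by simp
 hence "CARD('a)^s = CARD('a)^(r*n)" by(simp add: power_mult)
 hence "s = r*n" using card_field_ge_2[where ?'a = 'a] power_inject_exp[of "CARD('a)" s "r*n"] by simp
 moreover have "inertia_degree L ?Q = n"
  unfolding inertia_degree_def Let_def I_def[symmetric] using Q.dimI[OF K n] by(simp add: over_def)
 ultimately show ?thesis by simp
qed

section \<open>Unramified and fully decomposed extensions\<close>

lemma place_Int_prime:
 assumes V:"place V" and F:"ifield F"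
 shows "V Int F:primes_of F"
proof -
 note f = ifield_sfield[OF F]
 have "V Int F~=F" using kk_not_subset_place[OF V] ifield_kk[OF F] by blast
 moreover have "cst a:V Int F" for a using place_cst[OF V] cst_kk ifield_kk[OF F] by blast
 moreover have "x:V Int F | inverse x:V Int F" if "x:F" for x
  using place_total[OF V, of x] sfield_inverse[OF f that] that by blast
 ultimately show ?thesis
  unfolding primes_of_iff
  using place_1[OF V] sfield_1[OF f] place_diff[OF V] sfield_diff[OF f] place_mult[OF V] sfield_mult[OF f] by auto
qed

definition infinite_place :: "'a::{field,finite} ac set => bool" where
 "infinite_place V <-> place V & \<TT>~:V"

lemma infinite_placeD:"infinite_place V ==> place V" "infinite_place V ==> \<TT>~:V"
 by(auto simp: infinite_place_def)

text \<open>\<open>\<TT>\<close> has negative value and nonzero constants have value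
  \<open>0\<close>, so in Horner form the term with \<open>\<TT>\<close> dominates.\<close>

lemma vord_polynomial:
 assumes V:"infinite_place V" and a:"a~=0"
 shows "to_ac (Fract a 1)~=0 & vord V (to_ac (Fract a 1)) = real (pdeg a)*vord V \<TT>"
 using a
proof (induction a)
 case (pCons b a)
 note P = infinite_placeD(1)[OF V]
 have Tneg:"vord V \<TT> < 0" using vord_nonneg_iff[OF P T_neq_0] infinite_placeD(2)[OF V] by auto
 have "Fract (pCons b a) 1 = Fract [:b:] 1+Fract [:0, 1:] 1*Fract a 1" by simp
 hence eq:"to_ac (Fract (pCons b a) 1) = \<TT>*to_ac (Fract a 1) + cst b"
  by(simp only: to_ac_add to_ac_mult cst_def \<TT>_def add.commute)
 have c0:"cst b~=0 & vord V (cst b) = 0" if "b~=0"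
  by(metis P cst_eq_iff cst_inverse cst_simps(1) place_cst that unit_at_iff vord_unit)
 show ?case
 proof (cases "a = 0")
  case True
  hence "to_ac (Fract (pCons b a) 1) = cst b" unfolding eq by(simp add: fract_collapse)
  thus ?thesis using c0 pCons.prems True by auto
 next
  case False
  let ?A = "to_ac (Fract a 1)"
  have A:"?A~=0" "vord V ?A = real (pdeg a)*vord V \<TT>" using pCons.IH[OF False] by blast+
  have TA:"\<TT>*?A~=0" "vord V (\<TT>*?A) = real (pdeg (pCons b a))*vord V \<TT>"
   using A(1) T_neq_0 vord_mult[OF P T_neq_0 A(1)] False unfolding A(2) by(simp_all add: algebra_simps)
  show ?thesis
  proof (cases "b = 0")
   case True
   thus ?thesis unfolding eq using TA by(simp add: cst_simps)
  next
   case b: False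
   have neg:"vord V (\<TT>*?A) < vord V (cst b)" unfolding TA(2) using c0[OF b] Tneg False by(simp add: mult_pos_neg)
   show ?thesis unfolding eq using vord_add_eq[OF P TA(1) _ neg] c0[OF b] TA(2) by simp
  qed
 qed
qed simp

text \<open>At a pole of \<open>\<TT>\<close> the value of a nonzero fraction is a positive multiple
  of the degree of its denominator minus that of its numerator.\<close>

lemma infinite_place_iff:
 fixes V :: "'a::{field,finite} ac set"
 assumes V:"place V"
 shows "V Int \<kk> = P_infty <-> infinite_place V"
proof
 assume eq:"V Int \<kk> = P_infty"
 have "\<TT>~:V"
 proof
  assume "\<TT>:V"
  hence "(\<TT> :: 'a ac):P_infty" using eq T_kk by blast
  hence "EX f g. (\<TT> :: 'a ac) = to_ac (Fract f g) & g~=0 & pdeg f<=pdeg (g :: 'a poly)"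
   unfolding P_infty_def by simp
  then obtain f g :: "'a poly" where fg:"\<TT> = to_ac (Fract f g)" "g~=0" "pdeg f<=pdeg g"
   by(elim exE conjE)
  have "Fract [:0, 1:] 1 = Fract f g" using fg(1) unfolding \<TT>_def by(simp only: to_ac_eq_iff)
  hence "[:0, 1:]*g = f" using fg(2) by(simp add: eq_fract)
  moreover have "pdeg ([:0, 1:]*g) = Suc (pdeg g)" using fg(2) by simp
  ultimately show False using fg(3) by simp
 qed
 thus "infinite_place V" using V by(simp add: infinite_place_def)
next
 assume I:"infinite_place V"
 have Tneg:"vord V \<TT> < 0" using vord_nonneg_iff[OF V T_neq_0] infinite_placeD(2)[OF I] by auto
 have key:"to_ac (Fract f g):V <-> f = 0 | pdeg f<=pdeg g" if g:"g~=0" for f g :: "'a poly"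
 proof (cases "f = 0")
  case True
  thus ?thesis using place_0[OF V] by(simp add: fract_collapse)
 next
  case False
  have "Fract f g = Fract f 1/Fract g 1" using g by(simp add: divide_fract)
  hence eq:"to_ac (Fract f g) = to_ac (Fract f 1)/to_ac (Fract g 1)" by(simp only: to_ac_divide)
  note f' = vord_polynomial[OF I False] and g' = vord_polynomial[OF I g]
  have nz:"to_ac (Fract f g)~=0" unfolding eq using f' g' by simp
  have "vord V (to_ac (Fract f g)) = (real (pdeg f)-real (pdeg g))*vord V \<TT>"
   unfolding eq using vord_divide[OF V conjunct1[OF f'] conjunct1[OF g']] f' g' by(simp add: algebra_simps)
  hence "vord V (to_ac (Fract f g)) >= 0 <-> pdeg f<=pdeg g"
   using Tneg by(simp add: zero_le_mult_iff)
  thus ?thesis using vord_nonneg_iff[OF V nz] False by simp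
 qed
 show "V Int \<kk> = P_infty"
 proof
  show "V Int \<kk><=P_infty"
  proof
   fix x assume "x:V Int \<kk>"
   then obtain z where z:"x = to_ac z" "x:V" unfolding \<kk>_def by blast
   obtain f g where fg:"z = Fract f g" "g~=0" by(cases z)
   have "f = 0 | pdeg f<=pdeg g" using key[OF fg(2)] z fg(1) by blast
   hence "pdeg f<=pdeg g" by auto
   thus "x:P_infty" unfolding P_infty_def z(1) fg(1) using fg(2) by blast
  qed
  show "P_infty<=V Int \<kk>" unfolding P_infty_def \<kk>_def using key by blast
 qed
qed

lemma S_infty_iff:
 assumes F:"ifield F"
 shows "P:S_infty F <-> (EX V. infinite_place V & P = V Int F)"
proof
 assume P:"P:S_infty F"
 hence "P:primes_of F" "P Int \<kk> = P_infty" by(auto simp: S_infty_def)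
 moreover obtain V where V:"place V" "V Int F = P" using extend_prime[OF ifield_sfield[OF F] calculation(1)] by blast
 ultimately have "V Int \<kk> = P_infty" using ifield_kk[OF F] by blast
 thus "EX V. infinite_place V & P = V Int F" using infinite_place_iff[OF V(1)] V(2) by blast
next
 assume "EX V. infinite_place V & P = V Int F"
 then obtain V where V:"infinite_place V" "P = V Int F" by blast
 have "P Int \<kk> = P_infty" using infinite_place_iff[OF infinite_placeD(1)[OF V(1)]] V ifield_kk[OF F] by blast
 thus "P:S_infty F" using place_Int_prime[OF infinite_placeD(1)[OF V(1)] F] V(2) by(simp add: S_infty_def)
qed

lemma unramified_iff:
 fixes L E :: "'a::{field,finite} ac set"
 assumes L:"finab \<kk> L" and E:"finab L E"
 shows "unramified L E <-> (ALL V. place V --> trivial_on (igrp V L) E)"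
proof -
 note Ei = finabD(2)[OF E]
 have *: "ramification_index L (V Int E) = 1 <-> trivial_on (igrp V L) E" if V:"place V" for V
  by(rule ramification_index_eq_1_iff[OF E V discrete_finab[OF L V discrete_kk[OF V]] rfinite_finab[OF L V rfinite_kk[OF V]]])
 show ?thesis
 proof
  assume u:"unramified L E"
  show "ALL V. place V --> trivial_on (igrp V L) E"
   using "*" Ei place_Int_prime u unramified_def by blast
 next
  assume t:"ALL V. place V --> trivial_on (igrp V L) E"
  show "unramified L E"
   unfolding unramified_def
  proof
   fix Q assume "Q:primes_of E"
   then obtain V where "place V" "V Int E = Q" using extend_prime[OF ifield_sfield[OF Ei]] by blast
   thus "ramification_index L Q = 1" using t * by blast
  qed
 qed
qed

text \<open>The primes of \<open>E\<close> above that of \<open>L\<close> are conjugate, so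
  \<open>?f\<close> maps the Galois group onto them. Their number equals the degree iff
  \<open>?f\<close> is injective, that is, iff only the identity preserves the prime.\<close>

lemma decomposes_fully_iff:
 fixes L E V :: "'a::{field,finite} ac set"
 assumes E:"finab L E" and V:"place V"
 shows "decomposes_fully L E (V Int L) <-> trivial_on (dgrp V L) E"
proof -
 note Li = finabD(1)[OF E] and Ei = finabD(2)[OF E] and LE = finabD(3)[OF E]
 define PS where "PS = {Q:primes_of E. Q Int L = V Int L}"
 define Ga where "Ga = rgrp (auts L) E"
 have fG:"finite Ga" unfolding Ga_def by(rule finabD(7)[OF E])
 let ?f = "%g. {x:E. g x:V}"
 have f:"?f (restrict sg E) = sg -` V Int E" for sg by auto
 have PS:"PS = ?f`Ga"
 proof
  show "PS<=?f`Ga"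
  proof
   fix Q assume "Q:PS"
   hence Q:"Q:primes_of E" "Q Int L = V Int L" by(auto simp: PS_def)
   obtain V' where V':"place V'" "V' Int E = Q" using extend_prime[OF ifield_sfield[OF Ei] Q(1)] by blast
   have "V' Int L = V Int L" using V'(2) Q(2) LE by blast
   from places_conjugate[OF Li V'(1) V this] obtain ta where t:"ta:auts L" "ta -` V = V'" by blast
   have "Q = ?f (restrict ta E)" unfolding f t(2) using V'(2) by simp
   thus "Q:?f`Ga" unfolding Ga_def using rgrpI[OF t(1)] by blast
  qed
  show "?f`Ga<=PS"
  proof
   fix Q assume "Q:?f`Ga"
   then obtain sg where s:"sg:auts L" "Q = ?f (restrict sg E)" unfolding Ga_def using rgrpE by blast
   have pl:"place (sg -` V)" by(rule place_vimage(1)[OF V auts_kk[OF Li s(1)]])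
   have "Q Int L = V Int L" unfolding s(2) f using LE auts_fix[OF s(1)] by auto
   thus "Q:PS" unfolding PS_def using place_Int_prime[OF pl Ei] s(2) f by simp
  qed
 qed
 have fin:"finite PS" unfolding PS using fG by simp
 have dim:"has_degree L E n <-> n = card Ga" for n
 proof -
  interpret Ring.field "\<Omega> :: 'a ac ring" by(rule field_\<Omega>)
  have K:"subfield L \<Omega>" unfolding subfield_\<Omega>_iff by(rule ifield_sfield[OF Li])
  have "has_degree L E (card Ga)" unfolding Ga_def by(rule finab_dimension[OF E])
  thus ?thesis using dimension_is_inj[OF K] by blast
 qed
 have "decomposes_fully L E (V Int L) <-> card (?f`Ga) = card Ga"
  unfolding decomposes_fully_def PS_def[symmetric] dim using fin PS by simp
 also have "\<dots> <-> inj_on ?f Ga" using card_image[of ?f Ga] eq_card_imp_inj_on[OF fG, of ?f] by blast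
 also have "\<dots> <-> trivial_on (dgrp V L) E"
 proof
  assume inj:"inj_on ?f Ga"
  show "trivial_on (dgrp V L) E"
   unfolding trivial_on_def
  proof (intro ballI)
   fix sg x assume s:"sg:dgrp V L" and x:"x:E"
   have "?f (restrict sg E) = ?f (restrict (%x. x) E)" unfolding f using dgrpD(2)[OF s] by auto
   moreover have "restrict sg E:Ga" "restrict (%x. x) E:Ga"
    unfolding Ga_def using rgrpI[OF dgrpD(1)[OF s]] rgrpI[OF auts_id] by blast+
   ultimately have "restrict sg E = restrict (%x. x) E" using inj_onD[OF inj] by blast
   thus "sg x = x" using x unfolding rgrp_eq_iff by blast
  qed
 next
  assume triv:"trivial_on (dgrp V L) E"
  show "inj_on ?f Ga"
  proof (rule inj_onI)
   fix g g' assume gg:"g:Ga" "g':Ga" "?f g = ?f g'"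
   obtain sg where s:"sg:auts L" "g = restrict sg E" using rgrpE[OF gg(1)[unfolded Ga_def]] by(rule bexE)
   obtain ta where t:"ta:auts L" "g' = restrict ta E" using rgrpE[OF gg(2)[unfolded Ga_def]] by(rule bexE)
   have eq:"sg -` V Int E = ta -` V Int E" using gg(3) unfolding s(2) t(2) f .
   have tk:"ta:auts \<kk>" by(rule auts_kk[OF Li t(1)])
   have ti:"ainv ta:auts L" by(rule auts_inv[OF t(1) Li])
   let ?rh = "%x. sg (ainv ta x)"
   have r:"?rh:auts L" by(rule auts_comp[OF s(1) ti])
   have "?rh x:V <-> x:V" if "x:E" for x
    by(smt (verit, ccfv_threshold) E IntE IntI auts_inv_simps(1) eq finabD(4) that ti tk vimageE vimageI)
   hence "?rh -` V Int E = V Int E" by blast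
   from dgrp_adjust[OF Li Ei LE V r this] obtain ps where p:"ps:dgrp V L" "ALL x:E. ps x = ?rh x" by(rule bexE)
   have "sg x = ta x" if x:"x:E" for x
    by(metis E auts_inv_simps(2) finabD(4) p(1,2) t(1) tk triv trivial_onD x)
   thus "g = g'" unfolding s(2) t(2) rgrp_eq_iff by blast
  qed
 qed
 finally show ?thesis .
qed

lemma infinite_places_conjugate:
 assumes "infinite_place V" "infinite_place V'"
 shows "EX ta:auts \<kk>. ta -` V' = V"
 by(metis assms(1,2) ifield_kk_self infinite_placeD(1) infinite_place_iff places_conjugate)

text \<open>Conjugate places have the same decomposition group on abelian extensions.\<close>

lemma trivial_on_dgrp_conjugate:
 assumes L:"finab \<kk> L" and E:"finab \<kk> E" and V:"infinite_place V" "infinite_place V'"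
  and triv:"trivial_on (dgrp V L) E"
 shows "trivial_on (dgrp V' L) E"
 unfolding trivial_on_def
proof (intro ballI)
 fix sg x assume s:"sg:dgrp V' L" and x:"x:E"
 obtain ta where t:"ta:auts \<kk>" "ta -` V' = V" using infinite_places_conjugate[OF V] by(rule bexE)
 have ti:"ainv ta:auts \<kk>" by(rule auts_inv[OF t(1) ifield_kk_self])
 have sk:"sg:auts \<kk>" by(rule auts_kk[OF finabD(2)[OF L] dgrpD(1)[OF s]])
 let ?rh = "%x. ainv ta (sg (ta x))"
 have rk:"?rh:auts \<kk>" by(rule auts_comp[OF ti auts_comp[OF sk t(1)]])
 have rL:"?rh:auts L" by(smt (verit, best) L auts_def auts_inv_simps(2) dgrpD(1) finabD(5) mem_Collect_eq rk s sk t(1))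
 have "?rh y:V <-> y:V" for y
  by(metis auts_inv_simps(1) dgrpD(2) s t(1,2) vimage_eq)
 hence "?rh:dgrp V L" using rL by(auto simp: dgrp_def)
 hence "ainv ta (sg (ta x)) = x" using trivial_onD[OF triv _ x] by blast
 moreover have "sg (ta x) = ta (sg x)" by(rule finabD(5)[OF E sk t(1) x])
 ultimately show "sg x = x" by(simp add: auts_inv_simps[OF t(1)])
qed

lemma rfield_conjugate:
 assumes F:"finab \<kk> F" and V:"infinite_place V" "infinite_place V'" and r:"rfield V F = Fq s"
 shows "rfield V' F<=Fq s"
proof
 fix c assume "c:rfield V' F"
 then obtain x where x:"x:V'" "x:F" "c = res V' x" using rfieldE by blast
 obtain ta where t:"ta:auts \<kk>" "ta -` V' = V" using infinite_places_conjugate[OF V] by(rule bexE)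
 have ti:"ainv ta:auts \<kk>" by(rule auts_inv[OF t(1) ifield_kk_self])
 let ?y = "ainv ta x"
 have y:"?y:F" by(rule finabD(4)[OF F ti x(2)])
 have ty:"ta ?y = x" by(rule auts_inv_simps(1)[OF t(1)])
 hence yV:"?y:V" using t(2) x(1) by blast
 have "res V' (ta ?y) = ta (res V ?y)" using res_vimage[OF infinite_placeD(1)[OF V(2)] t(1), of ?y] t(2) x(1) ty by simp
 moreover have "res V ?y:Fq s" using rfieldI[OF yV y] r by simp
 ultimately show "c:Fq s" using endo_Fq[OF auts_endo[OF t(1)]] ty x(3) by simp
qed

text \<open>Counting elements gives the inequality, which is what bounds the order of a Frobenius
  automorphism from below.\<close>

lemma Fq_subset_imp_dvd:
 assumes "Fq s<=(Fq r :: 'a::{field,finite} ac set)" "s >= 1" "r >= 1"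
 shows "s<=r"
proof -
 have "card (Fq s :: 'a ac set) <= card (Fq r :: 'a ac set)" by(rule card_mono[OF finite_Fq[OF assms(3)] assms(1)])
 hence "CARD('a)^s<=CARD('a)^r" using card_Fq assms(2,3) by metis
 thus ?thesis using card_field_ge_2[where ?'a = 'a] power_increasing_iff[of "CARD('a)" s r] by simp
qed

lemma rfield_infinite_place_eq:
 assumes F:"finab \<kk> F" and V:"infinite_place V" "infinite_place V'" and r:"rfield V F = Fq s" "s >= 1"
 shows "rfield V' F = Fq s"
 by(metis (lifting) ext F assms(2,3) infinite_placeD(1) r(1) rfield_conjugate rfinite_def rfinite_finab rfinite_kk set_eq_subset)

theorem f_infty_eq:
 assumes E:"finab \<kk> E" and F:"finab \<kk> F" "F<=E" and V:"infinite_place V"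
  and s:"rfield V E = Fq s" "s >= 1" and r:"rfield V F = Fq r" "r >= 1"
 shows "f_infty E F*r = s"
proof -
 note Ei = finabD(2)[OF E] and Fi = finabD(2)[OF F(1)]
 have deg:"inertia_degree F Q*r = s" if "Q:S_infty E" for Q
  by(smt (verit) E Ei Fi S_infty_iff V assms(2,3) ifield_sfield inertia_degree_eq infinite_placeD(1) r(1,2) rfield_infinite_place_eq s(1,2) that)
 \<comment> \<open>\<open>S_infty E\<close> is not empty, so the number described in
   \<open>f_infty\<close> is unique.\<close>
 have Q:"V Int E:S_infty E" unfolding S_infty_iff[OF Ei] using V by(intro exI[of _ V] conjI refl)
 define f where "f = inertia_degree F (V Int E)"
 have "f_infty E F = f"
  unfolding f_infty_def
 proof (rule the_equality)
  have "inertia_degree F Q = f" if "Q:S_infty E" for Q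
  proof -
   have "inertia_degree F Q*r = f*r" unfolding f_def using deg[OF that] deg[OF Q] by simp
   thus ?thesis using r(2) by simp
  qed
  thus "ALL Q:S_infty E. inertia_degree F Q = f" by blast
  fix f' assume "ALL Q:S_infty E. inertia_degree F Q = f'"
  thus "f' = f" unfolding f_def using Q by simp
 qed
 thus ?thesis unfolding f_def using deg[OF Q] by simp
qed

section \<open>The genus field in terms of decomposition and inertia groups\<close>

text \<open>The finite layers of the genus field: unramifiedness and full decomposition over
  \<open>L\<close> are expressed by inertia and decomposition groups, see
  \<open>genus_field_eq\<close>.\<close>

definition genus_ext :: "'a::{field,finite} ac set => 'a ac set => bool" where
 "genus_ext L E <-> finab \<kk> E & L<=E & (ALL V. place V --> trivial_on (igrp V L) E) &
   (ALL V. infinite_place V --> trivial_on (dgrp V L) E)"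

lemma genus_extD:
 assumes "genus_ext L E"
 shows "finab \<kk> E" "L<=E" "place V ==> trivial_on (igrp V L) E" "infinite_place V ==> trivial_on (dgrp V L) E"
 using assms by(simp_all add: genus_ext_def)

lemma genus_extI:
 assumes "finab \<kk> E" "L<=E" "!!V. place V ==> trivial_on (igrp V L) E" "!!V. infinite_place V ==> trivial_on (dgrp V L) E"
 shows "genus_ext L E"
 using assms by(simp add: genus_ext_def)

lemma trivial_on_mono:"trivial_on Ga E ==> De<=Ga ==> F<=E ==> trivial_on De F"
 unfolding trivial_on_def by blast

lemma trivial_on_composite:
 assumes "Ga<=auts \<kk>" "trivial_on Ga A" "trivial_on Ga B"
 shows "trivial_on Ga (A**B)"
 unfolding trivial_on_def composite_eq
proof (intro ballI)
 fix sg x assume s:"sg:Ga" and x:"x:adj (A Un B)"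
 have "sg y = y" if "y:A Un B" for y using that trivial_onD[OF assms(2) s] trivial_onD[OF assms(3) s] by blast
 thus "sg x = x" using endo_eq_adj[OF _ auts_endo[OF auts_id] _ x, of sg] auts_endo assms(1) s by blast
qed

lemma genus_ext_composite:
 assumes L:"ifield L" and A:"genus_ext L A" and B:"genus_ext L B"
 shows "genus_ext L (A**B)"
proof -
 have sub:"igrp V L<=auts \<kk>" "dgrp V L<=auts \<kk>" for V using auts_kk[OF L] igrp_auts dgrpD(1) by blast+
 show ?thesis
 proof (rule genus_extI)
  show "finab \<kk> (A**B)" by(rule finab_composite[OF genus_extD(1)[OF A] genus_extD(1)[OF B]])
  show "L<=A**B" by(rule order_trans[OF genus_extD(2)[OF A] composite_incl(1)])
  show "trivial_on (igrp V L) (A**B)" if "place V" for V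
   by(rule trivial_on_composite[OF sub(1) genus_extD(3)[OF A that] genus_extD(3)[OF B that]])
  show "trivial_on (dgrp V L) (A**B)" if "infinite_place V" for V
   by(rule trivial_on_composite[OF sub(2) genus_extD(4)[OF A that] genus_extD(4)[OF B that]])
 qed
qed

lemma genus_ext_refl:
 assumes L:"finab \<kk> L"
 shows "genus_ext L L"
 by(meson assms auts_fix dgrpD(1) genus_extI igrp_auts order_refl trivial_on_def)

lemma hilbert_class_field_fixed:
 assumes L:"finab \<kk> L" and x:"x:hilbert_class_field L"
 shows "place V ==> sg:igrp V L ==> sg x = x" "infinite_place V ==> sg:dgrp V L ==> sg x = x"
proof -
 note Li = finabD(2)[OF L]
 let ?S = "{E. finite_abelian_ext L E & unramified L E & (ALL P:S_infty L. decomposes_fully L E P)}"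
 have x:"x:adj (\<Union>?S)" using x unfolding hilbert_class_field_def compositum_def .
 have E:"(place V --> trivial_on (igrp V L) E) & (infinite_place V --> trivial_on (dgrp V L) E)" if h:"E:?S" for E V
  by(metis (lifting) L Li S_infty_iff decomposes_fully_iff finabD(3) finite_abelian_ext_iff infinite_place_def mem_Collect_eq that unramified_iff)
 have red:"sg x = x" if "sg:auts L" "!!y. y:\<Union>?S ==> sg y = y" for sg
  by(rule endo_eq_adj[OF auts_endo[OF that(1)] auts_endo[OF auts_id] that(2) x])
 show "sg x = x" if V:"place V" and s:"sg:igrp V L"
 proof (rule red[OF igrp_auts[OF s]])
  fix y assume "y:\<Union>?S"
  then obtain E where e:"E:?S" "y:E" by(rule UnionE)
  show "sg y = y" using E[OF e(1), of V] V trivial_onD[OF _ s e(2)] by blast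
 qed
 show "sg x = x" if V:"infinite_place V" and s:"sg:dgrp V L"
 proof (rule red[OF dgrpD(1)[OF s]])
  fix y assume "y:\<Union>?S"
  then obtain E where e:"E:?S" "y:E" by(rule UnionE)
  show "sg y = y" using E[OF e(1), of V] V trivial_onD[OF _ s e(2)] by blast
 qed
qed

text \<open>Layers are closed under composita, so whatever is generated by finitely many elements of
  layers lies in one layer. In later arguments this stands in for finiteness of the genus
  field.\<close>

theorem genus_field_eq:
 assumes L:"finab \<kk> L"
 shows "genus_field L = \<Union>{E. genus_ext L E}"
proof
 note Li = finabD(2)[OF L]
 let ?S = "{E. L<=E & finite_abelian_ext \<kk> E & E<=hilbert_class_field L}"
 have 1:"genus_ext L E" if E:"E:?S" for E
  by(smt (verit, del_insts) assms finite_abelian_ext_finab genus_extI hilbert_class_field_fixed(1,2) mem_Collect_eq subset_iff that trivial_on_def)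
 have 2:"genus_ext L E ==> E:?S" for E
 proof -
  assume E:"genus_ext L E"
  note Ek = genus_extD(1)[OF E] and LE = genus_extD(2)[OF E]
  have LEf:"finab L E" by(rule finab_mid(2)[OF Ek Li ifield_kk[OF Li] LE])
  have "unramified L E" using unramified_iff[OF L LEf] genus_extD(3)[OF E] by blast
  moreover have "decomposes_fully L E P" if "P:S_infty L" for P
   by(metis E LEf Li S_infty_iff decomposes_fully_iff genus_extD(4) infinite_place_def that)
  moreover have "finite_abelian_ext L E" by(rule finab_finite_abelian_ext[OF LEf])
  ultimately have mem:"E:{E. finite_abelian_ext L E & unramified L E & (ALL P:S_infty L. decomposes_fully L E P)}" by blast
  have "E<=hilbert_class_field L"
   unfolding hilbert_class_field_def compositum_def by(rule order_trans[OF Union_upper[OF mem] adj_incl])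
  moreover have "finite_abelian_ext \<kk> E" by(rule finab_finite_abelian_ext[OF Ek])
  ultimately show "E:?S" using LE by blast
 qed
 show "genus_field L<=\<Union>{E. genus_ext L E}"
 proof
  fix x assume "x:genus_field L"
  hence "x:adj (\<Union>?S)" unfolding genus_field_def compositum_def .
  from adj_finitary[OF this] obtain T where T:"finite T" "T<=\<Union>?S" "x:adj T" by blast
  have "EX E. genus_ext L E & T<=E"
   using T(1,2)
  proof (induction T rule: finite_induct)
   case empty
   show ?case using genus_ext_refl[OF L] by blast
  next
   case (insert y T)
   then obtain E where E:"genus_ext L E" "T<=E" by auto
   obtain E' where E':"E':?S" "y:E'" using insert.prems by blast
   have "genus_ext L (E**E')" by(rule genus_ext_composite[OF Li E(1) 1[OF E'(1)]])
   moreover have "insert y T<=E**E'" using E(2) E'(2) composite_incl[of E E'] composite_incl(2)[of E' E] by blast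
   ultimately show ?case by blast
  qed
  then obtain E where E:"genus_ext L E" "T<=E" by blast
  have "sfield E" by(rule ifield_sfield[OF finabD(2)[OF genus_extD(1)[OF E(1)]]])
  from adj_min[OF this E(2)] T(3) E(1) show "x:\<Union>{E. genus_ext L E}" by blast
 qed
 show "\<Union>{E. genus_ext L E}<=genus_field L"
  by(metis (mono_tags, lifting) "1" "2" adj_incl compositum_def genus_field_def mem_Collect_eq subsetI subset_antisym)
qed

lemma ifield_genus_field:"finab \<kk> L ==> ifield (genus_field L)"
proof -
 assume L:"finab \<kk> L"
 have "\<kk><=genus_field L" unfolding genus_field_eq[OF L] using genus_ext_refl[OF L] finabD(3)[OF L] by blast
 moreover have "sfield (genus_field L)" unfolding genus_field_def compositum_def by(rule sfield_adj)
 ultimately show ?thesis by(simp add: ifield_def)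
qed

section \<open>Torsion of the Carlitz module\<close>

definition linear_op :: "('a::{field,finite} ac => 'a ac) => bool" where
 "linear_op ps <-> (ALL x y. ps (x+y) = ps x+ps y) & (ALL c x. ps (cst c*x) = cst c*ps x)"

text \<open>The polynomial \<open>f\<close> evaluated at the operator \<open>ps\<close>. With
  \<open>ps = cz t\<close> it is the Carlitz action; with \<open>ps\<close> an automorphism it is
  used in \<open>auts_power_scalar\<close>.\<close>

definition opoly :: "('a::{field,finite} ac => 'a ac) => 'a poly => 'a ac => 'a ac" where
 "opoly ps f x = (SUM i<=pdeg f. cst (coeff f i)*(ps ^^ i) x)"

definition cz :: "'a::{field,finite} ac => 'a ac => 'a ac" where
 "cz t = (%y. t*y+y^CARD('a))"

lemma carlitz_eq:"carlitz t N x = opoly (cz t) N x"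
 by(simp add: carlitz_def opoly_def cz_def)

lemma opoly_0:"opoly ps 0 x = 0"
 by(simp add: opoly_def cst_simps)

lemma opoly_bound:"pdeg f<=n ==> opoly ps f x = (SUM i<=n. cst (coeff f i)*(ps ^^ i) x)"
 unfolding opoly_def by(rule sum.mono_neutral_left) (auto simp: coeff_eq_0 cst_simps)

lemma opoly_pCons:"opoly ps (pCons a f) x = cst a*x + opoly ps f (ps x)"
proof -
 have "opoly ps (pCons a f) x = (SUM i<=Suc (pdeg f). cst (coeff (pCons a f) i)*(ps ^^ i) x)"
  by(rule opoly_bound) (rule degree_pCons_le)
 also have "\<dots> = cst a*x+(SUM i<=pdeg f. cst (coeff f i)*(ps ^^ Suc i) x)"
  by(simp only: sum.atMost_Suc_shift coeff_pCons_0 coeff_pCons_Suc funpow.simps(1) id_apply)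
 also have "\<dots> = cst a*x + opoly ps f (ps x)" by(simp only: opoly_def funpow_Suc_right comp_apply)
 finally show ?thesis .
qed

lemma opoly_add:"opoly ps (f+g) x = opoly ps f x + opoly ps g x"
proof -
 let ?n = "max (pdeg f) (pdeg g)"
 show ?thesis
  using opoly_bound[OF degree_add_le_max, of ps f g x] opoly_bound[of f ?n ps x] opoly_bound[of g ?n ps x]
  by(simp add: cst_simps distrib_right sum.distrib)
qed

lemma opoly_smult:"opoly ps (psmul a f) x = cst a * opoly ps f x"
 using opoly_bound[OF degree_smult_le, of ps a f x] opoly_bound[of f "pdeg f" ps x]
 by(simp add: cst_simps sum_distrib_left mult.assoc)

lemma opoly_monom:"opoly ps (pmon a n) x = cst a*(ps ^^ n) x"
proof -
 have "opoly ps (pmon a n) x = (SUM i<=n. cst (coeff (pmon a n) i)*(ps ^^ i) x)"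
  by(rule opoly_bound) (rule degree_monom_le)
 also have "\<dots> = (SUM i<=n. if i = n then cst a*(ps ^^ n) x else 0)"
  by(rule sum.cong) (simp_all add: cst_simps)
 finally show ?thesis by simp
qed

context
 fixes ps :: "'a::{field,finite} ac => 'a ac"
 assumes lin:"linear_op ps"
begin

lemma linear_op_add:"ps (x+y) = ps x+ps y" and linear_op_cst:"ps (cst c*x) = cst c*ps x"
 using lin by(auto simp: linear_op_def)

lemma linear_op_0:"ps 0 = 0"
 using linear_op_cst[of 0 0] by(simp add: cst_simps)

lemma linear_op_diff:"ps (x-y) = ps x-ps y"
 using linear_op_add[of "x-y" y] by simp

lemma linear_op_funpow:"linear_op (ps ^^ n)"
proof (induction n)
 case (Suc n)
 thus ?case using linear_op_add linear_op_cst by(simp add: linear_op_def)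
qed (simp add: linear_op_def)

lemma linear_op_opoly:"linear_op (opoly ps f)"
proof -
 have 1:"(ps ^^ i) (x+y) = (ps ^^ i) x+(ps ^^ i) y" and 2:"(ps ^^ i) (cst c*x) = cst c*(ps ^^ i) x" for i x y c
  using linear_op_funpow by(simp_all add: linear_op_def)
 show ?thesis unfolding linear_op_def opoly_def 1 2
  by(simp add: distrib_left sum.distrib sum_distrib_left mult.left_commute)
qed

lemma opoly_mult:"opoly ps (f*g) x = opoly ps f (opoly ps g x)"
proof (induction f arbitrary: x)
 case (pCons a f)
 have com:"opoly ps g (ps x) = ps (opoly ps g x)"
 proof (induction g arbitrary: x)
  case (pCons b g)
  thus ?case by(simp add: opoly_pCons linear_op_add linear_op_cst)
 qed (simp add: opoly_0 linear_op_0)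
 show ?case
  by(simp add: opoly_add opoly_smult opoly_pCons pCons.IH com cst_simps)
qed (simp add: opoly_0)

lemma opoly_commute:"opoly ps f (opoly ps g x) = opoly ps g (opoly ps f x)"
 by(simp only: opoly_mult[symmetric] mult.commute)

lemma opoly_op:"opoly ps f (ps x) = ps (opoly ps f x)"
 using opoly_commute[of f "[:0, 1:]" x] by(simp add: opoly_pCons opoly_0 cst_simps)

end

lemma opoly_intertwine:
 assumes s:"!!x y. sg (x+y) = sg x+sg y" "!!c x. sg (cst c*x) = cst c*sg x" "sg 0 = 0" "!!x. sg (ps x) = ps (sg x)"
 shows "sg (opoly ps f x) = opoly ps f (sg x)"
proof (induction f arbitrary: x)
 case (pCons a f)
 thus ?case by(simp add: opoly_pCons s)
qed (simp add: opoly_0 s)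

lemma linear_op_cz:"linear_op (cz t)"
 unfolding linear_op_def cz_def
 by(simp add: power_q_add algebra_simps power_mult_distrib flip: cst_simps(7)) (simp add: power_card_eq)

lemma cz_0 [simp]:"cz t 0 = 0"
 by(rule linear_op_0[OF linear_op_cz])

lemma auts_cst:"sg:auts \<kk> ==> sg (cst c) = cst c"
 using auts_fix[of sg \<kk> "cst c"] cst_kk by blast

lemma linear_op_auts:"sg:auts \<kk> ==> linear_op sg"
 unfolding linear_op_def by(simp add: endo_add[OF auts_endo] endo_mult[OF auts_endo] auts_cst)

lemma auts_cz:"sg:auts \<kk> ==> t:\<kk> ==> sg (cz t x) = cz t (sg x)"
 unfolding cz_def by(simp add: endo_add[OF auts_endo] endo_mult[OF auts_endo] endo_power[OF auts_endo] auts_fix)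

lemma auts_opoly_cz:
 assumes s:"sg:auts \<kk>" and t:"t:\<kk>"
 shows "sg (opoly (cz t) f x) = opoly (cz t) f (sg x)"
 by(simp add: auts_cz linear_op_0 linear_op_add linear_op_auts linear_op_cst opoly_intertwine s t)

definition torsion :: "'a::{field,finite} ac => 'a poly => 'a ac set" where
 "torsion t N = {x. opoly (cz t) N x = 0}"

lemma cyclotomic_wrt_eq:"cyclotomic_wrt t N = adj (\<kk> Un torsion t N)"
 by(simp add: cyclotomic_wrt_def composite_eq torsion_def carlitz_eq)

lemma torsion_0:"0:torsion t N"
 by(simp add: torsion_def linear_op_0[OF linear_op_opoly[OF linear_op_cz]])

lemma torsion_diff:"x:torsion t N ==> y:torsion t N ==> x-y:torsion t N"
 by(simp add: torsion_def linear_op_diff[OF linear_op_opoly[OF linear_op_cz]])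

lemma torsion_cst:"x:torsion t N ==> cst c*x:torsion t N"
 by(simp add: torsion_def linear_op_cst[OF linear_op_opoly[OF linear_op_cz]])

lemma torsion_cz:"x:torsion t N ==> cz t x:torsion t N"
 by(simp add: torsion_def opoly_op[OF linear_op_cz])

lemma torsion_auts:"sg:auts \<kk> ==> t:\<kk> ==> x:torsion t N ==> sg x:torsion t N"
 unfolding torsion_def using endo_0[OF auts_endo] by(simp flip: auts_opoly_cz)

text \<open>\<open>q\<close>-th powers have derivative \<open>0\<close>, so only the linear term
  contributes to the derivative. Hence torsion points are simple roots once this constant is
  nonzero.\<close>

lemma opoly_cz_polynomial:
 fixes t :: "'a::{field,finite} ac"
 assumes t:"t:\<kk>"
 shows "EX p. coeffs_in \<kk> p & pderiv p = [:poly (map_poly cst f) t:] & (ALL x. poly p x = opoly (cz t) f x)"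
proof -
 note K = sfield_kk[where ?'a = 'a]
 let ?G = "%a F. EX p. coeffs_in \<kk> p & pderiv p = [:a :: 'a ac:] & (ALL x. poly p x = F x)"
 have step:"?G (t*a) (%x. cz t (F x))" if G:"?G a F" for a F
 proof -
  obtain p where p:"coeffs_in \<kk> p" "pderiv p = [:a:]" "ALL x. poly p x = F x" using G by(elim exE conjE)
  let ?r = "psmul t p+p^CARD('a)"
  have "coeffs_in \<kk> ?r" by(intro coeffs_in_add[OF K] coeffs_in_smult[OF K] coeffs_in_power[OF K] t p(1))
  moreover have "pderiv (p^CARD('a)) = 0"
   using of_nat_q_eq_0[where ?'a = 'a] by(simp add: pderiv_power of_nat_poly)
  hence "pderiv ?r = [:t*a:]" using p(2) by(simp add: pderiv_add pderiv_smult)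
  moreover have "poly ?r x = cz t (F x)" for x using p(3) by(simp add: cz_def)
  ultimately show ?thesis by blast
 qed
 have "?G (poly (map_poly cst f) t) (%x. opoly (cz t) f x)"
 proof (induction f)
  case 0
  show ?case using coeffs_in_0[OF K] by(intro exI[of _ 0]) (simp add: opoly_0)
 next
  case (pCons c f)
  from step[OF pCons.IH]
  obtain p where p:"coeffs_in \<kk> p" "pderiv p = [:t*poly (map_poly cst f) t:]" "ALL x. poly p x = cz t (opoly (cz t) f x)"
   by(elim exE conjE)
  let ?r = "[:0, cst c:]+p"
  have "coeffs_in \<kk> [:0, cst c:]"
   unfolding coeffs_in_pCons[OF K] using sfield_0[OF K] coeffs_in_0[OF K] cst_kk by blast
  hence "coeffs_in \<kk> ?r" by(rule coeffs_in_add[OF K _ p(1)])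
  moreover have "pderiv ?r = [:poly (map_poly cst (pCons c f)) t:]"
   using p(2) by(simp add: pderiv_add pderiv_pCons map_poly_pCons cst_simps)
  moreover have "poly ?r x = opoly (cz t) (pCons c f) x" for x
   using p(3) by(simp add: opoly_pCons opoly_op[OF linear_op_cz] mult.commute)
  ultimately show ?case by blast
 qed
 thus ?thesis .
qed

lemma cst_poly_nonzero:
 fixes N :: "'a::{field,finite} poly"
 assumes t:"parameter t" and N:"N~=0"
 shows "poly (map_poly cst N) t~=0"
proof -
 have "coeff (map_poly cst N) (pdeg N)~=0"
  using N cst_eq_iff[of "plc N" 0] by(simp add: coeff_map_poly cst_simps)
 hence "map_poly cst N~=0" by auto
 moreover have "coeffs_in (range cst) (map_poly cst N)" by(simp add: coeffs_in_def coeff_map_poly cst_simps)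
 ultimately show ?thesis using parameter_poly_nonzero[OF t] by blast
qed

lemma torsion_polynomial:
 fixes t :: "'a::{field,finite} ac"
 assumes t:"parameter t" and N:"N~=0"
 shows "EX p. coeffs_in \<kk> p & p~=0 & torsion t N = {x. poly p x = 0} & (ALL x. poly (pderiv p) x~=0)"
proof -
 obtain p where p:"coeffs_in \<kk> p" "pderiv p = [:poly (map_poly cst N) t:]" "ALL x. poly p x = opoly (cz t) N x"
  using opoly_cz_polynomial[OF parameter_kk[OF t]] by blast
 have d:"poly (pderiv p) x~=0" for x unfolding p(2) using cst_poly_nonzero[OF t N] by simp
 hence "p~=0" by auto
 moreover have "torsion t N = {x. poly p x = 0}" unfolding torsion_def using p(3) by simp
 ultimately show ?thesis using p(1) d by blast
qed

lemma finite_torsion:"parameter t ==> N~=0 ==> finite (torsion t N)"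
 using torsion_polynomial[of t N] poly_roots_finite by metis

definition generates :: "'a::{field,finite} ac => 'a poly => 'a ac => bool" where
 "generates t N et <-> et:torsion t N & (ALL x:torsion t N. EX f. x = opoly (cz t) f et)"

lemma generatesD:"generates t N et ==> et:torsion t N" "generates t N et ==> x:torsion t N ==> EX f. x = opoly (cz t) f et"
 unfolding generates_def by blast+

text \<open>An automorphism sends the generator \<open>et\<close> to some
  \<open>opoly (cz t) f et\<close> and commutes with the module action, so it acts as
  \<open>opoly (cz t) f\<close> on all torsion; such operators commute.\<close>

theorem finab_cyclotomic_wrt:
 fixes t :: "'a::{field,finite} ac"
 assumes t:"parameter t" and N:"N~=0" and g:"generates t N et"
 shows "finab \<kk> (cyclotomic_wrt t N)"
 unfolding cyclotomic_wrt_eq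
proof (rule finab_adj[OF ifield_kk_self])
 note tk = parameter_kk[OF t]
 show "sg x:adj (\<kk> Un torsion t N)" if "sg:auts \<kk>" "x:torsion t N" for sg x
  using torsion_auts[OF that(1) tk that(2)] adj_incl[of "\<kk> Un torsion t N"] by blast
 show "sg (ta x) = ta (sg x)" if s:"sg:auts \<kk>" and u:"ta:auts \<kk>" and x:"x:torsion t N" for sg ta x
 proof -
  obtain f where f:"sg et = opoly (cz t) f et" using generatesD(2)[OF g torsion_auts[OF s tk generatesD(1)[OF g]]] by blast
  obtain h where h:"ta et = opoly (cz t) h et" using generatesD(2)[OF g torsion_auts[OF u tk generatesD(1)[OF g]]] by blast
  obtain k where k:"x = opoly (cz t) k et" using generatesD(2)[OF g x] by blast
  have "sg (ta et) = opoly (cz t) h (opoly (cz t) f et)" unfolding h auts_opoly_cz[OF s tk] f ..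
  also have "\<dots> = opoly (cz t) f (opoly (cz t) h et)" by(rule opoly_commute[OF linear_op_cz])
  also have "\<dots> = ta (sg et)" unfolding f auts_opoly_cz[OF u tk] h ..
  finally show ?thesis unfolding k auts_opoly_cz[OF s tk] auts_opoly_cz[OF u tk] by simp
 qed
 show "sep \<kk> x" if "x:torsion t N" for x
  using torsion_polynomial[OF t N] that unfolding sep_def by blast
 show "finite (rgrp (auts \<kk>) (torsion t N))" by(rule finite_restrict_finite[OF finite_torsion[OF t N] order_refl])
qed

lemma endo_eq_cyclotomic_wrt:
 assumes "sg:auts \<kk>" "ta:auts \<kk>" "!!x. x:torsion t N ==> sg x = ta x" "x:cyclotomic_wrt t N"
 shows "sg x = ta x"
proof (rule endo_eq_adj[OF auts_endo[OF assms(1)] auts_endo[OF assms(2)]])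
 show "x:adj (\<kk> Un torsion t N)" using assms(4) unfolding cyclotomic_wrt_eq .
 show "sg y = ta y" if "y:\<kk> Un torsion t N" for y
  using that assms(3) auts_fix[OF assms(1)] auts_fix[OF assms(2)] by auto
qed

text \<open>At a pole of \<open>t\<close> the valuations of torsion points are \<open>-\<delta>/(q-1) + k\<delta>\<close> with \<open>k \<in> \<nat>\<close>, where \<open>-\<delta>\<close> is that
  of \<open>t\<close>. Points of the same valuation have the same leading term up to \<open>\<F>\<^sub>q\<^sup>*\<close>; so any point of largest
  valuation generates the torsion.\<close>

context
 fixes V :: "'a::{field,finite} ac set" and t :: "'a ac" and N :: "'a poly"
 assumes V:"place V" and t:"parameter t" "vord V t < 0" and N:"N~=0"
begin

abbreviation (input) dl :: real where "dl ==-vord V t"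
text \<open>The value \<open>v\<close> at which \<open>t*y\<close> and \<open>y^q\<close> balance:
  \<open>vord V t+v = q*v\<close>.\<close>

abbreviation (input) crit :: real where "crit == vord V t/(real CARD('a)-1)"
abbreviation (input) Cz :: "'a ac => 'a ac" where "Cz == cz t"

lemma q1:"real CARD('a)-1 > 0"
 using card_field_ge_2[where ?'a = 'a] by simp

lemma crit:"(real CARD('a)-1) * crit = vord V t" "crit < 0"
 using q1 t(2) by(simp_all add: divide_neg_pos)

lemma vord_power_q:"y~=0 ==> vord V (y^CARD('a)) = real CARD('a)*vord V y"
 and vord_t_mult:"y~=0 ==> vord V (t*y) = vord V t+vord V y"
 by(simp_all add: vord_power[OF V] vord_mult[OF V] parameter_neq_0[OF t(1)])

lemma cz_above:
 assumes y:"y~=0" "vord V y > crit"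
 shows "Cz y~=0" "vord V (Cz y) = vord V y+vord V t" "Cz y/(t*y)-1:mx V"
proof -
 note t0 = parameter_neq_0[OF t(1)]
 have "(real CARD('a)-1)*vord V y > vord V t" using mult_strict_left_mono[OF y(2) q1] crit(1) by simp
 hence lt:"vord V (t*y) < vord V (y^CARD('a))"
  unfolding vord_power_q[OF y(1)] vord_t_mult[OF y(1)] by(simp add: algebra_simps)
 have nz:"t*y~=0" "y^CARD('a)~=0" using t0 y(1) by simp_all
 from vord_add_eq[OF V nz lt] show "Cz y~=0" "vord V (Cz y) = vord V y+vord V t"
  unfolding cz_def vord_t_mult[OF y(1)] by(simp_all add: add.commute)
 have "Cz y/(t*y)-1 = y^CARD('a)/(t*y)" using nz by(simp add: cz_def add_divide_distrib)
 moreover have "vord V (y^CARD('a)/(t*y)) > 0" using lt by(simp add: vord_divide[OF V nz(2,1)])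
 ultimately show "Cz y/(t*y)-1:mx V" using vord_pos_iff[OF V, of "y^CARD('a)/(t*y)"] nz by simp
qed

lemma cz_below:
 assumes y:"y~=0" "vord V y < crit"
 shows "Cz y~=0" "vord V (Cz y) < vord V y"
proof -
 note t0 = parameter_neq_0[OF t(1)]
 have "(real CARD('a)-1)*vord V y < vord V t" using mult_strict_left_mono[OF y(2) q1] crit(1) by simp
 hence lt:"vord V (y^CARD('a)) < vord V (t*y)"
  unfolding vord_power_q[OF y(1)] vord_t_mult[OF y(1)] by(simp add: algebra_simps)
 have nz:"t*y~=0" "y^CARD('a)~=0" using t0 y(1) by simp_all
 note v = vord_add_eq[OF V nz(2,1) lt]
 show "Cz y~=0" using v(1) by(simp add: cz_def add.commute)
 have "vord V (Cz y) = real CARD('a)*vord V y" using v(2) by(simp add: cz_def add.commute vord_power_q[OF y(1)])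
 moreover have "(real CARD('a)-1)*vord V y < 0" using q1 y(2) crit(2) by(intro mult_pos_neg) linarith+
 ultimately show "vord V (Cz y) < vord V y" by(simp add: algebra_simps)
qed

text \<open>Below \<open>crit\<close> the term \<open>y^q\<close> dominates, so iterating
  \<open>cz t\<close> lowers the value strictly. The top term of the polynomial action then
  outweighs the others, and the sum cannot vanish.\<close>

lemma torsion_vord_ge:
 assumes x:"x:torsion t N" "x~=0"
 shows "vord V x >= crit"
proof (rule ccontr)
 assume "~?thesis"
 hence lt:"vord V x < crit" by simp
 have it:"(Cz ^^ i) x~=0 & vord V ((Cz ^^ i) x) < crit & (ALL j<i. vord V ((Cz ^^ i) x) < vord V ((Cz ^^ j) x))" for i
 proof (induction i)
  case (Suc i)
  hence y:"(Cz ^^ i) x~=0" "vord V ((Cz ^^ i) x) < crit" by blast+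
  note z = cz_below[OF y]
  have "vord V (Cz ((Cz ^^ i) x)) < vord V ((Cz ^^ j) x)" if "j < Suc i" for j
   using that Suc z(2) by(cases "j = i") (auto intro: less_trans)
  thus ?case using z less_trans[OF z(2) y(2)] by simp
 qed (use lt x(2) in simp)
 let ?d = "pdeg N"
 let ?g = "%i. cst (coeff N i)*(Cz ^^ i) x"
 have lead:"cst (coeff N ?d)~=0" using N cst_eq_iff[of "coeff N ?d" 0] by(simp add: cst_simps)
 have vc:"vord V (cst c) = 0" if "cst c~=0" for c
  by(metis V cst_inverse place_cst that unit_at_iff vord_unit)
 have top:"?g ?d~=0" "vord V (?g ?d) = vord V ((Cz ^^ ?d) x)"
  using lead it[of ?d] vc[OF lead] by(simp_all add: vord_mult[OF V])
 have sum:"(SUM i<=?d. ?g i) = ?g ?d+(SUM i<?d. ?g i)" unfolding lessThan_Suc_atMost[symmetric] by(simp add: add.commute)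
 have "(SUM i<=?d. ?g i)~=0"
 proof (cases "(SUM i<?d. ?g i) = 0")
  case True
  thus ?thesis unfolding sum using top by simp
 next
  case False
  obtain e where e:"e:{..<?d}" "ALL i:{..<?d}. vord V ((Cz ^^ e) x)<=vord V ((Cz ^^ i) x)"
  proof -
   have "{..<?d}~={}" using False by auto
   from ex_min_if_finite[of "(%i. vord V ((Cz ^^ i) x))`{..<?d}"] this
   obtain m where "m:(%i. vord V ((Cz ^^ i) x))`{..<?d}" "~(EX y:(%i. vord V ((Cz ^^ i) x))`{..<?d}. y < m)" by auto
   thus ?thesis using that by(auto simp: not_less)
  qed
  have "?g i = 0 | vord V ((Cz ^^ e) x)<=vord V (?g i)" if "i:{..<?d}" for i
   using e(2) that it[of i] vc[of "coeff N i"] by(cases "cst (coeff N i) = 0") (simp_all add: vord_mult[OF V])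
  from vord_sum[OF V finite_lessThan this False]
  have "vord V (?g ?d) < vord V (SUM i<?d. ?g i)" using e(1) it[of ?d] top(2) by fastforce
  from vord_add_eq(1)[OF V top(1) False this] show ?thesis unfolding sum .
 qed
 thus False using x(1) by(simp add: torsion_def opoly_def)
qed

lemma near_1_mult:"a-1:mx V ==> b-1:mx V ==> a*b-1:mx V"
 using mx_diff_cong[OF V, of a 1 b 1] near_1[OF V, of a] place_1[OF V] by simp

lemma near_1_power:"a-1:mx V ==> a^n-1:mx V"
proof (induction n)
 case (Suc n)
 thus ?case using near_1_mult[of a "a^n"] by simp
qed (simp add: mx_0[OF V])

lemma near_1_inverse:
 assumes "a-1:mx V"
 shows "inverse a-1:mx V"
proof -
 have a:"a:V" "a~:mx V" using near_1[OF V assms] by blast+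
 hence i:"a~=0" "inverse a:V" using unit_at_iff[OF V, of a] by(auto simp: unit_at_def)
 have "inverse a-1 =-inverse a*(a-1)" using i(1) by(simp add: algebra_simps)
 thus ?thesis using mx_mult[OF V place_uminus[OF V i(2)] assms] by simp
qed

text \<open>At \<open>crit\<close>, \<open>cz t x\<close> is small compared with \<open>t*x\<close>,
  whence \<open>x^(q-1)\<close> is close to \<open>-t\<close>. Above it, \<open>cz t x\<close> is
  \<open>t*x\<close> up to a factor near \<open>1\<close>; so one application lowers the level
  \<open>k\<close> by one and preserves the congruence.\<close>

lemma torsion_level:
 assumes x:"x:torsion t N" "x~=0"
 shows "EX k. vord V x = crit+real k*dl & (t^k*x)^(CARD('a)-1)/(- t)-1:mx V"
proof -
 note t0 = parameter_neq_0[OF t(1)]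
 obtain m :: nat where m:"real m > (vord V x - crit)/dl" using reals_Archimedean2 by blast
 hence "vord V x < crit+real m*dl" using t(2) by(simp add: field_simps)
 thus ?thesis
  using x
 proof (induction m arbitrary: x)
  case 0
  thus ?case using torsion_vord_ge[of x] by simp
 next
  case (Suc m)
  note x = Suc.prems(2,3)
  have px:"Cz x:torsion t N" by(rule torsion_cz[OF x(1)])
  show ?case
  proof (cases "vord V x = crit")
   case True
   have pw:"x^CARD('a) = x^(CARD('a)-1)*x"
    by(metis power_minus_mult zero_less_card_finite)
   have eq:"x^(CARD('a)-1)/(- t)-1 =-(Cz x/(t*x))"
    using t0 x(2) pw by(simp add: cz_def field_simps)
   have "x^(CARD('a)-1)/(- t)-1:mx V"
   proof (cases "Cz x = 0")
    case True
    thus ?thesis unfolding eq by(simp add: mx_0[OF V])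
   next
    case False
    hence "vord V (Cz x) >= crit" by(rule torsion_vord_ge[OF px])
    hence "vord V (Cz x/(t*x)) > 0"
     using vord_divide[OF V False, of "t*x"] t0 x(2) vord_t_mult[OF x(2)] True t(2) by simp
    hence "Cz x/(t*x):mx V" using vord_pos_iff[OF V, of "Cz x/(t*x)"] False t0 x(2) by simp
    thus ?thesis unfolding eq by(rule mx_uminus[OF V])
   qed
   thus ?thesis using True by(intro exI[of _ 0]) simp
  next
   case False
   hence gt:"vord V x > crit" using torsion_vord_ge[OF x] by simp
   note c = cz_above[OF x(2) gt]
   have "vord V (Cz x) < crit+real m*dl" using Suc.prems(1) unfolding c(2) by(simp add: algebra_simps)
   from Suc.IH[OF this px c(1)]
   obtain k where k:"vord V (Cz x) = crit+real k*dl" "(t^k*Cz x)^(CARD('a)-1)/(- t)-1:mx V" by blast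
   have eq:"(t^Suc k*x)^(CARD('a)-1)/(- t)
     = (t^k*Cz x)^(CARD('a)-1)/(- t)*inverse (Cz x/(t*x))^(CARD('a)-1)"
   proof -
    have "t^Suc k*x = (t^k*Cz x)*inverse (Cz x/(t*x))" using c(1) by simp
    thus ?thesis by(simp only: power_mult_distrib times_divide_eq_left)
   qed
   have "(t^Suc k*x)^(CARD('a)-1)/(- t)-1:mx V"
    unfolding eq by(rule near_1_mult[OF k(2) near_1_power[OF near_1_inverse[OF c(3)]]])
   moreover have "vord V x = crit+real (Suc k)*dl" using k(1) unfolding c(2) by(simp add: algebra_simps)
   ultimately show ?thesis by blast
  qed
 qed
qed

text \<open>The congruences of \<open>torsion_level\<close> cancel in the quotient, so
  \<open>(x/y)^(q-1)\<close> is near \<open>1\<close> and the residue of \<open>x/y\<close> is a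
  nonzero element of \<open>Fq 1\<close>.\<close>

lemma torsion_same_level:
 assumes x:"x:torsion t N" "x~=0" and y:"y:torsion t N" "y~=0" and eq:"vord V x = vord V y"
 shows "EX c. cst c~=0 & (x - cst c*y = 0 | vord V (x - cst c*y) > vord V y)"
proof -
 note t0 = parameter_neq_0[OF t(1)]
 obtain k where k:"vord V x = crit+real k*dl" "(t^k*x)^(CARD('a)-1)/(- t)-1:mx V"
  using torsion_level[OF x] by blast
 obtain l where l:"vord V y = crit+real l*dl" "(t^l*y)^(CARD('a)-1)/(- t)-1:mx V"
  using torsion_level[OF y] by blast
 have "l = k" using k(1) l(1) eq t(2) by simp
 have "(x/y)^(CARD('a)-1) = ((t^k*x)^(CARD('a)-1)/(- t))*inverse ((t^k*y)^(CARD('a)-1)/(- t))"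
  using t0 x(2) y(2) by(simp add: power_mult_distrib field_simps)
 hence one:"(x/y)^(CARD('a)-1)-1:mx V"
  using near_1_mult[OF k(2) near_1_inverse[OF l(2)]] unfolding `l = k` by simp
 have u:"unit_at V (x/y)"
  using vord_zero_iff[OF V, of "x/y"] vord_divide[OF V x(2) y(2)] eq x(2) y(2) by simp
 hence xyV:"x/y:V" "x/y~:mx V" by(simp_all add: unit_at_def)
 let ?r = "res V (x/y)"
 have r1:"?r^(CARD('a)-1) = 1" by(metis V local.one place_1 place_power res_1 res_eq_iff res_power xyV(1))
 have "?r^CARD('a) = ?r^(CARD('a)-1)*?r" by(metis power_minus_mult zero_less_card_finite)
 hence "?r:Fq 1" using r1 by(simp add: Fq_iff)
 then obtain c where c:"?r = cst c" unfolding Fq_1 by blast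
 have "cst c~=0" using res_eq_0_iff[OF V xyV(1)] xyV(2) c by simp
 moreover have "x - cst c*y = 0 | vord V (x - cst c*y) > vord V y"
 proof (cases "x - cst c*y = 0")
  case False
  have "x/y - cst c:mx V" using res_cong[OF V xyV(1)] c by simp
  moreover have e:"x/y - cst c = (x - cst c*y)/y" using y(2) by(simp add: diff_divide_distrib)
  ultimately have "vord V ((x - cst c*y)/y) > 0"
   using vord_pos_iff[OF V, of "(x - cst c*y)/y"] False y(2) by simp
  thus ?thesis by(simp add: vord_divide[OF V False y(2)])
 qed simp
 ultimately show ?thesis by blast
qed

lemma torsion_maximal:
 assumes "torsion t N~={0}"
 shows "EX et:torsion t N. et~=0 & (ALL x:torsion t N. x~=0 --> vord V x<=vord V et)"
proof -
 let ?S = "vord V`(torsion t N-{0})"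
 have fin:"finite ?S" using finite_torsion[OF t(1) N] by simp
 have ne:"?S~={}" using assms torsion_0 by blast
 have "Max ?S:?S" by(rule Max_in[OF fin ne])
 then obtain et where "et:torsion t N-{0}" "Max ?S = vord V et" by blast
 moreover have "vord V x<=Max ?S" if "x:torsion t N-{0}" for x
  by(rule Max_ge[OF fin]) (use that in blast)
 ultimately show ?thesis by(metis DiffE DiffI insertCI singletonD)
qed

text \<open>The iterates of \<open>et\<close> under \<open>cz t\<close> reach every level from
  \<open>K\<close> down to \<open>0\<close>. Subtracting a scalar multiple of the iterate of equal
  level raises the level of a torsion point; beyond \<open>K\<close> only \<open>0\<close>
  remains.\<close>

lemma torsion_maximal_generates:
 assumes l:"et:torsion t N" "et~=0" and max:"!!x. x:torsion t N ==> x~=0 ==> vord V x<=vord V et"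
 shows "generates t N et"
proof -
 obtain K where K:"vord V et = crit+real K*dl" using torsion_level[OF l] by blast
 have it:"(Cz ^^ j) et:torsion t N & (Cz ^^ j) et~=0 & vord V ((Cz ^^ j) et) = crit+(real K-real j)*dl" if "j<=K" for j
  using that
 proof (induction j)
  case (Suc j)
  let ?y = "(Cz ^^ j) et"
  have y:"?y:torsion t N" "?y~=0" "vord V ?y = crit+(real K-real j)*dl" using Suc by auto
  have "(real K-real j)*dl > 0" using Suc.prems t(2) by(intro mult_pos_pos) simp_all
  hence "vord V ?y > crit" using y(3) by linarith
  note c = cz_above[OF y(2) this]
  have "vord V (Cz ?y) = crit+(real K-real (Suc j))*dl" unfolding c(2) y(3) by(simp add: algebra_simps)
  thus ?case using torsion_cz[OF y(1)] c(1) by simp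
 qed (use l K in simp)
 \<comment> \<open>The induction variable \<open>m\<close> counts levels down from
   \<open>K+1\<close>, where only \<open>0\<close> is left.\<close>
 have "EX f. x = opoly Cz f et" if "x:torsion t N" "x = 0 | vord V x >= crit+(real K+1-real m)*dl" for m x
  using that
 proof (induction m arbitrary: x)
  case 0
  have "x = 0"
  proof (rule ccontr)
   assume "x~=0"
   hence "vord V x <= crit+real K*dl" using max[OF 0(1)] K by simp
   moreover have "vord V x >= crit+(real K+1)*dl" using 0(2) `x ~= 0` by simp
   ultimately show False using t(2) by(simp add: algebra_simps)
  qed
  thus ?case by(metis opoly_0)
 next
  case (Suc m)
  show ?case
  proof (cases "x = 0 | vord V x >= crit+(real K+1-real m)*dl")
   case True
   thus ?thesis using Suc by blast
  next
   case False
   hence x0:"x~=0" by blast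
   obtain k where k:"vord V x = crit+real k*dl" using torsion_level[OF Suc.prems(1) x0] by blast
   have "real k*dl < (real K+1-real m)*dl" "(real K-real m)*dl<=real k*dl"
    using False Suc.prems(2) x0 k by(simp_all add: algebra_simps)
   hence "real k < real K+1-real m" "real K-real m<=real k" using t(2) by(simp_all add: mult_less_cancel_right mult_le_cancel_right)
   hence "real (k+m) < real (K+1)" "real K<=real (k+m)" by simp_all
   hence "k+m = K" unfolding of_nat_less_iff of_nat_le_iff by simp
   hence km:"real k = real K-real m" "m<=K" by auto
   let ?y = "(Cz ^^ m) et"
   have y:"?y:torsion t N" "?y~=0" "vord V ?y = vord V x" using it[OF km(2)] k km(1) by simp_all
   obtain c where c:"x - cst c*?y = 0 | vord V (x - cst c*?y) > vord V ?y"
    using torsion_same_level[OF Suc.prems(1) x0 y(1,2) y(3)[symmetric]] by blast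
   let ?z = "x - cst c*?y"
   have z:"?z:torsion t N" by(rule torsion_diff[OF Suc.prems(1) torsion_cst[OF y(1)]])
   have "?z = 0 | vord V ?z >= crit+(real K+1-real m)*dl"
   proof (cases "?z = 0")
    case False
    obtain j where j:"vord V ?z = crit+real j*dl" using torsion_level[OF z False] by blast
    have "real k*dl < real j*dl" using c False y(3) k j by simp
    hence "real k < real j" using t(2) by(simp add: mult_less_cancel_right)
    hence "real (k+1)<=real j" by simp
    hence "real K+1-real m<=real j" using km(1) by simp
    hence "(real K+1-real m)*dl<=real j*dl" using t(2) by(intro mult_right_mono) simp_all
    thus ?thesis using j by simp
   qed simp
   from Suc.IH[OF z this] obtain f where f:"?z = opoly Cz f et" by blast
   have "opoly Cz (pmon c m+f) et = cst c*?y+?z" by(simp only: opoly_add opoly_monom f)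
   thus ?thesis by(intro exI[of _ "pmon c m+f"]) simp
  qed
 qed
 note main = this
 have "EX f. x = opoly Cz f et" if x:"x:torsion t N" for x
  by(rule main[of x "Suc K", OF x]) (use torsion_vord_ge[OF x] in auto)
 thus ?thesis using l(1) unfolding generates_def by blast
qed

theorem torsion_generator:"EX et. generates t N et"
 by(metis empty_iff generates_def insert_iff opoly_0 torsion_maximal torsion_maximal_generates)

text \<open>The image of a generator of maximal valuation differs from a scalar multiple by an element of larger
  valuation, that is, by \<open>0\<close>.\<close>

theorem dgrp_scalar:
 assumes s:"sg:dgrp V \<kk>"
 shows "EX c. cst c~=0 & (ALL x:torsion t N. sg x = cst c*x)"
proof (cases "torsion t N = {0}")
 case True
 thus ?thesis using linear_op_0[OF linear_op_auts[OF dgrpD(1)[OF s]]] by(intro exI[of _ 1]) (simp add: cst_simps)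
next
 case False
 obtain et where l:"et:torsion t N" "et~=0" "ALL x:torsion t N. x~=0 --> vord V x<=vord V et"
  using torsion_maximal[OF False] by blast
 have g:"generates t N et" using torsion_maximal_generates l by blast
 note sa = dgrpD(1)[OF s] and tk = parameter_kk[OF t(1)]
 have sl:"sg et:torsion t N" by(rule torsion_auts[OF sa tk l(1)])
 have sl0:"sg et~=0" using endo_eq_0_iff[OF auts_endo[OF sa]] l(2) by simp
 obtain c where c:"cst c~=0" "sg et - cst c*et = 0 | vord V (sg et - cst c*et) > vord V et"
  using torsion_same_level[OF sl sl0 l(1,2) dgrp_vord[OF ifield_kk_self V s l(2)]] by blast
 have eq:"sg et = cst c*et" by(smt (verit, ccfv_threshold) c(2) eq_iff_diff_eq_0 l(1,3) sl torsion_cst torsion_diff)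
 have "sg x = cst c*x" if x:"x:torsion t N" for x
 proof -
  obtain f where f:"x = opoly Cz f et" using generatesD(2)[OF g x] by blast
  show ?thesis unfolding f auts_opoly_cz[OF sa tk] eq by(rule linear_op_cst[OF linear_op_opoly[OF linear_op_cz]])
 qed
 thus ?thesis using c(1) by blast
qed

end

section \<open>Cyclotomic fields at the infinite places\<close>

text \<open>The uniformizer has value \<open>1\<close> and is a fraction of polynomials, so
  \<open>1\<close> is an integer multiple of \<open>vord V \<TT>\<close>, itself an integer; at a
  pole the sign is negative.\<close>

lemma vord_T_infinite:
 fixes V :: "'a::{field,finite} ac set"
 assumes I:"infinite_place V"
 shows "vord V \<TT> = -1"
proof -
 note V = infinite_placeD(1)[OF I]
 obtain z :: "'a poly fract" where z:"unif V = to_ac z" using unif_kk[OF V] unfolding \<kk>_def by blast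
 obtain f g where fg:"z = Fract f g" "g~=0" by(cases z)
 have "Fract f g = Fract f 1/Fract g 1" using fg(2) by(simp add: divide_fract)
 hence eq:"unif V = to_ac (Fract f 1)/to_ac (Fract g 1)" unfolding z fg(1) by(simp only: to_ac_divide)
 have "f~=0" using unif_neq_0[OF V] z fg(1) by(auto simp: fract_collapse)
 note f' = vord_polynomial[OF I this] and g' = vord_polynomial[OF I fg(2)]
 obtain i :: int where i:"vord V \<TT> = of_int i" using vord_kk[OF V T_kk T_neq_0] by blast
 have "1 = vord V (to_ac (Fract f 1)/to_ac (Fract g 1))" using vord_unif[OF V] eq by simp
 also have "\<dots> = (real (pdeg f)-real (pdeg g))*vord V \<TT>"
  using vord_divide[OF V conjunct1[OF f'] conjunct1[OF g']] f' g' by(simp add: algebra_simps)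
 also have "\<dots> = of_int ((int (pdeg f)-int (pdeg g))*i)" using i by simp
 finally have "(int (pdeg f)-int (pdeg g))*i = 1" by linarith
 hence "i = 1 | i = -1" by(auto simp: zmult_eq_1_iff)
 moreover have "vord V \<TT> < 0" using vord_nonneg_iff[OF V T_neq_0] infinite_placeD(2)[OF I] by auto
 ultimately show ?thesis using i by auto
qed

lemma parameter_T:"parameter \<TT>" "parameter (inverse \<TT>)"
 by(simp_all add: parameter_def)

lemma finab_cyclotomic:
 fixes V :: "'a::{field,finite} ac set" and N :: "'a poly"
 assumes I:"infinite_place V" and N:"N~=0"
 shows "finab \<kk> (cyclotomic N)"
 using I N finab_cyclotomic_wrt infinite_placeD(1) parameter_T(1) torsion_generator vord_T_infinite by fastforce

lemma scalar_funpow: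
 assumes s:"sg:auts \<kk>" and eq:"!!x. x:torsion t N ==> sg x = cst c*x" and x:"x:torsion t N"
 shows "(sg ^^ k) x = cst (c^k)*x"
proof (induction k)
 case (Suc k)
 have "(sg ^^ Suc k) x = sg (cst (c^k)*x)" by(simp only: funpow.simps comp_apply Suc)
 also have "\<dots> = cst (c^k)*(cst c*x)" by(simp only: linear_op_cst[OF linear_op_auts[OF s]] eq[OF x])
 finally show ?case by(simp add: cst_simps mult_ac)
qed (simp add: cst_simps)

lemma power_card_minus_1:"(c :: 'a::{field,finite})~=0 ==> c^(CARD('a)-1) = 1"
proof -
 assume c:"c~=0"
 have "c^(CARD('a)-1) * c = 1 * c" using power_card_eq[of c] by(metis mult_1 power_minus_mult zero_less_card_finite)
 thus ?thesis using c by simp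
qed

lemma power_card_power_eq:"(c :: 'a::{field,finite})^(CARD('a)^n) = c"
 by(induction n) (simp_all add: power_mult power_card_eq mult.commute[of "CARD('a)"])

lemma scalar_image_card:
 fixes y :: "'a::{field,finite} ac"
 assumes "y~=0"
 shows "card {cst c*y | c. cst c~=(0 :: 'a ac)} = CARD('a)-1" "finite {cst c*y | c. cst c~=(0 :: 'a ac)}"
proof -
 have eq:"{cst c*y | c. cst c~=(0 :: 'a ac)} = (%c. cst c*y)`(UNIV-{0})"
  using cst_eq_iff[of _ 0] by(auto simp: cst_simps)
 show "finite {cst c*y | c. cst c~=(0 :: 'a ac)}" unfolding eq by simp
 have "inj (%c. cst c*y)" using assms by(simp add: inj_on_def cst_eq_iff)
 hence "inj_on (%c. cst c*y) (UNIV-{0})" by(rule inj_on_subset) simp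
 thus "card {cst c*y | c. cst c~=(0 :: 'a ac)} = CARD('a)-1" unfolding eq by(simp add: card_image card_Diff_singleton)
qed

text \<open>By \<open>card_inertia_mult_vord\<close> the order of the inertia group clears the
  denominator \<open>n\<close> of the value of \<open>x\<close>. The first form occurs for torsion
  of \<open>cyclotomic N\<close> at infinity, the second for primitive torsion of a power of
  \<open>inverse \<TT>\<close>.\<close>

lemma card_inertia_multiple:
 assumes B:"finab \<kk> B" and V:"place V" and x:"x:B" "x~=0" "vord V x = of_int k-1/real n | vord V x = 1/real n" and n:"n > 0"
 shows "n dvd card (rgrp (igrp V \<kk>) B)"
proof -
 let ?c = "card (rgrp (igrp V \<kk>) B)"
 obtain i :: int where i:"real ?c*vord V x = of_int i" using card_inertia_mult_vord[OF B V x(1,2)] by blast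
 have "EX j::int. real ?c = of_int j*real n"
 proof (cases "vord V x = 1/real n")
  case True
  have "real ?c = of_int i*real n" using i[unfolded True] n by(simp add: field_simps)
  thus ?thesis by blast
 next
  case False
  hence v:"vord V x = of_int k-1/real n" using x(3) by blast
  have "real ?c*(real_of_int k*real n-1) = of_int i*real n"
   using i n unfolding v by(simp add: field_simps)
  hence "real ?c = of_int (int ?c*k-i)*real n" by(simp add: algebra_simps)
  thus ?thesis by blast
 qed
 then obtain j :: int where "real ?c = of_int j*real n" by blast
 hence "int ?c = j*int n" by(metis of_int_eq_iff of_int_mult of_int_of_nat_eq)
 hence "int n dvd int ?c" by simp
 thus ?thesis by simp
qed

lemma card_restrict_igrp_pos:
 assumes B:"finab \<kk> B"
 shows "finite (rgrp (igrp V \<kk>) B)" "card (rgrp (igrp V \<kk>) B) > 0"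
proof -
 have sub:"igrp V \<kk><=auts \<kk>" using igrp_auts by blast
 show f:"finite (rgrp (igrp V \<kk>) B)" using finite_subset[OF rgrp_mono[OF sub] finabD(7)[OF B]] .
 have "rgrp (igrp V \<kk>) B~={}" using rgrpI[OF autgrpD(2)[OF autgrp_igrp[OF ifield_kk_self, of V]]] by blast
 thus "card (rgrp (igrp V \<kk>) B) > 0" using f by(simp add: card_gt_0_iff)
qed

text \<open>The decomposition group acts on torsion by nonzero scalars, and the image of one point
  \<open>y~=0\<close> determines the scalar. As \<open>y\<close> has value \<open>k-1/(q-1)\<close>
  with an integer \<open>k\<close>, inertia has at least \<open>q-1\<close> elements on
  \<open>cyclotomic N\<close>; so all scalars already come from inertia.\<close>

theorem cyclotomic_totally_ramified:
 fixes V :: "'a::{field,finite} ac set"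
 assumes I:"infinite_place V" and N:"N~=0" and s:"sg:dgrp V \<kk>"
 shows "EX i:igrp V \<kk>. ALL x:cyclotomic N. i x = sg x"
proof -
 note V = infinite_placeD(1)[OF I]
 have tneg:"vord V \<TT> < 0" using vord_T_infinite[OF I] by simp
 note scal = dgrp_scalar[OF V parameter_T(1) tneg N]
 note sa = dgrpD(1)[OF s]
 note A = finab_cyclotomic[OF I N]
 obtain c where c:"cst c~=0" "ALL x:torsion \<TT> N. sg x = cst c*x" using scal[OF s] by blast
 have red:"EX i:igrp V \<kk>. ALL x:cyclotomic N. i x = sg x"
  if i:"i:igrp V \<kk>" "ALL x:torsion \<TT> N. i x = sg x" for i
  using endo_eq_cyclotomic_wrt[OF igrp_auts[OF i(1)] sa, of \<TT> N] i by blast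
 show ?thesis
 proof (cases "torsion \<TT> N = {0}")
  case True
  show ?thesis by(metis True all_not_in_conv autgrpD(2) autgrp_igrp c(2) ifield_kk_self insert_iff mult_zero_right red)
 next
  case False
  then obtain y where y:"y:torsion \<TT> N" "y~=0" using torsion_0 by blast
  have yA:"y:cyclotomic N" unfolding cyclotomic_wrt_eq using adj_incl[of "\<kk> Un torsion \<TT> N"] y(1) by blast
  define R where "R = rgrp (igrp V \<kk>) (cyclotomic N)"
  define S where "S = {cst c*y | c. cst c~=(0 :: 'a ac)}"
  note fR = card_restrict_igrp_pos[OF A, of V, folded R_def]
  have ev:"(%g. g y)`R<=S"
  proof
   fix z assume "z:(%g. g y)`R"
   then obtain g where g:"g:R" "z = g y" by(rule imageE)
   obtain i where i:"i:igrp V \<kk>" "g = restrict i (cyclotomic N)" using rgrpE[OF g(1)[unfolded R_def]] by(rule bexE)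
   obtain e where "cst e~=0" "ALL x:torsion \<TT> N. i x = cst e*x" using scal[OF igrpD(1)[OF i(1)]] by blast
   thus "z:S" unfolding S_def g(2) i(2) using yA y(1) by auto
  qed
  have det:"ALL x:torsion \<TT> N. i x = j x" if h:"i:dgrp V \<kk>" "j:dgrp V \<kk>" "i y = j y" for i j
   by(metis mult_cancel_right scal that(1,2,3) y(1,2))
  have inj:"inj_on (%g. g y) R"
  proof (rule inj_onI)
   fix g g' assume gg:"g:R" "g':R" "g y = g' y"
   obtain i where i:"i:igrp V \<kk>" "g = restrict i (cyclotomic N)" using rgrpE[OF gg(1)[unfolded R_def]] by(rule bexE)
   obtain j where j:"j:igrp V \<kk>" "g' = restrict j (cyclotomic N)" using rgrpE[OF gg(2)[unfolded R_def]] by(rule bexE)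
   have "i y = j y" using gg(3) i(2) j(2) yA by simp
   note d = det[OF igrpD(1)[OF i(1)] igrpD(1)[OF j(1)] this]
   show "g = g'" unfolding i(2) j(2) rgrp_eq_iff
    using endo_eq_cyclotomic_wrt[OF igrp_auts[OF i(1)] igrp_auts[OF j(1)], of \<TT> N] d by blast
  qed
  obtain k :: nat where k:"vord V y = vord V \<TT>/(real CARD('a)-1)+real k *-vord V \<TT>"
   using torsion_level[OF V parameter_T(1) tneg N y] by blast
  have q:"CARD('a)-1 > 0" "real (CARD('a)-1) = real CARD('a)-1" using card_field_ge_2[where ?'a = 'a] by simp_all
  have vy:"vord V y = of_int (int k)-1/real (CARD('a)-1)" unfolding k vord_T_infinite[OF I] q(2) by simp
  have "CARD('a)-1 <= card R" using A R_def V card_inertia_multiple dvd_imp_le fR(2) q(1) vy y(2) yA by blast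
  note S = scalar_image_card[OF y(2), folded S_def]
  have "(%g. g y)`R = S"
   by(rule card_subset_eq[OF S(2) ev]) (use card_image[OF inj] card_mono[OF S(2) ev] S(1) `CARD('a) - 1 <= card R` in simp)
  moreover have "sg y:S" unfolding S_def using c y(1) by blast
  ultimately obtain g where g:"g:R" "sg y = g y" by blast
  obtain i where i:"i:igrp V \<kk>" "g = restrict i (cyclotomic N)" using rgrpE[OF g(1)[unfolded R_def]] by(rule bexE)
  have "i y = sg y" using g(2) i(2) yA by simp
  from det[OF igrpD(1)[OF i(1)] s this] show ?thesis by(rule red[OF i(1)])
 qed
qed

text \<open>On torsion \<open>sg\<close> is a nonzero scalar \<open>c\<close>, and
  \<open>c^(q-1) = 1\<close>, \<open>c^(q^n) = c\<close>.\<close>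

lemma dgrp_powers_cyclotomic:
 fixes V :: "'a::{field,finite} ac set"
 assumes I:"infinite_place V" and N:"N~=0" and s:"sg:dgrp V \<kk>" and x:"x:cyclotomic N"
 shows "(sg ^^ (CARD('a)-1)) x = x" "(sg ^^ (CARD('a)^n)) x = sg x"
proof -
 note V = infinite_placeD(1)[OF I]
 have tneg:"vord V \<TT> < 0" using vord_T_infinite[OF I] by simp
 note sa = dgrpD(1)[OF s]
 obtain c where c:"cst c~=0" "ALL x:torsion \<TT> N. sg x = cst c*x"
  using dgrp_scalar[OF V parameter_T(1) tneg N s] by blast
 have c0:"c~=0" using c(1) by(auto simp: cst_simps)
 have pw:"(sg ^^ k) y = cst (c^k)*y" if "y:torsion \<TT> N" for k y
  by(rule scalar_funpow[OF sa _ that]) (use c(2) in blast)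
 show "(sg ^^ (CARD('a)-1)) x = x"
  by(rule endo_eq_cyclotomic_wrt[OF auts_funpow[OF sa] auts_id _ x]) (simp only: pw power_card_minus_1[OF c0] cst_simps(2) mult_1)
 show "(sg ^^ (CARD('a)^n)) x = sg x"
  by(rule endo_eq_cyclotomic_wrt[OF auts_funpow[OF sa] sa _ x]) (use c(2) in \<open>simp add: pw power_card_power_eq\<close>)
qed

section \<open>Galois degrees\<close>

lemma finab_tower:
 assumes F:"finab L F" and F':"ifield F'" "L<=F'" "F'<=F"
 shows "card (rgrp (auts L) F) = card (rgrp (auts L) F') * card (rgrp (auts F') F)"
proof -
 note m = finab_mid[OF F F']
 interpret Ring.field "\<Omega> :: 'a ac ring" by(rule field_\<Omega>)
 have K:"subfield L \<Omega>" "subfield F' \<Omega>"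
  unfolding subfield_\<Omega>_iff using ifield_sfield finabD(1)[OF F] F'(1) by blast+
 have "has_degree L F (card (rgrp (auts L) F') * card (rgrp (auts F') F))"
  by(rule telescopic_base[OF K finab_dimension[OF m(1)] finab_dimension[OF m(2)]])
 thus ?thesis using dimension_is_inj[OF K(1) finab_dimension[OF F]] by blast
qed

lemma finab_has_degree_iff:
 assumes F:"finab L F"
 shows "has_degree L F n <-> n = card (rgrp (auts L) F)"
proof -
 interpret Ring.field "\<Omega> :: 'a ac ring" by(rule field_\<Omega>)
 have K:"subfield L \<Omega>" unfolding subfield_\<Omega>_iff by(rule ifield_sfield[OF finabD(1)[OF F]])
 show ?thesis using finab_dimension[OF F] dimension_is_inj[OF K] by blast
qed

lemma aut_group_pow:
 assumes G:"autgrp Ga" and st:"stable Ga E" and s:"sg:Ga"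
 shows "restrict sg E [^]\<^bsub>aut_group E De\<^esub> (n::nat) = restrict (sg ^^ n) E"
proof (induction n)
 case 0
 show ?case by(simp add: aut_group_def BijGroup_def nat_pow_def id_def)
next
 case (Suc n)
 note sn = autgrp_funpow[OF G s, of n]
 note k = subsetD[OF autgrpD(1)[OF G]] and im = autgrp_image_eq[OF G st]
 have "restrict sg E [^]\<^bsub>aut_group E De\<^esub> Suc n = restrict (sg ^^ n) E \<otimes>\<^bsub>aut_group E De\<^esub> restrict sg E"
  unfolding Suc.IH[symmetric] by(simp add: nat_pow_def)
 also have "\<dots> = restrict (%x. (sg ^^ n) (sg x)) E" by(rule BijGroup_mult_restrict[OF k[OF sn] im[OF sn] k[OF s] im[OF s]])
 finally show ?case by(simp only: funpow_Suc_right comp_def)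
qed

lemma funpow_card_trivial:
 assumes G:"autgrp Ga" and st:"stable Ga E" and s:"sg:Ga" and x:"x:E"
 shows "(sg ^^ card (rgrp Ga E)) x = x"
proof -
 let ?A = "aut_group E (rgrp Ga E)"
 interpret A: group ?A by(rule group_aut_group[OF G st])
 have c:"carrier ?A = rgrp Ga E" by(simp add: aut_group_def)
 have "restrict sg E [^]\<^bsub>?A\<^esub> Coset.order ?A = \<one>\<^bsub>?A\<^esub>" by(rule A.pow_order_eq_1) (use c rgrpI[OF s] in simp)
 hence "restrict (sg ^^ card (rgrp Ga E)) E = restrict (%x. x) E"
  unfolding aut_group_pow[OF G st s] Coset.order_def c by(simp add: aut_group_def BijGroup_def)
 thus ?thesis using x unfolding rgrp_eq_iff by blast
qed

section \<open>Torsion of a power of the parameter\<close>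

lemma power_q_add_poly:"(f+g)^CARD('a) = f^CARD('a)+(g :: 'a::{field,finite} poly)^CARD('a)"
proof -
 have pw:"to_ac (Fract a 1)^k = to_ac (Fract (a^k) 1)" for a :: "'a poly" and k
 proof (induction k)
  case (Suc k)
  have "Fract (a^Suc k) 1 = Fract a 1*Fract (a^k) 1" by simp
  thus ?case by(simp only: power_Suc Suc to_ac_mult)
 qed (simp add: fract_collapse)
 have ad:"to_ac (Fract a 1)+to_ac (Fract b 1) = to_ac (Fract (a+b) 1)" for a b :: "'a poly"
  by(simp only: to_ac_add[symmetric] add_fract one_neq_zero not_False_eq_True mult_1_right mult_1_left)
 have "to_ac (Fract ((f+g)^CARD('a)) 1) = to_ac (Fract (f^CARD('a)+g^CARD('a)) 1)"
  unfolding pw[symmetric] ad[symmetric] by(rule power_q_add)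
 thus ?thesis by(simp add: to_ac_eq_iff eq_fract)
qed

text \<open>The \<open>q^n\<close>-th power is additive and fixes \<open>c\<close>. This turns
  nilpotency of \<open>sg - c\<close> into a statement about a power of \<open>sg\<close>
  itself.\<close>

lemma linear_factor_power:
 fixes c :: "'a::{field,finite}"
 shows "[:- c, 1:]^(CARD('a)^n) = pmon 1 (CARD('a)^n)+[:- c:]"
proof -
 have add:"(f+g)^(CARD('a)^n) = f^(CARD('a)^n)+g^(CARD('a)^n)" for f g :: "'a poly"
  by(induction n) (simp_all add: power_q_add_poly power_mult mult.commute[of "CARD('a)"])
 have "[:- c, 1:] = pmon 1 1+[:- c:]" by(simp add: monom_Suc)
 hence "[:- c, 1:]^(CARD('a)^n) = pmon 1 1^(CARD('a)^n)+[:- c:]^(CARD('a)^n)" by(simp only: add)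
 moreover have "[:- c:]^k = [:(- c)^k:]" for k by(induction k) (simp_all add: one_pCons)
 ultimately show ?thesis by(simp add: monom_power power_card_power_eq)
qed

lemma opoly_linear_factor:"opoly ps [:- c, 1:] x = ps x - cst c*x"
 by(simp add: opoly_pCons opoly_0 cst_simps)

abbreviation ktorsion :: "'a::{field,finite} ac => nat => 'a ac set" where
 "ktorsion t n == torsion t (pmon 1 n)"

lemma ktorsion_iff:"x:ktorsion t n <-> (cz t ^^ n) x = 0"
 by(simp add: torsion_def opoly_monom cst_simps)

lemma ktorsion_Suc_iff:"x:ktorsion t (Suc n) <-> cz t x:ktorsion t n"
 unfolding ktorsion_iff by(simp only: funpow_Suc_right comp_apply)

lemma ktorsion_funpow:"x:ktorsion t (m+n) ==> (cz t ^^ m) x:ktorsion t n"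
 unfolding ktorsion_iff by(simp add: funpow_add[symmetric, THEN fun_cong, unfolded comp_apply] add.commute)

text \<open>Both points satisfy \<open>z^q = -t*z\<close>, so their quotient satisfies
  \<open>z^q = z\<close>.\<close>

lemma ktorsion_1_unique:
 fixes t :: "'a::{field,finite} ac"
 assumes x:"x:ktorsion t 1" and y:"y:ktorsion t 1" "y~=0"
 shows "EX c. x = cst c*y"
proof -
 have e:"x^CARD('a) =-(t*x)" "y^CARD('a) =-(t*y)"
  using x y(1) unfolding ktorsion_iff by(simp_all add: cz_def eq_neg_iff_add_eq_0 add.commute)
 have "t~=0"
 proof
  assume "t = 0"
  hence "y^CARD('a) = 0" using e(2) by simp
  thus False using y(2) by simp
 qed
 hence "(x/y)^CARD('a) = x/y" unfolding power_divide e using y(2) by simp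
 hence "x/y:Fq 1" by(simp add: Fq_iff)
 then obtain c where "x/y = cst c" unfolding Fq_1 by blast
 hence "x = cst c*y" using y(2) by(simp add: field_simps)
 thus ?thesis by blast
qed

lemma cz_surj:"EX y. cz t y = (x :: 'a::{field,finite} ac)"
proof -
 let ?p = "pmon 1 CARD('a)+[:- x, t:]"
 have q:"CARD('a) >= 2" by(rule card_field_ge_2)
 have "pdeg [:- x, t:] < pdeg (pmon (1 :: 'a ac) CARD('a))"
  using q by(simp add: degree_monom_eq)
 hence "pdeg ?p = CARD('a)" by(simp add: degree_add_eq_left degree_monom_eq)
 hence "pdeg ?p > 0" using q by simp
 from alg_closed_imp_poly_has_root[OF this] obtain y where "poly ?p y = 0" ..
 hence "cz t y = x" by(simp add: cz_def poly_monom algebra_simps eq_neg_iff_add_eq_0)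
 thus ?thesis ..
qed

lemma ex_primitive_torsion:
 fixes t :: "'a::{field,finite} ac"
 assumes "t~=0"
 shows "EX l. l:ktorsion t (Suc n) & l~:ktorsion t n"
proof (induction n)
 case 0
 have "CARD('a)-1 > 0" using card_field_ge_2[where ?'a = 'a] by simp
 from nth_root_exists[OF this] obtain y :: "'a ac" where y:"y^(CARD('a)-1) =-t" by blast
 have y0:"y~=0" using y assms `CARD('a) - 1 > 0` by(metis neg_equal_0_iff_equal power_0_left less_numeral_extra(3))
 have "y^CARD('a) = y^(CARD('a)-1)*y" by(metis power_minus_mult zero_less_card_finite)
 hence "cz t y = 0" using y by(simp add: cz_def)
 thus ?case using y0 unfolding ktorsion_iff by(intro exI[of _ y]) simp
next
 case (Suc n)
 then obtain l where l:"l:ktorsion t (Suc n)" "l~:ktorsion t n" by blast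
 obtain y where y:"cz t y = l" using cz_surj[of t l] by blast
 have "y:ktorsion t (Suc (Suc n))" "y~:ktorsion t (Suc n)" using l unfolding ktorsion_Suc_iff[of y] y by blast+
 thus ?case by blast
qed

context
 fixes t :: "'a::{field,finite} ac" and n :: nat and l :: "'a ac"
 assumes t:"parameter t" and l:"l:ktorsion t (Suc n)" "l~:ktorsion t n"
begin

lemma monom_neq_0:"pmon (1 :: 'a) k~=0"
 by(simp add: monom_eq_0_iff)

text \<open>\<open>j\<close> applications of \<open>cz t\<close> send \<open>x\<close> and the
  iterate of \<open>l\<close> into the torsion of \<open>t\<close> itself, which is one-dimensional
  by \<open>ktorsion_1_unique\<close>.\<close>

lemma ktorsion_step:
 assumes j:"j<=n" and x:"x:ktorsion t (Suc j)"
 shows "EX c. x - cst c*(cz t ^^ (n-j)) l:ktorsion t j"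
proof -
 note lin = linear_op_funpow[OF linear_op_cz[of t], of j]
 let ?w = "(cz t ^^ (n-j)) l"
 have w:"(cz t ^^ j) ?w = (cz t ^^ n) l" using j by(simp add: funpow_add[symmetric, THEN fun_cong, unfolded comp_apply])
 have 1:"(cz t ^^ j) x:ktorsion t 1" by(rule ktorsion_funpow) (use x in simp)
 have 2:"(cz t ^^ n) l:ktorsion t 1" by(rule ktorsion_funpow) (use l(1) in simp)
 have 3:"(cz t ^^ n) l~=0" using l(2) unfolding ktorsion_iff .
 obtain c where c:"(cz t ^^ j) x = cst c*(cz t ^^ n) l" using ktorsion_1_unique[OF 1 2 3] by blast
 have "(cz t ^^ j) (x - cst c*?w) = 0" by(simp add: linear_op_diff[OF lin] linear_op_cst[OF lin] w c)
 thus ?thesis unfolding ktorsion_iff by blast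
qed

lemma ktorsion_span:
 assumes "j<=Suc n" "x:ktorsion t j"
 shows "EX f. x = opoly (cz t) f l"
 using assms
proof (induction j arbitrary: x)
 case 0
 hence "x = 0" unfolding ktorsion_iff by simp
 thus ?case by(metis opoly_0)
next
 case (Suc j)
 hence j:"j<=n" by simp
 obtain c where c:"x - cst c*(cz t ^^ (n-j)) l:ktorsion t j" using ktorsion_step[OF j Suc.prems(2)] by blast
 obtain f where f:"x - cst c*(cz t ^^ (n-j)) l = opoly (cz t) f l" using Suc.IH[OF _ c] j by auto
 have "opoly (cz t) (pmon c (n-j)+f) l = x" by(simp add: opoly_add opoly_monom f[symmetric])
 thus ?case by metis
qed

lemma generates_ktorsion:"generates t (pmon 1 (Suc n)) l"
 unfolding generates_def using l(1) ktorsion_span[OF order_refl] by blast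

lemma finite_ktorsion:"finite (ktorsion t j)"
 by(rule finite_torsion[OF t monom_neq_0])

lemma card_ktorsion_le:"j<=Suc n ==> card (ktorsion t j)<=CARD('a)^j"
proof (induction j)
 case 0
 have "x:ktorsion t 0 <-> x = 0" for x unfolding ktorsion_iff by simp
 hence "ktorsion t 0 = {0}" by blast
 thus ?case by simp
next
 case (Suc j)
 hence j:"j<=n" by simp
 let ?w = "(cz t ^^ (n-j)) l" and ?S = "(UNIV :: 'a set) \<times> ktorsion t j"
 have fin:"finite ?S" using finite_ktorsion by simp
 have "ktorsion t (Suc j)<=(%(c, z). cst c*?w+z)`?S"
 proof
  fix x assume x:"x:ktorsion t (Suc j)"
  obtain c where c:"x - cst c*?w:ktorsion t j" using ktorsion_step[OF j x] by blast
  show "x:(%(c, z). cst c*?w+z)`?S"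
   by(rule image_eqI[of _ _ "(c, x - cst c*?w)"]) (use c in auto)
 qed
 from card_mono[OF finite_imageI[OF fin] this] have "card (ktorsion t (Suc j)) <= card ?S"
  using card_image_le[OF fin, of "%(c, z). cst c*?w+z"] by linarith
 also have "\<dots><=CARD('a)*CARD('a)^j" using Suc j by(simp add: card_cartesian_product)
 finally show ?case by simp
qed

definition primitive_torsion :: "'a ac set" where
 "primitive_torsion = ktorsion t (Suc n)-ktorsion t n"

lemma card_primitive_torsion_le:"card primitive_torsion<=(CARD('a)-1)*CARD('a)^n"
proof -
 let ?S = "(UNIV-{0 :: 'a}) \<times> ktorsion t n"
 have fin:"finite ?S" using finite_ktorsion by simp
 have "primitive_torsion<=(%(c, z). cst c*l+z)`?S"
 proof
  fix x assume "x:primitive_torsion"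
  hence x:"x:ktorsion t (Suc n)" "x~:ktorsion t n" by(auto simp: primitive_torsion_def)
  obtain c where c:"x - cst c*l:ktorsion t n" using ktorsion_step[OF order_refl x(1)] by auto
  have "c~=0" using c x(2) by(auto simp: cst_simps)
  thus "x:(%(c, z). cst c*l+z)`?S"
   by(intro image_eqI[of _ _ "(c, x - cst c*l)"]) (use c in auto)
 qed
 from card_mono[OF finite_imageI[OF fin] this] have "card primitive_torsion <= card ?S"
  using card_image_le[OF fin, of "%(c, z). cst c*l+z"] by linarith
 also have "\<dots><=(CARD('a)-1)*CARD('a)^n"
  using card_ktorsion_le[of n] by(simp add: card_cartesian_product card_Diff_singleton)
 finally show ?thesis .
qed

lemma finite_primitive_torsion:"finite primitive_torsion"
 unfolding primitive_torsion_def using finite_ktorsion by simp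

lemma primitive_torsion_auts:"sg:auts \<kk> ==> sg l:primitive_torsion"
proof -
 assume s:"sg:auts \<kk>"
 note tk = parameter_kk[OF t]
 have "sg l:ktorsion t (Suc n)" by(rule torsion_auts[OF s tk l(1)])
 moreover have "sg l~:ktorsion t n"
  by(metis auts_inv auts_inv_simps(2) ifield_kk_self l(2) s tk torsion_auts)
 ultimately show ?thesis by(simp add: primitive_torsion_def)
qed

text \<open>On the torsion \<open>\<sigma> - c\<close> is nilpotent for some scalar \<open>c\<close>, hence \<open>\<sigma>\<^bsup>q^n\<^esup> = c\<^bsup>q^n\<^esup> = c\<close> there.\<close>

theorem auts_power_scalar:
 assumes s:"sg:auts \<kk>"
 shows "EX c. ALL x:ktorsion t (Suc n). (sg ^^ (CARD('a)^n)) x = cst c*x"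
proof -
 note tk = parameter_kk[OF t] and ls = linear_op_auts[OF s]
 have "sg l:ktorsion t (Suc n)" by(rule torsion_auts[OF s tk l(1)])
 then obtain c where c:"sg l - cst c*l:ktorsion t n" using ktorsion_step[OF order_refl] by auto
 let ?p = "[:- c, 1:] :: 'a poly"
 have it:"(cz t ^^ j) (sg x) = sg ((cz t ^^ j) x)" for j x
  by(induction j) (simp_all add: auts_cz[OF s tk])
 \<comment> \<open>The bottom layer is spanned by the \<open>n\<close>-th iterate of
   \<open>l\<close>, on which \<open>sg\<close> acts as \<open>c\<close>; so \<open>sg - c\<close>
   lowers the torsion level by one.\<close>
 have step:"sg x - cst c*x:ktorsion t j" if x:"x:ktorsion t (Suc j)" for x j
 proof -
  note lin = linear_op_funpow[OF linear_op_cz[of t]]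
  have 1:"(cz t ^^ j) x:ktorsion t 1" by(rule ktorsion_funpow) (use x in simp)
  have 2:"(cz t ^^ n) l:ktorsion t 1" by(rule ktorsion_funpow) (use l(1) in simp)
  have 3:"(cz t ^^ n) l~=0" using l(2) unfolding ktorsion_iff .
  obtain b where b:"(cz t ^^ j) x = cst b*(cz t ^^ n) l" using ktorsion_1_unique[OF 1 2 3] by blast
  have "(cz t ^^ n) (sg l - cst c*l) = 0" using c unfolding ktorsion_iff .
  hence sl:"sg ((cz t ^^ n) l) = cst c*(cz t ^^ n) l" by(simp add: linear_op_diff[OF lin] linear_op_cst[OF lin] it)
  have "(cz t ^^ j) (sg x - cst c*x) = sg ((cz t ^^ j) x) - cst c*(cz t ^^ j) x"
   by(simp add: linear_op_diff[OF lin] linear_op_cst[OF lin] it)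
  also have "\<dots> = 0" unfolding b by(simp add: linear_op_cst[OF ls] sl)
  finally show ?thesis unfolding ktorsion_iff .
 qed
 have nil:"opoly sg (?p^j) x = 0" if "x:ktorsion t j" for j x
  using that
 proof (induction j arbitrary: x)
  case 0
  hence "x = 0" unfolding ktorsion_iff by simp
  thus ?case by(simp add: linear_op_0[OF linear_op_opoly[OF ls]])
 next
  case (Suc j)
  have "opoly sg (?p^Suc j) x = opoly sg (?p^j) (opoly sg ?p x)"
   by(simp only: power_Suc2 opoly_mult[OF ls])
  thus ?case using Suc.IH[OF step[OF Suc.prems]] by(simp only: opoly_linear_factor)
 qed
 \<comment> \<open>\<open>sg - c\<close> is nilpotent of index at most \<open>n+1\<close> on torsion
   of level \<open>n+1\<close>, and \<open>n+1<=q^n\<close>.\<close>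
 have "n < CARD('a)^n"
 proof -
  have "n < 2^n" by(rule less_exp)
  also have "\<dots><=CARD('a)^n" by(rule power_mono[OF card_field_ge_2]) simp
  finally show ?thesis .
 qed
 hence e:"?p^(CARD('a)^n) = ?p^(CARD('a)^n-Suc n)*?p^Suc n"
  by(simp only: power_add[symmetric] le_add_diff_inverse2 Suc_leI)
 have "(sg ^^ (CARD('a)^n)) x = cst c*x" if x:"x:ktorsion t (Suc n)" for x
 proof -
  have "opoly sg (?p^(CARD('a)^n)) x = 0"
   unfolding e opoly_mult[OF ls] nil[OF x] by(rule linear_op_0[OF linear_op_opoly[OF ls]])
  hence "opoly sg (pmon 1 (CARD('a)^n)) x + opoly sg [:- c:] x = 0"
   unfolding linear_factor_power opoly_add .
  thus ?thesis by(simp add: opoly_monom opoly_pCons opoly_0 cst_simps)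
 qed
 thus ?thesis by blast
qed

text \<open>Newton polygons: at a zero of \<open>t\<close> the valuation of a preimage of \<open>y\<close> under the Carlitz action of \<open>t\<close> is
  \<open>1/q\<close> of that of \<open>y\<close>, unless the latter is large.\<close>

lemma vord_primitive_torsion:
 assumes V:"place V" and vt:"vord V t = 1"
 shows "vord V l = 1/real (CARD('a)^n*(CARD('a)-1))"
proof -
 let ?q = "real CARD('a)"
 note t0 = parameter_neq_0[OF t]
 have q:"?q >= 2" "real (CARD('a)-1) = ?q-1" using card_field_ge_2[where ?'a = 'a] by simp_all
 have nz:"(cz t ^^ j) l~=0" if "j<=n" for j
 proof
  assume "(cz t ^^ j) l = 0"
  moreover have "(cz t ^^ n) l = (cz t ^^ (n-j)) ((cz t ^^ j) l)"
   using that by(simp add: funpow_add[symmetric, THEN fun_cong, unfolded comp_apply])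
  ultimately have "(cz t ^^ n) l = 0" using linear_op_0[OF linear_op_funpow[OF linear_op_cz]] by simp
  thus False using l(2) unfolding ktorsion_iff by blast
 qed
 have vp:"vord V (y^CARD('a)) = ?q*vord V y" "vord V (t*y) = 1+vord V y" if "y~=0" for y
  using that t0 vt by(simp_all add: vord_power[OF V] vord_mult[OF V])
 have main:"vord V ((cz t ^^ (n-j)) l) = 1/(?q^j*(?q-1))" if "j<=n" for j
  using that
 proof (induction j)
  case 0
  let ?y = "(cz t ^^ n) l"
  have y0:"?y~=0" by(rule nz) simp
  have "cz t ?y = 0" using l(1) unfolding ktorsion_iff by simp
  hence "vord V (?y^CARD('a)) = vord V (t*?y)" by(metis Groups.add_ac(2) V cz_def eq_neg_iff_add_eq_0 vord_minus)
  hence "?q*vord V ?y = 1+vord V ?y" unfolding vp[OF y0] .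
  thus ?case using q by(simp add: field_simps)
 next
  case (Suc j)
  let ?y = "(cz t ^^ (n-Suc j)) l" and ?x = "(cz t ^^ (n-j)) l"
  have eq:"n-j = Suc (n-Suc j)" using Suc.prems by simp
  have x:"?x = ?y^CARD('a)+t*?y" unfolding eq by(simp add: cz_def add.commute)
  have y0:"?y~=0" and x0:"?x~=0" using nz[of "n-Suc j"] nz[of "n-j"] by simp_all
  have y1:"?y^CARD('a)~=0" "t*?y~=0" using y0 t0 by simp_all
  let ?v = "vord V ?y"
  have vx:"vord V ?x = 1/(?q^j*(?q-1))" using Suc by simp
  have "?q^j >= 1" using q by simp
  hence "?q-1<=?q^j*(?q-1)" using q by(simp add: mult_le_cancel_right1)
  hence vx':"vord V ?x > 0" "vord V ?x<=1/(?q-1)" unfolding vx using q by(simp_all add: divide_left_mono frac_le)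
  \<comment> \<open>Otherwise \<open>?v >= 1/(q-1)\<close>, and \<open>?x\<close> would have value
    at least \<open>1+?v\<close>, exceeding its known bound.\<close>
  have "?q*?v < 1+?v"
  proof (rule ccontr)
   assume "~?q*?v < 1+?v"
   hence ge:"1+?v<=?q*?v" by simp
   hence "1<=(?q-1)*?v" by(simp add: algebra_simps)
   hence v:"?v >= 1/(?q-1)" using q by(simp add: field_simps)
   have "1+?v<=vord V ?x" unfolding x
    by(rule vord_add[OF V y1]) (use x x0 ge vp[OF y0] in auto)
   thus False using v vx'(2) by linarith
  qed
  hence "vord V (?y^CARD('a)) < vord V (t*?y)" unfolding vp[OF y0] .
  from vord_add_eq(2)[OF V y1 this] have "vord V ?x = ?q*?v" unfolding x[symmetric] vp[OF y0] .
  thus ?case unfolding vx using q by(simp add: field_simps)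
 qed
 from main[of n] have "vord V l = 1/(?q^n*(?q-1))" by simp
 thus ?thesis using q(2) by simp
qed

end

section \<open>The wildly ramified fields\<close>

lemma card_power_mod:"EX k. CARD('a::{field,finite})^n = Suc ((CARD('a)-1)*k)"
proof (induction n)
 case 0
 show ?case by(intro exI[of _ 0]) simp
next
 case (Suc n)
 then obtain k where k:"CARD('a)^n = Suc ((CARD('a)-1)*k)" by blast
 define r where "r = CARD('a)-1"
 have q:"CARD('a) = Suc r" unfolding r_def using card_field_ge_2[where ?'a = 'a] by simp
 have "CARD('a)^Suc n = Suc (r*Suc (Suc r*k))" unfolding power_Suc k r_def[symmetric] unfolding q by(simp add: algebra_simps)
 thus ?case unfolding r_def[symmetric] by blast
qed

lemma rfield_kk_infinite:
 fixes V :: "'a::{field,finite} ac set"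
 assumes I:"infinite_place V"
 shows "rfield V \<kk> = Fq 1"
proof
 note V = infinite_placeD(1)[OF I]
 have u:"inverse \<TT>:mx V" by(rule notin_place[OF V infinite_placeD(2)[OF I]])
 hence "res V (inverse \<TT>) = 0" using res_eq_0_iff[OF V mx_place[OF V]] by blast
 hence "res V (inverse \<TT>):Fq 1" using sfield_0[OF sfield_Fq[of 1]] by simp
 thus "rfield V \<kk><=Fq 1" by(rule rfield_kk_subset[OF V parameter_T(2) mx_place[OF V u]]) simp
 show "Fq 1<=rfield V \<kk>" unfolding Fq_1 by(rule cst_rfield[OF V order_refl])
qed

context
 fixes n :: nat and l :: "'a::{field,finite} ac" and W :: "'a ac set"
 assumes l:"l:ktorsion (inverse \<TT>) (Suc n)" "l~:ktorsion (inverse \<TT>) n"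
  and W:"infinite_place W"
begin

abbreviation (input) tor :: "'a ac set" where "tor == ktorsion (inverse \<TT>) (Suc n)"
abbreviation (input) AA :: "'a ac set" where "AA == cyclotomic_wrt (inverse \<TT>) (pmon 1 (Suc n))"
abbreviation (input) prim :: "'a ac set" where "prim == primitive_torsion (inverse \<TT>) n"

lemma finab_A:"finab \<kk> AA"
 by(rule finab_cyclotomic_wrt[OF parameter_T(2) monom_neq_0[OF parameter_T(2) l] generates_ktorsion[OF parameter_T(2) l]])

lemma tor_A:"tor<=AA"
 unfolding cyclotomic_wrt_eq using adj_incl[of "\<kk> Un tor"] by blast

lemma eq_on_A:
 assumes s:"sg:auts \<kk>" "ta:auts \<kk>" and eq:"sg l = ta l" and x:"x:AA"
 shows "sg x = ta x"
proof (rule endo_eq_cyclotomic_wrt[OF s _ x])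
 fix y assume y:"y:tor"
 obtain f where f:"y = opoly (cz (inverse \<TT>)) f l" using generatesD(2)[OF generates_ktorsion[OF parameter_T(2) l] y] by blast
 note k = parameter_kk[OF parameter_T(2)]
 show "sg y = ta y" unfolding f auts_opoly_cz[OF s(1) k] auts_opoly_cz[OF s(2) k] eq ..
qed

lemma l_neq_0:"l~=0"
 using l(2) torsion_0[of "inverse \<TT>"] by blast

lemma l_A:"l:AA"
 using l(1) tor_A by blast

text \<open>A sandwich: the images of \<open>l\<close> are primitive torsion points, at most
  \<open>q^n (q-1)\<close> in number, while the value \<open>1/(q^n (q-1))\<close> of
  \<open>l\<close> makes the inertia group at least that large. So inertia at \<open>W\<close> is
  the whole Galois group, and all primitive torsion points are conjugate.\<close>

lemma A_totally_ramified:
 shows "card (rgrp (auts \<kk>) AA) = CARD('a)^n*(CARD('a)-1)"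
  "sg:auts \<kk> ==> EX i:igrp W \<kk>. ALL x:AA. i x = sg x"
  "z:prim ==> EX sg:auts \<kk>. sg l = z"
proof -
 let ?N = "CARD('a)^n*(CARD('a)-1)"
 note V = infinite_placeD(1)[OF W]
 define R where "R = rgrp (auts \<kk>) AA"
 define J where "J = rgrp (igrp W \<kk>) AA"
 have fR:"finite R" unfolding R_def by(rule finabD(7)[OF finab_A])
 have JR:"J<=R" unfolding J_def R_def by(rule rgrp_mono) (use igrp_auts in blast)
 have into:"(%g. g l)`R<=prim"
 proof
  fix z assume "z:(%g. g l)`R"
  then obtain g where g:"g:R" "z = g l" by(rule imageE)
  obtain sg where s:"sg:auts \<kk>" "g = restrict sg AA" using rgrpE[OF g(1)[unfolded R_def]] by(rule bexE)
  show "z:prim" unfolding g(2) s(2) using primitive_torsion_auts[OF parameter_T(2) l s(1)] l_A by simp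
 qed
 have inj:"inj_on (%g. g l) R"
 proof (rule inj_onI)
  fix g g' assume gg:"g:R" "g':R" "g l = g' l"
  obtain sg where s:"sg:auts \<kk>" "g = restrict sg AA" using rgrpE[OF gg(1)[unfolded R_def]] by(rule bexE)
  obtain ta where u:"ta:auts \<kk>" "g' = restrict ta AA" using rgrpE[OF gg(2)[unfolded R_def]] by(rule bexE)
  have "sg l = ta l" using gg(3) s(2) u(2) l_A by simp
  thus "g = g'" unfolding s(2) u(2) rgrp_eq_iff using eq_on_A[OF s(1) u(1)] by blast
 qed
 have vu:"vord W (inverse \<TT>) = 1" using vord_inverse[OF V T_neq_0] vord_T_infinite[OF W] by simp
 have N:"?N > 0" using card_field_ge_2[where ?'a = 'a] by simp
 have "?N dvd card J"
  unfolding J_def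
  by(rule card_inertia_multiple[OF finab_A V l_A l_neq_0 _ N]) (rule disjI2[OF vord_primitive_torsion[OF parameter_T(2) l V vu]])
 hence NJ:"?N <= card J" using card_restrict_igrp_pos(2)[OF finab_A, of W] unfolding J_def by(rule dvd_imp_le)
 have cR:"card ((%g. g l)`R) = card R" by(rule card_image[OF inj])
 have Rp:"card R <= card prim" using card_mono[OF finite_primitive_torsion[OF parameter_T(2) l] into] cR by simp
 have pN:"card prim<=?N" using card_primitive_torsion_le[OF parameter_T(2) l] by(simp add: mult.commute)
 have JRc:"card J <= card R" by(rule card_mono[OF fR JR])
 show "card (rgrp (auts \<kk>) AA) = ?N" using NJ Rp pN JRc unfolding R_def[symmetric] by linarith
 have "J = R" by(rule card_subset_eq[OF fR JR]) (use NJ Rp pN JRc in linarith)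
 have surj:"(%g. g l)`R = prim"
  by(rule card_subset_eq[OF finite_primitive_torsion[OF parameter_T(2) l] into]) (use cR NJ Rp pN JRc in linarith)
 show "EX i:igrp W \<kk>. ALL x:AA. i x = sg x" if s:"sg:auts \<kk>"
 proof -
  have "restrict sg AA:J" unfolding `J = R` R_def by(rule rgrpI[OF s])
  then obtain i where i:"i:igrp W \<kk>" "restrict sg AA = restrict i AA" unfolding J_def by(rule rgrpE[THEN bexE])
  have "ALL x:AA. i x = sg x" using i(2) unfolding rgrp_eq_iff by simp
  thus ?thesis using i(1) by blast
 qed
 show "EX sg:auts \<kk>. sg l = z" if z:"z:prim"
 proof -
  have "z:(%g. g l)`R" using z surj by simp
  then obtain g where g:"g:R" "z = g l" by(rule imageE)
  obtain sg where s:"sg:auts \<kk>" "g = restrict sg AA" using rgrpE[OF g(1)[unfolded R_def]] by(rule bexE)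
  thus ?thesis using g(2) l_A by(intro bexI[of _ sg]) simp_all
 qed
qed

section \<open>The fixed field of the scalars and its identification with
  \<open>\<LL> n\<close>\<close>

definition scal :: "('a ac => 'a ac) set" where
 "scal = {sg:auts \<kk>. EX c. ALL x:tor. sg x = cst c*x}"

lemma scalD:"sg:scal ==> sg:auts \<kk>" "sg:scal ==> EX c. ALL x:tor. sg x = cst c*x"
 by(simp_all add: scal_def)

lemma scalI:"sg:auts \<kk> ==> ALL x:tor. sg x = cst c*x ==> sg:scal"
 by(auto simp: scal_def)

lemma scal_subset:"scal<=auts \<kk>"
 using scalD(1) by blast

lemma scal_id:"(%x. x):scal"
 by(rule scalI[OF auts_id, of 1]) (simp add: cst_simps)

lemma scal_comp:
 assumes s:"sg:scal" and u:"ta:scal"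
 shows "(%x. sg (ta x)):scal"
proof -
 obtain c d where c:"ALL x:tor. sg x = cst c*x" and d:"ALL x:tor. ta x = cst d*x" using scalD(2) s u by meson
 have "ALL x:tor. sg (ta x) = cst (d * c)*x"
  using c d linear_op_cst[OF linear_op_auts[OF scalD(1)[OF s]]] by(simp add: cst_simps mult.assoc)
 thus ?thesis by(rule scalI[OF auts_comp[OF scalD(1)[OF s] scalD(1)[OF u]]])
qed

lemma scal_realized:
 assumes c:"c~=0"
 shows "EX sg:scal. sg l = cst c*l"
proof -
 have c0:"cst c~=0" using c cst_eq_iff[of c 0] by(simp add: cst_simps)
 have "cst c*l~:ktorsion (inverse \<TT>) n"
 proof
  assume "cst c*l:ktorsion (inverse \<TT>) n"
  hence "cst (inverse c)*(cst c*l):ktorsion (inverse \<TT>) n" by(rule torsion_cst)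
  thus False using l(2) c0 by(simp add: cst_inverse mult.assoc[symmetric])
 qed
 hence "cst c*l:prim"
  using torsion_cst[OF l(1)] unfolding primitive_torsion_def[OF parameter_T(2) l] by blast
 then obtain sg where s:"sg:auts \<kk>" "sg l = cst c*l" using A_totally_ramified(3) by blast
 note k = parameter_kk[OF parameter_T(2)]
 have "sg x = cst c*x" if x:"x:tor" for x
 proof -
  obtain f where f:"x = opoly (cz (inverse \<TT>)) f l" using generatesD(2)[OF generates_ktorsion[OF parameter_T(2) l] x] by blast
  show ?thesis unfolding f auts_opoly_cz[OF s(1) k] s(2) by(rule linear_op_cst[OF linear_op_opoly[OF linear_op_cz]])
 qed
 thus ?thesis using scalI[OF s(1)] s(2) by blast
qed

definition LF :: "'a ac set" where
 "LF = {x:AA. ALL sg:scal. sg x = x}"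

lemma LF_fixed:"sg:scal ==> x:LF ==> sg x = x"
 by(simp add: LF_def)

lemma LF_A:"LF<=AA"
 by(auto simp: LF_def)

lemma ifield_LF:"ifield LF"
proof (rule ifieldI)
 note a = ifield_sfield[OF finabD(2)[OF finab_A]]
 show "\<kk><=LF" unfolding LF_def using finabD(3)[OF finab_A] auts_fix scalD(1) by blast
 fix x y assume xy:"x:LF" "y:LF"
 have "sg (x-y) = x-y & sg (x*y) = x*y" if s:"sg:scal" for sg
  using LF_fixed[OF s xy(1)] LF_fixed[OF s xy(2)]
  by(simp add: endo_diff[OF auts_endo[OF scalD(1)[OF s]]] endo_mult[OF auts_endo[OF scalD(1)[OF s]]])
 moreover have "x-y:AA" "x*y:AA" using sfield_diff[OF a] sfield_mult[OF a] xy LF_A by blast+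
 ultimately show "x-y:LF" "x*y:LF" unfolding LF_def by blast+
qed

lemmas finab_LF = finab_mid[OF finab_A ifield_LF ifield_kk[OF ifield_LF] LF_A]

lemma auts_LF:
 assumes s:"sg:auts LF"
 shows "sg:scal"
proof -
 have sk:"sg:auts \<kk>" by(rule auts_kk[OF ifield_LF s])
 have "EX ta:scal. ALL x:AA. ta x = sg x"
 proof (rule galois_correspondence[OF finab_A scal_subset scal_id _ sk])
  show "(%x. rh (ta x)):scal" if "rh:scal" "ta:scal" for rh ta by(rule scal_comp[OF that])
 next
  fix x assume x:"x:AA" and f:"!!ta. ta:scal ==> ta x = x"
  have "x:LF" unfolding LF_def using x f by simp
  thus "sg x = x" by(rule auts_fix[OF s])
 qed
 then obtain ta where t:"ta:scal" "ALL x:AA. ta x = sg x" by(rule bexE)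
 obtain c where c:"ALL x:tor. ta x = cst c*x" using scalD(2)[OF t(1)] by blast
 have "ALL x:tor. sg x = cst c*x"
 proof
  fix x assume x:"x:tor"
  hence "x:AA" using tor_A by blast
  hence "sg x = ta x" using t(2) by simp
  thus "sg x = cst c*x" using c x by simp
 qed
 thus ?thesis by(rule scalI[OF sk])
qed

lemma scal_auts_LF:"sg:scal ==> sg:auts LF"
 using scalD(1)[of sg] LF_fixed[of sg] by(simp add: auts_def)

lemma card_scal:"card (rgrp (auts LF) AA) = CARD('a)-1"
proof -
 define R where "R = rgrp (auts LF) AA"
 define S where "S = {cst c*l | c. cst c~=(0 :: 'a ac)}"
 note S = scalar_image_card[OF l_neq_0, folded S_def]
 have "(%g. g l)`R = S"
 proof
  show "(%g. g l)`R<=S"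
  proof
   fix z assume "z:(%g. g l)`R"
   then obtain g where g:"g:R" "z = g l" by(rule imageE)
   obtain sg where s:"sg:auts LF" "g = restrict sg AA" using rgrpE[OF g(1)[unfolded R_def]] by(rule bexE)
   obtain c where c:"ALL x:tor. sg x = cst c*x" using scalD(2)[OF auts_LF[OF s(1)]] by blast
   have z:"z = cst c*l" unfolding g(2) s(2) using c l(1) l_A by simp
   have "z~=0" unfolding g(2) s(2) using endo_eq_0_iff[OF auts_endo[OF s(1)]] l_neq_0 l_A by simp
   hence "cst c~=0" using z by auto
   thus "z:S" unfolding S_def using z by blast
  qed
  show "S<=(%g. g l)`R"
  proof
   fix z assume "z:S"
   then obtain c where c:"z = cst c*l" "cst c~=0" unfolding S_def by blast
   have "c~=0" using c(2) by(auto simp: cst_simps)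
   then obtain sg where s:"sg:scal" "sg l = cst c*l" using scal_realized by blast
   show "z:(%g. g l)`R"
    by(rule image_eqI[of _ _ "restrict sg AA"])
     (use s l_A c(1) rgrpI[OF scal_auts_LF[OF s(1)]] in \<open>simp_all add: R_def\<close>)
  qed
 qed
 moreover have "inj_on (%g. g l) R"
 proof (rule inj_onI)
  fix g g' assume gg:"g:R" "g':R" "g l = g' l"
  obtain sg where s:"sg:auts LF" "g = restrict sg AA" using rgrpE[OF gg(1)[unfolded R_def]] by(rule bexE)
  obtain ta where u:"ta:auts LF" "g' = restrict ta AA" using rgrpE[OF gg(2)[unfolded R_def]] by(rule bexE)
  have "sg l = ta l" using gg(3) s(2) u(2) l_A by simp
  thus "g = g'" unfolding s(2) u(2) rgrp_eq_iff
   using eq_on_A[OF auts_kk[OF ifield_LF s(1)] auts_kk[OF ifield_LF u(1)]] by blast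
 qed
 ultimately show ?thesis using card_image S(1) unfolding R_def by metis
qed

lemma card_LF:"card (rgrp (auts \<kk>) LF) = CARD('a)^n"
proof -
 have "CARD('a)^n*(CARD('a)-1) = card (rgrp (auts \<kk>) LF)*(CARD('a)-1)"
  using finab_tower[OF finab_A ifield_LF ifield_kk[OF ifield_LF] LF_A] unfolding A_totally_ramified(1) card_scal .
 thus ?thesis using card_field_ge_2[where ?'a = 'a] by simp
qed

text \<open>If \<open>A/F\<close> has degree \<open>q - 1\<close>, then \<open>\<sigma> = \<sigma>\<^bsup>q^n\<^esup>\<close> on \<open>A\<close> for the automorphisms over \<open>F\<close>, so they are scalars.\<close>

lemma LF_unique:
 assumes F:"sfield F" "\<kk><=F" "F<=AA" "has_degree \<kk> F (CARD('a)^n)"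
 shows "F = LF"
proof -
 have Fi:"ifield F" using F(1,2) by(simp add: ifield_def)
 note m = finab_mid[OF finab_A Fi F(2,3)]
 have cF:"card (rgrp (auts \<kk>) F) = CARD('a)^n" using F(4) finab_has_degree_iff[OF m(1)] by simp
 have "CARD('a)^n*(CARD('a)-1) = CARD('a)^n * card (rgrp (auts F) AA)"
  using finab_tower[OF finab_A Fi F(2,3)] unfolding A_totally_ramified(1) cF .
 hence cA:"card (rgrp (auts F) AA) = CARD('a)-1" using card_field_ge_2[where ?'a = 'a] by simp
 have sub:"sg:scal" if s:"sg:auts F" for sg
 proof -
  have sk:"sg:auts \<kk>" by(rule auts_kk[OF Fi s])
  have triv:"(sg ^^ (CARD('a)-1)) x = x" if "x:AA" for x
   using funpow_card_trivial[OF autgrp_auts[OF Fi] stable_finab[OF m(2)] s that] unfolding cA .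
  have triv':"(sg ^^ ((CARD('a)-1)*k)) x = x" if x:"x:AA" for x k
  proof (induction k)
   case (Suc k)
   have "(sg ^^ ((CARD('a)-1)*Suc k)) x = (sg ^^ (CARD('a)-1)) ((sg ^^ ((CARD('a)-1)*k)) x)"
    by(simp only: mult_Suc_right funpow_add comp_apply)
   thus ?case unfolding Suc using triv[OF x] by simp
  qed simp
  obtain k where k:"CARD('a)^n = Suc ((CARD('a)-1)*k)" using card_power_mod by blast
  obtain c where c:"ALL x:tor. (sg ^^ (CARD('a)^n)) x = cst c*x" using auts_power_scalar[OF parameter_T(2) l sk] by blast
  have "ALL x:tor. sg x = cst c*x"
  proof
   fix x assume x:"x:tor"
   hence "x:AA" using tor_A by blast
   hence "(sg ^^ (CARD('a)^n)) x = sg x" unfolding k using triv'[of x k] by simp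
   thus "sg x = cst c*x" using c x by simp
  qed
  thus ?thesis by(rule scalI[OF sk])
 qed
 have LFF:"LF<=F"
  by(meson LF_A LF_fixed finab_fixed m(2) sub subset_eq)
 note m' = finab_mid[OF m(1) ifield_LF ifield_kk[OF ifield_LF] LFF]
 have "CARD('a)^n = CARD('a)^n * card (rgrp (auts LF) F)"
  using finab_tower[OF m(1) ifield_LF ifield_kk[OF ifield_LF] LFF] unfolding cF card_LF .
 hence one:"card (rgrp (auts LF) F) = 1" using card_field_ge_2[where ?'a = 'a] by simp
 have "F<=LF"
 proof
  fix x assume x:"x:F"
  show "x:LF"
  proof (rule finab_fixed[OF m'(2) x])
   fix sg assume s:"sg:auts LF"
   obtain g where g:"rgrp (auts LF) F = {g}" using one by(rule card_1_singletonE)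
   have "restrict sg F = g" "restrict (%x. x) F = g"
    using rgrpI[OF s, of F] rgrpI[OF auts_id[of LF], of F] unfolding g by simp_all
   hence "restrict sg F = restrict (%x. x) F" by simp
   thus "sg x = x" using x unfolding rgrp_eq_iff by blast
  qed
 qed
 thus ?thesis using LFF by blast
qed

lemma LL_eq:"\<LL> n = LF"
 unfolding \<LL>_def
proof (rule the_equality)
 show "subfield LF \<Omega> & \<kk><=LF & LF <= cyclotomic_wrt (inverse \<TT>) (pmon 1 (n+1)) & has_degree \<kk> LF (CARD('a)^n)"
  by(metis LF_A Suc_eq_plus1 card_LF finab_LF(1) finab_has_degree_iff ifield_LF ifield_kk ifield_sfield subfield_\<Omega>_iff)
 fix F :: "'a ac set"
 assume "subfield F \<Omega> & \<kk><=F & F <= cyclotomic_wrt (inverse \<TT>) (pmon 1 (n+1)) & has_degree \<kk> F (CARD('a)^n)"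
 hence F:"sfield F" "\<kk><=F" "F<=AA" "has_degree \<kk> F (CARD('a)^n)"
  unfolding subfield_\<Omega>_iff by(simp_all only: Suc_eq_plus1)
 show "F = LF" by(rule LF_unique[OF F])
qed

lemma LL_power:
 assumes s:"sg:auts \<kk>" and x:"x:(\<LL> n :: 'a ac set)"
 shows "(sg ^^ (CARD('a)^n)) x = x"
proof -
 obtain c where c:"ALL x:tor. (sg ^^ (CARD('a)^n)) x = cst c*x" using auts_power_scalar[OF parameter_T(2) l s] by(rule exE)
 show ?thesis by(rule LF_fixed[OF scalI[OF auts_funpow[OF s] c] x[unfolded LL_eq]])
qed

text \<open>The action on constants is realized first, by \<open>ps\<close> in the decomposition
  group. What is missing on \<open>AA\<close> is supplied by an inertia element, by total
  ramification, and this leaves the constants alone.\<close>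

lemma LL_infinite:
 assumes s:"sg:auts \<kk>"
 shows "EX ta:dgrp W \<kk>. ALL x:(\<LL> n :: 'a ac set) Un Fqbar. ta x = sg x"
proof -
 note V = infinite_placeD(1)[OF W]
 have fx:"sg c = c" if "c:rfield W \<kk>" for c
  using that auts_cst[OF s] unfolding rfield_kk_infinite[OF W] Fq_1 by blast
 obtain ps where p:"ps:dgrp W \<kk>" "ALL c:Fqbar. ps c = sg c"
  using residue_automorphism[OF ifield_kk_self V auts_endo[OF s] fx] by blast
 note pa = dgrpD(1)[OF p(1)]
 have pi:"ainv ps:auts \<kk>" by(rule auts_inv[OF pa ifield_kk_self])
 obtain i where i:"i:igrp W \<kk>" "ALL x:AA. i x = ainv ps (sg x)"
  using A_totally_ramified(2)[OF auts_comp[OF pi s]] by blast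
 have t:"(%x. ps (i x)):dgrp W \<kk>" by(rule autgrpD(3)[OF autgrp_dgrp[OF ifield_kk_self] p(1) igrpD(1)[OF i(1)]])
 have "ps (i x) = sg x" if "x:\<LL> n Un Fqbar" for x
 proof (cases "x:\<LL> n")
  case True
  hence "x:AA" using LF_A unfolding LL_eq by blast
  thus ?thesis using i(2) by(simp add: auts_inv_simps[OF pa])
 next
  case False
  hence "x:Fqbar" using that by blast
  thus ?thesis using igrpD(2)[OF i(1)] p(2) by simp
 qed
 thus ?thesis using t by(intro bexI[of _ "%x. ps (i x)"]) blast
qed

text \<open>At finite places the torsion is unramified where \<open>1/T\<close> is a unit, because it consists of units with
  distinct residues; at the zero of \<open>T\<close> the inertia group acts by scalars.\<close>

lemma LL_finite:
 assumes V:"place V" and fin:"\<TT>:V" and s:"sg:igrp V \<kk>" and x:"x:(\<LL> n :: 'a ac set)"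
 shows "sg x = x"
proof -
 note sa = igrp_auts[OF s]
 have u0:"inverse \<TT>~=(0 :: 'a ac)" by(rule parameter_neq_0[OF parameter_T(2)])
 have "vord V \<TT> >= 0" using vord_nonneg_iff[OF V T_neq_0] fin by simp
 then consider "vord V (inverse \<TT>) < 0" | "vord V (inverse \<TT>) = 0"
  using vord_inverse[OF V T_neq_0] by linarith
 thus ?thesis
 proof cases
  case 1
  obtain c where c:"ALL x:tor. sg x = cst c*x"
   using dgrp_scalar[OF V parameter_T(2) 1 monom_neq_0[OF parameter_T(2) l] igrpD(1)[OF s]] by blast
  show ?thesis by(rule LF_fixed[OF scalI[OF sa c] x[unfolded LL_eq]])
 next
  case 2
  let ?u = "inverse \<TT> :: 'a ac"
  have vp:"vord V (y^CARD('a)) = real CARD('a)*vord V y" "vord V (?u*y) = vord V y" if "y~=0" for y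
   using that u0 2 by(simp_all add: vord_power[OF V] vord_mult[OF V])
  have q:"real CARD('a) > 1" using card_field_ge_2[where ?'a = 'a] by simp
  have int:"y:V" if y:"cz ?u y:V" for y
  proof (rule ccontr)
   assume n:"y~:V"
   hence y0:"y~=0" using place_0[OF V] by auto
   have neg:"vord V y < 0" using vord_nonneg_iff[OF V y0] n by linarith
   have nz:"y^CARD('a)~=0" "?u*y~=0" using y0 u0 by simp_all
   have "vord V (y^CARD('a)) < vord V (?u*y)" unfolding vp[OF y0] using neg q by simp
   note v = vord_add_eq[OF V nz this]
   have "cz ?u y~=0" "vord V (cz ?u y) = real CARD('a)*vord V y"
    using v unfolding vp[OF y0] by(simp_all add: cz_def add.commute)
   moreover have "real CARD('a)*vord V y < 0" using neg q by(simp add: mult_pos_neg)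
   ultimately show False using vord_nonneg_iff[OF V, of "cz ?u y"] y by simp
  qed
  have torV:"y:V" if "y:ktorsion ?u j" for j y
   using that
  proof (induction j arbitrary: y)
   case 0
   hence "y = 0" unfolding ktorsion_iff by simp
   thus ?case by(simp add: place_0[OF V])
  next
   case (Suc j)
   show ?case by(rule int) (rule Suc.IH[OF Suc.prems[unfolded ktorsion_Suc_iff]])
  qed
  have mx0:"y = 0" if "y:ktorsion ?u j" "y:mx V" for j y
   using that
  proof (induction j arbitrary: y)
   case 0
   thus ?case unfolding ktorsion_iff by simp
  next
   case (Suc j)
   show ?case
   proof (rule ccontr)
    assume y0:"y~=0"
    have pos:"vord V y > 0" by(rule vord_pos[OF V y0 Suc.prems(2)])
    have nz:"y^CARD('a)~=0" "?u*y~=0" using y0 u0 by simp_all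
    have "vord V (?u*y) < vord V (y^CARD('a))" unfolding vp[OF y0] using pos q by simp
    note v = vord_add_eq[OF V nz(2,1) this]
    have c:"cz ?u y~=0" "vord V (cz ?u y) = vord V y" using v unfolding vp[OF y0] by(simp_all add: cz_def)
    hence "cz ?u y:mx V" using vord_pos_iff[OF V c(1)] pos by simp
    hence "cz ?u y = 0" by(rule Suc.IH[OF Suc.prems(1)[unfolded ktorsion_Suc_iff]])
    thus False using c(1) by blast
   qed
  qed
  have "sg y = y" if y:"y:tor" for y
  proof -
   have sy:"sg y:tor" by(rule torsion_auts[OF sa parameter_kk[OF parameter_T(2)] y])
   have "res V (sg y) = res V y"
    using dgrp_res[OF ifield_kk_self V igrpD(1)[OF s] torV[OF y]] igrpD(2)[OF s res_Fqbar[OF V torV[OF y]]] by simp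
   hence "sg y-y:mx V" using res_eq_iff[OF V torV[OF sy] torV[OF y]] by blast
   hence "sg y-y = 0" by(rule mx0[OF torsion_diff[OF sy y]])
   thus ?thesis by simp
  qed
  hence "sg:scal" using sa scalD(2) scalI scal_id by presburger
  thus ?thesis by(rule LF_fixed[OF _ x[unfolded LL_eq]])
 qed
qed

end

text \<open>The facts about \<open>\<LL> n\<close> used from here on, freed from the auxiliary
  torsion point \<open>l\<close>.\<close>

lemma
 fixes W :: "'a::{field,finite} ac set"
 assumes W:"infinite_place W"
 shows finab_LL:"finab \<kk> (\<LL> n :: 'a ac set)"
  and LL_power_trivial:"sg:auts \<kk> ==> x:\<LL> n ==> (sg ^^ (CARD('a)^n)) x = (x :: 'a ac)"
  and LL_Fqbar_lift:"sg:auts \<kk> ==> EX ta:dgrp W \<kk>. ALL x:\<LL> n Un Fqbar. ta x = (sg x :: 'a ac)"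
  and LL_inertia_finite:"place V ==> ~infinite_place V ==> sg:igrp V \<kk> ==> x:\<LL> n ==> sg x = (x :: 'a ac)"
proof -
 obtain l :: "'a ac" where l:"l:ktorsion (inverse \<TT>) (Suc n)" "l~:ktorsion (inverse \<TT>) n"
  using ex_primitive_torsion[OF parameter_neq_0[OF parameter_T(2)]] by blast
 show "finab \<kk> (\<LL> n :: 'a ac set)" unfolding LL_eq[OF l W] by(rule finab_LF(1)[OF l W])
 show "sg:auts \<kk> ==> x:\<LL> n ==> (sg ^^ (CARD('a)^n)) x = x" by(rule LL_power[OF l W])
 show "sg:auts \<kk> ==> EX ta:dgrp W \<kk>. ALL x:\<LL> n Un Fqbar. ta x = sg x" by(rule LL_infinite[OF l W])
 show "sg x = x" if V:"place V" "~infinite_place V" and s:"sg:igrp V \<kk>" and x:"x:(\<LL> n :: 'a ac set)"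
  by(rule LL_finite[OF l W V(1) _ s x]) (use V in \<open>simp add: infinite_place_def\<close>)
qed

section \<open>The genus field of a subfield of a composite with a cyclotomic field\<close>

lemma eq_on_composite:
 assumes "endo sg" "endo ta" "ALL x:A. sg x = ta x" "ALL x:B. sg x = ta x"
 shows "ALL x:A**B. sg x = ta x"
proof
 fix x assume "x:A**B"
 hence x:"x:adj (A Un B)" by(simp add: composite_eq)
 have "sg y = ta y" if "y:A Un B" for y using that assms(3,4) by auto
 from endo_eq_adj[OF assms(1,2) this x] show "sg x = ta x" .
qed

lemma fixes_composite:
 assumes s:"sg:auts \<kk>" and "ALL x:A. sg x = x" "ALL x:B. sg x = x"
 shows "ALL x:A**B. sg x = x"
 by(rule eq_on_composite[OF auts_endo[OF s] auts_endo[OF auts_id] assms(2,3)])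

lemma autsI:"sg:auts \<kk> ==> ALL x:L. sg x = x ==> sg:auts L"
 by(simp add: auts_def)

lemma auts_fixes:"sg:auts L ==> F<=L ==> ALL x:F. sg x = x"
 using auts_fix[of sg L] by blast

lemma subset_if_fixed:
 assumes F:"finab L F" and fx:"!!sg. sg:auts L ==> ALL x:S. sg x = x" and S:"S<=F"
 shows "S<=L"
 using F S finab_fixed fx by blast

lemma fixed_subfield:
 assumes B:"ifield B" and G:"Ga<=auts \<kk>"
 shows "ifield {x:B. ALL sg:Ga. sg x = x}" (is "ifield ?F")
proof (rule ifieldI)
 note b = ifield_sfield[OF B]
 show "\<kk><=?F" using ifield_kk[OF B] auts_fix G by blast
 fix x y assume xy:"x:?F" "y:?F"
 have "sg (x-y) = x-y & sg (x*y) = x*y" if s:"sg:Ga" for sg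
 proof -
  have e:"endo sg" using s G auts_endo by blast
  have "sg x = x" "sg y = y" using xy s by blast+
  thus ?thesis by(simp add: endo_diff[OF e] endo_mult[OF e])
 qed
 moreover have "x-y:B" "x*y:B" using xy sfield_diff[OF b] sfield_mult[OF b] by blast+
 ultimately show "x-y:?F" "x*y:?F" by blast+
qed

lemma group_correspondence:
 assumes F:"finab L F" and G:"autgrp Ga" "Ga<=auts L" and s:"sg:auts L"
  and fx:"ALL x:{x:F. ALL rh:Ga. rh x = x}. sg x = x"
 shows "EX ta:Ga. ALL x:F. ta x = sg x"
 by(smt (verit, ccfv_threshold) F assms(2,3) autgrpD(2,3) fx galois_correspondence mem_Collect_eq s)

lemma genus_field_trivial:
 assumes L:"finab \<kk> L"
 shows "place V ==> sg:igrp V L ==> ALL x:genus_field L. sg x = x"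
  "infinite_place V ==> sg:dgrp V L ==> ALL x:genus_field L. sg x = x"
proof -
 have 1:"sg x = x" if V:"place V" and s:"sg:igrp V L" and x:"x:genus_field L" for x
 proof -
  obtain E where E:"genus_ext L E" "x:E" using x unfolding genus_field_eq[OF L] by blast
  show ?thesis by(rule trivial_onD[OF genus_extD(3)[OF E(1) V] s E(2)])
 qed
 have 2:"sg x = x" if V:"infinite_place V" and s:"sg:dgrp V L" and x:"x:genus_field L" for x
 proof -
  obtain E where E:"genus_ext L E" "x:E" using x unfolding genus_field_eq[OF L] by blast
  show ?thesis by(rule trivial_onD[OF genus_extD(4)[OF E(1) V] s E(2)])
 qed
 show "place V ==> sg:igrp V L ==> ALL x:genus_field L. sg x = x" using 1 by blast
 show "infinite_place V ==> sg:dgrp V L ==> ALL x:genus_field L. sg x = x" using 2 by blast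
qed

lemma genus_ext_subset:"finab \<kk> L ==> genus_ext L E ==> E<=genus_field L"
 unfolding genus_field_eq by blast

lemma genus_field_ge:"finab \<kk> L ==> L<=genus_field L"
 using genus_ext_subset[OF _ genus_ext_refl] by blast

lemma trivial_onI:"(!!sg. sg:Ga ==> ALL x:F. sg x = x) ==> trivial_on Ga F"
 unfolding trivial_on_def by blast

text \<open>One infinite place \<open>V\<close> is fixed; statements at the others follow by
  \<open>trivial_on_dgrp_conjugate\<close>.\<close>

locale genus_setting =
 fixes K :: "'a::{field,finite} ac set" and N :: "'a poly" and n m :: nat and V :: "'a ac set"
 assumes K:"finab \<kk> K" and N:"N~=0" and m:"m >= 1" and Ksub:"K<=nkNm n N m" and V:"infinite_place V"
begin

abbreviation (input) "Cyc == cyclotomic N"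
abbreviation (input) "LM == (\<LL> n**k_ext m :: 'a ac set)"
abbreviation (input) "KM == K**LM"
abbreviation (input) "EE == KM Int Cyc"
abbreviation (input) "Ege == genus_field EE"

lemma place_V:"place V"
 by(rule infinite_placeD(1)[OF V])

lemma finab_Cyc:"finab \<kk> Cyc"
 by(rule finab_cyclotomic[OF V N])

lemma finab_LM:"finab \<kk> LM"
 unfolding k_ext_def composite_eq[of \<kk> "Fq m"] by(rule finab_composite[OF finab_LL[OF V] finab_Fq[OF m]])

lemma finab_KM:"finab \<kk> KM"
 by(rule finab_composite[OF K finab_LM])

lemma finab_E:"finab \<kk> EE"
 by(rule finab_mid(1)[OF finab_KM ifield_Int[OF finabD(2)[OF finab_KM] finabD(2)[OF finab_Cyc]]])
  (use finabD(3)[OF finab_KM] finabD(3)[OF finab_Cyc] in auto)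

lemmas Ki = finabD(2)[OF K] and Ei = finabD(2)[OF finab_E]

lemma ifield_Ege:"ifield Ege"
 by(rule ifield_genus_field[OF finab_E])

lemma K_subset:"K<=Cyc**LM"
 by(smt (verit) Ksub composite_incl(1,2) composite_min k_ext_def nkNm_def order_trans sfield_composite)

lemma eq_on_LM:
 assumes s:"sg:auts \<kk>" "ta:auts \<kk>" and eq:"ALL x:\<LL> n Un Fqbar. sg x = ta x"
 shows "ALL x:LM. sg x = ta x"
 unfolding k_ext_def
proof (intro eq_on_composite auts_endo[OF s(1)] auts_endo[OF s(2)])
 show "ALL x:\<LL> n. sg x = ta x" using eq by blast
 show "ALL x:\<kk>. sg x = ta x" using auts_fix[OF s(1)] auts_fix[OF s(2)] by simp
 show "ALL x:Fq m. sg x = ta x" using eq Fq_Fqbar[OF m] by blast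
qed

text \<open>\<open>Gal(Cyc\<cdot>LM/EE)\<close> is generated by the subgroups fixing \<open>KM\<close> and \<open>Cyc\<close>. An element that also fixes \<open>LM\<close>
  has trivial component in the latter.\<close>

lemma KM_eq:"EE**LM = KM"
proof
 have fE:"sfield (EE**LM)" by(rule sfield_composite)
 show "EE**LM<=KM" by(rule composite_min[OF sfield_composite]) (use composite_incl(2)[of LM K] in auto)
 let ?F = "Cyc**LM"
 have F:"finab \<kk> ?F" by(rule finab_composite[OF finab_Cyc finab_LM])
 have LF:"LM<=?F" by(rule composite_incl(2))
 have KMF:"KM<=?F" by(rule composite_min[OF sfield_composite K_subset LF])
 have ELF:"EE**LM<=?F" by(rule composite_min[OF sfield_composite _ LF]) (use KMF in blast)
 have ELi:"ifield (EE**LM)" by(rule ifield_composite(1)[OF ifield_kk[OF Ei]])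
 have FK:"finab KM ?F" by(rule finab_mid(2)[OF F finabD(2)[OF finab_KM] finabD(3)[OF finab_KM] KMF])
 have FC:"finab Cyc ?F" by(rule finab_mid(2)[OF F finabD(2)[OF finab_Cyc] finabD(3)[OF finab_Cyc] composite_incl(1)])
 have FE:"finab (EE**LM) ?F" by(rule finab_mid(2)[OF F ELi ifield_kk[OF ELi] ELF])
 \<comment> \<open>Products of an automorphism over \<open>KM\<close> and one over
   \<open>Cyc\<close>; closure under composition uses commutativity on \<open>?F\<close>. The fixed
   field of \<open>D\<close> in \<open>?F\<close> is \<open>KM Int Cyc\<close>, that is,
   \<open>EE\<close>.\<close>
 define D where "D = {sg:auts \<kk>. EX al:auts KM. EX be:auts Cyc. ALL x:?F. sg x = al (be x)}"
 have DI:"sg:D" if "sg:auts \<kk>" "al:auts KM" "be:auts Cyc" "ALL x:?F. sg x = al (be x)" for sg al be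
  unfolding D_def using that by blast
 have DE:"sg:auts \<kk> & (EX al:auts KM. EX be:auts Cyc. ALL x:?F. sg x = al (be x))" if "sg:D" for sg
  using that unfolding D_def by simp
 have kk:"al:auts \<kk>" if "al:auts KM | al:auts Cyc" for al
  using that auts_kk[OF finabD(2)[OF finab_KM]] auts_kk[OF finabD(2)[OF finab_Cyc]] by blast
 have KF:"ALL x:K. sg x = x" if s:"sg:auts (EE**LM)" for sg
 proof -
  have sk:"sg:auts \<kk>" by(rule auts_kk[OF ELi s])
  have "EX ta:D. ALL x:?F. ta x = sg x"
  proof (rule galois_correspondence[OF F _ _ _ sk])
   show "D<=auts \<kk>" using DE by blast
   show "(%x. x):D" by(rule DI[OF auts_id auts_id auts_id]) simp
   show "(%x. rh (ta x)):D" if rt:"rh:D" "ta:D" for rh ta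
   proof -
    obtain a b where ab:"rh:auts \<kk>" "a:auts KM" "b:auts Cyc" "ALL x:?F. rh x = a (b x)" using DE[OF rt(1)] by blast
    obtain c d where cd:"ta:auts \<kk>" "c:auts KM" "d:auts Cyc" "ALL x:?F. ta x = c (d x)" using DE[OF rt(2)] by blast
    have "rh (ta x) = a (c (b (d x)))" if x:"x:?F" for x
     by(metis F ab(3,4) cd(2,3,4) finabD(4,5) kk x)
    thus ?thesis by(intro DI[OF auts_comp[OF ab(1) cd(1)] auts_comp[OF ab(2) cd(2)] auts_comp[OF ab(3) cd(3)]]) blast
   qed
   fix x assume x:"x:?F" and fx:"!!ta. ta:D ==> ta x = x"
   have "x:KM" by(rule finab_fixed[OF FK x]) (rule fx, rule DI[OF kk _ auts_id], auto)
   moreover have "x:Cyc" by(rule finab_fixed[OF FC x]) (rule fx, rule DI[OF kk auts_id], auto)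
   ultimately have "x:EE" by blast
   thus "sg x = x" using auts_fix[OF s] composite_incl(1)[of EE LM] by blast
  qed
  then obtain ta where t:"ta:D" "ALL x:?F. ta x = sg x" by(rule bexE)
  obtain a b where ab:"a:auts KM" "b:auts Cyc" "ALL x:?F. ta x = a (b x)" using DE[OF t(1)] by blast
  \<comment> \<open>Both \<open>a\<close> and \<open>sg\<close> fix \<open>LM\<close>, hence so does
    \<open>b\<close>. It also fixes \<open>Cyc\<close>, so it is trivial on \<open>?F\<close>, and
    \<open>sg\<close> acts as \<open>a\<close>, which fixes \<open>K\<close>.\<close>
  have "ALL x:LM. b x = x"
  proof
   fix x assume x:"x:LM"
   have "b x:LM" by(rule finabD(4)[OF finab_LM kk[OF disjI2[OF ab(2)]] x])
   hence "a (b x) = b x" using auts_fix[OF ab(1)] composite_incl(2)[of LM K] by blast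
   moreover have "a (b x) = sg x" using ab(3) t(2) LF x by auto
   moreover have "sg x = x" using auts_fix[OF s] composite_incl(2)[of LM EE] x by blast
   ultimately show "b x = x" by simp
  qed
  hence "ALL x:?F. b x = x" by(rule fixes_composite[OF kk[OF disjI2[OF ab(2)]] auts_fixes[OF ab(2) order_refl]])
  hence sa:"sg x = a x" if "x:?F" for x using ab(3) t(2) that by simp
  show ?thesis
  proof
   fix x assume x:"x:K"
   have "sg x = a x" by(rule sa) (use K_subset x in blast)
   also have "\<dots> = x" by(rule auts_fix[OF ab(1)]) (use composite_incl(1)[of K LM] x in blast)
   finally show "sg x = x" .
  qed
 qed
 show "KM<=EE**LM" by(meson FE KF K_subset composite_incl(2) composite_min fE subset_if_fixed)
qed

lemma E_KM:"EE<=KM" and K_KM:"K<=KM" and LM_KM:"LM<=KM"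
 using composite_incl[of K LM] composite_incl(2)[of LM K] by blast+

lemma fix_K_if_fix_E:
 assumes s:"sg:auts \<kk>" and "ALL x:EE. sg x = x" "ALL x:LM. sg x = x"
 shows "ALL x:K. sg x = x"
 using fixes_composite[OF assms] K_KM unfolding KM_eq by blast

lemma fix_E_if_fix_K:
 assumes s:"sg:auts \<kk>" and "ALL x:K. sg x = x" "ALL x:LM. sg x = x"
 shows "ALL x:EE. sg x = x"
 using fixes_composite[OF assms] E_KM by blast

lemma igrp_finite_LM:
 assumes W:"place W" "~infinite_place W" and s:"sg:igrp W \<kk>"
 shows "ALL x:LM. sg x = x"
proof (rule eq_on_LM[OF igrp_auts[OF s] auts_id])
 show "ALL x:\<LL> n Un Fqbar. sg x = x"
  using LL_inertia_finite[OF V W s] igrpD(2)[OF s] by blast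
qed

lemma igrp_power_LM:
 assumes s:"sg:igrp W \<kk>"
 shows "ALL x:LM. (sg ^^ (CARD('a)^n)) x = x"
proof (rule eq_on_LM[OF auts_funpow[OF igrp_auts[OF s]] auts_id])
 have "(sg ^^ k) c = c" if "c:Fqbar" for c k
  by(induction k) (simp_all add: igrpD(2)[OF s that])
 thus "ALL x:\<LL> n Un Fqbar. (sg ^^ (CARD('a)^n)) x = x"
  using LL_power_trivial[OF V igrp_auts[OF s]] by blast
qed

text \<open>At a finite place inertia is trivial on \<open>LM\<close>, so fixing \<open>K\<close>
  means fixing \<open>KM\<close>. At an infinite place the same holds for the \<open>q^n\<close>-th
  iterate, which agrees with \<open>sg\<close> on \<open>EE\<close>.\<close>

lemma igrp_fix_E:
 assumes W:"place W" and s:"sg:igrp W K"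
 shows "ALL x:EE. sg x = x"
proof -
 have sk:"sg:igrp W \<kk>" using igrp_mono[OF ifield_kk[OF Ki]] s by blast
 have sK:"ALL x:K. sg x = x" by(rule auts_fixes[OF igrp_auts[OF s] order_refl])
 show ?thesis
 proof (cases "infinite_place W")
  case False
  show ?thesis by(rule fix_E_if_fix_K[OF igrp_auts[OF sk] sK igrp_finite_LM[OF W False sk]])
 next
  case True
  let ?j = "sg ^^ (CARD('a)^n)"
  have "(sg ^^ k) x = x" if "x:K" for x k by(induction k) (use sK that in simp_all)
  hence jE:"ALL x:EE. ?j x = x" by(intro fix_E_if_fix_K[OF auts_funpow[OF igrp_auts[OF sk]] _ igrp_power_LM[OF sk]]) blast
  show ?thesis using jE dgrp_powers_cyclotomic(2)[OF True N igrpD(1)[OF sk]] by force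
 qed
qed

lemma igrp_fix_Ege:
 assumes W:"place W" and s:"sg:igrp W K"
 shows "ALL x:Ege**K. sg x = x"
proof (rule fixes_composite)
 show "sg:auts \<kk>" by(rule auts_kk[OF Ki igrp_auts[OF s]])
 show "ALL x:K. sg x = x" by(rule auts_fixes[OF igrp_auts[OF s] order_refl])
 have "sg:igrp W EE" by(rule igrpI[OF s]) (use igrp_fix_E[OF W s] in blast)
 thus "ALL x:Ege. sg x = x" by(rule genus_field_trivial(1)[OF finab_E W])
qed

text \<open>A lift to the decomposition group acts on \<open>Cyc\<close> as some \<open>i\<close> in the inertia group. Since \<open>i\<close> and
  \<open>i\<^bsup>q^n\<^esup>\<close> agree on \<open>Cyc\<close> and the latter is trivial on \<open>LM\<close>, dividing by it does the job.\<close>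

lemma lift_trivial_on_Ege:
 assumes s:"sg:auts \<kk>"
 shows "EX ta:dgrp V Ege. ALL x:\<LL> n Un Fqbar. ta x = sg x"
proof -
 note G = autgrpD[OF autgrp_dgrp[OF ifield_kk_self, of V]] and I = autgrpD[OF autgrp_igrp[OF ifield_kk_self, of V]]
 obtain t where t:"t:dgrp V \<kk>" "ALL x:\<LL> n Un Fqbar. t x = sg x" using LL_Fqbar_lift[OF V s] by(rule bexE)
 obtain i where i:"i:igrp V \<kk>" "ALL x:Cyc. i x = t x" using cyclotomic_totally_ramified[OF V N t(1)] by(rule bexE)
 let ?j = "i ^^ (CARD('a)^n)"
 note ik = igrp_auts[OF i(1)] and tk = dgrpD(1)[OF t(1)]
 have jI:"?j:igrp V \<kk>" by(rule autgrp_funpow[OF autgrp_igrp[OF ifield_kk_self] i(1)])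
 note jk = igrp_auts[OF jI]
 let ?a = "%x. ainv ?j (t x)"
 have a:"?a:dgrp V \<kk>" by(rule G(3)[OF G(4)[OF igrpD(1)[OF jI]] t(1)])
 have ji:"?j x = t x" if x:"x:Cyc" for x
  using dgrp_powers_cyclotomic(2)[OF V N igrpD(1)[OF i(1)] x] i(2) x by simp
 have aE:"?a x = x" if "x:EE" for x
  using ji[of x] that by(simp add: auts_inv_simps(2)[OF jk] flip: ji)
 have "?a:dgrp V EE" by(rule dgrpI[OF a aE])
 hence aD:"?a:dgrp V Ege" by(meson dgrpI finab_E genus_field_trivial(2) genus_setting.V genus_setting_axioms)
 have "?a x = sg x" if x:"x:\<LL> n Un Fqbar" for x
 proof -
  have "sg x:\<LL> n Un Fqbar" using x finabD(4)[OF finab_LL[OF V] s] endo_Fqbar[OF auts_endo[OF s]] by blast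
  moreover have "?j y = y" if "y:\<LL> n Un Fqbar" for y
   using that LL_power_trivial[OF V ik] igrpD(2)[OF jI] by blast
  ultimately have "?j (sg x) = sg x" by blast
  hence "ainv ?j (sg x) = sg x" using auts_inv_simps(2)[OF jk, of "sg x"] by simp
  thus ?thesis using t(2) x by simp
 qed
 thus ?thesis using aD by(intro bexI[of _ ?a]) blast
qed

text \<open>\<open>B\<close> is the part of \<open>?C\<close> fixed by the decomposition group over
  \<open>EE\<close>; it is a layer of the genus field of \<open>EE\<close>. Two comparisons follow:
  \<open>B\<close> and \<open>LM\<close> generate \<open>?C\<close>, and \<open>F\<close> lies in
  the field generated by \<open>B\<close> and \<open>K\<close>. In both, an automorphism over the
  smaller field is exchanged for one in the decomposition group over \<open>K\<close>, which fixes
  \<open>F\<close>.\<close>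

lemma genus_ext_subset_EgeK:
 assumes F:"genus_ext K F"
 shows "F<=Ege**K"
proof -
 let ?C = "F**LM"
 note Fk = genus_extD(1)[OF F] and KF = genus_extD(2)[OF F]
 have C:"finab \<kk> ?C" by(rule finab_composite[OF Fk finab_LM])
 note Ci = finabD(2)[OF C] and Dk = dgrp_mono[OF ifield_kk[OF Ei]]
 have Dsub:"dgrp V EE<=auts \<kk>" using auts_kk[OF Ei] dgrpD(1) by blast
 have FC:"F<=?C" and LC:"LM<=?C" using composite_incl(1)[of F LM] composite_incl(2)[of LM F] by blast+
 have KC:"K<=?C" using KF FC by blast
 have KMC:"KM<=?C" by(rule composite_min[OF sfield_composite KC LC])
 have EC:"EE<=?C" using E_KM KMC by blast
 define B where "B = {x:?C. ALL sg:dgrp V EE. sg x = x}"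
 have Bi:"ifield B" unfolding B_def by(rule fixed_subfield[OF Ci Dsub])
 have BC:"B<=?C" unfolding B_def by blast
 have EB:"EE<=B" unfolding B_def using EC auts_fix dgrpD(1) by blast
 have Bk:"finab \<kk> B" by(rule finab_mid(1)[OF C Bi ifield_kk[OF Bi] BC])
 have Dtriv:"trivial_on (dgrp V EE) B" unfolding B_def trivial_on_def by blast
 have Ctriv:"ALL x:?C. sg x = x" if s:"sg:auts \<kk>" and sL:"ALL x:LM. sg x = x" and sF:"ALL x:F. sg x = x" for sg
  by(rule fixes_composite[OF s sF sL])
 have "genus_ext EE B"
 proof (rule genus_extI[OF Bk EB])
  fix W :: "'a ac set" assume W:"infinite_place W"
  show "trivial_on (dgrp W EE) B" by(rule trivial_on_dgrp_conjugate[OF finab_E Bk V W Dtriv])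
 next
  fix W :: "'a ac set" assume W:"place W"
  show "trivial_on (igrp W EE) B"
  proof (cases "infinite_place W")
   case True
   show ?thesis by(meson Bk Dtriv True V finab_E igrpD(1) subsetI trivial_on_dgrp_conjugate trivial_on_mono)
  next
   case False
   show ?thesis
   proof (rule trivial_onI)
    \<comment> \<open>Inertia at a finite place fixes \<open>LM\<close>; together with
      \<open>EE\<close> it then fixes \<open>K\<close>, and so \<open>F\<close>.\<close>
    fix sg assume s:"sg:igrp W EE"
    have sk:"sg:igrp W \<kk>" using igrp_mono[OF ifield_kk[OF Ei]] s by blast
    have sL:"ALL x:LM. sg x = x" by(rule igrp_finite_LM[OF W False sk])
    have "ALL x:K. sg x = x" by(rule fix_K_if_fix_E[OF igrp_auts[OF sk] auts_fixes[OF igrp_auts[OF s] order_refl] sL])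
    hence sK:"sg:igrp W K" by(intro igrpI[OF s]) blast
    have "ALL x:F. sg x = x" using trivial_onD[OF genus_extD(3)[OF F W] sK] by blast
    thus "ALL x:B. sg x = x" using Ctriv[OF igrp_auts[OF sk] sL] BC by blast
   qed
  qed
 qed
 hence BE:"B<=Ege" by(rule genus_ext_subset[OF finab_E])
 \<comment> \<open>An automorphism fixing \<open>B\<close> agrees on \<open>?C\<close> with some
   \<open>ta\<close> in the decomposition group over \<open>EE\<close>. If it also fixes
   \<open>LM\<close>, then \<open>ta\<close> fixes \<open>K\<close> and hence
   \<open>F\<close>.\<close>
 have CB:"?C<=B**LM"
 proof (rule subset_if_fixed[OF _ _ order_refl])
  have BLi:"ifield (B**LM)" by(rule ifield_composite(1)[OF ifield_kk[OF Bi]])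
  show "finab (B**LM) ?C"
   by(rule finab_mid(2)[OF C BLi ifield_kk[OF BLi] composite_min[OF sfield_composite BC LC]])
  fix sg assume s:"sg:auts (B**LM)"
  have sk:"sg:auts \<kk>" by(rule auts_kk[OF BLi s])
  have sB:"ALL x:B. sg x = x" by(rule auts_fixes[OF s composite_incl(1)])
  obtain ta where t:"ta:dgrp V EE" "ALL x:?C. ta x = sg x"
   using group_correspondence[OF C autgrp_dgrp[OF Ei] Dsub sk sB[unfolded B_def]] by(rule bexE)
  have tk:"ta:auts \<kk>" using t(1) Dsub by blast
  have tL:"ALL x:LM. ta x = x" using t(2) LC auts_fixes[OF s composite_incl(2)] by auto
  have tK:"ta:dgrp V K" by(smt (verit) auts_fix dgrpD(1) dgrpI fix_K_if_fix_E t(1) tL tk)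
  have "ALL x:F. ta x = x" using trivial_onD[OF genus_extD(4)[OF F V] tK] by blast
  hence "ALL x:?C. ta x = x" by(rule Ctriv[OF tk tL])
  thus "ALL x:?C. sg x = x" using t(2) by simp
 qed
 \<comment> \<open>Here \<open>sg\<close> may move \<open>LM\<close>.
   \<open>lift_trivial_on_Ege\<close> provides \<open>ta\<close> with the same action on
   \<open>LM\<close> and, as \<open>B<=Ege\<close>, on \<open>B\<close>; by the previous step the
   two agree on \<open>?C\<close>. So \<open>ta\<close> fixes \<open>K\<close> and lies in the
   decomposition group over \<open>K\<close>.\<close>
 have "F<=B**K"
 proof (rule subset_if_fixed[OF _ _ FC])
  have BKi:"ifield (B**K)" by(rule ifield_composite(1)[OF ifield_kk[OF Bi]])
  show "finab (B**K) ?C"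
   by(rule finab_mid(2)[OF C BKi ifield_kk[OF BKi] composite_min[OF sfield_composite BC KC]])
  fix sg assume s:"sg:auts (B**K)"
  have sk:"sg:auts \<kk>" by(rule auts_kk[OF BKi s])
  obtain ta where t:"ta:dgrp V Ege" "ALL x:\<LL> n Un Fqbar. ta x = sg x" using lift_trivial_on_Ege[OF sk] by(rule bexE)
  have tk:"ta:auts \<kk>" by(rule auts_kk[OF ifield_Ege dgrpD(1)[OF t(1)]])
  have tB:"ALL x:B. ta x = sg x"
   using auts_fixes[OF s composite_incl(1)] auts_fixes[OF dgrpD(1)[OF t(1)] BE] by simp
  have "ALL x:B**LM. ta x = sg x"
   by(rule eq_on_composite[OF auts_endo[OF tk] auts_endo[OF sk] tB eq_on_LM[OF tk sk t(2)]])
  hence tC:"ALL x:?C. ta x = sg x" using CB by blast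
  have "ta x = x" if x:"x:K" for x
  proof -
   have "ta x = sg x" using tC KC x by blast
   thus ?thesis using auts_fixes[OF s composite_incl(2)] x by simp
  qed
  hence tK:"ta:dgrp V K" by(rule dgrpI[OF t(1)])
  show "ALL x:F. sg x = x"
  proof
   fix x assume x:"x:F"
   have "ta x = sg x" using tC FC x by blast
   thus "sg x = x" using trivial_onD[OF genus_extD(4)[OF F V] tK x] by simp
  qed
 qed
 also have "\<dots><=Ege**K" by(rule composite_mono[OF BE order_refl])
 finally show ?thesis .
qed

lemma Ege_finite_level:
 assumes "x:Ege**K"
 shows "EX F. genus_ext EE F & x:F**K"
proof -
 have "x:adj (Ege Un K)" using assms by(simp add: composite_eq)
 from adj_finitary[OF this] obtain T where T:"finite T" "T<=Ege Un K" "x:adj T" by blast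
 have "EX F. genus_ext EE F & T<=F Un K"
  using T(1,2)
 proof (induction T rule: finite_induct)
  case empty
  show ?case using genus_ext_refl[OF finab_E] by blast
 next
  case (insert y T)
  then obtain F where F:"genus_ext EE F" "T<=F Un K" by auto
  show ?case
  proof (cases "y:K")
   case True
   thus ?thesis using F by blast
  next
   case False
   hence "y:Ege" using insert.prems by blast
   then obtain F' where F':"genus_ext EE F'" "y:F'" unfolding genus_field_eq[OF finab_E] by blast
   have "genus_ext EE (F**F')" by(rule genus_ext_composite[OF Ei F(1) F'(1)])
   moreover have "insert y T<=F**F' Un K" using F(2) F'(2) composite_incl(1)[of F F'] composite_incl(2)[of F' F] by blast
   ultimately show ?thesis by blast
  qed
 qed
 then obtain F where F:"genus_ext EE F" "T<=F Un K" by blast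
 have "x:F**K" using T(3) adj_mono[OF F(2)] by(auto simp: composite_eq)
 thus ?thesis using F(1) by blast
qed

lemma genus_composite_finab:"genus_ext EE F ==> finab \<kk> (F**K)"
 by(rule finab_composite[OF genus_extD(1) K])

lemma genus_composite_subset:"genus_ext EE F ==> F**K<=Ege**K"
 by(rule composite_mono[OF genus_ext_subset[OF finab_E] order_refl])

lemma dgrp_K_kk:"dgrp V K<=auts \<kk>"
 using auts_kk[OF Ki] dgrpD(1) by blast

text \<open>One inclusion uses \<open>genus_ext_subset_EgeK\<close>. For the other, the part of a
  finite composite \<open>F**K\<close> fixed by the decomposition group over \<open>K\<close> is a
  layer: inertia over \<open>K\<close> is trivial on all of \<open>Ege**K\<close> by
  \<open>igrp_fix_Ege\<close>, and full decomposition at infinity holds by construction.\<close>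

theorem genus_field_K:"genus_field K = {x:Ege**K. ALL sg:dgrp V K. sg x = x}"
proof
 show "genus_field K<={x:Ege**K. ALL sg:dgrp V K. sg x = x}"
 proof
  fix x assume x:"x:genus_field K"
  then obtain F where F:"genus_ext K F" "x:F" unfolding genus_field_eq[OF K] by blast
  have "x:Ege**K" using genus_ext_subset_EgeK[OF F(1)] F(2) by blast
  moreover have "ALL sg:dgrp V K. sg x = x" using genus_field_trivial(2)[OF K V] x by blast
  ultimately show "x:{x:Ege**K. ALL sg:dgrp V K. sg x = x}" by blast
 qed
 show "{x:Ege**K. ALL sg:dgrp V K. sg x = x}<=genus_field K"
 proof
  fix x assume "x:{x:Ege**K. ALL sg:dgrp V K. sg x = x}"
  hence x:"x:Ege**K" "ALL sg:dgrp V K. sg x = x" by blast+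
  obtain F where F:"genus_ext EE F" "x:F**K" using Ege_finite_level[OF x(1)] by blast
  let ?C = "F**K"
  define F1 where "F1 = {y:?C. ALL sg:dgrp V K. sg y = y}"
  note C = genus_composite_finab[OF F(1)]
  have Fi:"ifield F1" unfolding F1_def by(rule fixed_subfield[OF finabD(2)[OF C] dgrp_K_kk])
  have FC:"F1<=?C" unfolding F1_def by blast
  have KF:"K<=F1" unfolding F1_def using composite_incl(2)[of K F] auts_fix dgrpD(1) by blast
  have Fk:"finab \<kk> F1" by(rule finab_mid(1)[OF C Fi ifield_kk[OF Fi] FC])
  have "genus_ext K F1"
  proof (rule genus_extI[OF Fk KF])
   fix W :: "'a ac set" assume W:"infinite_place W"
   show "trivial_on (dgrp W K) F1" by(metis (mono_tags, lifting) F1_def Fk K V W mem_Collect_eq trivial_onI trivial_on_dgrp_conjugate)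
  next
   fix W :: "'a ac set" assume W:"place W"
   show "trivial_on (igrp W K) F1"
   proof (rule trivial_onI)
    fix sg assume "sg:igrp W K"
    from igrp_fix_Ege[OF W this] show "ALL y:F1. sg y = y" using FC genus_composite_subset[OF F(1)] by blast
   qed
  qed
  moreover have "x:F1" unfolding F1_def using F(2) x(2) by blast
  ultimately show "x:genus_field K" using genus_ext_subset[OF K] by blast
 qed
qed

end

section \<open>The decomposition group\<close>

lemma cyclic_aut_group:
 assumes G:"autgrp Ga" and st:"stable Ga Z" and p:"p:Ga" and d:"d > 0"
  and gen:"ALL sg:Ga. EX i. ALL x:Z. sg x = (p ^^ i) x" and per:"ALL x:Z. (p ^^ d) x = x"
  and min:"!!i. 0 < i ==> i < d ==> ~(ALL x:Z. (p ^^ i) x = x)"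
 shows "aut_group Z (rgrp Ga Z) \<cong> integer_mod_group d" "card (rgrp Ga Z) = d"
proof -
 let ?A = "aut_group Z (rgrp Ga Z)"
 define f where "f k = restrict (p ^^ nat k) Z" for k :: int
 have pk:"p ^^ i:Ga" for i by(rule autgrp_funpow[OF G p])
 have red:"(p ^^ i) x = (p ^^ (i mod d)) x" if x:"x:Z" for i x
 proof -
  have *: "(p ^^ (d*k)) x = x" for k
  proof (induction k)
   case (Suc k)
   have "(p ^^ (d*Suc k)) x = (p ^^ d) ((p ^^ (d*k)) x)" by(simp only: mult_Suc_right funpow_add comp_apply)
   thus ?case using Suc per x by simp
  qed simp
  show ?thesis by(simp add: funpow_mod_eq per x)
 qed
 have neq:"~(ALL x:Z. (p ^^ i) x = (p ^^ j) x)" if ij:"i < j" "j < d" for i j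
 proof
  assume eq:"ALL x:Z. (p ^^ i) x = (p ^^ j) x"
  have e:"endo (p ^^ i)" using pk autgrpD(1)[OF G] auts_endo by blast
  have id:"(p ^^ (j-i)) x = x" if "x:Z" for x
  proof -
   have "(p ^^ j) x = (p ^^ (i+(j-i))) x" using ij(1) by simp
   hence "(p ^^ j) x = (p ^^ i) ((p ^^ (j-i)) x)" by(simp only: funpow_add comp_apply)
   hence "(p ^^ i) ((p ^^ (j-i)) x) = (p ^^ i) x" using eq that by simp
   thus ?thesis unfolding endo_inj[OF e] .
  qed
  have "0 < j-i" "j-i < d" using ij by simp_all
  from min[OF this] show False using id by blast
 qed
 have bij:"bij_betw f {0..<int d} (rgrp Ga Z)"
  unfolding bij_betw_def
 proof
  show "inj_on f {0..<int d}"
  proof (rule inj_onI)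
   fix a b assume ab:"a:{0..<int d}" "b:{0..<int d}" "f a = f b"
   have "ALL x:Z. (p ^^ nat a) x = (p ^^ nat b) x" using ab(3) unfolding f_def rgrp_eq_iff .
   moreover have "nat a < d" "nat b < d" using ab(1,2) by(simp_all add: nat_less_iff)
   ultimately have "~nat a < nat b" "~nat b < nat a" using neq[of "nat a" "nat b"] neq[of "nat b" "nat a"] by auto
   thus "a = b" using ab(1,2) by auto
  qed
  show "f`{0..<int d} = rgrp Ga Z"
  proof
   show "f`{0..<int d}<=rgrp Ga Z" unfolding f_def using rgrpI[OF pk] by blast
   show "rgrp Ga Z<=f`{0..<int d}"
   proof
    fix g assume "g:rgrp Ga Z"
    then obtain sg where s:"sg:Ga" "g = restrict sg Z" by(rule rgrpE[THEN bexE])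
    obtain i where i:"ALL x:Z. sg x = (p ^^ i) x" using gen s(1) by blast
    have "sg x = (p ^^ (i mod d)) x" if "x:Z" for x by(rule trans[OF bspec[OF i that] red[OF that]])
    hence "g = f (int (i mod d))" unfolding s(2) f_def rgrp_eq_iff by simp
    thus "g:f`{0..<int d}" using d by simp
   qed
  qed
 qed
 have car:"carrier ?A = rgrp Ga Z" by(simp add: aut_group_def)
 have carZ:"carrier (integer_mod_group d) = {0..<int d}" using d by(simp add: carrier_integer_mod_group)
 have "f:iso (integer_mod_group d) ?A"
 proof (rule isoI)
  show "bij_betw f (carrier (integer_mod_group d)) (carrier ?A)" unfolding car carZ by(rule bij)
  show "f:hom (integer_mod_group d) ?A"
  proof (rule homI)
   show "f x:carrier ?A" if "x:carrier (integer_mod_group d)" for x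
    using bij that unfolding carZ car bij_betw_def by blast
   fix a b assume ab:"a:carrier (integer_mod_group d)" "b:carrier (integer_mod_group d)"
   hence nn:"0<=a" "0<=b" unfolding carZ by auto
   note k = subsetD[OF autgrpD(1)[OF G]] and im = autgrp_image_eq[OF G st]
   have "f a \<otimes>\<^bsub>?A\<^esub> f b = restrict (%x. (p ^^ nat a) ((p ^^ nat b) x)) Z"
    unfolding f_def by(rule BijGroup_mult_restrict[OF k[OF pk] im[OF pk] k[OF pk] im[OF pk]])
   also have "\<dots> = restrict (p ^^ ((nat a+nat b) mod d)) Z"
    unfolding rgrp_eq_iff
    by(metis comp_apply funpow_add red)
   also have "(nat a+nat b) mod d = nat ((a+b) mod int d)" using nn d by(simp add: nat_mod_distrib nat_add_distrib)
   finally have "f a \<otimes>\<^bsub>?A\<^esub> f b = f ((a+b) mod int d)" by(simp only: f_def)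
   thus "f (a \<otimes>\<^bsub>integer_mod_group d\<^esub> b) = f a \<otimes>\<^bsub>?A\<^esub> f b" unfolding mult_integer_mod_group by(rule sym)
  qed
 qed
 hence "integer_mod_group d \<cong> ?A" unfolding is_iso_def by blast
 thus "?A \<cong> integer_mod_group d" by(rule group.iso_sym[OF group_integer_mod_group])
 show "card (rgrp Ga Z) = d" using bij_betw_same_card[OF bij] by simp
qed

lemma fixed_field_restrict_group:"fixed_field Z (rgrp Ga Z) = {x:Z. ALL sg:Ga. sg x = x}"
 unfolding fixed_field_def restrict_group_def by auto

context genus_setting
begin

abbreviation (input) "EK == EE**K"
abbreviation (input) "EgK == Ege**K"

lemma EE_Ege:"EE<=Ege"
 by(rule genus_field_ge[OF finab_E])

lemma EK_EgK:"EK<=EgK"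
 by(rule composite_mono[OF EE_Ege order_refl])

lemma finab_EK:"finab \<kk> EK"
 by(rule finab_composite[OF finab_E K])

lemma ifield_EgK:"ifield EgK"
 by(rule ifield_composite(2)[OF ifield_kk[OF Ki]])

lemma stable_Ege:"stable (auts \<kk>) Ege"
 unfolding stable_def
proof (intro ballI)
 fix sg :: "'a ac => 'a ac" and x assume s:"sg:auts \<kk>" and x:"x:Ege"
 obtain F where F:"genus_ext EE F" "x:F" using x unfolding genus_field_eq[OF finab_E] by blast
 have "sg x:F" by(rule finabD(4)[OF genus_extD(1)[OF F(1)] s F(2)])
 thus "sg x:Ege" using genus_ext_subset[OF finab_E F(1)] by blast
qed

lemma stable_EgK:"stable (auts \<kk>) EgK"
 unfolding stable_def
proof (intro ballI)
 fix sg :: "'a ac => 'a ac" and x assume s:"sg:auts \<kk>" and x:"x:EgK"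
 obtain F where F:"genus_ext EE F" "x:F**K" using Ege_finite_level[OF x] by blast
 have "sg x:F**K" by(rule finabD(4)[OF genus_composite_finab[OF F(1)] s F(2)])
 thus "sg x:EgK" using genus_composite_subset[OF F(1)] by blast
qed

lemmas autgrp_D = autgrp_dgrp[OF Ki, of V]

text \<open>An element of \<open>Gal\<close> that preserves \<open>Q\<close> lifts to the closure,
  and \<open>dgrp_adjust\<close> changes the lift outside \<open>EgK\<close> so that it preserves
  \<open>V\<close>.\<close>

lemma decomposition_group_eq:
 assumes Q:"V Int EgK = Q"
 shows "decomposition_group EgK K Q = rgrp (dgrp V K) EgK"
proof
 have KE:"K<=EgK" by(rule composite_incl(2))
 note stD = stable_mono[OF stable_EgK dgrp_K_kk]
 show "decomposition_group EgK K Q<=rgrp (dgrp V K) EgK"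
 proof
  fix g assume "g:decomposition_group EgK K Q"
  hence g:"g:Gal EgK K" "g`Q = Q" by(simp_all add: decomposition_group_def)
  obtain sg where s:"sg:auts K" "g = restrict sg EgK" using Gal_extends[OF ifield_kk[OF Ki] ifield_EgK g(1) KE] by(rule bexE)
  have sk:"sg:auts \<kk>" by(rule auts_kk[OF Ki s(1)])
  have sQ:"sg`Q = Q"
  proof -
   have "g`Q = sg`Q" by(rule image_cong[OF refl]) (use Q s(2) in auto)
   thus ?thesis using g(2) by simp
  qed
  have "sg x:V <-> x:V" if x:"x:EgK" for x
  proof
   assume "x:V"
   hence "sg x:sg`Q" using x Q by blast
   thus "sg x:V" using sQ Q by blast
  next
   assume "sg x:V"
   hence "sg x:sg`Q" using stableD[OF stable_EgK sk x] Q sQ by blast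
   then obtain y where y:"sg x = sg y" "y:Q" by(rule imageE)
   have "x = y" using y(1) unfolding endo_inj[OF auts_endo[OF sk]] .
   thus "x:V" using y(2) Q by blast
  qed
  hence "sg -` V Int EgK = V Int EgK" by blast
  from dgrp_adjust[OF Ki ifield_EgK KE place_V s(1) this] obtain ps where p:"ps:dgrp V K" "ALL x:EgK. ps x = sg x" by(rule bexE)
  show "g:rgrp (dgrp V K) EgK" by(smt (verit) p(1,2) rgrpI rgrp_eq_iff s(2))
 qed
 show "rgrp (dgrp V K) EgK<=decomposition_group EgK K Q"
 proof
  fix g assume "g:rgrp (dgrp V K) EgK"
  then obtain sg where s:"sg:dgrp V K" "g = restrict sg EgK" by(rule rgrpE[THEN bexE])
  have im:"sg`EgK = EgK" by(rule autgrp_image_eq[OF autgrp_D stD s(1)])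
  have "g:Gal EgK K" unfolding s(2)
   by(rule restrict_in_Gal[OF subsetD[OF dgrp_K_kk s(1)] im KE _ ifield_sfield[OF ifield_EgK]]) (rule auts_fix[OF dgrpD(1)[OF s(1)]])
  moreover have "g`Q = sg`Q" by(rule image_cong[OF refl]) (use Q s(2) in auto)
  moreover have "sg`Q = Q"
  proof
   show "sg`Q<=Q" using Q im dgrpD(2)[OF s(1)] by blast
   show "Q<=sg`Q"
   proof
    fix y assume y:"y:Q"
    hence "y:sg`EgK" using im Q by blast
    then obtain x where x:"y = sg x" "x:EgK" by(rule imageE)
    hence "x:Q" using y Q dgrpD(2)[OF s(1), of x] by blast
    thus "y:sg`Q" using x(1) by blast
   qed
  qed
  ultimately show "g:decomposition_group EgK K Q" by(simp add: decomposition_group_def)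
 qed
qed

text \<open>An element that fixes \<open>EE\<close> lies in the decomposition group over
  \<open>EE\<close>, which is trivial on the genus field of \<open>EE\<close>. So restriction from
  \<open>EgK\<close> to \<open>EE\<close> is injective on the decomposition group over
  \<open>K\<close>.\<close>

lemma trivial_on_EgK_if_E:
 assumes s:"sg:dgrp V K" and E:"ALL x:EE. sg x = x"
 shows "ALL x:EgK. sg x = x"
proof (rule fixes_composite)
 show "sg:auts \<kk>" using s dgrp_K_kk by blast
 show "ALL x:K. sg x = x" by(rule auts_fixes[OF dgrpD(1)[OF s] order_refl])
 have "sg:dgrp V EE" by(rule dgrpI[OF s]) (use E in blast)
 thus "ALL x:Ege. sg x = x" by(rule genus_field_trivial(2)[OF finab_E V])
qed

text \<open>An automorphism over \<open>F1**K\<close> agrees on \<open>F\<close> with an element of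
  the decomposition group over \<open>K\<close>. Both fix \<open>K\<close>, so they agree on
  \<open>F**K\<close>, and the latter fixes \<open>x\<close>.\<close>

lemma fixed_Ege_composite:"{x:Ege. ALL sg:dgrp V K. sg x = x}**K = genus_field K" (is "?Y**K = _")
proof
 show "?Y**K<=genus_field K"
 proof (rule composite_min[OF ifield_sfield[OF ifield_genus_field[OF K]] _ genus_field_ge[OF K]])
  show "?Y<=genus_field K" unfolding genus_field_K using composite_incl(1)[of Ege K] by blast
 qed
 show "genus_field K<=?Y**K"
 proof
  fix x assume "x:genus_field K"
  hence x:"x:EgK" "ALL sg:dgrp V K. sg x = x" unfolding genus_field_K by blast+
  obtain F where F:"genus_ext EE F" "x:F**K" using Ege_finite_level[OF x(1)] by blast
  note Fk = genus_extD(1)[OF F(1)] and C = genus_composite_finab[OF F(1)]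
  define F1 where "F1 = {y:F. ALL sg:dgrp V K. sg y = y}"
  have F1i:"ifield F1" unfolding F1_def by(rule fixed_subfield[OF finabD(2)[OF Fk] dgrp_K_kk])
  have F1Y:"F1<=?Y" unfolding F1_def using genus_ext_subset[OF finab_E F(1)] by blast
  have Ci:"ifield (F1**K)" by(rule ifield_composite(2)[OF ifield_kk[OF Ki]])
  have sub:"F1**K<=F**K" by(rule composite_mono) (auto simp: F1_def)
  have "x:F1**K"
  proof (rule finab_fixed[OF finab_mid(2)[OF C Ci ifield_kk[OF Ci] sub] F(2)])
   fix sg assume s:"sg:auts (F1**K)"
   have sk:"sg:auts \<kk>" by(rule auts_kk[OF Ci s])
   obtain ta where t:"ta:dgrp V K" "ALL y:F. ta y = sg y"
    using group_correspondence[OF Fk autgrp_D dgrp_K_kk sk auts_fixes[OF s composite_incl(1), unfolded F1_def]] by(rule bexE)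
   have tk:"ta:auts \<kk>" using t(1) dgrp_K_kk by blast
   have "ALL y:K. ta y = sg y" using auts_fixes[OF s composite_incl(2)] auts_fixes[OF dgrpD(1)[OF t(1)] order_refl] by simp
   from eq_on_composite[OF auts_endo[OF tk] auts_endo[OF sk] t(2) this] F(2) have "ta x = sg x" by blast
   thus "sg x = x" using bspec[OF x(2) t(1)] by simp
  qed
  thus "x:?Y**K" using composite_mono[OF F1Y order_refl] by blast
 qed
qed

section \<open>Frobenius at infinity and extensions of constants\<close>

context
 fixes t s d :: nat and p :: "'a ac => 'a ac"
 assumes rK:"rfield V K = Fq t" "t >= 1" and rE:"rfield V EK = Fq s" "s >= 1" and sd:"s = t*d"
  and p:"p:dgrp V K" "ALL i. ALL c:Fqbar. (p ^^ i) c = c^(CARD('a)^(t*i))"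
begin

lemma d_pos:"d > 0"
 using rE(2) sd by(cases d) auto

text \<open>\<open>u\<close> fixes the residue field \<open>Fq s\<close> of \<open>EK\<close>, so it
  agrees on \<open>EK\<close> with an inertia element over \<open>K\<close>; these fix
  \<open>EE\<close> by \<open>igrp_fix_E\<close>.\<close>

lemma trivial_on_EgK:
 assumes u:"u:dgrp V K" and c:"!!c. c:Fq s ==> u c = c"
 shows "ALL x:EgK. u x = x"
proof (rule trivial_on_EgK_if_E[OF u])
 have KEK:"K<=EK" by(rule composite_incl(2))
 obtain ta where t:"ta:igrp V K" "ALL x:EK. ta x = u x" by(metis (no_types, lifting) KEK Ki c finabD(2) finab_EK inertia_lift place_V rE(1) u)
 show "ALL x:EE. u x = x"
 proof
  fix x assume x:"x:EE"
  hence "x:EK" by(rule subsetD[OF composite_incl(1)])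
  hence "u x = ta x" using t(2) by simp
  thus "u x = x" using igrp_fix_E[OF place_V t(1)] x by simp
 qed
qed

text \<open>An automorphism over \<open>EK\<close> acts on constants and on \<open>LM\<close> like
  some \<open>ta\<close> that preserves \<open>V\<close> and fixes \<open>Ege\<close>. As
  \<open>K\<close> lies in \<open>EE**LM\<close>, \<open>ta\<close> also fixes \<open>K\<close>; so
  it belongs to the decomposition group over \<open>EK\<close> and fixes the residue field
  \<open>Fq s\<close>.\<close>

lemma Fq_s_EK:"Fq s<=EK"
proof
 fix c :: "'a ac" assume c:"c:Fq s"
 note EKi = finabD(2)[OF finab_EK]
 have fx:"sg c = c" if s:"sg:auts EK" for sg
 proof -
  have sk:"sg:auts \<kk>" by(rule auts_kk[OF EKi s])
  obtain ta where t:"ta:dgrp V Ege" "ALL x:\<LL> n Un Fqbar. ta x = sg x" using lift_trivial_on_Ege[OF sk] by(rule bexE)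
  have tk:"ta:auts \<kk>" by(rule auts_kk[OF ifield_Ege dgrpD(1)[OF t(1)]])
  have tE:"ALL x:EE. ta x = x" by(rule auts_fixes[OF dgrpD(1)[OF t(1)] EE_Ege])
  have "ALL x:EE. ta x = sg x" using tE auts_fixes[OF s composite_incl(1)] by simp
  from eq_on_composite[OF auts_endo[OF tk] auts_endo[OF sk] this eq_on_LM[OF tk sk t(2)]]
  have tM:"ALL x:K. ta x = sg x" unfolding KM_eq using K_KM by blast
  have tK:"ALL x:K. ta x = x" using tM auts_fixes[OF s composite_incl(2)] by simp
  have "ta:dgrp V EK" by(rule dgrpI[OF t(1)]) (use fixes_composite[OF tk tE tK] in blast)
  hence "ta c = c" by(rule dgrp_rfield[OF EKi place_V]) (use c rE(1) in simp)
  moreover have "ta c = sg c" using t(2) Fq_Fqbar[OF rE(2)] c by blast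
  ultimately show ?thesis by simp
 qed
 have "c:adj (EK Un {c})" using adj_incl[of "EK Un {c}"] by blast
 thus "c:EK"
  using sep_fixed[OF EKi, of "{c}" c] sep_mono[OF sep_Fq[OF rE(2) c] ifield_kk[OF EKi]] fx by blast
qed

text \<open>On \<open>Fq s\<close> the element \<open>u\<close> is a power of the
  \<open>q^t\<close>-Frobenius, so \<open>u\<close> divided by an iterate of \<open>p\<close> fixes
  \<open>Fq s\<close> and is trivial on \<open>EgK\<close>.\<close>

lemma p_gen:"ALL u:dgrp V K. EX i. ALL x:EgK. u x = (p ^^ i) x"
proof
 fix u assume u:"u:dgrp V K"
 note G = autgrpD[OF autgrp_D]
 have fx:"u c = c" if "c:Fq t" for c by(rule dgrp_rfield[OF Ki place_V u]) (use that rK(1) in simp)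
 have "d >= 1" using d_pos by simp
 obtain i where i:"ALL c:Fq (t*d). u c = c^(CARD('a)^(t*i))"
  using endo_Fq_power[OF rK(2) `d >= 1` auts_endo[OF dgrpD(1)[OF u]] fx] by blast
 have pi:"p ^^ i:dgrp V K" by(rule autgrp_funpow[OF autgrp_D p(1)])
 have pk:"p ^^ i:auts \<kk>" using pi dgrp_K_kk by blast
 let ?r = "%x. ainv (p ^^ i) (u x)"
 have "ALL x:EgK. ?r x = x"
 proof (rule trivial_on_EgK[OF G(3)[OF G(4)[OF pi] u]])
  fix c :: "'a ac" assume c:"c:Fq s"
  hence "u c = (p ^^ i) c" using i p(2) Fq_Fqbar[OF rE(2)] sd by auto
  thus "?r c = c" using auts_inv_simps(2)[OF pk] by simp
 qed
 thus "EX i. ALL x:EgK. u x = (p ^^ i) x" by(metis auts_inv_simps(1) pk)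
qed

lemma p_period:"ALL x:EgK. (p ^^ d) x = x"
proof (rule trivial_on_EgK[OF autgrp_funpow[OF autgrp_D p(1)]])
 fix c :: "'a ac" assume c:"c:Fq s"
 hence "(p ^^ d) c = c^(CARD('a)^s)" using p(2) Fq_Fqbar[OF rE(2)] sd by blast
 thus "(p ^^ d) c = c" using c by(simp add: Fq_iff)
qed

text \<open>If the \<open>i\<close>-th iterate fixed \<open>EE\<close>, it would fix
  \<open>EgK\<close>, hence \<open>EK\<close> and the residue field \<open>Fq s\<close>. But on
  constants it is \<open>c^(q^(t*i))\<close>, which forces \<open>s<=t*i\<close>.\<close>

lemma p_min:
 assumes i:"0 < i" "i < d"
 shows "~(ALL x:EE. (p ^^ i) x = x)"
proof
 assume E:"ALL x:EE. (p ^^ i) x = x"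
 have pi:"p ^^ i:dgrp V K" by(rule autgrp_funpow[OF autgrp_D p(1)])
 have "ALL x:EgK. (p ^^ i) x = x" by(rule trivial_on_EgK_if_E[OF pi E])
 hence "p ^^ i:dgrp V EK" by(intro dgrpI[OF pi]) (use EK_EgK in blast)
 hence fx:"(p ^^ i) c = c" if "c:Fq s" for c
  by(rule dgrp_rfield[OF finabD(2)[OF finab_EK] place_V]) (use that rE(1) in simp)
 have "Fq s<=(Fq (t*i) :: 'a ac set)"
  by(metis (no_types, lifting) ext Fq_Fqbar Fq_iff fx in_mono p(2) rE(2) subsetI)
 hence "s<=t*i" by(rule Fq_subset_imp_dvd) (use rE(2) rK(2) i(1) in simp_all)
 thus False using sd i(2) rK(2) by simp
qed

text \<open>The iterate with exponent \<open>q-1\<close> is trivial on \<open>EE\<close>, a subfield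
  of \<open>Cyc\<close>; by minimality of the period \<open>d\<close> the remainder of
  \<open>q-1\<close> modulo \<open>d\<close> vanishes.\<close>

lemma d_dvd:"d dvd CARD('a)-1"
proof -
 let ?r = "(CARD('a)-1) mod d" and ?k = "(CARD('a)-1) div d"
 have per:"(p ^^ (d*k)) x = x" if x:"x:EgK" for x k
 proof (induction k)
  case (Suc k)
  have "(p ^^ (d*Suc k)) x = (p ^^ d) ((p ^^ (d*k)) x)" by(simp only: mult_Suc_right funpow_add comp_apply)
  thus ?case using Suc p_period x by simp
 qed simp
 have fx:"(p ^^ ?r) x = x" if x:"x:EE" for x
 proof -
  have "x:EgK" using x EE_Ege composite_incl(1)[of Ege K] by blast
  have "(p ^^ (CARD('a)-1)) x = (p ^^ (?r+d*?k)) x" by simp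
  also have "\<dots> = (p ^^ ?r) x" by(simp only: funpow_add comp_apply per[OF `x:EgK`])
  finally show ?thesis
   using dgrp_powers_cyclotomic(1)[OF V N subsetD[OF dgrp_mono[OF ifield_kk[OF Ki]] p(1)], of x] x by simp
 qed
 have "?r = 0"
 proof (rule ccontr)
  assume "?r~=0"
  hence "0 < ?r" "?r < d" using d_pos by simp_all
  from p_min[OF this] show False using fx by blast
 qed
 thus ?thesis by(simp add: mod_eq_0_iff_dvd)
qed

lemma cyclic_D:
 assumes Z:"EE<=Z" "Z<=EgK" and st:"stable (auts \<kk>) Z"
 shows "aut_group Z (rgrp (dgrp V K) Z) \<cong> integer_mod_group d" "card (rgrp (dgrp V K) Z) = d"
proof -
 have gen:"ALL u:dgrp V K. EX i. ALL x:Z. u x = (p ^^ i) x"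
 proof
  fix u assume "u:dgrp V K"
  then obtain i where "ALL x:EgK. u x = (p ^^ i) x" using p_gen by blast
  thus "EX i. ALL x:Z. u x = (p ^^ i) x" using Z(2) by blast
 qed
 have per:"ALL x:Z. (p ^^ d) x = x" using p_period Z(2) by blast
 have min:"~(ALL x:Z. (p ^^ i) x = x)" if "0 < i" "i < d" for i using p_min[OF that] Z(1) by blast
 note c = cyclic_aut_group[OF autgrp_D stable_mono[OF st dgrp_K_kk] p(1) d_pos gen per min]
 show "aut_group Z (rgrp (dgrp V K) Z) \<cong> integer_mod_group d" "card (rgrp (dgrp V K) Z) = d"
  by(rule c, assumption+)+
qed

text \<open>An automorphism over the fixed field of the decomposition group and over the constants of \<open>Z\<close> agrees on
  \<open>Z\<close> with an element of the decomposition group fixing those constants, which is trivial.\<close>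

lemma constants_generate:
 assumes Z:"finab \<kk> Z" "EE<=Z" "Z<=EgK"
 shows "Z<=({x:Z. ALL u:dgrp V K. u x = x}**K)**Fq s" (is "Z<=?Y**K**Fq s")
proof (rule subset_if_fixed)
 let ?B = "?Y**K**Fq s" and ?C = "Z**K"
 have C:"finab \<kk> ?C" by(rule finab_composite[OF Z(1) K])
 have YC:"?Y**K<=?C" by(rule composite_mono) auto
 have EKC:"EK<=?C" by(rule composite_mono[OF Z(2) order_refl])
 have BC:"?B<=?C" by(rule composite_min[OF sfield_composite YC order_trans[OF Fq_s_EK EKC]])
 have Bi:"ifield ?B" by(rule ifield_composite(1)[OF ifield_kk[OF ifield_composite(2)[OF ifield_kk[OF Ki]]]])
 show "finab ?B ?C" by(rule finab_mid(2)[OF C Bi ifield_kk[OF Bi] BC])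
 show "Z<=?C" by(rule composite_incl(1))
 have YB:"?Y<=?B" "K<=?B"
  using composite_incl(1)[of ?Y K] composite_incl(2)[of K ?Y] composite_incl(1)[of "?Y**K" "Fq s"] by blast+
 fix sg assume s:"sg:auts ?B"
 have sk:"sg:auts \<kk>" by(rule auts_kk[OF Bi s])
 obtain u where u:"u:dgrp V K" "ALL x:Z. u x = sg x"
  using group_correspondence[OF Z(1) autgrp_D dgrp_K_kk sk auts_fixes[OF s YB(1)]] by(rule bexE)
 have uk:"u:auts \<kk>" using u(1) dgrp_K_kk by blast
 have "ALL x:K. u x = sg x" using auts_fixes[OF s YB(2)] auts_fixes[OF dgrpD(1)[OF u(1)] order_refl] by simp
 from eq_on_composite[OF auts_endo[OF uk] auts_endo[OF sk] u(2) this] have uC:"ALL x:?C. u x = sg x" .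
 have "u c = c" if c:"c:Fq s" for c
  by(metis (no_types, lifting) EKC Fq_s_EK auts_fixes composite_incl(2) s subset_iff that uC)
 from trivial_on_EgK[OF u(1) this] show "ALL x:Z. sg x = x" using u(2) Z(3) by fastforce
qed

lemma EgK_eq:"EgK = genus_field K**Fq s"
proof
 show "genus_field K**Fq s<=EgK"
  by(rule composite_min[OF sfield_composite _ order_trans[OF Fq_s_EK EK_EgK]]) (auto simp: genus_field_K)
 show "EgK<=genus_field K**Fq s"
 proof
  fix x assume "x:EgK"
  then obtain F where F:"genus_ext EE F" "x:F**K" using Ege_finite_level by blast
  let ?Z = "F**K"
  note Z = genus_composite_finab[OF F(1)] and ZE = genus_composite_subset[OF F(1)]
  have EZ:"EE<=?Z" by(rule order_trans[OF genus_extD(2)[OF F(1)] composite_incl(1)])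
  have "{y:?Z. ALL u:dgrp V K. u y = y}**K<=genus_field K"
   by(rule composite_min[OF ifield_sfield[OF ifield_genus_field[OF K]] _ genus_field_ge[OF K]]) (use ZE in \<open>auto simp: genus_field_K\<close>)
  hence "({y:?Z. ALL u:dgrp V K. u y = y}**K)**Fq s<=genus_field K**Fq s" by(rule composite_mono[OF _ order_refl])
  thus "x:genus_field K**Fq s" using constants_generate[OF Z EZ ZE] F(2) by blast
 qed
qed

lemma EK_eq:"EK = ({x:EE. ALL u:dgrp V K. u x = x}**K)**Fq s" (is "_ = ?Y**K**Fq s")
proof
 have Y:"?Y**K<=EK" by(rule composite_mono) auto
 show "?Y**K**Fq s<=EK" by(rule composite_min[OF sfield_composite Y Fq_s_EK])
 have E:"EE<=?Y**K**Fq s"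
  by(rule constants_generate[OF finab_E order_refl order_trans[OF EE_Ege composite_incl(1)]])
 show "EK<=?Y**K**Fq s"
  by(rule composite_min[OF sfield_composite E order_trans[OF composite_incl(2) composite_incl(1)]])
qed

text \<open>\<open>Z\<close> arises from \<open>L\<close> by adjoining \<open>Fq s\<close>, so
  \<open>finab_lift\<close> makes it finite abelian over \<open>L\<close> even when \<open>L\<close>
  is only known as a union of layers. Its group is the restriction of the decomposition group, which
  has order \<open>d\<close>.\<close>

lemma degree_d:
 assumes L:"ifield L" "L<=Z" "!!u x. u:dgrp V K ==> x:L ==> u x = x" and Z:"Z = L**Fq s"
  and sub:"EE<=Z" "Z<=EgK" "stable (auts \<kk>) Z" and corr:"{x:Z. ALL u:dgrp V K. u x = x}<=L"
 shows "has_degree L Z d"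
proof -
 have "finab L (adj (\<kk> Un Fq s)**L)" by(rule finab_lift[OF finab_Fq[OF rE(2)] L(1) ifield_kk[OF L(1)]])
 moreover have "adj (\<kk> Un Fq s)**L = Z"
 proof
  have "adj (\<kk> Un Fq s)<=Z"
   unfolding Z by(rule adj_min[OF sfield_composite])
    (use ifield_kk[OF L(1)] composite_incl(1)[of L "Fq s"] composite_incl(2)[of "Fq s" L] in blast)
  thus "adj (\<kk> Un Fq s)**L<=Z" unfolding Z by(rule composite_min[OF sfield_composite _ composite_incl(1)])
  show "Z<=adj (\<kk> Un Fq s)**L"
   unfolding Z by(rule composite_min[OF sfield_composite composite_incl(2)])
    (use adj_incl[of "\<kk> Un Fq s"] composite_incl(1)[of "adj (\<kk> Un Fq s)" L] in blast)
 qed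
 ultimately have LX:"finab L Z" by simp
 have Dsub:"dgrp V K<=auts L" 
  by(meson Ki assms(3) autsI auts_kk dgrpD(1) subsetI)
 have "rgrp (auts L) Z = rgrp (dgrp V K) Z"
 proof
  show "rgrp (dgrp V K) Z<=rgrp (auts L) Z" by(rule rgrp_mono[OF Dsub])
  show "rgrp (auts L) Z<=rgrp (dgrp V K) Z"
  proof
   fix g assume "g:rgrp (auts L) Z"
   then obtain sg where s:"sg:auts L" "g = restrict sg Z" by(rule rgrpE[THEN bexE])
   obtain u where u:"u:dgrp V K" "ALL x:Z. u x = sg x"
    using group_correspondence[OF LX autgrp_D Dsub s(1) auts_fixes[OF s(1) corr]] by(rule bexE)
   have "g = restrict u Z" unfolding s(2) rgrp_eq_iff using u(2) by simp
   thus "g:rgrp (dgrp V K) Z" using rgrpI[OF u(1)] by simp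
  qed
 qed
 thus ?thesis using finab_dimension[OF LX] cyclic_D(2)[OF sub] by simp
qed

lemma degree_EgK:"has_degree (genus_field K) EgK d"
proof (rule degree_d[OF ifield_genus_field[OF K] _ _ EgK_eq _ order_refl stable_EgK])
 show "genus_field K<=EgK" "{x:EgK. ALL u:dgrp V K. u x = x}<=genus_field K" unfolding genus_field_K by blast+
 show "u x = x" if "u:dgrp V K" "x:genus_field K" for u x using that unfolding genus_field_K by blast
 show "EE<=EgK" by(rule order_trans[OF EE_Ege composite_incl(1)])
qed

lemma degree_EK:"has_degree ({x:EE. ALL u:dgrp V K. u x = x}**K) EK d" (is "has_degree (?Y**K) _ _")
proof (rule degree_d[OF _ _ _ EK_eq composite_incl(1) EK_EgK stable_finab[OF finab_EK]])
 show Bi:"ifield (?Y**K)" by(rule ifield_composite(2)[OF ifield_kk[OF Ki]])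
 show YE:"?Y**K<=EK" by(rule composite_mono) auto
 show "u x = x" if u:"u:dgrp V K" and x:"x:?Y**K" for u x
  by(smt (verit, ccfv_SIG) Ki auts_fix auts_kk dgrpD(1) fixes_composite mem_Collect_eq u x)
 show "{x:EK. ALL u:dgrp V K. u x = x}<=?Y**K"
 proof
  fix x assume "x:{x:EK. ALL u:dgrp V K. u x = x}"
  hence x:"x:EK" "!!u. u:dgrp V K ==> u x = x" by blast+
  show "x:?Y**K"
  proof (rule finab_fixed[OF finab_mid(2)[OF finab_EK Bi ifield_kk[OF Bi] YE] x(1)])
   fix sg assume s:"sg:auts (?Y**K)"
   have sk:"sg:auts \<kk>" by(rule auts_kk[OF Bi s])
   obtain u where u:"u:dgrp V K" "ALL y:EE. u y = sg y"
    using group_correspondence[OF finab_E autgrp_D dgrp_K_kk sk auts_fixes[OF s composite_incl(1)]] by(rule bexE)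
   have "ALL y:K. u y = sg y" using auts_fixes[OF s composite_incl(2)] auts_fixes[OF dgrpD(1)[OF u(1)] order_refl] by simp
   from eq_on_composite[OF auts_endo[OF subsetD[OF dgrp_K_kk u(1)]] auts_endo[OF sk] u(2) this] x(1) have "u x = sg x" by blast
   thus "sg x = x" using x(2)[OF u(1)] by simp
  qed
 qed
qed

text \<open>\<open>p\<close> fixes the genus field and raises constants to the power
  \<open>q^t\<close>, so the constants of the genus field lie in \<open>Fq t\<close>. Conversely
  \<open>Fq t\<close> lies in \<open>EgK\<close> and, as residue field of \<open>K\<close>, is fixed
  by the decomposition group over \<open>K\<close>.\<close>

lemma constants_genus_field_K:"field_of_constants (genus_field K) = Fq t"
 unfolding field_of_constants_eq
proof
 show "genus_field K Int Fqbar<=Fq t"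
 proof
  fix c assume c:"c:genus_field K Int Fqbar"
  hence "p c = c" using p(1) unfolding genus_field_K by blast
  moreover have "(p ^^ 1) c = c^(CARD('a)^(t*1))" using p(2) c by blast
  ultimately show "c:Fq t" by(simp add: Fq_iff)
 qed
 have "Fq t<=Fq s" unfolding sd by(rule Fq_mono) simp
 hence "Fq t<=EgK" using Fq_s_EK EK_EgK by blast
 moreover have "u c = c" if "u:dgrp V K" "c:Fq t" for u c
  by(rule dgrp_rfield[OF Ki place_V that(1)]) (use that(2) rK(1) in simp)
 ultimately have "Fq t<=genus_field K" unfolding genus_field_K by blast
 thus "Fq t<=genus_field K Int Fqbar" using Fq_Fqbar[OF rK(2)] by blast
qed

end

end

theorem theorem2p2:
  fixes K M E P Q :: "'a::{field,finite} ac set" and N :: "'a poly" and n m d t :: nat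
    and H H\<^sub>1 H\<^sub>2 :: "('a ac \<Rightarrow> 'a ac) set"
  assumes "finite_abelian_ext \<kk> K"
    and "N \<noteq> 0" and "m \<ge> 1"
    and "K \<subseteq> nkNm n N m"
    and "M = \<LL> n \<squnion>\<^sub>F k_ext m"
    and "E = (K \<squnion>\<^sub>F M) \<inter> cyclotomic N"
    and "P \<in> S_infty K"
    and "Q \<in> primes_of (genus_field E \<squnion>\<^sub>F K)" and "Q \<inter> K = P"
    and "H = decomposition_group (genus_field E \<squnion>\<^sub>F K) K Q"
    and "H\<^sub>1 = restrict_group H (genus_field E)"
    and "H\<^sub>2 = restrict_group H\<^sub>1 E"
    and "d = f_infty (E \<squnion>\<^sub>F K) K"
    and "t = f_infty K \<kk>"
  shows "genus_field K = fixed_field (genus_field E) H\<^sub>1 \<squnion>\<^sub>F K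
    \<and> genus_field K = fixed_field (genus_field E \<squnion>\<^sub>F K) H
    \<and> aut_group (genus_field E \<squnion>\<^sub>F K) H \<cong> aut_group (genus_field E) H\<^sub>1
    \<and> aut_group (genus_field E) H\<^sub>1 \<cong> aut_group E H\<^sub>2
    \<and> aut_group E H\<^sub>2 \<cong> integer_mod_group d
    \<and> d dvd CARD('a) - 1
    \<and> ext_of_constants (genus_field K) (genus_field E \<squnion>\<^sub>F K)
    \<and> has_degree (genus_field K) (genus_field E \<squnion>\<^sub>F K) d
    \<and> ext_of_constants (fixed_field E H\<^sub>2 \<squnion>\<^sub>F K) (E \<squnion>\<^sub>F K)
    \<and> has_degree (fixed_field E H\<^sub>2 \<squnion>\<^sub>F K) (E \<squnion>\<^sub>F K) d
    \<and> field_of_constants (genus_field K) = Fq t"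
proof -
 have Kf:"finab \<kk> K" using assms(1) finite_abelian_ext_iff[of \<kk> K] by blast
 obtain V where Vp:"place V" and VQ:"V Int (genus_field E**K) = Q"
  using extend_prime[OF sfield_composite assms(8)] by blast
 have "V Int K = P" using VQ assms(9) composite_incl(2)[of K "genus_field E"] by blast
 moreover have "P Int \<kk> = P_infty" using assms(7) by(simp add: S_infty_def)
 ultimately have "V Int \<kk> = P_infty" using finabD(3)[OF Kf] by blast
 hence V:"infinite_place V" using infinite_place_iff[OF Vp] by blast
 interpret G: genus_setting K N n m V by unfold_locales (rule Kf assms(2,3,4) V)+
 have E:"(K**(\<LL> n**k_ext m)) Int cyclotomic N = E" unfolding assms(5,6) ..
 note Ef = G.finab_E[unfolded E] and EKf = G.finab_EK[unfolded E]
 obtain t' where t':"t' >= 1" "rfield V K = Fq t'" using rfinite_finab[OF Kf Vp rfinite_kk[OF Vp]] unfolding rfinite_def by blast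
 obtain s where s:"s >= 1" "rfield V (E**K) = Fq s"
  using rfinite_finab[OF EKf Vp rfinite_kk[OF Vp]] unfolding rfinite_def by blast
 \<comment> \<open>The residue field of \<open>\<kk>\<close> at infinity is \<open>Fq 1\<close>, so
   \<open>t\<close> is the exponent of the residue field of \<open>K\<close>.\<close>
 have "f_infty K \<kk>*1 = t'"
  by(rule f_infty_eq[OF Kf finab_refl[OF ifield_kk_self] finabD(3)[OF Kf] V t'(2,1) rfield_kk_infinite[OF V]]) simp
 hence t:"t' = t" using assms(14) by simp
 have "f_infty (E**K) K*t' = s" by(rule f_infty_eq[OF EKf Kf composite_incl(2) V s(2,1) t'(2,1)])
 hence sd:"s = t*d" using assms(13) t by(simp add: mult.commute)
 obtain p where p:"p:dgrp V K" "ALL i. ALL c:Fqbar. (p ^^ i) c = c^(CARD('a)^(t*i))"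
  using ex_frobenius[OF finabD(2)[OF Kf] Vp, of t] t' t by blast
 note c = t'(2)[unfolded t] t'(1)[unfolded t] s(2)[folded E] s(1) sd p
 have H:"H = rgrp (dgrp V K) (genus_field E**K)"
  unfolding assms(10) by(rule G.decomposition_group_eq[unfolded E, OF VQ])
 have H1:"H\<^sub>1 = rgrp (dgrp V K) (genus_field E)"
  unfolding assms(11) H by(rule rgrp_restrict[OF composite_incl(1)])
 have H2:"H\<^sub>2 = rgrp (dgrp V K) E"
  unfolding assms(12) H1 by(rule rgrp_restrict[OF genus_field_ge[OF Ef]])
 note EE = G.EE_Ege[unfolded E] and stD = stable_mono[OF _ G.dgrp_K_kk]
 note cyc = G.cyclic_D[OF c, unfolded E]
 have i:"aut_group (genus_field E**K) H \<cong> integer_mod_group d"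
  unfolding H by(rule cyc(1)[OF order_trans[OF EE composite_incl(1)] order_refl G.stable_EgK[unfolded E]])
 have i1:"aut_group (genus_field E) H\<^sub>1 \<cong> integer_mod_group d"
  unfolding H1 by(rule cyc(1)[OF EE composite_incl(1) G.stable_Ege[unfolded E]])
 have i2:"aut_group E H\<^sub>2 \<cong> integer_mod_group d"
  unfolding H2 by(rule cyc(1)[OF order_refl order_trans[OF EE composite_incl(1)] stable_finab[OF Ef]])
 have g1:"group (aut_group (genus_field E) H\<^sub>1)"
  unfolding H1 by(rule group_aut_group[OF G.autgrp_D stD[OF G.stable_Ege[unfolded E]]])
 have g2:"group (aut_group E H\<^sub>2)"
  unfolding H2 by(rule group_aut_group[OF G.autgrp_D stD[OF stable_finab[OF Ef]]])
 show ?thesis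
 proof (intro conjI)
  show "genus_field K = fixed_field (genus_field E) H\<^sub>1**K"
   unfolding H1 fixed_field_restrict_group by(rule G.fixed_Ege_composite[unfolded E, symmetric])
  show "genus_field K = fixed_field (genus_field E**K) H"
   unfolding H fixed_field_restrict_group by(rule G.genus_field_K[unfolded E])
  show "aut_group (genus_field E**K) H \<cong> aut_group (genus_field E) H\<^sub>1"
   by(rule iso_trans[OF i group.iso_sym[OF g1 i1]])
  show "aut_group (genus_field E) H\<^sub>1 \<cong> aut_group E H\<^sub>2" by(rule iso_trans[OF i1 group.iso_sym[OF g2 i2]])
  show "aut_group E H\<^sub>2 \<cong> integer_mod_group d" by(rule i2)
  show "d dvd CARD('a)-1" by(rule G.d_dvd[OF c])
  show "ext_of_constants (genus_field K) (genus_field E**K)"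
   unfolding ext_of_constants_def using G.EgK_eq[OF c, unfolded E] s(1) by blast
  show "has_degree (genus_field K) (genus_field E**K) d" by(rule G.degree_EgK[OF c, unfolded E])
  show "ext_of_constants (fixed_field E H\<^sub>2**K) (E**K)"
   unfolding ext_of_constants_def H2 fixed_field_restrict_group using G.EK_eq[OF c, unfolded E] s(1) by blast
  show "has_degree (fixed_field E H\<^sub>2**K) (E**K) d"
   unfolding H2 fixed_field_restrict_group by(rule G.degree_EK[OF c, unfolded E])
  show "field_of_constants (genus_field K) = Fq t" by(rule G.constants_genus_field_K[OF c])
 qed
qed

end
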